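(* The construction associating to an $A_\infty$-algebra in twisted complexes $(A,M_j)$ the derived $A_\infty$-algebra $(A,m_{ij})$ with $m_{ij}=(-1)^{ij}(M_j)_i$ ($i\ge0$, $j\ge1$) extends to a functor $\Psi:A_\infty^{\mathrm{tC}}(R)\to d\mathrm A_\infty(R)$ from the category of $A_\infty$-algebras in twisted complexes to the category of derived $A_\infty$-algebras, and $\Psi$ is an isomorphism of categories.
   Context: $R$ is a commutative ring with unit; tensor products are over $R$. Bigraded modules $A=\{A_i^j\}$ are $(\mathbb Z,\mathbb Z)$-bigraded $R$-modules; a map of bidegree $(p,q)$ sends $A_i^j$ to $A_{i+p}^{j+q}$; total degree of bidegree $(i,j)$ is $|\cdot|=j-i$; $\langle(x_1,x_2),(y_1,y_2)\rangle=x_1y_1+x_2y_2$; Koszul rule $(f\otimes g)(a\otimes c)=(-1)^{\langle g,a\rangle}f(a)\otimes g(c)$. Twisted complex $(A,d_m)$: bigraded module with maps $d_m$, $m\ge0$, of bidegree $(-m,-m+1)$, $\sum_{i+j=m}(-1)^id_id_j=0$ for all $m$. Tensor product: $A\otimes B$ with maps $d_m^A\otimes1+1\otimes d^B_m$. Hom-objects: for bigraded modules (or twisted complexes) $A,B$, $\underline{tC_R}(A,B)_u^v$ is the set of sequences $f=(f_0,f_1,\dots)$, $f_i:A\to B$ of bidegree $(u-i,v-i)$. Composition: $c(f,g)_m=\sum_{i+j=m}(-1)^{i|g|}f_ig_j$, where $|g|=v-u$ for $g$ of bidegree $(u,v)$. Tensor: $(f\widehat\otimes g)_m=\sum_{i+j=m}(-1)^{i|g|}f_i\otimes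 g_j$. The identity is $1=(1_A,0,0,\dots)$. Category $A_\infty^{\mathrm{tC}}(R)$. An $A_\infty$-algebra in twisted complexes is a twisted complex $(A,d^A)$ with elements $M_j\in\underline{tC_R}(A^{\otimes j},A)_0^{2-j}$, $j\ge2$, such that, setting $M_1:=(d_0^A,d_1^A,\dots)$, for all $v\ge1$ $$\sum_{v=r+q+t,\ j=1+r+t}(-1)^{rq+t}c\bigl(M_j,1^{\widehat\otimes r}\widehat\otimes M_q\widehat\otimes1^{\widehat\otimes t}\bigr)=0 .$$ A morphism $F:(B,M^B)\to(C,M^C)$ is a family $F_j\in\underline{tC_R}(B^{\otimes j},C)_0^{1-j}$, $j\ge1$, with for all $v\ge1$ $$\sum_{v=r+q+t,\ j=1+r+t}(-1)^{rq+t}c\bigl(F_j,1^{\widehat\otimes r}\widehat\otimes M^B_q\widehat\otimes1^{\widehat\otimes t}\bigr)=\sum_{v=q_1+\cdots+q_j}(-1)^{\sigma}c\bigl(M_j^C,F_{q_1}\widehat\otimes\cdots\widehat\otimes F_{q_j}\bigr),$$ and composition is $(F\circ G)_v=\sum_{v=q_1+\cdots+q_j}(-1)^\sigma c(F_j,G_{q_1}\widehat\otimes\cdots\widehat\otimes G_{q_j})$, where in both cases $\sigma=\sum_{k=1}^{j-1}\bigl(q_k(j+k)+q_k\sum_{s=k+1}^jq_s\bigr)$. Category $d\mathrm A_\infty(R)$. A (non-unital) derived $A_\infty$-algebra is a bigraded module $A$ with maps $m_{ij}:A^{\otimes j}\to A$, $i\ge0$, $j\ge1$, of bidegree $(-i,2-i-j)$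 such that for all $u\ge0$, $v\ge1$ $$\sum_{u=i+p,\ v=j+q-1,\ j=1+r+t}(-1)^{rq+t+pj}m_{ij}(1^{\otimes r}\otimes m_{pq}\otimes1^{\otimes t})=0.$$ A morphism $f:A\to B$ is a family $f_{ij}:A^{\otimes j}\to B$, $i\ge0,j\ge1$, of bidegree $(-i,1-i-j)$ with for all $u\ge0$, $v\ge1$ $$\sum_{u=i+p,\ v=j+q-1,\ j=1+r+t}(-1)^{rq+t+pj}f_{ij}(1^{\otimes r}\otimes m^A_{pq}\otimes1^{\otimes t})=\sum_{u=i+p_1+\cdots+p_j,\ v=q_1+\cdots+q_j}(-1)^{u+\sigma'}m^B_{ij}(f_{p_1q_1}\otimes\cdots\otimes f_{p_jq_j}),$$ with $\sigma'=\sum_{t=1}^j\bigl((p_t+q_t)(j+t)+q_t\sum_{w=t+1}^j(p_w+q_w)\bigr)$. The composite of $g:A\to B$ and $f:B\to C$ is $(fg)_{uk}=\sum(-1)^{\sigma'}f_{ij}(g_{p_1q_1}\otimes\cdots\otimes g_{p_jq_j})$, summed over $i+p_1+\cdots+p_j=u$, $q_1+\cdots+q_j=k$, with the same $\sigma'$. Identity: $(1_A)_{01}=1_A$, other components zero. *)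

theory Defs
  imports "HOL-Algebra.Module" "HOL-Algebra.AbelCoset" "HOL-Library.Product_Plus"
begin

section \<open>Bigraded modules\<close>

text \<open>The bidegree \<open>(i, j)\<close> stands for lower index \<open>i\<close> and upper index \<open>j\<close>, so \<open>A (i, j)\<close> is
  $A_i^j$.\<close>

type_synonym bideg = "int \<times> int"
type_synonym ('r, 'a) bgmod = "bideg \<Rightarrow> ('r, 'a) module"
type_synonym ('a, 'b) gmap = "bideg \<Rightarrow> 'a \<Rightarrow> 'b"

definition tdeg :: "bideg \<Rightarrow> int" where
  "tdeg e = snd e - fst e"

definition bdot :: "bideg \<Rightarrow> bideg \<Rightarrow> int" where
  "bdot d e = fst d * fst e + snd d * snd e"

definition bigraded_module :: "('r, 's) ring_scheme \<Rightarrow> ('r, 'a) bgmod \<Rightarrow> bool" where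
  "bigraded_module R A \<longleftrightarrow> (\<forall>d. module R (A d))"

text \<open>Maps are extensional on the carriers, so that equality of maps is equality of functions.\<close>

definition gmaps ::
  "('r, 's) ring_scheme \<Rightarrow> ('r, 'a) bgmod \<Rightarrow> ('r, 'b) bgmod \<Rightarrow> bideg \<Rightarrow> ('a, 'b) gmap set" where
  "gmaps R A B e = {f. \<forall>d.
     f d \<in> carrier (A d) \<rightarrow>\<^sub>E carrier (B (d + e)) \<and>
     (\<forall>x\<in>carrier (A d). \<forall>y\<in>carrier (A d).
        f d (x \<oplus>\<^bsub>A d\<^esub> y) = f d x \<oplus>\<^bsub>B (d + e)\<^esub> f d y) \<and>
     (\<forall>r\<in>carrier R. \<forall>x\<in>carrier (A d). f d (r \<odot>\<^bsub>A d\<^esub> x) = r \<odot>\<^bsub>B (d + e)\<^esub> f d x)}"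

text \<open>\<open>signed M n x\<close> is $(-1)^n x$.\<close>

definition signed :: "('r, 'a) module \<Rightarrow> int \<Rightarrow> 'a \<Rightarrow> 'a" where
  "signed M n x = (if even n then x else \<ominus>\<^bsub>M\<^esub> x)"

text \<open>\<open>gsum A B e I s h\<close> is the signed sum $\sum_{k\in I}(-1)^{s(k)}h_k$ of maps \<open>A \<rightarrow> B\<close> of
  bidegree \<open>e\<close>.\<close>

definition gsum :: "('r, 'a) bgmod \<Rightarrow> ('r, 'b) bgmod \<Rightarrow> bideg \<Rightarrow> 'k set \<Rightarrow> ('k \<Rightarrow> int) \<Rightarrow>
    ('k \<Rightarrow> ('a, 'b) gmap) \<Rightarrow> ('a, 'b) gmap" where
  "gsum A B e I s h =
     (\<lambda>d. \<lambda>x\<in>carrier (A d). \<Oplus>\<^bsub>B (d + e)\<^esub>k\<in>I. signed (B (d + e)) (s k) (h k d x))"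

definition gzero :: "('r, 'a) bgmod \<Rightarrow> ('r, 'b) bgmod \<Rightarrow> bideg \<Rightarrow> ('a, 'b) gmap" where
  "gzero A B e = (\<lambda>d. \<lambda>x\<in>carrier (A d). \<zero>\<^bsub>B (d + e)\<^esub>)"

definition gsigned ::
  "('r, 'a) bgmod \<Rightarrow> ('r, 'b) bgmod \<Rightarrow> bideg \<Rightarrow> int \<Rightarrow> ('a, 'b) gmap \<Rightarrow> ('a, 'b) gmap" where
  "gsigned A B e n f = (\<lambda>d. \<lambda>x\<in>carrier (A d). signed (B (d + e)) n (f d x))"

text \<open>The composite of \<open>f : B \<rightarrow> C\<close> and \<open>g : A \<rightarrow> B\<close>, where \<open>g\<close> has bidegree \<open>eg\<close>.\<close>

definition gcomp ::
  "('r, 'a) bgmod \<Rightarrow> bideg \<Rightarrow> ('b, 'c) gmap \<Rightarrow> ('a, 'b) gmap \<Rightarrow> ('a, 'c) gmap" where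
  "gcomp A eg f g = (\<lambda>d. \<lambda>x\<in>carrier (A d). f (d + eg) (g d x))"

definition gid :: "('r, 'a) bgmod \<Rightarrow> ('a, 'a) gmap" where
  "gid A = (\<lambda>d. \<lambda>x\<in>carrier (A d). x)"


section \<open>Tensor powers of a bigraded module\<close>

text \<open>The component of bidegree \<open>d\<close> of the \<open>n\<close>-th tensor power is the free module on the words of
  \<open>n\<close> homogeneous elements of total bidegree \<open>d\<close> modulo multilinearity. Letters carry their
  bidegree because the carriers of the components of a bigraded module need not be disjoint.\<close>

type_synonym ('a, 'r) tens = "((bideg \<times> 'a) list \<Rightarrow> 'r) set"

definition wdeg :: "(bideg \<times> 'a) list \<Rightarrow> bideg" where
  "wdeg w = sum_list (map fst w)"

definition hwords :: "('r, 'a) bgmod \<Rightarrow> nat \<Rightarrow> bideg \<Rightarrow> (bideg \<times> 'a) list set" where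
  "hwords A n d = {w. length w = n \<and> wdeg w = d \<and> (\<forall>(e, x)\<in>set w. x \<in> carrier (A e))}"

definition free_module :: "('r, 's) ring_scheme \<Rightarrow> 'w set \<Rightarrow> ('r, 'w \<Rightarrow> 'r) module" where
  "free_module R W =
     \<lparr>carrier = {f. range f \<subseteq> carrier R \<and> finite {w. f w \<noteq> \<zero>\<^bsub>R\<^esub>} \<and> {w. f w \<noteq> \<zero>\<^bsub>R\<^esub>} \<subseteq> W},
      mult = undefined, one = undefined,
      zero = (\<lambda>w. \<zero>\<^bsub>R\<^esub>), add = (\<lambda>f g w. f w \<oplus>\<^bsub>R\<^esub> g w), smult = (\<lambda>r f w. r \<otimes>\<^bsub>R\<^esub> f w)\<rparr>"

definition free_gen :: "('r, 's) ring_scheme \<Rightarrow> 'w \<Rightarrow> 'w \<Rightarrow> 'r" where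
  "free_gen R w = (\<lambda>v. if v = w then \<one>\<^bsub>R\<^esub> else \<zero>\<^bsub>R\<^esub>)"

definition generated_submodule ::
  "('r, 's) ring_scheme \<Rightarrow> ('r, 'a) module \<Rightarrow> 'a set \<Rightarrow> 'a set" where
  "generated_submodule R M S = \<Inter> {N. submodule N R M \<and> S \<subseteq> N}"

definition quotient_module :: "('r, 'a) module \<Rightarrow> 'a set \<Rightarrow> ('r, 'a set) module" where
  "quotient_module M N =
     \<lparr>carrier = a_rcosets\<^bsub>M\<^esub> N, mult = undefined, one = undefined,
      zero = N, add = set_add M, smult = (\<lambda>r X. \<Union>x\<in>X. N +>\<^bsub>M\<^esub> (r \<odot>\<^bsub>M\<^esub> x))\<rparr>"

definition free_words ::
  "('r, 's) ring_scheme \<Rightarrow> ('r, 'a) bgmod \<Rightarrow> nat \<Rightarrow> bideg \<Rightarrow> ('r, (bideg \<times> 'a) list \<Rightarrow> 'r) module"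
  where "free_words R A n d = free_module R (hwords A n d)"

definition tensor_relations ::
  "('r, 's) ring_scheme \<Rightarrow> ('r, 'a) bgmod \<Rightarrow> nat \<Rightarrow> bideg \<Rightarrow> ((bideg \<times> 'a) list \<Rightarrow> 'r) set" where
  "tensor_relations R A n d = generated_submodule R (free_words R A n d)
     ({free_gen R (u @ (e, x \<oplus>\<^bsub>A e\<^esub> y) # w) \<ominus>\<^bsub>free_words R A n d\<^esub>
         (free_gen R (u @ (e, x) # w) \<oplus>\<^bsub>free_words R A n d\<^esub> free_gen R (u @ (e, y) # w))
       | u e x y w. u @ (e, x) # w \<in> hwords A n d \<and> u @ (e, y) # w \<in> hwords A n d} \<union>
      {free_gen R (u @ (e, r \<odot>\<^bsub>A e\<^esub> x) # w) \<ominus>\<^bsub>free_words R A n d\<^esub>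
         (r \<odot>\<^bsub>free_words R A n d\<^esub> free_gen R (u @ (e, x) # w))
       | u e r x w. r \<in> carrier R \<and> u @ (e, x) # w \<in> hwords A n d})"

definition tensor_power ::
  "('r, 's) ring_scheme \<Rightarrow> ('r, 'a) bgmod \<Rightarrow> nat \<Rightarrow> ('r, ('a, 'r) tens) bgmod" where
  "tensor_power R A n = (\<lambda>d. quotient_module (free_words R A n d) (tensor_relations R A n d))"

text \<open>The word \<open>[(e1, x1), \<dots>, (en, xn)]\<close> represents $x_1\otimes\cdots\otimes x_n$.\<close>

definition pure_tensor ::
  "('r, 's) ring_scheme \<Rightarrow> ('r, 'a) bgmod \<Rightarrow> (bideg \<times> 'a) list \<Rightarrow> ('a, 'r) tens" where
  "pure_tensor R A w =
     tensor_relations R A (length w) (wdeg w) +>\<^bsub>free_words R A (length w) (wdeg w)\<^esub> free_gen R w"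

text \<open>Evaluation at \<open>X\<close> of the linear map to \<open>N\<close> that sends the pure tensor of each word \<open>w\<close> to
  \<open>\<phi> w\<close>. It does not depend on the chosen representative of \<open>X\<close> when \<open>\<phi>\<close> is multilinear, which
  is the case wherever it is used below.\<close>

definition tensor_lift ::
  "('r, 's) ring_scheme \<Rightarrow> ('r, 'b) module \<Rightarrow> ((bideg \<times> 'a) list \<Rightarrow> 'b) \<Rightarrow> ('a, 'r) tens \<Rightarrow> 'b" where
  "tensor_lift R N \<phi> X =
     (let f = (SOME f. f \<in> X) in \<Oplus>\<^bsub>N\<^esub>w\<in>{w. f w \<noteq> \<zero>\<^bsub>R\<^esub>}. f w \<odot>\<^bsub>N\<^esub> \<phi> w)"

text \<open>The identity \<open>1\<^sub>A\<close>, with its source regarded as the first tensor power of \<open>A\<close>.\<close>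

definition tensor1_id :: "('r, 's) ring_scheme \<Rightarrow> ('r, 'a) bgmod \<Rightarrow> (('a, 'r) tens, 'a) gmap" where
  "tensor1_id R A = (\<lambda>d. \<lambda>X\<in>carrier (tensor_power R A 1 d). tensor_lift R (A d) (\<lambda>w. snd (hd w)) X)"

text \<open>\<open>b \<otimes> y\<close> in the tensor power \<open>m + 1\<close>, for \<open>b\<close> of bidegree \<open>e\<close> and \<open>y\<close> of bidegree \<open>d\<close> in the
  tensor power \<open>m\<close>.\<close>

definition tensor_cons :: "('r, 's) ring_scheme \<Rightarrow> ('r, 'a) bgmod \<Rightarrow> nat \<Rightarrow>
    bideg \<Rightarrow> 'a \<Rightarrow> bideg \<Rightarrow> ('a, 'r) tens \<Rightarrow> ('a, 'r) tens" where
  "tensor_cons R B m e b d y =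
     tensor_lift R (tensor_power R B (Suc m) (e + d)) (\<lambda>w. pure_tensor R B ((e, b) # w)) y"

text \<open>\<open>gtensor R A B p n m ef eg f g\<close> is \<open>f \<otimes> g\<close>, formed with the Koszul rule, for
  $f : A^{\otimes p}\to B$ of bidegree \<open>ef\<close> and $g : A^{\otimes n}\to B^{\otimes m}$ of bidegree
  \<open>eg\<close>. It maps $A^{\otimes p}\otimes A^{\otimes n}=A^{\otimes(p+n)}$ to
  $B\otimes B^{\otimes m}=B^{\otimes(m+1)}$.\<close>

definition gtensor :: "('r, 's) ring_scheme \<Rightarrow> ('r, 'a) bgmod \<Rightarrow> ('r, 'b) bgmod \<Rightarrow>
    nat \<Rightarrow> nat \<Rightarrow> nat \<Rightarrow> bideg \<Rightarrow> bideg \<Rightarrow>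
    (('a, 'r) tens, 'b) gmap \<Rightarrow> (('a, 'r) tens, ('b, 'r) tens) gmap \<Rightarrow>
    (('a, 'r) tens, ('b, 'r) tens) gmap" where
  "gtensor R A B p n m ef eg f g =
     (\<lambda>d. \<lambda>X\<in>carrier (tensor_power R A (p + n) d).
        let N = tensor_power R B (Suc m) (d + (ef + eg)) in
        tensor_lift R N
          (\<lambda>w. let a = take p w; c = drop p w in
             signed N (bdot eg (wdeg a))
               (tensor_cons R B m
                  (wdeg a + ef) (f (wdeg a) (pure_tensor R A a))
                  (wdeg c + eg) (g (wdeg c) (pure_tensor R A c)))) X)"

text \<open>An operation \<open>(q, e, f)\<close> is a map \<open>f\<close> of bidegree \<open>e\<close> (or a sequence of maps of bidegree \<open>e\<close> in the
  sense of \<open>tC_hom\<close> below) from $A^{\otimes q}$ to \<open>B\<close>. A tensor product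
  $f_1\otimes\cdots\otimes f_j$ is formed as $f_1\otimes(f_2\otimes(\cdots\otimes(f_j\otimes 1)))$ with
  \<open>1\<close> the identity of the tensor power 0, which is the same for \<open>A\<close> and for \<open>B\<close> because the only
  word of length 0 is \<open>[]\<close>.\<close>

type_synonym 'f op = "nat \<times> bideg \<times> 'f"

definition ops_arity :: "'f op list \<Rightarrow> nat" where
  "ops_arity fs = sum_list (map fst fs)"

definition ops_deg :: "'f op list \<Rightarrow> bideg" where
  "ops_deg fs = sum_list (map (fst \<circ> snd) fs)"

fun gtensors :: "('r, 's) ring_scheme \<Rightarrow> ('r, 'a) bgmod \<Rightarrow> ('r, 'a) bgmod \<Rightarrow>
    (('a, 'r) tens, 'a) gmap op list \<Rightarrow> (('a, 'r) tens, ('a, 'r) tens) gmap" where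
  "gtensors R A B [] = gid (tensor_power R A 0)"
| "gtensors R A B ((q, e, f) # fs) =
     gtensor R A B q (ops_arity fs) (length fs) e (ops_deg fs) f (gtensors R A B fs)"


section \<open>Twisted complexes and their Hom-objects\<close>

definition twisted_complex ::
  "('r, 's) ring_scheme \<Rightarrow> ('r, 'a) bgmod \<Rightarrow> (nat \<Rightarrow> ('a, 'a) gmap) \<Rightarrow> bool" where
  "twisted_complex R A d \<longleftrightarrow> bigraded_module R A \<and>
     (\<forall>m. d m \<in> gmaps R A A (- int m, 1 - int m)) \<and>
     (\<forall>m. gsum A A (- int m, 2 - int m) {(i, j). i + j = m} (\<lambda>(i, j). int i)
        (\<lambda>(i, j). gcomp A (- int j, 1 - int j) (d i) (d j)) = gzero A A (- int m, 2 - int m))"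

text \<open>The bidegree of the entry \<open>f\<^sub>i\<close> of an element of bidegree \<open>e\<close> of a Hom-object.\<close>

definition entry_deg :: "bideg \<Rightarrow> nat \<Rightarrow> bideg" where
  "entry_deg e i = e - (int i, int i)"

definition tC_hom :: "('r, 's) ring_scheme \<Rightarrow> ('r, 'a) bgmod \<Rightarrow> ('r, 'b) bgmod \<Rightarrow> bideg \<Rightarrow>
    (nat \<Rightarrow> ('a, 'b) gmap) set" where
  "tC_hom R A B e = {f. \<forall>i. f i \<in> gmaps R A B (entry_deg e i)}"

definition tC_sum :: "('r, 'a) bgmod \<Rightarrow> ('r, 'b) bgmod \<Rightarrow> bideg \<Rightarrow> 'k set \<Rightarrow> ('k \<Rightarrow> int) \<Rightarrow>
    ('k \<Rightarrow> nat \<Rightarrow> ('a, 'b) gmap) \<Rightarrow> nat \<Rightarrow> ('a, 'b) gmap" where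
  "tC_sum A B e I s h = (\<lambda>m. gsum A B (entry_deg e m) I s (\<lambda>k. h k m))"

definition tC_zero :: "('r, 'a) bgmod \<Rightarrow> ('r, 'b) bgmod \<Rightarrow> bideg \<Rightarrow> nat \<Rightarrow> ('a, 'b) gmap" where
  "tC_zero A B e = (\<lambda>m. gzero A B (entry_deg e m))"

text \<open>The sequence \<open>(f, 0, 0, \<dots>)\<close> of bidegree \<open>(0, 0)\<close>.\<close>

definition tC_single ::
  "('r, 'a) bgmod \<Rightarrow> ('r, 'b) bgmod \<Rightarrow> ('a, 'b) gmap \<Rightarrow> nat \<Rightarrow> ('a, 'b) gmap" where
  "tC_single A B f = (\<lambda>m. if m = 0 then f else gzero A B (entry_deg (0, 0) m))"

definition tC_comp :: "('r, 'a) bgmod \<Rightarrow> ('r, 'c) bgmod \<Rightarrow> bideg \<Rightarrow> bideg \<Rightarrow>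
    (nat \<Rightarrow> ('b, 'c) gmap) \<Rightarrow> (nat \<Rightarrow> ('a, 'b) gmap) \<Rightarrow> nat \<Rightarrow> ('a, 'c) gmap" where
  "tC_comp A C ef eg f g = (\<lambda>m.
     gsum A C (entry_deg (ef + eg) m) {(i, j). i + j = m} (\<lambda>(i, j). int i * tdeg eg)
       (\<lambda>(i, j). gcomp A (entry_deg eg j) (f i) (g j)))"

definition tC_tensor :: "('r, 's) ring_scheme \<Rightarrow> ('r, 'a) bgmod \<Rightarrow> ('r, 'b) bgmod \<Rightarrow>
    nat \<Rightarrow> nat \<Rightarrow> nat \<Rightarrow> bideg \<Rightarrow> bideg \<Rightarrow>
    (nat \<Rightarrow> (('a, 'r) tens, 'b) gmap) \<Rightarrow> (nat \<Rightarrow> (('a, 'r) tens, ('b, 'r) tens) gmap) \<Rightarrow>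
    nat \<Rightarrow> (('a, 'r) tens, ('b, 'r) tens) gmap" where
  "tC_tensor R A B p n m ef eg f g = (\<lambda>k.
     gsum (tensor_power R A (p + n)) (tensor_power R B (Suc m)) (entry_deg (ef + eg) k)
       {(i, j). i + j = k} (\<lambda>(i, j). int i * tdeg eg)
       (\<lambda>(i, j). gtensor R A B p n m (entry_deg ef i) (entry_deg eg j) (f i) (g j)))"

fun tC_tensors :: "('r, 's) ring_scheme \<Rightarrow> ('r, 'a) bgmod \<Rightarrow> ('r, 'a) bgmod \<Rightarrow>
    (nat \<Rightarrow> (('a, 'r) tens, 'a) gmap) op list \<Rightarrow> nat \<Rightarrow> (('a, 'r) tens, ('a, 'r) tens) gmap" where
  "tC_tensors R A B [] =
     tC_single (tensor_power R A 0) (tensor_power R A 0) (gid (tensor_power R A 0))"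
| "tC_tensors R A B ((q, e, f) # fs) =
     tC_tensor R A B q (ops_arity fs) (length fs) e (ops_deg fs) f (tC_tensors R A B fs)"

definition tC_one ::
  "('r, 's) ring_scheme \<Rightarrow> ('r, 'a) bgmod \<Rightarrow> nat \<Rightarrow> (('a, 'r) tens, 'a) gmap" where
  "tC_one R A = tC_single (tensor_power R A 1) A (tensor1_id R A)"


section \<open>Categories\<close>

record ('o, 'm) category_data =
  Obj :: "'o set"
  Hom :: "'o \<Rightarrow> 'o \<Rightarrow> 'm set"
  Ident :: "'o \<Rightarrow> 'm"
  Comp :: "'o \<Rightarrow> 'o \<Rightarrow> 'o \<Rightarrow> 'm \<Rightarrow> 'm \<Rightarrow> 'm"

text \<open>\<open>Comp C X Y Z f g\<close> is the composite of \<open>g : X \<rightarrow> Y\<close> and \<open>f : Y \<rightarrow> Z\<close>.\<close>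

locale category =
  fixes C :: "('o, 'm) category_data"
  assumes Ident_in_Hom: "X \<in> Obj C \<Longrightarrow> Ident C X \<in> Hom C X X"
    and Comp_in_Hom: "\<lbrakk>X \<in> Obj C; Y \<in> Obj C; Z \<in> Obj C; f \<in> Hom C Y Z; g \<in> Hom C X Y\<rbrakk>
      \<Longrightarrow> Comp C X Y Z f g \<in> Hom C X Z"
    and Comp_Ident_left: "\<lbrakk>X \<in> Obj C; Y \<in> Obj C; f \<in> Hom C X Y\<rbrakk>
      \<Longrightarrow> Comp C X Y Y (Ident C Y) f = f"
    and Comp_Ident_right: "\<lbrakk>X \<in> Obj C; Y \<in> Obj C; f \<in> Hom C X Y\<rbrakk>
      \<Longrightarrow> Comp C X X Y f (Ident C X) = f"
    and Comp_assoc: "\<lbrakk>W \<in> Obj C; X \<in> Obj C; Y \<in> Obj C; Z \<in> Obj C;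
        f \<in> Hom C Y Z; g \<in> Hom C X Y; h \<in> Hom C W X\<rbrakk>
      \<Longrightarrow> Comp C W X Z (Comp C X Y Z f g) h = Comp C W Y Z f (Comp C W X Y g h)"

record ('o1, 'm1, 'o2, 'm2) functor_data =
  on_obj :: "'o1 \<Rightarrow> 'o2"
  on_hom :: "'o1 \<Rightarrow> 'o1 \<Rightarrow> 'm1 \<Rightarrow> 'm2"

locale cat_functor = dom: category C + cod: category D
  for C :: "('o1, 'm1) category_data" and D :: "('o2, 'm2) category_data" +
  fixes F :: "('o1, 'm1, 'o2, 'm2) functor_data"
  assumes on_obj_in: "X \<in> Obj C \<Longrightarrow> on_obj F X \<in> Obj D"
    and on_hom_in: "\<lbrakk>X \<in> Obj C; Y \<in> Obj C; f \<in> Hom C X Y\<rbrakk>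
      \<Longrightarrow> on_hom F X Y f \<in> Hom D (on_obj F X) (on_obj F Y)"
    and on_hom_Ident: "X \<in> Obj C \<Longrightarrow> on_hom F X X (Ident C X) = Ident D (on_obj F X)"
    and on_hom_Comp: "\<lbrakk>X \<in> Obj C; Y \<in> Obj C; Z \<in> Obj C; f \<in> Hom C Y Z; g \<in> Hom C X Y\<rbrakk>
      \<Longrightarrow> on_hom F X Z (Comp C X Y Z f g) =
        Comp D (on_obj F X) (on_obj F Y) (on_obj F Z) (on_hom F Y Z f) (on_hom F X Y g)"

definition functor_left_inverse :: "('o1, 'm1) category_data \<Rightarrow>
    ('o2, 'm2, 'o1, 'm1) functor_data \<Rightarrow> ('o1, 'm1, 'o2, 'm2) functor_data \<Rightarrow> bool" where
  "functor_left_inverse C G F \<longleftrightarrow>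
     (\<forall>X\<in>Obj C. on_obj G (on_obj F X) = X) \<and>
     (\<forall>X\<in>Obj C. \<forall>Y\<in>Obj C. \<forall>f\<in>Hom C X Y.
        on_hom G (on_obj F X) (on_obj F Y) (on_hom F X Y f) = f)"

definition isomorphism_of_categories :: "('o1, 'm1) category_data \<Rightarrow>
    ('o2, 'm2) category_data \<Rightarrow> ('o1, 'm1, 'o2, 'm2) functor_data \<Rightarrow> bool" where
  "isomorphism_of_categories C D F \<longleftrightarrow> cat_functor C D F \<and>
     (\<exists>G. cat_functor D C G \<and> functor_left_inverse C G F \<and> functor_left_inverse D F G)"


section \<open>$A_\infty$-algebras in twisted complexes\<close>

definition compositions :: "nat \<Rightarrow> nat list set" where
  "compositions v = {qs. sum_list qs = v \<and> (\<forall>q\<in>set qs. 1 \<le> q)}"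

definition sgn_tC :: "nat list \<Rightarrow> nat" where
  "sgn_tC qs = (let j = length qs; q = (\<lambda>k. qs ! (k - 1)) in
     \<Sum>k = 1..<j. q k * (j + k) + q k * (\<Sum>s = k + 1..j. q s))"

text \<open>\<open>tC_mul X j\<close> is $M_j$ for \<open>j \<ge> 2\<close>; the element $M_1$ is built from \<open>tC_diff\<close> in \<open>tC_op\<close>. The
  twisted complex structure of a tensor power does not enter, since the Hom-objects depend only on
  the underlying bigraded modules.\<close>

record ('r, 'a) tC_algebra =
  tC_module :: "('r, 'a) bgmod"
  tC_diff :: "nat \<Rightarrow> ('a, 'a) gmap"
  tC_mul :: "nat \<Rightarrow> nat \<Rightarrow> (('a, 'r) tens, 'a) gmap"

definition tC_op :: "('r, 's) ring_scheme \<Rightarrow> ('r, 'a) tC_algebra \<Rightarrow>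
    nat \<Rightarrow> nat \<Rightarrow> (('a, 'r) tens, 'a) gmap" where
  "tC_op R X j = (if j = 1
     then (\<lambda>i. gcomp (tensor_power R (tC_module X) 1) (0, 0) (tC_diff X i) (tensor1_id R (tC_module X)))
     else tC_mul X j)"

text \<open>$\sum (-1)^{rq+t}\, c(F_j, 1^{\hat\otimes r}\hat\otimes M_q\hat\otimes 1^{\hat\otimes t})$ for a
  family $F_j : A^{\otimes j}\to B$ of bidegree \<open>(0, k - j)\<close>; the result has bidegree
  \<open>(0, k + 1 - v)\<close>.\<close>

definition tC_precomp :: "('r, 's) ring_scheme \<Rightarrow> ('r, 'a) bgmod \<Rightarrow> ('r, 'a) bgmod \<Rightarrow> int \<Rightarrow>
    (nat \<Rightarrow> nat \<Rightarrow> (('a, 'r) tens, 'a) gmap) \<Rightarrow> (nat \<Rightarrow> nat \<Rightarrow> (('a, 'r) tens, 'a) gmap) \<Rightarrow>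
    nat \<Rightarrow> nat \<Rightarrow> (('a, 'r) tens, 'a) gmap" where
  "tC_precomp R A B k F M v =
     tC_sum (tensor_power R A v) B (0, k + 1 - int v)
       {(r, q, t, j). v = r + q + t \<and> j = 1 + r + t \<and> 1 \<le> q}
       (\<lambda>(r, q, t, j). int (r * q + t))
       (\<lambda>(r, q, t, j). tC_comp (tensor_power R A v) B (0, k - int j) (0, 2 - int q) (F j)
          (tC_tensors R A A
             (replicate r (1, (0, 0), tC_one R A) @ [(q, (0, 2 - int q), M q)] @
              replicate t (1, (0, 0), tC_one R A))))"

text \<open>$\sum (-1)^{\sigma}\, c(H_j, G_{q_1}\hat\otimes\cdots\hat\otimes G_{q_j})$ for a family
  $H_j : B^{\otimes j}\to C$ of bidegree \<open>(0, k - j)\<close> and a family $G_q : A^{\otimes q}\to B$ of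
  bidegree \<open>(0, 1 - q)\<close>; the result has bidegree \<open>(0, k - v)\<close>.\<close>

definition tC_postcomp :: "('r, 's) ring_scheme \<Rightarrow> ('r, 'a) bgmod \<Rightarrow> ('r, 'a) bgmod \<Rightarrow>
    ('r, 'a) bgmod \<Rightarrow> int \<Rightarrow>
    (nat \<Rightarrow> nat \<Rightarrow> (('a, 'r) tens, 'a) gmap) \<Rightarrow> (nat \<Rightarrow> nat \<Rightarrow> (('a, 'r) tens, 'a) gmap) \<Rightarrow>
    nat \<Rightarrow> nat \<Rightarrow> (('a, 'r) tens, 'a) gmap" where
  "tC_postcomp R A B C k H G v =
     tC_sum (tensor_power R A v) C (0, k - int v) (compositions v)
       (\<lambda>qs. int (sgn_tC qs))
       (\<lambda>qs. let gs = map (\<lambda>q. (q, (0, 1 - int q), G q)) qs in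
          tC_comp (tensor_power R A v) C (0, k - int (length qs)) (ops_deg gs) (H (length qs))
            (tC_tensors R A B gs))"

definition tC_algebras :: "('r, 's) ring_scheme \<Rightarrow> ('r, 'a) tC_algebra set" where
  "tC_algebras R = {X. twisted_complex R (tC_module X) (tC_diff X) \<and>
     tC_mul X \<in> (\<Pi>\<^sub>E j\<in>{2..}.
       tC_hom R (tensor_power R (tC_module X) j) (tC_module X) (0, 2 - int j)) \<and>
     (\<forall>v\<ge>1. tC_precomp R (tC_module X) (tC_module X) 2 (tC_op R X) (tC_op R X) v =
       tC_zero (tensor_power R (tC_module X) v) (tC_module X) (0, 3 - int v))}"

definition tC_morphisms :: "('r, 's) ring_scheme \<Rightarrow> ('r, 'a) tC_algebra \<Rightarrow> ('r, 'a) tC_algebra \<Rightarrow>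
    (nat \<Rightarrow> nat \<Rightarrow> (('a, 'r) tens, 'a) gmap) set" where
  "tC_morphisms R X Y = {F.
     F \<in> (\<Pi>\<^sub>E j\<in>{1..}.
       tC_hom R (tensor_power R (tC_module X) j) (tC_module Y) (0, 1 - int j)) \<and>
     (\<forall>v\<ge>1. tC_precomp R (tC_module X) (tC_module Y) 1 F (tC_op R X) v =
       tC_postcomp R (tC_module X) (tC_module Y) (tC_module Y) 2 (tC_op R Y) F v)}"

definition A_infinity_tC :: "('r, 's) ring_scheme \<Rightarrow>
    (('r, 'a) tC_algebra, nat \<Rightarrow> nat \<Rightarrow> (('a, 'r) tens, 'a) gmap) category_data" where
  "A_infinity_tC R =
     \<lparr>Obj = tC_algebras R,
      Hom = tC_morphisms R,
      Ident = (\<lambda>X. \<lambda>j\<in>{1..}. if j = 1 then tC_one R (tC_module X)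
         else tC_zero (tensor_power R (tC_module X) j) (tC_module X) (0, 1 - int j)),
      Comp = (\<lambda>X Y Z F G. \<lambda>v\<in>{1..}.
         tC_postcomp R (tC_module X) (tC_module Y) (tC_module Z) 1 F G v)\<rparr>"


section \<open>Derived $A_\infty$-algebras\<close>

definition sgn_dA :: "nat list \<Rightarrow> nat list \<Rightarrow> nat" where
  "sgn_dA ps qs = (let j = length qs; p = (\<lambda>k. ps ! (k - 1)); q = (\<lambda>k. qs ! (k - 1)) in
     \<Sum>t = 1..j. (p t + q t) * (j + t) + q t * (\<Sum>w = t + 1..j. p w + q w))"

text \<open>The structure maps are indexed by the pairs \<open>(i, j)\<close> with \<open>j \<ge> 1\<close>.\<close>

record ('r, 'a) dA_algebra =
  dA_module :: "('r, 'a) bgmod"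
  dA_op :: "nat \<times> nat \<Rightarrow> (('a, 'r) tens, 'a) gmap"

text \<open>$\sum (-1)^{rq+t+pj} f_{ij}(1^{\otimes r}\otimes m_{pq}\otimes 1^{\otimes t})$ for a family
  $f_{ij} : A^{\otimes j}\to B$ of bidegree \<open>(-i, k - i - j)\<close>.\<close>

definition dA_precomp :: "('r, 's) ring_scheme \<Rightarrow> ('r, 'a) bgmod \<Rightarrow> ('r, 'a) bgmod \<Rightarrow> int \<Rightarrow>
    (nat \<times> nat \<Rightarrow> (('a, 'r) tens, 'a) gmap) \<Rightarrow> (nat \<times> nat \<Rightarrow> (('a, 'r) tens, 'a) gmap) \<Rightarrow>
    nat \<Rightarrow> nat \<Rightarrow> (('a, 'r) tens, 'a) gmap" where
  "dA_precomp R A B k f m u v =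
     gsum (tensor_power R A v) B (- int u, k + 1 - int u - int v)
       {(i, p, j, q, r, t). u = i + p \<and> v = j + q - 1 \<and> j = 1 + r + t \<and> 1 \<le> q}
       (\<lambda>(i, p, j, q, r, t). int (r * q + t + p * j))
       (\<lambda>(i, p, j, q, r, t). gcomp (tensor_power R A v) (- int p, 2 - int p - int q) (f (i, j))
          (gtensors R A A
             (replicate r (1, (0, 0), tensor1_id R A) @
              [(q, (- int p, 2 - int p - int q), m (p, q))] @
              replicate t (1, (0, 0), tensor1_id R A))))"

text \<open>$\sum (-1)^{\epsilon+\sigma'} h_{ij}(g_{p_1q_1}\otimes\cdots\otimes g_{p_jq_j})$ for a family
  $h_{ij} : B^{\otimes j}\to C$ of bidegree \<open>(-i, k - i - j)\<close> and a family
  $g_{pq} : A^{\otimes q}\to B$ of bidegree \<open>(-p, 1 - p - q)\<close>.\<close>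

definition dA_postcomp :: "('r, 's) ring_scheme \<Rightarrow> ('r, 'a) bgmod \<Rightarrow> ('r, 'a) bgmod \<Rightarrow>
    ('r, 'a) bgmod \<Rightarrow> int \<Rightarrow> nat \<Rightarrow>
    (nat \<times> nat \<Rightarrow> (('a, 'r) tens, 'a) gmap) \<Rightarrow> (nat \<times> nat \<Rightarrow> (('a, 'r) tens, 'a) gmap) \<Rightarrow>
    nat \<Rightarrow> nat \<Rightarrow> (('a, 'r) tens, 'a) gmap" where
  "dA_postcomp R A B C k \<epsilon> h g u v =
     gsum (tensor_power R A v) C (- int u, k - int u - int v)
       {(i, ps, qs). u = i + sum_list ps \<and> qs \<in> compositions v \<and> length ps = length qs}
       (\<lambda>(i, ps, qs). int (\<epsilon> + sgn_dA ps qs))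
       (\<lambda>(i, ps, qs).
          let gs = map (\<lambda>(p, q). (q, (- int p, 1 - int p - int q), g (p, q))) (zip ps qs) in
          gcomp (tensor_power R A v) (ops_deg gs) (h (i, length qs)) (gtensors R A B gs))"

definition dA_algebras :: "('r, 's) ring_scheme \<Rightarrow> ('r, 'a) dA_algebra set" where
  "dA_algebras R = {X. bigraded_module R (dA_module X) \<and>
     dA_op X \<in> (\<Pi>\<^sub>E (i, j)\<in>UNIV \<times> {1..}.
       gmaps R (tensor_power R (dA_module X) j) (dA_module X) (- int i, 2 - int i - int j)) \<and>
     (\<forall>u. \<forall>v\<ge>1. dA_precomp R (dA_module X) (dA_module X) 2 (dA_op X) (dA_op X) u v =
       gzero (tensor_power R (dA_module X) v) (dA_module X) (- int u, 3 - int u - int v))}"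

definition dA_morphisms :: "('r, 's) ring_scheme \<Rightarrow> ('r, 'a) dA_algebra \<Rightarrow> ('r, 'a) dA_algebra \<Rightarrow>
    (nat \<times> nat \<Rightarrow> (('a, 'r) tens, 'a) gmap) set" where
  "dA_morphisms R X Y = {f.
     f \<in> (\<Pi>\<^sub>E (i, j)\<in>UNIV \<times> {1..}.
       gmaps R (tensor_power R (dA_module X) j) (dA_module Y) (- int i, 1 - int i - int j)) \<and>
     (\<forall>u. \<forall>v\<ge>1. dA_precomp R (dA_module X) (dA_module Y) 1 f (dA_op X) u v =
       dA_postcomp R (dA_module X) (dA_module Y) (dA_module Y) 2 u (dA_op Y) f u v)}"

definition derived_A_infinity :: "('r, 's) ring_scheme \<Rightarrow>
    (('r, 'a) dA_algebra, nat \<times> nat \<Rightarrow> (('a, 'r) tens, 'a) gmap) category_data" where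
  "derived_A_infinity R =
     \<lparr>Obj = dA_algebras R,
      Hom = dA_morphisms R,
      Ident = (\<lambda>X. \<lambda>(i, j)\<in>UNIV \<times> {1..}. if (i, j) = (0, 1) then tensor1_id R (dA_module X)
         else gzero (tensor_power R (dA_module X) j) (dA_module X) (- int i, 1 - int i - int j)),
      Comp = (\<lambda>X Y Z f g. \<lambda>(u, k)\<in>UNIV \<times> {1..}.
         dA_postcomp R (dA_module X) (dA_module Y) (dA_module Z) 1 0 f g u k)\<rparr>"


section \<open>The construction on objects\<close>

definition derived_of_tC ::
  "('r, 's) ring_scheme \<Rightarrow> ('r, 'a) tC_algebra \<Rightarrow> ('r, 'a) dA_algebra" where
  "derived_of_tC R X =
     \<lparr>dA_module = tC_module X,
      dA_op = (\<lambda>(i, j)\<in>UNIV \<times> {1..}.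
        gsigned (tensor_power R (tC_module X) j) (tC_module X) (- int i, 2 - int i - int j)
          (int (i * j)) (tC_op R X j i))\<rparr>"

end

theory Submission
  imports Defs "HOL-Algebra.Free_Abelian_Groups"
begin

text \<open>All maps involved are determined by their values on pure tensors, so a family \<open>f\<^sub>i\<^sub>j\<close> is a function on
  nonempty words of homogeneous elements. After multiplication by the sign \<open>(-1)^theta\<close> of the
  suspension and the shift of all degrees by one, the signs of the derived structure equations become
  those of the bar construction: the composite of two morphisms is the substitution of one family into
  the other over all ways of cutting a word (the comultiplicative extension), and a multiplication acts
  as a coderivation. Associativity of composition and closure of morphisms under composition are then
  statements about cuts, without signs.

  On the other side the factor \<open>(-1)^(ij)\<close> turns each twisted-complex expression of arity \<open>v\<close> into its
  derived counterpart in index \<open>u\<close> up to one global sign, \<open>(-1)^(uv)\<close> for composites and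
  \<open>(-1)^(uv + u)\<close> on both sides of the structure equations. So this factor gives bijections of
  objects and morphisms that respect composition, and the category structure is transported along them.\<close>

section \<open>Substitution and coderivations on words\<close>

text \<open>Two sign rules have to be reconciled. The Koszul rule pairs the two gradings separately
  (\<open>bdot\<close>), whereas coderivations on suspended words see only the parity of
  \<open>shifted_deg\<close>. For letters of bidegrees (x1, x2) and (y1, y2) the exponents of the
  two rules differ modulo 2 by x1 y2 + x2 y1 + x1 + x2 + y1 + y2 + 1. Up to the constant 1 this is
  the form x1 + (x1 + x2 + 1) y2 plus its transpose, and \<open>theta\<close> is the sum of that
  form over all pairs of letters of a word. Being quadratic, it changes under a cut by cross terms
  only (\<open>theta_append\<close>), which makes the sign identities provable block by block.

  The second obstacle is that additivity of a family in a letter holds only for carrier elements,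
  only after evaluation and only in the right component. The congruence rules therefore follow the
  quantity \<open>sdeg c - diag i\<close>: morphisms preserve it and structure maps raise it by (0,
  1).

  Finally, M_1 is stored as a sequence of maps on A, not on the first tensor power, so the inverse
  on objects needs the isomorphism of A with its first tensor power.\<close>

definition cuts :: "('x list \<Rightarrow> 'x list \<Rightarrow> 'n::comm_monoid_add) \<Rightarrow> 'x list \<Rightarrow> 'n" where
  "cuts \<Psi> w = (\<Sum>k\<le>length w. \<Psi> (take k w) (drop k w))"

text \<open>The index u of a composite is shared among its factors. It is treated as a budget that
  is split along with the word, which is why laws for \<open>cuts\<close> come with counterparts for
  \<open>sum_splits\<close>.\<close>

definition sum_splits :: "(nat \<Rightarrow> nat \<Rightarrow> 'n::comm_monoid_add) \<Rightarrow> nat \<Rightarrow> 'n" where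
  "sum_splits \<Theta> u = (\<Sum>p\<le>u. \<Theta> p (u - p))"

text \<open>The first piece is nonempty while the rest may be empty: a component of a morphism or of
  a structure has arity at least 1, and one cut of this kind splits off the arguments of the first
  output letter.\<close>

fun cuts1 :: "('x list \<Rightarrow> 'x list \<Rightarrow> 'n::comm_monoid_add) \<Rightarrow> 'x list \<Rightarrow> 'n" where
  "cuts1 \<Psi> [] = 0"
| "cuts1 \<Psi> (x # w) = cuts (\<lambda>a. \<Psi> (x # a)) w"

definition chain_sign :: "int \<Rightarrow> 'n::ab_group_add \<Rightarrow> 'n" where
  "chain_sign n c = (if even n then c else - c)"

section \<open>Calculus of cuts, index splittings and signs\<close>

lemma cuts_Nil [simp]: "cuts \<Psi> [] = \<Psi> [] []"
  by (simp add: cuts_def)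

lemma cuts_Cons: "cuts \<Psi> (x # w) = \<Psi> [] (x # w) + cuts (\<lambda>a. \<Psi> (x # a)) w"
  by (simp add: cuts_def sum.atMost_Suc_shift del: sum.atMost_Suc)

lemma cuts_add: "cuts (\<lambda>a b. \<Psi> a b + \<Phi> a b) w = cuts \<Psi> w + cuts \<Phi> w"
  by (simp add: cuts_def sum.distrib)

lemma cuts_0 [simp]: "cuts (\<lambda>a b. 0) w = 0"
  by (simp add: cuts_def)

lemma sum_splits_add: "sum_splits (\<lambda>a b. \<Psi> a b + \<Phi> a b) w = sum_splits \<Psi> w + sum_splits \<Phi> w"
  by (simp add: sum_splits_def sum.distrib)

lemma sum_splits_0 [simp]: "sum_splits (\<lambda>a b. 0) w = 0"
  by (simp add: sum_splits_def)

lemma sum_splits_cuts: "sum_splits (\<lambda>p r. cuts (\<Psi> p r) w) u = cuts (\<lambda>a b. sum_splits (\<lambda>p r. \<Psi> p r a b) u) w"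
  unfolding sum_splits_def cuts_def by (rule sum.swap)

lemma sum_splits_at_0 [simp]: "sum_splits \<Theta> 0 = \<Theta> 0 0"
  by (simp add: sum_splits_def)

lemma sum_splits_Suc: "sum_splits \<Theta> (Suc u) = \<Theta> 0 (Suc u) + sum_splits (\<lambda>p. \<Theta> (Suc p)) u"
  by (simp add: sum_splits_def sum.atMost_Suc_shift del: sum.atMost_Suc)

text \<open>Coassociativity of deconcatenation: both sides sum over the cuts of \<open>w\<close>
  into three pieces.\<close>

lemma cuts_assoc:
  "cuts (\<lambda>a b. cuts (\<lambda>c d. \<Psi> a c d) b) w = cuts (\<lambda>e d. cuts (\<lambda>a c. \<Psi> a c d) e) w"
  by (induction w arbitrary: \<Psi>) (simp_all add: cuts_Cons cuts_add ac_simps)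

lemma sum_splits_assoc:
  "sum_splits (\<lambda>p r. sum_splits (\<lambda>q s. \<Theta> p q s) r) u = sum_splits (\<lambda>t s. sum_splits (\<lambda>p q. \<Theta> p q s) t) u"
  by (induction u arbitrary: \<Theta>) (simp_all add: sum_splits_Suc sum_splits_add ac_simps)

lemma sum_splits_commute: "sum_splits \<Theta> u = sum_splits (\<lambda>p q. \<Theta> q p) u"
  unfolding sum_splits_def by (rule sum.reindex_bij_witness[of _ "\<lambda>p. u - p" "\<lambda>p. u - p"]) auto

lemma cuts_cong:
  assumes "\<And>a b. w = a @ b \<Longrightarrow> \<Psi> a b = \<Phi> a b"
  shows "cuts \<Psi> w = cuts \<Phi> w"
  unfolding cuts_def by (rule sum.cong[OF refl]) (simp add: assms)

lemma sum_splits_cong: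
  assumes "\<And>p r. p + r = u \<Longrightarrow> \<Psi> p r = \<Phi> p r"
  shows "sum_splits \<Psi> u = sum_splits \<Phi> u"
  unfolding sum_splits_def by (rule sum.cong[OF refl]) (simp add: assms)

lemma cuts1_cong:
  assumes "\<And>a b. w = a @ b \<Longrightarrow> a \<noteq> [] \<Longrightarrow> \<Psi> a b = \<Phi> a b"
  shows "cuts1 \<Psi> w = cuts1 \<Phi> w"
  using assms by (cases w) (auto intro!: cuts_cong)

lemma cuts1_eq_cuts: "cuts1 \<Psi> w = cuts (\<lambda>a b. if a = [] then 0 else \<Psi> a b) w"
  by (cases w) (simp_all add: cuts_Cons)

lemma cuts1_add: "cuts1 (\<lambda>a b. \<Psi> a b + \<Phi> a b) w = cuts1 \<Psi> w + cuts1 \<Phi> w"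
  by (cases w) (simp_all add: cuts_add)

lemma chain_sign_add: "chain_sign n (a + b) = chain_sign n a + chain_sign n b"
  by (simp add: chain_sign_def)

lemma chain_sign_sum: "chain_sign n (sum f I) = (\<Sum>i\<in>I. chain_sign n (f i))"
  by (simp add: chain_sign_def sum_negf)

lemma chain_sign_chain_sign: "chain_sign m (chain_sign n a) = chain_sign (m + n) a"
  by (simp add: chain_sign_def)

lemma chain_sign_0 [simp]: "chain_sign n 0 = 0"
  by (simp add: chain_sign_def)

lemma chain_sign_zero [simp]: "chain_sign 0 c = c"
  by (simp add: chain_sign_def)

lemma chain_sign_cuts: "chain_sign n (cuts \<Psi> w) = cuts (\<lambda>a b. chain_sign n (\<Psi> a b)) w"
  by (simp add: cuts_def chain_sign_sum)

lemma chain_sign_sum_splits: "chain_sign n (sum_splits \<Psi> w) = sum_splits (\<lambda>a b. chain_sign n (\<Psi> a b)) w"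
  by (simp add: sum_splits_def chain_sign_sum)

lemma chain_sign_cong: "even (m - n) \<Longrightarrow> chain_sign m a = chain_sign n a"
  by (auto simp: chain_sign_def)

text \<open>The value of \<open>\<Phi>\<close> on the coalgebra map induced by \<open>g\<close>: the sum of
  \<open>\<Phi> i [g p\<^sub>1 w\<^sub>1, \<dots>, g p\<^sub>j w\<^sub>j]\<close> over all cuts of \<open>w\<close> into nonempty words \<open>w\<^sub>1, \<dots>, w\<^sub>j\<close> and all
  \<open>i + p\<^sub>1 + \<cdots> + p\<^sub>j = u\<close>.\<close>

function extend :: "(nat \<Rightarrow> 'x list \<Rightarrow> 'y) \<Rightarrow> (nat \<Rightarrow> 'y list \<Rightarrow> 'n::comm_monoid_add) \<Rightarrow>
    nat \<Rightarrow> 'x list \<Rightarrow> 'n" where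
  "extend g \<Phi> u [] = \<Phi> u []"
| "extend g \<Phi> u (x # w) = (\<Sum>k\<le>length w. \<Sum>p\<le>u.
     extend g (\<lambda>i c. \<Phi> i (g p (x # take k w) # c)) (u - p) (drop k w))"
  by pat_completeness auto
termination
  by (relation "measure (\<lambda>(g, \<Phi>, u, w). length w)") auto

lemma extend_Cons: "extend g \<Phi> u (x # w) =
    cuts (\<lambda>a b. sum_splits (\<lambda>p r. extend g (\<lambda>i c. \<Phi> i (g p (x # a) # c)) r b) u) w"
  by (simp add: cuts_def sum_splits_def)

lemma extend_nonempty: "w \<noteq> [] \<Longrightarrow> extend g \<Phi> u w =
    cuts1 (\<lambda>a b. sum_splits (\<lambda>p r. extend g (\<lambda>i c. \<Phi> i (g p a # c)) r b) u) w"
  by (cases w) (simp_all add: extend_Cons del: extend.simps(2))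

declare extend.simps(2) [simp del]

text \<open>The value of \<open>\<Phi>\<close> on the coderivation induced by \<open>m\<close>, where \<open>\<pi>\<close> is the parity of a letter.\<close>

fun coderiv :: "('y \<Rightarrow> int) \<Rightarrow> (nat \<Rightarrow> 'y list \<Rightarrow> 'y) \<Rightarrow> (nat \<Rightarrow> 'y list \<Rightarrow> 'n::ab_group_add) \<Rightarrow>
    nat \<Rightarrow> 'y list \<Rightarrow> 'n" where
  "coderiv \<pi> m \<Phi> u [] = 0"
| "coderiv \<pi> m \<Phi> u (x # w) = cuts (\<lambda>a b. sum_splits (\<lambda>p r. \<Phi> r (m p (x # a) # b)) u) w +
     chain_sign (\<pi> x) (coderiv \<pi> m (\<lambda>i c. \<Phi> i (x # c)) u w)"

section \<open>Linearity, exchange of sums and sharing of the index\<close>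

lemma length_induct_word:
  "(\<And>w. (\<And>v. length v < length w \<Longrightarrow> P v) \<Longrightarrow> P w) \<Longrightarrow> P (w :: 'x list)"
  by (induct w rule: measure_induct_rule[of length]) blast

lemma extend_add: "extend g (\<lambda>i c. \<Phi> i c + \<Psi> i c) u w = extend g \<Phi> u w + extend g \<Psi> u w"
  by (induction g \<Phi> u w arbitrary: \<Psi> rule: extend.induct) (simp_all add: extend.simps sum.distrib)

lemma extend_0 [simp]: "extend g (\<lambda>i c. 0) u w = 0"
proof (induction w arbitrary: u rule: length_induct_word)
  case (1 w) then show ?case by (cases w) (simp_all add: extend.simps)
qed

lemma extend_sum: "extend g (\<lambda>i c. \<Sum>k\<in>I. \<Phi> k i c) u w = (\<Sum>k\<in>I. extend g (\<Phi> k) u w)"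
  by (induction I rule: infinite_finite_induct) (simp_all add: extend_add)

lemma extend_minus: "extend g (\<lambda>i c. - \<Phi> i c :: 'n::ab_group_add) u w = - extend g \<Phi> u w"
proof -
  have "extend g (\<lambda>i c. \<Phi> i c + - \<Phi> i c) u w = extend g \<Phi> u w + extend g (\<lambda>i c. - \<Phi> i c) u w"
    by (rule extend_add)
  then show ?thesis by (simp add: eq_neg_iff_add_eq_0 add.commute)
qed

lemma extend_chain_sign: "extend g (\<lambda>i c. chain_sign n (\<Phi> i c)) u w = chain_sign n (extend g \<Phi> u w)"
  by (simp add: chain_sign_def extend_minus)

lemma extend_cuts: "extend g (\<lambda>i c. cuts (\<lambda>a b. \<Phi> a b i c) v) u w = cuts (\<lambda>a b. extend g (\<Phi> a b) u w) v"
  by (simp add: cuts_def extend_sum)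

lemma extend_sum_splits: "extend g (\<lambda>i c. sum_splits (\<lambda>a b. \<Phi> a b i c) v) u w = sum_splits (\<lambda>a b. extend g (\<Phi> a b) u w) v"
  by (simp add: sum_splits_def extend_sum)

lemma extend_hom:
  assumes "\<And>a b. L (a + b) = L a + L b" "L 0 = 0"
  shows "L (extend g \<Phi> u w) = extend g (\<lambda>i c. L (\<Phi> i c)) u w"
proof (induction w arbitrary: \<Phi> u rule: length_induct_word)
  case (1 w)
  have L: "L (sum f I) = (\<Sum>i\<in>I. L (f i))" for f :: "nat \<Rightarrow> _" and I
    by (induction I rule: infinite_finite_induct) (simp_all add: assms)
  show ?case by (cases w) (simp_all add: extend.simps L 1)
qed

text \<open>Both substitutions are finite sums over data of separate words, so this is an exchange
  of summation.\<close>

lemma extend_swap: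
  "extend g (\<lambda>j c. extend h (\<lambda>q a. \<Xi> q a j c) p v) i b =
   extend h (\<lambda>q a. extend g (\<lambda>j c. \<Xi> q a j c) i b) p v"
proof (induction v arbitrary: \<Xi> p rule: length_induct_word)
  case (1 v) then show ?case by (cases v) (simp_all add: extend.simps extend_sum)
qed

lemma coderiv_add: "coderiv \<pi> m (\<lambda>i c. \<Phi> i c + \<Psi> i c) u w = coderiv \<pi> m \<Phi> u w + coderiv \<pi> m \<Psi> u w"
  by (induction w arbitrary: \<Phi> \<Psi>) (simp_all add: cuts_add sum_splits_add chain_sign_add ac_simps)

lemma coderiv_0 [simp]: "coderiv \<pi> m (\<lambda>i c. 0) u w = 0"
  by (induction w) simp_all

lemma coderiv_hom:
  assumes "\<And>a b. L (a + b) = L a + L b" "L 0 = 0" "\<And>a. L (- a) = - L a"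
  shows "L (coderiv \<pi> m \<Phi> u w) = coderiv \<pi> m (\<lambda>i c. L (\<Phi> i c)) u w"
proof (induction w arbitrary: \<Phi>)
  case Nil show ?case by (simp add: assms)
next
  case (Cons x w)
  have L: "L (sum f I) = (\<Sum>i\<in>I. L (f i))" for f :: "nat \<Rightarrow> _" and I
    by (induction I rule: infinite_finite_induct) (simp_all add: assms)
  have S: "L (chain_sign n c) = chain_sign n (L c)" for n c by (simp add: chain_sign_def assms)
  show ?case by (simp add: assms L S Cons cuts_def sum_splits_def)
qed

lemma extend_coderiv_swap:
  "extend g (\<lambda>j c. coderiv \<pi> m (\<lambda>q a. \<Xi> q a j c) p v) i b =
   coderiv \<pi> m (\<lambda>q a. extend g (\<lambda>j c. \<Xi> q a j c) i b) p v"
  by (induction v arbitrary: \<Xi>) (simp_all add: extend_add extend_cuts extend_sum_splits extend_chain_sign)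

text \<open>\<open>\<Xi>\<close> reserves a share r of the index for later use. Reserving it before
  the substitution or inside it runs through the same shares, by
  \<open>sum_splits_assoc\<close>.\<close>

lemma extend_budget:
  "sum_splits (\<lambda>p r. extend g (\<lambda>i a. \<Xi> i r a) p w) u = extend g (\<lambda>i a. sum_splits (\<lambda>p r. \<Xi> p r a) i) u w"
proof (induction w arbitrary: \<Xi> u rule: length_induct_word)
  case (1 w)
  show ?case
  proof (cases w)
    case Nil then show ?thesis by simp
  next
    case (Cons x v)
    have "sum_splits (\<lambda>p r. extend g (\<lambda>i a. \<Xi> i r a) p w) u =
        cuts (\<lambda>a b. sum_splits (\<lambda>p r. sum_splits (\<lambda>q s. extend g (\<lambda>i c. \<Xi> i r (g q (x # a) # c)) s b) p) u) v"
      by (simp add: Cons extend_Cons sum_splits_cuts)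
    also have "\<dots> = cuts (\<lambda>a b. sum_splits (\<lambda>q t. sum_splits (\<lambda>s r. extend g (\<lambda>i c. \<Xi> i r (g q (x # a) # c)) s b) t) u) v"
      by (simp add: sum_splits_assoc)
    also have "\<dots> = extend g (\<lambda>i a. sum_splits (\<lambda>p r. \<Xi> p r a) i) u w"
      by (auto simp: Cons extend_Cons 1 intro!: cuts_cong sum_splits_cong)
    finally show ?thesis .
  qed
qed

lemma extend_budget':
  "sum_splits (\<lambda>r p. extend g (\<lambda>i a. \<Xi> r i a) p w) u = extend g (\<lambda>i a. sum_splits (\<lambda>r p. \<Xi> r p a) i) u w"
  using extend_budget[of g "\<lambda>i r. \<Xi> r i" w u] by (subst (1 2) sum_splits_commute) simp

lemma coderiv_budget:
  "sum_splits (\<lambda>p r. coderiv \<pi> m (\<lambda>i a. \<Xi> i r a) p w) u = coderiv \<pi> m (\<lambda>i a. sum_splits (\<lambda>p r. \<Xi> p r a) i) u w"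
proof (induction w arbitrary: \<Xi>)
  case Nil show ?case by simp
next
  case (Cons x w)
  have "sum_splits (\<lambda>p r. coderiv \<pi> m (\<lambda>i a. \<Xi> i r a) p (x # w)) u =
     cuts (\<lambda>a b. sum_splits (\<lambda>p r. sum_splits (\<lambda>q s. \<Xi> s r (m q (x # a) # b)) p) u) w +
     chain_sign (\<pi> x) (sum_splits (\<lambda>p r. coderiv \<pi> m (\<lambda>i a. \<Xi> i r (x # a)) p w) u)"
    by (simp add: sum_splits_add sum_splits_cuts chain_sign_sum_splits)
  also have "\<dots> = coderiv \<pi> m (\<lambda>i a. sum_splits (\<lambda>p r. \<Xi> p r a) i) u (x # w)"
    by (simp add: Cons sum_splits_assoc)
  finally show ?case .
qed

lemma coderiv_budget':
  "sum_splits (\<lambda>r p. coderiv \<pi> m (\<lambda>i a. \<Xi> r i a) p w) u = coderiv \<pi> m (\<lambda>i a. sum_splits (\<lambda>r p. \<Xi> r p a) i) u w"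
  using coderiv_budget[of \<pi> m "\<lambda>i r. \<Xi> r i" w u] by (subst (1 2) sum_splits_commute) simp

section \<open>Compatibility with deconcatenation\<close>

text \<open>The extension of a family is a coalgebra map: a cut of the output word lies between two
  output letters, hence comes from a cut of \<open>w\<close> between their blocks. The inner
  \<open>extend\<close> receives the part i of the index that the outer one has left over. In the
  induction the cut before the first output letter is split off, and \<open>cuts_assoc\<close>
  reorders the remaining pairs of cuts.\<close>

lemma extend_coalgebra:
  "extend g (\<lambda>i. cuts (\<Psi> i)) u w =
   cuts (\<lambda>a b. extend g (\<lambda>i a'. extend g (\<lambda>j b'. \<Psi> j a' b') i b) u a) w"
proof (induction w arbitrary: \<Psi> u rule: length_induct_word)
  case (1 w)
  show ?case
  proof (cases w)
    case Nil then show ?thesis by simp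
  next
    case (Cons x v)
    have "extend g (\<lambda>i. cuts (\<Psi> i)) u w =
      cuts (\<lambda>a b. sum_splits (\<lambda>p r. extend g (\<lambda>i c. \<Psi> i [] (g p (x # a) # c)) r b) u) v +
      cuts (\<lambda>a b. sum_splits (\<lambda>p r. extend g (\<lambda>i. cuts (\<lambda>c. \<Psi> i (g p (x # a) # c))) r b) u) v"
      by (simp add: Cons extend_Cons cuts_Cons extend_add sum_splits_add cuts_add)
    also have "cuts (\<lambda>a b. sum_splits (\<lambda>p r. extend g (\<lambda>i. cuts (\<lambda>c. \<Psi> i (g p (x # a) # c))) r b) u) v =
      cuts (\<lambda>a b. sum_splits (\<lambda>p r. cuts (\<lambda>b1 b2.
         extend g (\<lambda>i a'. extend g (\<lambda>j b'. \<Psi> j (g p (x # a) # a') b') i b2) r b1) b) u) v"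
      using Cons by (auto simp: 1 intro!: cuts_cong sum_splits_cong)
    also have "\<dots> = cuts (\<lambda>e b2. cuts (\<lambda>a b1. sum_splits (\<lambda>p r.
         extend g (\<lambda>i a'. extend g (\<lambda>j b'. \<Psi> j (g p (x # a) # a') b') i b2) r b1) u) e) v"
      by (simp add: sum_splits_cuts cuts_assoc)
    finally show ?thesis
      by (simp add: Cons cuts_Cons extend_Cons)
  qed
qed

text \<open>Each output letter consumes a nonempty block, so the output is empty exactly when the
  input is.\<close>

lemma extend_cong:
  assumes "\<And>i c. (c = [] \<longleftrightarrow> w = []) \<Longrightarrow> \<Phi> i c = \<Psi> i c"
  shows "extend g \<Phi> u w = extend g \<Psi> u w"
  using assms by (cases w) (simp_all add: extend_Cons)

text \<open>The first piece of the output is nonempty exactly when that of the input is, so the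
  restriction to nonempty first pieces passes through the substitution.\<close>

lemma extend_coalgebra1:
  "extend g (\<lambda>i. cuts1 (\<Psi> i)) u w =
   cuts1 (\<lambda>a b. extend g (\<lambda>i a'. extend g (\<lambda>j b'. \<Psi> j a' b') i b) u a) w"
proof -
  have "extend g (\<lambda>i a'. extend g (\<lambda>j b'. if a' = [] then 0 else \<Psi> j a' b') i b) u a =
      (if a = [] then 0 else extend g (\<lambda>i a'. extend g (\<lambda>j b'. \<Psi> j a' b') i b) u a)" for a b
    by (auto intro: extend_cong)
  then show ?thesis
    unfolding cuts1_eq_cuts extend_coalgebra by (simp cong: if_cong)
qed

definition psum :: "('y \<Rightarrow> int) \<Rightarrow> 'y list \<Rightarrow> int" where
  "psum \<pi> w = sum_list (map \<pi> w)"

lemma psum_simps [simp]: "psum \<pi> [] = 0" "psum \<pi> (x # w) = \<pi> x + psum \<pi> w"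
  "psum \<pi> (w @ w') = psum \<pi> w + psum \<pi> w'"
  by (simp_all add: psum_def)

text \<open>The coderivation property: the operation acts to the left of the cut, or to the right of
  it after passing \<open>a\<close>, whose parity then enters the sign. No application straddles a
  cut of the output, because its result is a single letter.\<close>

lemma coderiv_coalgebra:
  "coderiv \<pi> m (\<lambda>i. cuts (\<Psi> i)) u w =
   cuts (\<lambda>a b. coderiv \<pi> m (\<lambda>i a'. \<Psi> i a' b) u a + chain_sign (psum \<pi> a) (coderiv \<pi> m (\<lambda>i. \<Psi> i a) u b)) w"
proof (induction w arbitrary: \<Psi>)
  case Nil show ?case by simp
next
  case (Cons x w)
  have "coderiv \<pi> m (\<lambda>i. cuts (\<Psi> i)) u (x # w) =
    cuts (\<lambda>a b. sum_splits (\<lambda>p r. \<Psi> r [] (m p (x # a) # b)) u) w +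
    cuts (\<lambda>a b. cuts (\<lambda>c d. sum_splits (\<lambda>p r. \<Psi> r (m p (x # a) # c) d) u) b) w +
    (chain_sign (\<pi> x) (coderiv \<pi> m (\<lambda>i c. \<Psi> i [] (x # c)) u w) +
     chain_sign (\<pi> x) (coderiv \<pi> m (\<lambda>i. cuts (\<lambda>c. \<Psi> i (x # c))) u w))"
    by (simp add: cuts_Cons sum_splits_add cuts_add coderiv_add sum_splits_cuts chain_sign_add)
  also have "cuts (\<lambda>a b. cuts (\<lambda>c d. sum_splits (\<lambda>p r. \<Psi> r (m p (x # a) # c) d) u) b) w =
     cuts (\<lambda>e d. cuts (\<lambda>a c. sum_splits (\<lambda>p r. \<Psi> r (m p (x # a) # c) d) u) e) w"
    by (rule cuts_assoc)
  finally show ?case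
    by (simp add: Cons cuts_Cons cuts_add chain_sign_add chain_sign_cuts chain_sign_chain_sign ac_simps)
qed

lemma coderiv_cong:
  assumes "\<And>i c. (c = [] \<longleftrightarrow> w = []) \<Longrightarrow> \<Phi> i c = \<Psi> i c"
  shows "coderiv \<pi> m \<Phi> u w = coderiv \<pi> m \<Psi> u w"
  using assms by (cases w) simp_all

lemma coderiv_coalgebra1:
  "coderiv \<pi> m (\<lambda>i. cuts1 (\<Psi> i)) u w =
   cuts1 (\<lambda>a b. coderiv \<pi> m (\<lambda>i a'. \<Psi> i a' b) u a + chain_sign (psum \<pi> a) (coderiv \<pi> m (\<lambda>i. \<Psi> i a) u b)) w"
proof -
  have *: "coderiv \<pi> m (\<lambda>i a'. if a' = [] then 0 else \<Psi> i a' b) u a =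
      (if a = [] then 0 else coderiv \<pi> m (\<lambda>i a'. \<Psi> i a' b) u a)" for a b
    by (auto intro: coderiv_cong)
  show ?thesis
    unfolding cuts1_eq_cuts coderiv_coalgebra *
    by (rule cuts_cong) auto
qed

section \<open>Chains with values in a graded module\<close>

text \<open>The sums over cuts are formed in the free abelian group, where they need no carrier conditions,
  and are evaluated afterwards; letters outside the carrier go to arbitrary elements of it.\<close>

definition chain_eval :: "('c, 'm) ring_scheme \<Rightarrow> ('c \<Rightarrow>\<^sub>0 int) \<Rightarrow> 'c" where
  "chain_eval N = (SOME h. h \<in> hom (free_Abelian_group UNIV) (add_monoid N) \<and>
     (\<forall>x\<in>carrier N. h (frag_of x) = x))"

lemma (in abelian_group) chain_eval_hom:
  "chain_eval G \<in> hom (free_Abelian_group UNIV) (add_monoid G) \<and> (\<forall>x\<in>carrier G. chain_eval G (frag_of x) = x)"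
proof -
  \<comment> \<open>The free abelian group is taken on the whole type, so generators outside the
    carrier need an image in the group as well.\<close>
  have "(\<lambda>x. if x \<in> carrier G then x else \<zero>) ` UNIV \<subseteq> carrier (add_monoid G)"
    by auto
  then obtain h where h: "h \<in> hom (free_Abelian_group UNIV) (add_monoid G)"
    "\<And>x. h (frag_of x) = (if x \<in> carrier G then x else \<zero>)"
    by (rule comm_group.free_Abelian_group_universal[OF a_comm_group]) (rule that, assumption, simp)
  then have "\<exists>h. h \<in> hom (free_Abelian_group UNIV) (add_monoid G) \<and>
      (\<forall>x\<in>carrier G. h (frag_of x) = x)"
    by (intro exI[of _ h]) simp
  then show ?thesis
    unfolding chain_eval_def by (rule someI_ex)
qed

context abelian_group
begin

lemma chain_eval_closed [simp, intro]: "chain_eval G c \<in> carrier G"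
  using chain_eval_hom by (auto simp: hom_def)

lemma chain_eval_add: "chain_eval G (a + b) = chain_eval G a \<oplus> chain_eval G b"
  using chain_eval_hom by (auto simp: hom_def)

lemma chain_eval_frag_of [simp]: "x \<in> carrier G \<Longrightarrow> chain_eval G (frag_of x) = x"
  using chain_eval_hom by auto

lemma chain_eval_0 [simp]: "chain_eval G 0 = \<zero>"
  using chain_eval_add[of 0 0] by (metis add_0 add.r_cancel_one' chain_eval_closed)

lemma chain_eval_minus: "chain_eval G (- a) = \<ominus> chain_eval G a"
  using chain_eval_add[of "- a" a] by (simp add: minus_equality)

lemma chain_eval_diff: "chain_eval G (a - b) = chain_eval G a \<ominus> chain_eval G b"
  using chain_eval_add[of a "- b"] by (simp add: chain_eval_minus a_minus_def)

lemma chain_eval_sum: "chain_eval G (\<Sum>i\<in>I. f i) = (\<Oplus>i\<in>I. chain_eval G (f i))"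
proof (induction I rule: infinite_finite_induct)
  case (infinite I) then show ?case by (simp add: finsum_infinite)
next
  case (insert i I) then show ?case by (simp add: chain_eval_add finsum_insert)
qed (simp_all add: finsum_empty)

lemma chain_eval_chain_sign_cong: "chain_eval G a = chain_eval G b \<Longrightarrow> chain_eval G (chain_sign n a) = chain_eval G (chain_sign n b)"
  by (simp add: chain_sign_def chain_eval_minus)

lemma chain_eval_sum_cong: "(\<And>i. i \<in> I \<Longrightarrow> chain_eval G (f i) = chain_eval G (g i)) \<Longrightarrow> chain_eval G (sum f I) = chain_eval G (sum g I)"
  by (induction I rule: infinite_finite_induct) (simp_all add: chain_eval_add)

lemma chain_eval_add_cong: "chain_eval G a = chain_eval G a' \<Longrightarrow> chain_eval G b = chain_eval G b' \<Longrightarrow> chain_eval G (a + b) = chain_eval G (a' + b')"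
  by (simp add: chain_eval_add)

lemma chain_eval_cuts1_cong:
  assumes "\<And>a b. w = a @ b \<Longrightarrow> a \<noteq> [] \<Longrightarrow> chain_eval G (\<Psi> a b) = chain_eval G (\<Phi> a b)"
  shows "chain_eval G (cuts1 \<Psi> w) = chain_eval G (cuts1 \<Phi> w)"
  using assms by (cases w) (auto simp: cuts_def intro!: chain_eval_sum_cong)

lemma chain_eval_sum_splits_cong:
  assumes "\<And>p r. p + r = u \<Longrightarrow> chain_eval G (\<Psi> p r) = chain_eval G (\<Phi> p r)"
  shows "chain_eval G (sum_splits \<Psi> u) = chain_eval G (sum_splits \<Phi> u)"
  unfolding sum_splits_def by (rule chain_eval_sum_cong) (simp add: assms)

text \<open>Turns a formal sum placed in one slot into the value of that sum in the slot. Additivity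
  of \<open>\<Theta>\<close> is available only on the carrier and after evaluation, which explains
  the condition on the keys. Since \<open>frag_induction\<close> generates by differences,
  additivity is first extended to subtraction.\<close>

lemma chain_eval_frag_extend:
  fixes B :: "('c, 'm) ring_scheme"
  assumes B: "abelian_group B" and c: "Poly_Mapping.keys c \<subseteq> carrier B"
    and \<Theta>: "\<And>x y. x \<in> carrier B \<Longrightarrow> y \<in> carrier B \<Longrightarrow> chain_eval G (\<Theta> (x \<oplus>\<^bsub>B\<^esub> y)) = chain_eval G (\<Theta> x + \<Theta> y)"
  shows "chain_eval G (frag_extend \<Theta> c) = chain_eval G (\<Theta> (chain_eval B c))"
proof -
  interpret B: abelian_group B by (rule B)
  have *: "chain_eval G (\<Theta> (x \<ominus>\<^bsub>B\<^esub> y)) = chain_eval G (\<Theta> x) \<ominus> chain_eval G (\<Theta> y)"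
    if "x \<in> carrier B" "y \<in> carrier B" for x y
  proof -
    have "(x \<ominus>\<^bsub>B\<^esub> y) \<oplus>\<^bsub>B\<^esub> y = x"
      using that by (simp add: B.minus_eq B.a_assoc B.l_neg)
    then have "chain_eval G (\<Theta> x) = chain_eval G (\<Theta> (x \<ominus>\<^bsub>B\<^esub> y)) \<oplus> chain_eval G (\<Theta> y)"
      using \<Theta>[of "x \<ominus>\<^bsub>B\<^esub> y" y] that by (simp add: chain_eval_add)
    then show ?thesis by (simp add: minus_eq a_assoc r_neg)
  qed
  have 0: "chain_eval G (\<Theta> \<zero>\<^bsub>B\<^esub>) = \<zero>"
    using *[of "\<zero>\<^bsub>B\<^esub>" "\<zero>\<^bsub>B\<^esub>"] by (simp add: minus_eq B.minus_eq r_neg B.r_neg)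
  show ?thesis using c
    by (induction c rule: frag_induction) (simp_all add: 0 frag_extend_diff chain_eval_diff B.chain_eval_diff *)
qed

end

section \<open>Homogeneous words, their degrees and additive families\<close>

definition hword :: "('r, 'a) bgmod \<Rightarrow> (bideg \<times> 'a) list \<Rightarrow> bool" where
  "hword A w \<longleftrightarrow> (\<forall>(e, x)\<in>set w. x \<in> carrier (A e))"

definition sdeg :: "(bideg \<times> 'a) list \<Rightarrow> bideg" where
  "sdeg w = wdeg w - (0, int (length w))"

definition diag :: "nat \<Rightarrow> bideg" where
  "diag n = (int n, int n)"

text \<open>The bidegree of the value of the component of index p on \<open>w\<close>; see
  \<open>outdeg_eq\<close>. Morphisms have k = 1 and structure maps k = 2. In suspended degrees the
  value of a morphism thus has the degree of \<open>w\<close> lowered by \<open>diag p\<close>, and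
  a structure map adds (0, 1).\<close>

definition outdeg :: "int \<Rightarrow> nat \<Rightarrow> (bideg \<times> 'a) list \<Rightarrow> bideg" where
  "outdeg k p w = sdeg w + (0, k) - diag p"

text \<open>The total degree after suspension, which governs the signs of the bar construction.\<close>

definition shifted_deg :: "bideg \<times> 'a \<Rightarrow> int" where
  "shifted_deg x = snd (fst x) - fst (fst x) - 1"

lemma hword_simps [simp]: "hword A []" "hword A (x # w) \<longleftrightarrow> snd x \<in> carrier (A (fst x)) \<and> hword A w"
  "hword A (v @ w) \<longleftrightarrow> hword A v \<and> hword A w"
  by (auto simp: hword_def split: prod.splits)

lemma hword_take_drop:
  assumes "hword A v" shows "hword A (take k v)" "hword A (drop k v)"
  using assms by (metis append_take_drop_id hword_simps(3))+

lemma wdeg_simps [simp]: "wdeg [] = 0" "wdeg (x # w) = fst x + wdeg w" "wdeg (v @ w) = wdeg v + wdeg w"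
  by (simp_all add: wdeg_def)

lemma sdeg_simps [simp]: "sdeg [] = 0" "sdeg (x # w) = fst x - (0, 1) + sdeg w"
  "sdeg (v @ w) = sdeg v + sdeg w"
  by (simp_all add: sdeg_def prod_eq_iff)

lemma diag_add: "diag (a + b) = diag a + diag b"
  by (simp add: diag_def)

lemma diag_0 [simp]: "diag 0 = 0"
  by (simp add: diag_def zero_prod_def)

definition word_family :: "('r, 'a) bgmod \<Rightarrow> ('r, 'b) bgmod \<Rightarrow> int \<Rightarrow>
    (nat \<Rightarrow> (bideg \<times> 'a) list \<Rightarrow> bideg \<times> 'b) \<Rightarrow> bool" where
  "word_family A B k g \<longleftrightarrow> (\<forall>p w. hword A w \<longrightarrow> w \<noteq> [] \<longrightarrow>
     fst (g p w) = outdeg k p w \<and> snd (g p w) \<in> carrier (B (outdeg k p w)))"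

text \<open>Additivity in each letter is enough here: substitution inserts sums with signs only, never scalars.\<close>

definition chain_additive :: "('r, 'c) module \<Rightarrow> ('r, 'a) bgmod \<Rightarrow> bideg \<Rightarrow>
    (nat \<Rightarrow> (bideg \<times> 'a) list \<Rightarrow> ('c \<Rightarrow>\<^sub>0 int)) \<Rightarrow> bool" where
  "chain_additive N A D \<Phi> \<longleftrightarrow> (\<forall>i u d x y w. x \<in> carrier (A d) \<longrightarrow> y \<in> carrier (A d) \<longrightarrow> hword A u \<longrightarrow> hword A w \<longrightarrow>
     sdeg (u @ (d, x) # w) - diag i = D \<longrightarrow>
     chain_eval N (\<Phi> i (u @ (d, x \<oplus>\<^bsub>A d\<^esub> y) # w)) = chain_eval N (\<Phi> i (u @ (d, x) # w) + \<Phi> i (u @ (d, y) # w)))"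

lemma chain_additiveD:
  assumes "chain_additive N A D \<Phi>" "x \<in> carrier (A d)" "y \<in> carrier (A d)" "hword A u" "hword A w"
    "sdeg (u @ (d, x) # w) - diag i = D"
  shows "chain_eval N (\<Phi> i (u @ (d, x \<oplus>\<^bsub>A d\<^esub> y) # w)) = chain_eval N (\<Phi> i (u @ (d, x) # w) + \<Phi> i (u @ (d, y) # w))"
  using assms unfolding chain_additive_def by blast

lemma chain_additive_Cons:
  assumes "chain_additive N A D \<Phi>" "snd z \<in> carrier (A (fst z))"
  shows "chain_additive N A (D - (fst z - (0, 1))) (\<lambda>i c. \<Phi> i (z # c))"
  unfolding chain_additive_def
proof (intro allI impI)
  fix i u d x y w
  assume *: "x \<in> carrier (A d)" "y \<in> carrier (A d)" "hword A u" "hword A w"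
    "sdeg (u @ (d, x) # w) - diag i = D - (fst z - (0, 1))"
  have "sdeg ((z # u) @ (d, x) # w) - diag i = D" using *(5) by (auto simp: prod_eq_iff)
  with chain_additiveD[OF assms(1) *(1,2) _ *(4), of "z # u" i] * assms(2)
  show "chain_eval N (\<Phi> i (z # u @ (d, x \<oplus>\<^bsub>A d\<^esub> y) # w)) =
      chain_eval N (\<Phi> i (z # u @ (d, x) # w) + \<Phi> i (z # u @ (d, y) # w))"
    by simp
qed

section \<open>Congruence rules that follow the degree\<close>

text \<open>An induction principle for any relation compatible with sums; it serves both for
  equality after evaluation and for bounds on supports. For k = 1 substitution preserves
  \<open>sdeg c - diag i\<close>, so \<open>\<Phi>\<close> and \<open>\<Psi>\<close> need to be
  compared only where this difference is the one of \<open>w\<close> and u.\<close>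

lemma extend_rel:
  assumes g: "word_family A B 1 g" and "hword A w" and R0: "Rl 0 0"
    and Radd: "\<And>a b a' b'. Rl a a' \<Longrightarrow> Rl b b' \<Longrightarrow> Rl (a + b) (a' + b')"
    and "\<And>i c. hword B c \<Longrightarrow> sdeg c - diag i = sdeg w - diag u \<Longrightarrow> (c = [] \<longleftrightarrow> w = []) \<Longrightarrow>
      Rl (\<Phi> i c) (\<Psi> i c)"
  shows "Rl (extend g \<Phi> u w) (extend g \<Psi> u w)"
  using assms(2,5)
proof (induction w arbitrary: \<Phi> \<Psi> u rule: length_induct_word)
  case (1 w)
  have sumR: "Rl (sum f I) (sum f' I)" if "\<And>i. i \<in> I \<Longrightarrow> Rl (f i) (f' i)"
    for f f' and I :: "nat set"
    using that by (induction I rule: infinite_finite_induct) (auto simp: R0 Radd)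
  show ?case
  proof (cases w)
    case Nil
    then show ?thesis using 1(3)[of "[]" u] by simp
  next
    case (Cons x v)
    show ?thesis unfolding Cons extend.simps
    proof (intro sumR 1(1), goal_cases)
      case (1 k p) then show ?case using Cons by simp
    next
      case (2 k p)
      show ?case using "1.prems"(1) Cons by (simp add: hword_take_drop)
    next
      case (3 k p c i)
      have **: "hword A (x # take k v)" using "1.prems"(1) Cons by (simp add: hword_take_drop)
      have s: "sdeg v = sdeg (take k v) + sdeg (drop k v)"
        by (metis append_take_drop_id sdeg_simps(3))
      have p: "diag u = diag p + diag (u - p)" using 3 by (simp flip: diag_add)
      show ?case
      proof (rule "1.prems"(2))
        show "hword B (g p (x # take k v) # c)"
          using g ** 3 unfolding word_family_def by auto
        have "fst (g p (x # take k v)) = outdeg 1 p (x # take k v)"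
          using g ** unfolding word_family_def by auto
        then show "sdeg (g p (x # take k v) # c) - diag i = sdeg w - diag u"
          using 3 unfolding Cons by (auto simp: s p outdeg_def prod_eq_iff)
      qed (simp add: Cons)
    qed
  qed
qed

text \<open>An insertion raises the difference \<open>sdeg c - diag i\<close> by (0, 1), the
  suspended degree of a structure map. The relation must also respect negation because of the signs
  for passed letters.\<close>

lemma coderiv_rel:
  assumes m: "word_family A A 2 m" and "hword A w" and R0: "Rl 0 0"
    and Radd: "\<And>a b a' b'. Rl a a' \<Longrightarrow> Rl b b' \<Longrightarrow> Rl (a + b) (a' + b')"
    and Rminus: "\<And>a a'. Rl a a' \<Longrightarrow> Rl (- a) (- a')"
    and "\<And>i c. hword A c \<Longrightarrow> sdeg c - diag i = sdeg w - diag u + (0, 1) \<Longrightarrow> (c = [] \<longleftrightarrow> w = []) \<Longrightarrow>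
      Rl (\<Phi> i c) (\<Psi> i c)"
  shows "Rl (coderiv \<pi> m \<Phi> u w) (coderiv \<pi> m \<Psi> u w)"
  using assms(2,6)
proof (induction w arbitrary: \<Phi> \<Psi>)
  case Nil show ?case by (simp add: R0)
next
  case (Cons x v)
  have sumR: "Rl (sum f I) (sum f' I)" if "\<And>i. i \<in> I \<Longrightarrow> Rl (f i) (f' i)"
    for f f' and I :: "nat set"
    using that by (induction I rule: infinite_finite_induct) (auto simp: R0 Radd)
  have "Rl (cuts (\<lambda>a b. sum_splits (\<lambda>p r. \<Phi> r (m p (x # a) # b)) u) v)
     (cuts (\<lambda>a b. sum_splits (\<lambda>p r. \<Psi> r (m p (x # a) # b)) u) v)"
    unfolding cuts_def sum_splits_def
  proof (intro sumR, goal_cases)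
    case (1 k p)
    have **: "hword A (x # take k v)" "hword A (drop k v)"
      using Cons.prems(1) by (simp_all add: hword_take_drop)
    have s: "sdeg v = sdeg (take k v) + sdeg (drop k v)"
      by (metis append_take_drop_id sdeg_simps(3))
    have p: "diag u = diag p + diag (u - p)" using 1 by (simp flip: diag_add)
    have f: "fst (m p (x # take k v)) = outdeg 2 p (x # take k v)"
      "snd (m p (x # take k v)) \<in> carrier (A (outdeg 2 p (x # take k v)))"
      using m ** unfolding word_family_def by auto
    show ?case
    proof (rule Cons.prems(2))
      show "hword A (m p (x # take k v) # drop k v)" using f ** by simp
      show "sdeg (m p (x # take k v) # drop k v) - diag (u - p) = sdeg (x # v) - diag u + (0, 1)"
        using f by (simp add: s p outdeg_def prod_eq_iff)
    qed simp
  qed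
  moreover have "Rl (coderiv \<pi> m (\<lambda>i c. \<Phi> i (x # c)) u v) (coderiv \<pi> m (\<lambda>i c. \<Psi> i (x # c)) u v)"
  proof (rule Cons.IH)
    fix i c assume "hword A c" "sdeg c - diag i = sdeg v - diag u + (0, 1)" "(c = []) = (v = [])"
    then show "Rl (\<Phi> i (x # c)) (\<Psi> i (x # c))"
      using Cons.prems(1) by (intro Cons.prems(2)) (auto simp: algebra_simps)
  qed (use Cons.prems in simp)
  ultimately show ?case
    by (simp add: Radd Rminus chain_sign_def)
qed

lemma extend_cong_chain_eval:
  assumes "abelian_group N" "word_family A B 1 g" "hword A w"
    "\<And>i c. hword B c \<Longrightarrow> sdeg c - diag i = sdeg w - diag u \<Longrightarrow> (c = [] \<longleftrightarrow> w = []) \<Longrightarrow>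
      chain_eval N (\<Phi> i c) = chain_eval N (\<Psi> i c)"
  shows "chain_eval N (extend g \<Phi> u w) = chain_eval N (extend g \<Psi> u w)"
  using assms(2,3)
  by (rule extend_rel[where Rl = "\<lambda>a b. chain_eval N a = chain_eval N b"])
     (use assms in \<open>auto intro: abelian_group.chain_eval_add_cong\<close>)

lemma coderiv_cong_chain_eval:
  assumes "abelian_group N" "word_family A A 2 m" "hword A w"
    "\<And>i c. hword A c \<Longrightarrow> sdeg c - diag i = sdeg w - diag u + (0, 1) \<Longrightarrow> (c = [] \<longleftrightarrow> w = []) \<Longrightarrow>
      chain_eval N (\<Phi> i c) = chain_eval N (\<Psi> i c)"
  shows "chain_eval N (coderiv \<pi> m \<Phi> u w) = chain_eval N (coderiv \<pi> m \<Psi> u w)"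
  using assms(2,3)
  by (rule coderiv_rel[where Rl = "\<lambda>a b. chain_eval N a = chain_eval N b"])
     (use assms in \<open>auto intro: abelian_group.chain_eval_add_cong simp: abelian_group.chain_eval_minus\<close>)

text \<open>Expands a letter that is itself a composite. All inner values \<open>g q a'\<close> lie
  in the same component, so the substitution yields a formal sum of elements of one module, and
  additivity of \<open>\<Phi>\<close> in its first letter allows this sum to be evaluated inside the
  word.\<close>

lemma chain_eval_extend_letter:
  assumes N: "abelian_group N" and C: "\<And>d. abelian_group (C d)"
    and h: "word_family A B 1 h" and g: "word_family B C k g" and a: "hword A a" "a \<noteq> []" and c: "hword C c"
    and \<Phi>: "chain_additive N C D \<Phi>" and D: "outdeg k p a - (0, 1) + sdeg c - diag j = D"
  shows "chain_eval N (extend h (\<lambda>q a'. \<Phi> j (g q a' # c)) p a) =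
    chain_eval N (\<Phi> j ((outdeg k p a,
      chain_eval (C (outdeg k p a)) (extend h (\<lambda>q a'. frag_of (snd (g q a'))) p a)) # c))"
proof -
  define d where "d = outdeg k p a"
  let ?\<Theta> = "\<lambda>y. \<Phi> j ((d, y) # c)"
  interpret N: abelian_group N by (rule N)
  have gq: "fst (g q a') = d \<and> snd (g q a') \<in> carrier (C d)"
    if "hword B a'" "sdeg a' - diag q = sdeg a - diag p" "a' = [] \<longleftrightarrow> a = []" for q a'
  proof -
    have "outdeg k q a' = sdeg a' - diag q + (0, k)" by (simp add: outdeg_def)
    also have "\<dots> = d" unfolding that(2) d_def outdeg_def by (simp add: prod_eq_iff)
    finally have "outdeg k q a' = d" .
    moreover have "a' \<noteq> []" using that(3) a(2) by simp
    ultimately show ?thesis using g that(1) unfolding word_family_def by auto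
  qed
  \<comment> \<open>The relation ignores its second argument, which turns \<open>extend_rel\<close>
    into a bound for the support.\<close>
  have keys: "Poly_Mapping.keys (extend h (\<lambda>q a'. frag_of (snd (g q a'))) p a) \<subseteq> carrier (C d)"
    by (rule extend_rel[OF h a(1), where Rl = "\<lambda>a b. Poly_Mapping.keys a \<subseteq> carrier (C d)"])
       (auto simp: gq dest!: set_mp[OF keys_add])
  have "chain_eval N (extend h (\<lambda>q a'. \<Phi> j (g q a' # c)) p a) =
      chain_eval N (extend h (\<lambda>q a'. frag_extend ?\<Theta> (frag_of (snd (g q a')))) p a)"
  proof (rule extend_cong_chain_eval[OF N h a(1)])
    fix i c' assume *: "hword B c'" "sdeg c' - diag i = sdeg a - diag p" "c' = [] \<longleftrightarrow> a = []"
    show "chain_eval N (\<Phi> j (g i c' # c)) = chain_eval N (frag_extend ?\<Theta> (frag_of (snd (g i c'))))"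
      using gq[OF *] by (cases "g i c'") simp
  qed
  also have "\<dots> = chain_eval N (frag_extend ?\<Theta> (extend h (\<lambda>q a'. frag_of (snd (g q a'))) p a))"
    by (subst extend_hom[of "frag_extend ?\<Theta>"]) (simp_all add: frag_extend_add)
  also have "\<dots> = chain_eval N (?\<Theta> (chain_eval (C d) (extend h (\<lambda>q a'. frag_of (snd (g q a'))) p a)))"
  proof (rule N.chain_eval_frag_extend[OF C keys])
    fix x y assume "x \<in> carrier (C d)" "y \<in> carrier (C d)"
    then show "chain_eval N (?\<Theta> (x \<oplus>\<^bsub>C d\<^esub> y)) = chain_eval N (?\<Theta> x + ?\<Theta> y)"
      using chain_additiveD[OF \<Phi> _ _ _ c, of x d y "[]" j] D unfolding d_def[symmetric] by simp
  qed
  finally show ?thesis unfolding d_def .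
qed

text \<open>The analogous expansion when the letter is \<open>g\<close> applied after one insertion
  of \<open>m\<close>; the degree of the inserted structure map explains
  \<open>outdeg 2\<close>.\<close>

lemma chain_eval_coderiv_letter:
  assumes N: "abelian_group N" and B: "\<And>d. abelian_group (B d)"
    and m: "word_family A A 2 m" and g: "word_family A B 1 g" and a: "hword A a" "a \<noteq> []" and c: "hword B c"
    and \<Phi>: "chain_additive N B D \<Phi>" and D: "outdeg 2 p a - (0, 1) + sdeg c - diag j = D"
  shows "chain_eval N (coderiv \<pi> m (\<lambda>q a'. \<Phi> j (g q a' # c)) p a) =
    chain_eval N (\<Phi> j ((outdeg 2 p a,
      chain_eval (B (outdeg 2 p a)) (coderiv \<pi> m (\<lambda>q a'. frag_of (snd (g q a'))) p a)) # c))"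
proof -
  define d where "d = outdeg 2 p a"
  let ?\<Theta> = "\<lambda>y. \<Phi> j ((d, y) # c)"
  interpret N: abelian_group N by (rule N)
  have gq: "fst (g q a') = d \<and> snd (g q a') \<in> carrier (B d)"
    if "hword A a'" "sdeg a' - diag q = sdeg a - diag p + (0, 1)" "a' = [] \<longleftrightarrow> a = []" for q a'
  proof -
    have "outdeg 1 q a' = sdeg a' - diag q + (0, 1)" by (simp add: outdeg_def)
    also have "\<dots> = d" unfolding that(2) d_def outdeg_def by (simp add: prod_eq_iff)
    finally have "outdeg 1 q a' = d" .
    moreover have "a' \<noteq> []" using that(3) a(2) by simp
    ultimately show ?thesis using g that(1) unfolding word_family_def by auto
  qed
  have keys: "Poly_Mapping.keys (coderiv \<pi> m (\<lambda>q a'. frag_of (snd (g q a'))) p a) \<subseteq> carrier (B d)"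
    by (rule coderiv_rel[OF m a(1), where Rl = "\<lambda>a b. Poly_Mapping.keys a \<subseteq> carrier (B d)"])
       (auto simp: gq dest!: set_mp[OF keys_add])
  have "chain_eval N (coderiv \<pi> m (\<lambda>q a'. \<Phi> j (g q a' # c)) p a) =
      chain_eval N (coderiv \<pi> m (\<lambda>q a'. frag_extend ?\<Theta> (frag_of (snd (g q a')))) p a)"
  proof (rule coderiv_cong_chain_eval[OF N m a(1)])
    fix i c' assume *: "hword A c'" "sdeg c' - diag i = sdeg a - diag p + (0, 1)" "c' = [] \<longleftrightarrow> a = []"
    show "chain_eval N (\<Phi> j (g i c' # c)) = chain_eval N (frag_extend ?\<Theta> (frag_of (snd (g i c'))))"
      using gq[OF *] by (cases "g i c'") simp
  qed
  also have "\<dots> = chain_eval N (frag_extend ?\<Theta> (coderiv \<pi> m (\<lambda>q a'. frag_of (snd (g q a'))) p a))"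
    by (subst coderiv_hom[of "frag_extend ?\<Theta>"]) (simp_all add: frag_extend_add frag_extend_minus)
  also have "\<dots> = chain_eval N (?\<Theta> (chain_eval (B d) (coderiv \<pi> m (\<lambda>q a'. frag_of (snd (g q a'))) p a)))"
  proof (rule N.chain_eval_frag_extend[OF B keys])
    fix x y assume "x \<in> carrier (B d)" "y \<in> carrier (B d)"
    then show "chain_eval N (?\<Theta> (x \<oplus>\<^bsub>B d\<^esub> y)) = chain_eval N (?\<Theta> x + ?\<Theta> y)"
      using chain_additiveD[OF \<Phi> _ _ _ c, of x d y "[]" j] D unfolding d_def[symmetric] by simp
  qed
  finally show ?thesis unfolding d_def .
qed

section \<open>Composition of extensions, and morphisms against coderivations\<close>

lemma extend_budget2:
  "extend g (\<lambda>i a'. extend h (\<lambda>k b'. sum_splits (\<lambda>q s. \<Xi> q s a' b') k) i b) u a =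
   sum_splits (\<lambda>p r. extend g (\<lambda>q a'. extend h (\<lambda>s b'. \<Xi> q s a' b') r b) p a) u"
proof -
  have "(\<lambda>i a'. extend h (\<lambda>k b'. sum_splits (\<lambda>q s. \<Xi> q s a' b') k) i b) =
      (\<lambda>i a'. sum_splits (\<lambda>q r. extend h (\<lambda>s b'. \<Xi> q s a' b') r b) i)"
    by (simp add: extend_budget')
  then show ?thesis by (simp only: extend_budget)
qed

text \<open>Isolates the first letter produced by \<open>g\<close>. It comes from a cut of the
  intermediate word, which \<open>extend_coalgebra1\<close> pulls back to a cut of \<open>w\<close>;
  \<open>extend_swap\<close> then moves the substitution that builds this letter innermost.\<close>

lemma extend_extend_nonempty:
  assumes "w \<noteq> []"
  shows "extend h (extend g \<Phi>) u w = cuts1 (\<lambda>a b. sum_splits (\<lambda>p r.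
    extend h (extend g (\<lambda>j c. extend h (\<lambda>q a'. \<Phi> j (g q a' # c)) p a)) r b) u) w"
proof -
  have "extend h (extend g \<Phi>) u w = extend h (\<lambda>i. cuts1 (\<lambda>a b.
      sum_splits (\<lambda>p r. extend g (\<lambda>i c. \<Phi> i (g p a # c)) r b) i)) u w"
    by (rule extend_cong) (use assms in \<open>simp add: extend_nonempty\<close>)
  also have "\<dots> = cuts1 (\<lambda>a b. sum_splits (\<lambda>p r. extend h (\<lambda>q a'.
      extend h (\<lambda>s b'. extend g (\<lambda>j c. \<Phi> j (g q a' # c)) s b') r b) p a) u) w"
    by (simp only: extend_coalgebra1 extend_budget2)
  also have "\<dots> = cuts1 (\<lambda>a b. sum_splits (\<lambda>p r. extend h (\<lambda>s b'. extend g (\<lambda>j c. extend h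
      (\<lambda>q a'. \<Phi> j (g q a' # c)) p a) s b') r b) u) w"
    by (subst (1 2) extend_swap) (rule refl)
  finally show ?thesis .
qed

text \<open>Functoriality of the coalgebra extension: the coalgebra map with corestriction
  \<open>gh\<close> is the composite of those of \<open>h\<close> and \<open>g\<close>. One output
  letter is treated at a time: the induction hypothesis settles the rest \<open>b\<close> with the
  letter \<open>gh p a\<close> fixed, and this letter is then expanded into the sum that defines
  it.\<close>

theorem extend_comp:
  assumes N: "abelian_group N" and C: "\<And>d. abelian_group (C d)"
    and h: "word_family A B 1 h" and g: "word_family B C 1 g" and w: "hword A w"
    and gh: "\<And>p a. hword A a \<Longrightarrow> a \<noteq> [] \<Longrightarrow> gh p a =
      (outdeg 1 p a, chain_eval (C (outdeg 1 p a)) (extend h (\<lambda>q a'. frag_of (snd (g q a'))) p a))"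
    and \<Phi>: "chain_additive N C (sdeg w - diag u) \<Phi>"
  shows "chain_eval N (extend gh \<Phi> u w) = chain_eval N (extend h (extend g \<Phi>) u w)"
  using w \<Phi>
proof (induction w arbitrary: \<Phi> u rule: length_induct_word)
  case (1 w)
  interpret N: abelian_group N by (rule N)
  show ?case
  proof (cases "w = []")
    case True then show ?thesis by simp
  next
    case False
    show ?thesis
      unfolding extend_extend_nonempty[OF False] extend_nonempty[OF False, of gh]
    proof (rule N.chain_eval_cuts1_cong, rule N.chain_eval_sum_splits_cong)
      fix a b p r assume ab: "w = a @ b" "a \<noteq> []" and pr: "p + r = u"
      have gab: "hword A a" "hword A b" using ab 1(2) by simp_all
      have du: "diag u = diag p + diag r" by (simp flip: pr diag_add)
      let ?z = "gh p a"
      have z: "fst ?z = outdeg 1 p a" "snd ?z \<in> carrier (C (outdeg 1 p a))"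
        by (simp_all add: gh[OF gab(1) ab(2)] abelian_group.chain_eval_closed[OF C])
      have D: "sdeg w - diag u - (fst ?z - (0, 1)) = sdeg b - diag r"
        unfolding z(1) ab(1) outdeg_def du by (simp add: algebra_simps)
      have "chain_eval N (extend gh (\<lambda>i c. \<Phi> i (?z # c)) r b) =
          chain_eval N (extend h (extend g (\<lambda>i c. \<Phi> i (?z # c))) r b)"
        using ab gab(2) chain_additive_Cons[OF 1(3), of ?z, unfolded D] z(2)
        by (intro 1(1)) (simp_all add: z(1))
      also have "\<dots> = chain_eval N (extend h (extend g (\<lambda>j c. extend h (\<lambda>q a'. \<Phi> j (g q a' # c)) p a)) r b)"
      proof (rule extend_cong_chain_eval[OF N h gab(2)], rule extend_cong_chain_eval[OF N g], assumption)
        fix i c i' c'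
        assume *: "sdeg c - diag i = sdeg b - diag r" "hword C c'" "sdeg c' - diag i' = sdeg c - diag i"
        have "outdeg 1 p a - (0, 1) + sdeg c' - diag i' = sdeg w - diag u"
          using D *(1,3) unfolding z(1) by (auto simp: prod_eq_iff)
        then show "chain_eval N (\<Phi> i' (?z # c')) = chain_eval N (extend h (\<lambda>q a'. \<Phi> i' (g q a' # c')) p a)"
          by (simp only: chain_eval_extend_letter[OF N C h g gab(1) ab(2) *(2) 1(3)] gh[OF gab(1) ab(2)])
      qed
      finally show "chain_eval N (extend gh (\<lambda>i c. \<Phi> i (?z # c)) r b) =
          chain_eval N (extend h (extend g (\<lambda>j c. extend h (\<lambda>q a'. \<Phi> j (g q a' # c)) p a)) r b)" .
    qed
  qed
qed

text \<open>The structure map is inserted either among the arguments \<open>a\<close> of the first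
  output letter, or to the right of them, where it has passed all of \<open>a\<close>.\<close>

lemma coderiv_extend_nonempty:
  assumes "w \<noteq> []"
  shows "coderiv \<pi> m (extend g \<Phi>) u w = cuts1 (\<lambda>a b.
    sum_splits (\<lambda>p r. extend g (\<lambda>j c. coderiv \<pi> m (\<lambda>q a'. \<Phi> j (g q a' # c)) p a) r b) u +
    sum_splits (\<lambda>p r. chain_sign (psum \<pi> a) (coderiv \<pi> m (extend g (\<lambda>j c. \<Phi> j (g p a # c))) r b)) u) w"
proof -
  have "coderiv \<pi> m (extend g \<Phi>) u w = coderiv \<pi> m (\<lambda>i. cuts1 (\<lambda>a b.
      sum_splits (\<lambda>p r. extend g (\<lambda>i c. \<Phi> i (g p a # c)) r b) i)) u w"
    by (rule coderiv_cong) (use assms in \<open>simp add: extend_nonempty\<close>)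
  also have "\<dots> = cuts1 (\<lambda>a b.
    sum_splits (\<lambda>p r. coderiv \<pi> m (\<lambda>q a'. extend g (\<lambda>j c. \<Phi> j (g q a' # c)) r b) p a) u +
    sum_splits (\<lambda>p r. chain_sign (psum \<pi> a) (coderiv \<pi> m (extend g (\<lambda>j c. \<Phi> j (g p a # c))) r b)) u) w"
    unfolding coderiv_coalgebra1 chain_sign_sum_splits[symmetric]
    by (intro cuts1_cong arg_cong2[where f = "(+)"] arg_cong[where f = "chain_sign _"]
        coderiv_budget[symmetric] coderiv_budget'[symmetric])
  finally show ?thesis by (simp add: extend_coderiv_swap)
qed

text \<open>The structure map consumes an initial run of output letters, which together come from
  \<open>a\<close>, or it passes the first output letter at the price of the parity of that
  letter.\<close>

lemma extend_coderiv_nonempty: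
  assumes "w \<noteq> []"
  shows "extend g (coderiv \<pi> m \<Phi>) u w = cuts1 (\<lambda>a b.
    sum_splits (\<lambda>p r. extend g (\<lambda>j c. extend g (\<lambda>q a'. \<Phi> j (m q a' # c)) p a) r b) u +
    sum_splits (\<lambda>p r. chain_sign (\<pi> (g p a)) (extend g (coderiv \<pi> m (\<lambda>j c. \<Phi> j (g p a # c))) r b)) u) w"
proof -
  \<comment> \<open>The part of the coderivation that leaves the first letter alone, written by
    cases so that it has a value on the empty word too.\<close>
  define T where "T = (\<lambda>i w. case w of [] \<Rightarrow> 0 | x # w' \<Rightarrow> chain_sign (\<pi> x) (coderiv \<pi> m (\<lambda>j c. \<Phi> j (x # c)) i w'))"
  have "extend g (coderiv \<pi> m \<Phi>) u w =
      extend g (\<lambda>i c. cuts1 (\<lambda>a b. sum_splits (\<lambda>p r. \<Phi> r (m p a # b)) i) c + T i c) u w"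
    by (rule extend_cong) (use assms in \<open>auto simp: T_def neq_Nil_conv\<close>)
  moreover have "extend g T u w = cuts1 (\<lambda>a b.
      sum_splits (\<lambda>p r. chain_sign (\<pi> (g p a)) (extend g (coderiv \<pi> m (\<lambda>j c. \<Phi> j (g p a # c))) r b)) u) w"
    using assms by (simp add: extend_nonempty T_def extend_chain_sign)
  moreover have "extend g (\<lambda>i. cuts1 (\<lambda>a b. sum_splits (\<lambda>p r. \<Phi> r (m p a # b)) i)) u w =
      cuts1 (\<lambda>a b. sum_splits (\<lambda>p r. extend g (\<lambda>q a'. extend g (\<lambda>j c. \<Phi> j (m q a' # c)) r b) p a) u) w"
    by (simp only: extend_coalgebra1 extend_budget2)
  moreover have "\<dots> = cuts1 (\<lambda>a b. sum_splits (\<lambda>p r. extend g (\<lambda>j c. extend g (\<lambda>q a'. \<Phi> j (m q a' # c)) p a) r b) u) w"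
    by (subst extend_swap) (rule refl)
  ultimately show ?thesis
    by (simp only: extend_add cuts1_add)
qed

text \<open>A suspended morphism has total degree 0, because \<open>diag p\<close> does not change
  the difference of the two degrees. Hence passing the value \<open>g p a\<close> costs the same
  sign as passing its arguments.\<close>

lemma shifted_deg_word_family:
  assumes "word_family A B 1 g" "hword A a" "a \<noteq> []"
  shows "shifted_deg (g p a) = psum shifted_deg a"
proof -
  have "psum shifted_deg a = snd (sdeg a) - fst (sdeg a)"
    by (induction a) (auto simp: shifted_deg_def)
  moreover have "fst (g p a) = outdeg 1 p a" using assms by (simp add: word_family_def)
  ultimately show ?thesis by (simp add: shifted_deg_def outdeg_def diag_def)
qed

text \<open>The hypothesis \<open>mor\<close> concerns single output letters; here it is spread to
  whole words. Once the first output letter is isolated, the terms that act on an initial run agree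
  by \<open>mor\<close>, and the terms that pass the first letter agree by induction, with equal
  signs by \<open>shifted_deg_word_family\<close>.\<close>

theorem coderiv_extend:
  assumes N: "abelian_group N" and B: "\<And>d. abelian_group (B d)"
    and m: "word_family A A 2 m" and m': "word_family B B 2 m'" and g: "word_family A B 1 g" and w: "hword A w"
    and mor: "\<And>p a. hword A a \<Longrightarrow> a \<noteq> [] \<Longrightarrow>
      chain_eval (B (outdeg 2 p a)) (coderiv shifted_deg m (\<lambda>q a'. frag_of (snd (g q a'))) p a) =
      chain_eval (B (outdeg 2 p a)) (extend g (\<lambda>q a'. frag_of (snd (m' q a'))) p a)"
    and \<Phi>: "chain_additive N B (sdeg w - diag u + (0, 1)) \<Phi>"
  shows "chain_eval N (coderiv shifted_deg m (extend g \<Phi>) u w) = chain_eval N (extend g (coderiv shifted_deg m' \<Phi>) u w)"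
  using w \<Phi>
proof (induction w arbitrary: \<Phi> u rule: length_induct_word)
  case (1 w)
  interpret N: abelian_group N by (rule N)
  show ?case
  proof (cases "w = []")
    case True then show ?thesis by simp
  next
    case False
    show ?thesis
      unfolding coderiv_extend_nonempty[OF False] extend_coderiv_nonempty[OF False]
    proof (intro N.chain_eval_cuts1_cong N.chain_eval_add_cong N.chain_eval_sum_splits_cong)
      fix a b p r assume ab: "w = a @ b" "a \<noteq> []" and pr: "p + r = u"
      have gab: "hword A a" "hword A b" using ab 1(2) by simp_all
      have du: "diag u = diag p + diag r" by (simp flip: pr diag_add)
      show "chain_eval N (extend g (\<lambda>j c. coderiv shifted_deg m (\<lambda>q a'. \<Phi> j (g q a' # c)) p a) r b) =
          chain_eval N (extend g (\<lambda>j c. extend g (\<lambda>q a'. \<Phi> j (m' q a' # c)) p a) r b)"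
      proof (rule extend_cong_chain_eval[OF N g gab(2)])
        fix i c assume c: "hword B c" "sdeg c - diag i = sdeg b - diag r"
        have "outdeg 2 p a - (0, 1) + sdeg c - diag i =
            sdeg a + ((0, 2) - (0, 1)) - diag p + (sdeg c - diag i)"
          unfolding outdeg_def by (simp add: algebra_simps)
        also have "\<dots> = sdeg w - diag u + (0, 1)"
          unfolding c(2) ab(1) du by (simp add: algebra_simps)
        finally have D: "outdeg 2 p a - (0, 1) + sdeg c - diag i = sdeg w - diag u + (0, 1)" .
        show "chain_eval N (coderiv shifted_deg m (\<lambda>q a'. \<Phi> i (g q a' # c)) p a) =
           chain_eval N (extend g (\<lambda>q a'. \<Phi> i (m' q a' # c)) p a)"
          by (simp only: chain_eval_coderiv_letter[OF N B m g gab(1) ab(2) c(1) 1(3) D]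
              chain_eval_extend_letter[OF N B g m' gab(1) ab(2) c(1) 1(3) D] mor[OF gab(1) ab(2)])
      qed
      let ?z = "g p a"
      have z: "fst ?z = outdeg 1 p a" "snd ?z \<in> carrier (B (outdeg 1 p a))"
        using g gab ab by (auto simp: word_family_def)
      have D: "sdeg w - diag u + (0, 1) - (fst ?z - (0, 1)) = sdeg b - diag r + (0, 1)"
        unfolding z(1) ab(1) outdeg_def du by (simp add: algebra_simps)
      have "chain_eval N (coderiv shifted_deg m (extend g (\<lambda>j c. \<Phi> j (?z # c))) r b) =
          chain_eval N (extend g (coderiv shifted_deg m' (\<lambda>j c. \<Phi> j (?z # c))) r b)"
        using ab gab(2) chain_additive_Cons[OF 1(3), of ?z, unfolded D] z(2)
        by (intro 1(1)) (simp_all add: z(1))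
      then show "chain_eval N (chain_sign (psum shifted_deg a) (coderiv shifted_deg m (extend g (\<lambda>j c. \<Phi> j (?z # c))) r b)) =
          chain_eval N (chain_sign (shifted_deg ?z) (extend g (coderiv shifted_deg m' (\<lambda>j c. \<Phi> j (?z # c))) r b))"
        unfolding shifted_deg_word_family[OF g gab(1) ab(2)] by (rule N.chain_eval_chain_sign_cong)
    qed
  qed
qed

section \<open>The universal property of tensor powers\<close>

lemma free_module_simps [simp]:
  "ring.zero (free_module R W) = (\<lambda>w. \<zero>\<^bsub>R\<^esub>)"
  "ring.add (free_module R W) f g = (\<lambda>w. f w \<oplus>\<^bsub>R\<^esub> g w)"
  "module.smult (free_module R W) r f = (\<lambda>w. r \<otimes>\<^bsub>R\<^esub> f w)"
  by (simp_all add: free_module_def)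

context cring
begin

lemma free_carrier: "f \<in> carrier (free_module R W) \<longleftrightarrow>
    (\<forall>w. f w \<in> carrier R) \<and> finite {w. f w \<noteq> \<zero>} \<and> (\<forall>w. f w \<noteq> \<zero> \<longrightarrow> w \<in> W)"
  by (auto simp: free_module_def)

lemma free_module_module: "module R (free_module R W)"
proof (rule moduleI)
  show "cring R" by (rule is_cring)
  have add: "(\<lambda>w. f w \<oplus> g w) \<in> carrier (free_module R W)"
    if "f \<in> carrier (free_module R W)" "g \<in> carrier (free_module R W)" for f g
  proof -
    have "finite {w. f w \<oplus> g w \<noteq> \<zero>}"
    proof (rule finite_subset)
      show "{w. f w \<oplus> g w \<noteq> \<zero>} \<subseteq> {w. f w \<noteq> \<zero>} \<union> {w. g w \<noteq> \<zero>}" by auto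
      show "finite ({w. f w \<noteq> \<zero>} \<union> {w. g w \<noteq> \<zero>})" using that unfolding free_carrier by blast
    qed
    moreover have "w \<in> W" if "f w \<oplus> g w \<noteq> \<zero>" for w
    proof (rule ccontr)
      assume "w \<notin> W"
      then have "f w = \<zero>" "g w = \<zero>" using \<open>f \<in> _\<close> \<open>g \<in> _\<close> unfolding free_carrier by blast+
      then show False using that by simp
    qed
    ultimately show ?thesis using that unfolding free_carrier by blast
  qed
  have smult: "(\<lambda>w. r \<otimes> f w) \<in> carrier (free_module R W)"
    if "r \<in> carrier R" "f \<in> carrier (free_module R W)" for r f
  proof -
    have "finite {w. r \<otimes> f w \<noteq> \<zero>}"
    proof (rule finite_subset)
      show "{w. r \<otimes> f w \<noteq> \<zero>} \<subseteq> {w. f w \<noteq> \<zero>}" using that by auto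
      show "finite {w. f w \<noteq> \<zero>}" using that unfolding free_carrier by blast
    qed
    moreover have "w \<in> W" if "r \<otimes> f w \<noteq> \<zero>" for w
    proof (rule ccontr)
      assume "w \<notin> W"
      then have "f w = \<zero>" using \<open>f \<in> _\<close> unfolding free_carrier by blast
      then show False using that \<open>r \<in> _\<close> by simp
    qed
    ultimately show ?thesis using that unfolding free_carrier by blast
  qed
  show "abelian_group (free_module R W)"
  proof (rule abelian_groupI)
    fix f assume f: "f \<in> carrier (free_module R W)"
    then have "(\<lambda>w. \<ominus> \<one> \<otimes> f w) \<in> carrier (free_module R W)" by (intro smult) auto
    moreover have "(\<lambda>w. \<ominus> \<one> \<otimes> f w \<oplus> f w) = (\<lambda>w. \<zero>)"
      using f by (auto simp: free_carrier l_minus l_neg)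
    ultimately show "\<exists>g\<in>carrier (free_module R W). g \<oplus>\<^bsub>free_module R W\<^esub> f = \<zero>\<^bsub>free_module R W\<^esub>"
      by (auto intro!: bexI)
    show "f \<oplus>\<^bsub>free_module R W\<^esub> g \<in> carrier (free_module R W)"
      if "f \<in> carrier (free_module R W)" "g \<in> carrier (free_module R W)" for f g
      using add[OF that] by simp
  qed (auto simp: free_carrier a_ac)
  show "r \<odot>\<^bsub>free_module R W\<^esub> f \<in> carrier (free_module R W)"
    if "r \<in> carrier R" "f \<in> carrier (free_module R W)" for r f
    using smult[OF that] by simp
qed (auto simp: free_carrier l_distr r_distr m_assoc)

lemma free_gen_carrier [simp]: "w \<in> W \<Longrightarrow> free_gen R w \<in> carrier (free_module R W)"
  by (auto simp: free_carrier free_gen_def intro: finite_subset[of _ "{w}"])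

end

definition free_lift :: "('r, 's) ring_scheme \<Rightarrow> ('r, 'b, 'm) module_scheme \<Rightarrow> ('w \<Rightarrow> 'b) \<Rightarrow> ('w \<Rightarrow> 'r) \<Rightarrow> 'b" where
  "free_lift R N \<phi> f = (\<Oplus>\<^bsub>N\<^esub>w\<in>{w. f w \<noteq> \<zero>\<^bsub>R\<^esub>}. f w \<odot>\<^bsub>N\<^esub> \<phi> w)"

context module
begin

text \<open>The support of a sum of functions is in general not that of either summand. Extending
  all sums to a common finite set makes them comparable.\<close>

lemma free_lift_superset:
  assumes "f \<in> carrier (free_module R W)" "\<phi> \<in> W \<rightarrow> carrier M"
    "finite F" "{w. f w \<noteq> \<zero>} \<subseteq> F" "F \<subseteq> W"
  shows "free_lift R M \<phi> f = (\<Oplus>\<^bsub>M\<^esub>w\<in>F. f w \<odot>\<^bsub>M\<^esub> \<phi> w)"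
  unfolding free_lift_def
proof (rule M.add.finprod_mono_neutral_cong_left)
  show "\<And>i. i \<in> F - {w. f w \<noteq> \<zero>} \<Longrightarrow> f i \<odot>\<^bsub>M\<^esub> \<phi> i = \<zero>\<^bsub>M\<^esub>"
    using assms by (auto simp: Pi_def)
  show "(\<lambda>w. f w \<odot>\<^bsub>M\<^esub> \<phi> w) \<in> F \<rightarrow> carrier M"
    using assms by (auto simp: R.free_carrier Pi_def intro!: smult_closed)
qed (use assms in auto)

lemma free_lift_closed:
  assumes "f \<in> carrier (free_module R W)" "\<phi> \<in> W \<rightarrow> carrier M"
  shows "free_lift R M \<phi> f \<in> carrier M"
  unfolding free_lift_def
  using assms by (auto simp: R.free_carrier Pi_def intro!: M.finsum_closed smult_closed)

lemma free_lift_add: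
  assumes f: "f \<in> carrier (free_module R W)" and g: "g \<in> carrier (free_module R W)"
    and \<phi>: "\<phi> \<in> W \<rightarrow> carrier M"
  shows "free_lift R M \<phi> (\<lambda>w. f w \<oplus> g w) = free_lift R M \<phi> f \<oplus>\<^bsub>M\<^esub> free_lift R M \<phi> g"
proof -
  let ?F = "{w. f w \<noteq> \<zero>} \<union> {w. g w \<noteq> \<zero>}"
  have F: "finite ?F" "?F \<subseteq> W" using f g by (auto simp: R.free_carrier)
  interpret FM: module R "free_module R W" by (rule R.free_module_module)
  have fg: "(\<lambda>w. f w \<oplus> g w) \<in> carrier (free_module R W)"
    using FM.M.a_closed[OF f g] by simp
  have "{w. f w \<oplus> g w \<noteq> \<zero>} \<subseteq> ?F" by auto
  then have "free_lift R M \<phi> (\<lambda>w. f w \<oplus> g w) = (\<Oplus>\<^bsub>M\<^esub>w\<in>?F. (f w \<oplus> g w) \<odot>\<^bsub>M\<^esub> \<phi> w)"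
    by (intro free_lift_superset[OF fg \<phi>] F)
  also have "\<dots> = (\<Oplus>\<^bsub>M\<^esub>w\<in>?F. f w \<odot>\<^bsub>M\<^esub> \<phi> w \<oplus>\<^bsub>M\<^esub> g w \<odot>\<^bsub>M\<^esub> \<phi> w)"
    using f g \<phi> F by (intro M.finsum_cong') (auto simp: R.free_carrier Pi_def smult_l_distr)
  also have "\<dots> = (\<Oplus>\<^bsub>M\<^esub>w\<in>?F. f w \<odot>\<^bsub>M\<^esub> \<phi> w) \<oplus>\<^bsub>M\<^esub> (\<Oplus>\<^bsub>M\<^esub>w\<in>?F. g w \<odot>\<^bsub>M\<^esub> \<phi> w)"
    using f g \<phi> F by (intro M.finsum_addf) (auto simp: R.free_carrier Pi_def)
  also have "\<dots> = free_lift R M \<phi> f \<oplus>\<^bsub>M\<^esub> free_lift R M \<phi> g"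
    by (simp only: free_lift_superset[OF f \<phi> F(1) Un_upper1 F(2)] free_lift_superset[OF g \<phi> F(1) Un_upper2 F(2)])
  finally show ?thesis .
qed

lemma free_lift_smult:
  assumes f: "f \<in> carrier (free_module R W)" and r: "r \<in> carrier R" and \<phi>: "\<phi> \<in> W \<rightarrow> carrier M"
  shows "free_lift R M \<phi> (\<lambda>w. r \<otimes> f w) = r \<odot>\<^bsub>M\<^esub> free_lift R M \<phi> f"
proof -
  let ?F = "{w. f w \<noteq> \<zero>}"
  have F: "finite ?F" "?F \<subseteq> W" using f by (auto simp: R.free_carrier)
  interpret FM: module R "free_module R W" by (rule R.free_module_module)
  have rf: "(\<lambda>w. r \<otimes> f w) \<in> carrier (free_module R W)"
    using FM.smult_closed[OF r f] by simp
  have "{w. r \<otimes> f w \<noteq> \<zero>} \<subseteq> ?F" using r by auto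
  then have "free_lift R M \<phi> (\<lambda>w. r \<otimes> f w) = (\<Oplus>\<^bsub>M\<^esub>w\<in>?F. (r \<otimes> f w) \<odot>\<^bsub>M\<^esub> \<phi> w)"
    by (intro free_lift_superset[OF rf \<phi>] F)
  also have "\<dots> = (\<Oplus>\<^bsub>M\<^esub>w\<in>?F. r \<odot>\<^bsub>M\<^esub> (f w \<odot>\<^bsub>M\<^esub> \<phi> w))"
    using f r \<phi> F by (intro M.finsum_cong') (auto simp: R.free_carrier Pi_def smult_assoc1)
  also have "\<dots> = r \<odot>\<^bsub>M\<^esub> free_lift R M \<phi> f"
    unfolding free_lift_def using f r \<phi> F
    by (intro finsum_smult_ldistr[symmetric]) (auto simp: R.free_carrier Pi_def)
  finally show ?thesis .
qed

lemma free_lift_gen: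
  assumes "w \<in> W" "\<phi> \<in> W \<rightarrow> carrier M"
  shows "free_lift R M \<phi> (free_gen R w) = \<phi> w"
proof -
  have "{v. free_gen R w v \<noteq> \<zero>} \<subseteq> {w}" by (auto simp: free_gen_def)
  then have "free_lift R M \<phi> (free_gen R w) = (\<Oplus>\<^bsub>M\<^esub>v\<in>{w}. free_gen R w v \<odot>\<^bsub>M\<^esub> \<phi> v)"
    using assms by (intro free_lift_superset[OF R.free_gen_carrier]) auto
  then show ?thesis using assms by (auto simp: free_gen_def Pi_def)
qed

lemma submodule_abelian_subgroup:
  assumes "submodule H R M" shows "abelian_subgroup H M"
  by (rule abelian_subgroupI3)
     (use assms M.abelian_group_axioms in \<open>auto simp: additive_subgroup_def submodule_def\<close>)

end

section \<open>Generated submodules and quotients\<close>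

lemma generated_submodule_subset: "S \<subseteq> generated_submodule R M S"
  by (auto simp: generated_submodule_def)

lemma generated_submodule_least:
  "submodule N R M \<Longrightarrow> S \<subseteq> N \<Longrightarrow> generated_submodule R M S \<subseteq> N"
  by (auto simp: generated_submodule_def)

lemma generated_submodule_submodule:
  assumes "module R M" "S \<subseteq> carrier M"
  shows "submodule (generated_submodule R M S) R M"
proof -
  interpret module R M by (rule assms)
  have c: "submodule (carrier M) R M" by (rule carrier_is_submodule)
  show ?thesis
  proof (rule submoduleI)
    show "generated_submodule R M S \<subseteq> carrier M"
      using c assms(2) by (rule generated_submodule_least)
    show "\<zero>\<^bsub>M\<^esub> \<in> generated_submodule R M S"
      using submodule.axioms(1) subgroup.one_closed
      by (fastforce simp: generated_submodule_def)
  qed (auto simp: generated_submodule_def dest: submoduleE)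
qed

text \<open>The kernel of a linear map is one of the submodules over which the intersection in
  \<open>generated_submodule\<close> is formed.\<close>

lemma generated_submodule_le_kernel:
  fixes N :: "('r, 'x) module" and M :: "('r, 'a) module"
  assumes M: "module R M" and N: "module R N" and S: "S \<subseteq> carrier M" and h: "\<And>x. x \<in> carrier M \<Longrightarrow> h x \<in> carrier N"
    "\<And>x y. x \<in> carrier M \<Longrightarrow> y \<in> carrier M \<Longrightarrow> h (x \<oplus>\<^bsub>M\<^esub> y) = h x \<oplus>\<^bsub>N\<^esub> h y"
    "\<And>r x. r \<in> carrier R \<Longrightarrow> x \<in> carrier M \<Longrightarrow> h (r \<odot>\<^bsub>M\<^esub> x) = r \<odot>\<^bsub>N\<^esub> h x"
    and "\<And>x. x \<in> S \<Longrightarrow> h x = \<zero>\<^bsub>N\<^esub>" and "x \<in> generated_submodule R M S"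
  shows "h x = \<zero>\<^bsub>N\<^esub>"
proof -
  interpret module R M by (rule M)
  interpret N: module R N by (rule N)
  have 0: "h \<zero>\<^bsub>M\<^esub> = \<zero>\<^bsub>N\<^esub>"
    using h(3)[of "\<zero>\<^bsub>R\<^esub>" "\<zero>\<^bsub>M\<^esub>"] h(1)[of "\<zero>\<^bsub>M\<^esub>"] by simp
  have "submodule {x \<in> carrier M. h x = \<zero>\<^bsub>N\<^esub>} R M"
  proof (rule submoduleI)
    fix a assume a: "a \<in> {x \<in> carrier M. h x = \<zero>\<^bsub>N\<^esub>}"
    then have "h (\<ominus>\<^bsub>M\<^esub> a) \<oplus>\<^bsub>N\<^esub> h a = \<zero>\<^bsub>N\<^esub>"
      using h(2)[of "\<ominus>\<^bsub>M\<^esub> a" a] 0 by (simp add: M.l_neg)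
    with a show "\<ominus>\<^bsub>M\<^esub> a \<in> {x \<in> carrier M. h x = \<zero>\<^bsub>N\<^esub>}" using h(1) by auto
  qed (auto simp: 0 h)
  then have "generated_submodule R M S \<subseteq> {x \<in> carrier M. h x = \<zero>\<^bsub>N\<^esub>}"
    by (rule generated_submodule_least) (use assms in auto)
  then show ?thesis using assms by auto
qed

lemma quotient_module_simps [simp]:
  "ring.zero (quotient_module M N) = N"
  "ring.add (quotient_module M N) = set_add M"
  "module.smult (quotient_module M N) = (\<lambda>r X. \<Union>x\<in>X. N +>\<^bsub>M\<^esub> (r \<odot>\<^bsub>M\<^esub> x))"
  "carrier (quotient_module M N) = a_rcosets\<^bsub>M\<^esub> N"
  by (simp_all add: quotient_module_def)

locale quotient = module R M for R :: "('r, 's) ring_scheme" and M :: "('r, 'a) module" +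
  fixes N :: "'a set"
  assumes sub: "submodule N R M"
begin

sublocale Q: abelian_subgroup N M
  by (rule submodule_abelian_subgroup[OF sub])

lemma coset_carrier: "x \<in> carrier M \<Longrightarrow> N +>\<^bsub>M\<^esub> x \<in> carrier (quotient_module M N)"
  by (auto intro: M.a_rcosetsI Q.a_subset)

lemma coset_cases:
  assumes "X \<in> carrier (quotient_module M N)"
  obtains x where "x \<in> carrier M" "X = N +>\<^bsub>M\<^esub> x"
  using assms by (auto simp: A_RCOSETS_def')

lemma coset_add:
  "x \<in> carrier M \<Longrightarrow> y \<in> carrier M \<Longrightarrow>
    (N +>\<^bsub>M\<^esub> x) \<oplus>\<^bsub>quotient_module M N\<^esub> (N +>\<^bsub>M\<^esub> y) = N +>\<^bsub>M\<^esub> (x \<oplus>\<^bsub>M\<^esub> y)"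
  by (simp add: Q.a_rcos_sum)

text \<open>The product is a union over all representatives. Their multiples differ by elements of
  \<open>N\<close>, which is stable under scalars, so all cosets in the union coincide.\<close>

lemma coset_smult:
  assumes r: "r \<in> carrier R" and x: "x \<in> carrier M"
  shows "r \<odot>\<^bsub>quotient_module M N\<^esub> (N +>\<^bsub>M\<^esub> x) = N +>\<^bsub>M\<^esub> (r \<odot>\<^bsub>M\<^esub> x)"
proof -
  have *: "N +>\<^bsub>M\<^esub> (r \<odot>\<^bsub>M\<^esub> y) = N +>\<^bsub>M\<^esub> (r \<odot>\<^bsub>M\<^esub> x)" if y: "y \<in> N +>\<^bsub>M\<^esub> x" for y
  proof -
    obtain n where n: "n \<in> N" "y = n \<oplus>\<^bsub>M\<^esub> x" using y by (auto simp: a_r_coset_def')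
    have "r \<odot>\<^bsub>M\<^esub> n \<in> N" using n r submoduleE(4)[OF sub] by blast
    moreover have "r \<odot>\<^bsub>M\<^esub> y = r \<odot>\<^bsub>M\<^esub> n \<oplus>\<^bsub>M\<^esub> r \<odot>\<^bsub>M\<^esub> x"
      using n r x Q.a_subset by (auto simp: smult_r_distr)
    ultimately have "r \<odot>\<^bsub>M\<^esub> y \<in> N +>\<^bsub>M\<^esub> (r \<odot>\<^bsub>M\<^esub> x)" by (auto simp: a_r_coset_def')
    then show ?thesis
      using M.a_repr_independence[OF _ smult_closed[OF r x] Q.a_subgroup] by simp
  qed
  have "x \<in> N +>\<^bsub>M\<^esub> x" using x by (rule Q.a_rcos_self)
  with * show ?thesis unfolding quotient_module_simps by blast
qed

lemma quotient_module_module: "module R (quotient_module M N)"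
proof (rule moduleI)
  show "cring R" by (rule R.is_cring)
  have N0: "N = N +>\<^bsub>M\<^esub> \<zero>\<^bsub>M\<^esub>" using Q.a_subset by simp
  show "abelian_group (quotient_module M N)"
  proof (rule abelian_groupI)
    show "\<zero>\<^bsub>quotient_module M N\<^esub> \<in> carrier (quotient_module M N)"
      using coset_carrier[of "\<zero>\<^bsub>M\<^esub>"] N0 by simp
  next
    fix X Y assume "X \<in> carrier (quotient_module M N)" "Y \<in> carrier (quotient_module M N)"
    then show "X \<oplus>\<^bsub>quotient_module M N\<^esub> Y \<in> carrier (quotient_module M N)"
      by (elim coset_cases) (simp only: coset_add coset_carrier M.a_closed)
  next
    fix X Y Z assume "X \<in> carrier (quotient_module M N)" "Y \<in> carrier (quotient_module M N)"
      "Z \<in> carrier (quotient_module M N)"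
    then show "X \<oplus>\<^bsub>quotient_module M N\<^esub> Y \<oplus>\<^bsub>quotient_module M N\<^esub> Z =
        X \<oplus>\<^bsub>quotient_module M N\<^esub> (Y \<oplus>\<^bsub>quotient_module M N\<^esub> Z)"
      by (elim coset_cases) (simp only: coset_add M.a_closed M.a_assoc)
  next
    fix X Y assume "X \<in> carrier (quotient_module M N)" "Y \<in> carrier (quotient_module M N)"
    then show "X \<oplus>\<^bsub>quotient_module M N\<^esub> Y = Y \<oplus>\<^bsub>quotient_module M N\<^esub> X"
      by (elim coset_cases) (simp only: coset_add M.a_comm)
  next
    fix X assume "X \<in> carrier (quotient_module M N)"
    then obtain x where x: "x \<in> carrier M" "X = N +>\<^bsub>M\<^esub> x" by (rule coset_cases)
    have "(N +>\<^bsub>M\<^esub> \<zero>\<^bsub>M\<^esub>) \<oplus>\<^bsub>quotient_module M N\<^esub> X = X"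
      unfolding x(2) by (subst coset_add) (simp_all only: x M.zero_closed M.l_zero)
    then show "\<zero>\<^bsub>quotient_module M N\<^esub> \<oplus>\<^bsub>quotient_module M N\<^esub> X = X" using N0 by simp
    show "\<exists>Y\<in>carrier (quotient_module M N). Y \<oplus>\<^bsub>quotient_module M N\<^esub> X = \<zero>\<^bsub>quotient_module M N\<^esub>"
    proof
      have "(N +>\<^bsub>M\<^esub> (\<ominus>\<^bsub>M\<^esub> x)) \<oplus>\<^bsub>quotient_module M N\<^esub> X = N +>\<^bsub>M\<^esub> \<zero>\<^bsub>M\<^esub>"
        unfolding x(2) by (subst coset_add) (simp_all only: x M.a_inv_closed M.l_neg)
      then show "(N +>\<^bsub>M\<^esub> (\<ominus>\<^bsub>M\<^esub> x)) \<oplus>\<^bsub>quotient_module M N\<^esub> X = \<zero>\<^bsub>quotient_module M N\<^esub>"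
        using N0 by simp
      show "N +>\<^bsub>M\<^esub> (\<ominus>\<^bsub>M\<^esub> x) \<in> carrier (quotient_module M N)"
        using x by (intro coset_carrier) simp
    qed
  qed
next
  fix a X assume "a \<in> carrier R" "X \<in> carrier (quotient_module M N)"
  then show "a \<odot>\<^bsub>quotient_module M N\<^esub> X \<in> carrier (quotient_module M N)"
    by (elim coset_cases) (simp only: coset_smult coset_carrier smult_closed)
next
  fix a b X assume "a \<in> carrier R" "b \<in> carrier R" "X \<in> carrier (quotient_module M N)"
  then show "(a \<oplus>\<^bsub>R\<^esub> b) \<odot>\<^bsub>quotient_module M N\<^esub> X =
      a \<odot>\<^bsub>quotient_module M N\<^esub> X \<oplus>\<^bsub>quotient_module M N\<^esub> b \<odot>\<^bsub>quotient_module M N\<^esub> X"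
    by (elim coset_cases) (simp only: coset_smult coset_add smult_closed R.a_closed smult_l_distr)
next
  fix a X Y assume "a \<in> carrier R" "X \<in> carrier (quotient_module M N)" "Y \<in> carrier (quotient_module M N)"
  then show "a \<odot>\<^bsub>quotient_module M N\<^esub> (X \<oplus>\<^bsub>quotient_module M N\<^esub> Y) =
      a \<odot>\<^bsub>quotient_module M N\<^esub> X \<oplus>\<^bsub>quotient_module M N\<^esub> a \<odot>\<^bsub>quotient_module M N\<^esub> Y"
    by (elim coset_cases) (simp only: coset_smult coset_add smult_closed M.a_closed smult_r_distr)
next
  fix a b X assume "a \<in> carrier R" "b \<in> carrier R" "X \<in> carrier (quotient_module M N)"
  then show "(a \<otimes>\<^bsub>R\<^esub> b) \<odot>\<^bsub>quotient_module M N\<^esub> X =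
      a \<odot>\<^bsub>quotient_module M N\<^esub> (b \<odot>\<^bsub>quotient_module M N\<^esub> X)"
    by (elim coset_cases) (simp only: coset_smult smult_closed R.m_closed smult_assoc1)
next
  fix X assume "X \<in> carrier (quotient_module M N)"
  then show "\<one>\<^bsub>R\<^esub> \<odot>\<^bsub>quotient_module M N\<^esub> X = X"
    by (elim coset_cases) (simp only: coset_smult R.one_closed smult_one)
qed

lemma coset_eqI:
  assumes "x \<in> carrier M" "y \<in> carrier M" "x \<ominus>\<^bsub>M\<^esub> y \<in> N"
  shows "N +>\<^bsub>M\<^esub> x = N +>\<^bsub>M\<^esub> y"
proof -
  have "x = (x \<ominus>\<^bsub>M\<^esub> y) \<oplus>\<^bsub>M\<^esub> y"
    using assms by (simp add: M.minus_eq M.a_assoc M.l_neg)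
  then have "x \<in> N +>\<^bsub>M\<^esub> y" using assms(3) by (auto simp: a_r_coset_def')
  then show ?thesis
    using M.a_repr_independence[OF _ assms(2) Q.a_subgroup] by simp
qed

end

section \<open>Multilinear functions and maps out of tensor powers\<close>

text \<open>The two equations mirror the two families of generators in
  \<open>tensor_relations\<close>, so that the linear extension of \<open>\<phi>\<close> vanishes on
  them.\<close>

definition multilinear :: "('r, 's) ring_scheme \<Rightarrow> ('r, 'a) bgmod \<Rightarrow> nat \<Rightarrow> bideg \<Rightarrow> ('r, 'b) module \<Rightarrow>
    ((bideg \<times> 'a) list \<Rightarrow> 'b) \<Rightarrow> bool" where
  "multilinear R A n d N \<phi> \<longleftrightarrow> \<phi> \<in> hwords A n d \<rightarrow> carrier N \<and>
    (\<forall>u e x y w. u @ (e, x) # w \<in> hwords A n d \<and> u @ (e, y) # w \<in> hwords A n d \<longrightarrow>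
       \<phi> (u @ (e, x \<oplus>\<^bsub>A e\<^esub> y) # w) = \<phi> (u @ (e, x) # w) \<oplus>\<^bsub>N\<^esub> \<phi> (u @ (e, y) # w)) \<and>
    (\<forall>u e r x w. r \<in> carrier R \<and> u @ (e, x) # w \<in> hwords A n d \<longrightarrow>
       \<phi> (u @ (e, r \<odot>\<^bsub>A e\<^esub> x) # w) = r \<odot>\<^bsub>N\<^esub> \<phi> (u @ (e, x) # w))"

lemma multilinear_closed: "multilinear R A n d N \<phi> \<Longrightarrow> w \<in> hwords A n d \<Longrightarrow> \<phi> w \<in> carrier N"
  unfolding multilinear_def by blast

lemma multilinear_add: "multilinear R A n d N \<phi> \<Longrightarrow> u @ (e, x) # w \<in> hwords A n d \<Longrightarrow> u @ (e, y) # w \<in> hwords A n d \<Longrightarrow>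
    \<phi> (u @ (e, x \<oplus>\<^bsub>A e\<^esub> y) # w) = \<phi> (u @ (e, x) # w) \<oplus>\<^bsub>N\<^esub> \<phi> (u @ (e, y) # w)"
  unfolding multilinear_def by blast

lemma multilinear_smult: "multilinear R A n d N \<phi> \<Longrightarrow> r \<in> carrier R \<Longrightarrow> u @ (e, x) # w \<in> hwords A n d \<Longrightarrow>
    \<phi> (u @ (e, r \<odot>\<^bsub>A e\<^esub> x) # w) = r \<odot>\<^bsub>N\<^esub> \<phi> (u @ (e, x) # w)"
  unfolding multilinear_def by blast

locale bigraded = cring R for R :: "('r, 's) ring_scheme" + fixes A :: "('r, 'a) bgmod"
  assumes bg: "bigraded_module R A"
begin

lemma A_module: "module R (A d)"
  using bg unfolding bigraded_module_def by blast

lemma hwords_add: "u @ (e, x) # w \<in> hwords A n d \<Longrightarrow> u @ (e, y) # w \<in> hwords A n d \<Longrightarrow>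
    u @ (e, x \<oplus>\<^bsub>A e\<^esub> y) # w \<in> hwords A n d"
  using module.axioms(2)[OF A_module, of e]
  by (auto simp: hwords_def intro: abelian_groupE(1))

lemma hwords_smult: "r \<in> carrier R \<Longrightarrow> u @ (e, x) # w \<in> hwords A n d \<Longrightarrow>
    u @ (e, r \<odot>\<^bsub>A e\<^esub> x) # w \<in> hwords A n d"
  using A_module[of e] by (auto simp: hwords_def intro: module.smult_closed)

definition rels :: "nat \<Rightarrow> bideg \<Rightarrow> ((bideg \<times> 'a) list \<Rightarrow> 'r) set" where
  "rels n d =
     ({free_gen R (u @ (e, x \<oplus>\<^bsub>A e\<^esub> y) # w) \<ominus>\<^bsub>free_words R A n d\<^esub>
         (free_gen R (u @ (e, x) # w) \<oplus>\<^bsub>free_words R A n d\<^esub> free_gen R (u @ (e, y) # w))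
       | u e x y w. u @ (e, x) # w \<in> hwords A n d \<and> u @ (e, y) # w \<in> hwords A n d} \<union>
      {free_gen R (u @ (e, r \<odot>\<^bsub>A e\<^esub> x) # w) \<ominus>\<^bsub>free_words R A n d\<^esub>
         (r \<odot>\<^bsub>free_words R A n d\<^esub> free_gen R (u @ (e, x) # w))
       | u e r x w. r \<in> carrier R \<and> u @ (e, x) # w \<in> hwords A n d})"

lemma tensor_relations_eq:
  "tensor_relations R A n d = generated_submodule R (free_words R A n d) (rels n d)"
  unfolding tensor_relations_def rels_def ..

lemma free_words_module: "module R (free_words R A n d)"
  unfolding free_words_def by (rule free_module_module)

lemma free_gen_words [simp]: "w \<in> hwords A n d \<Longrightarrow> free_gen R w \<in> carrier (free_words R A n d)"
  unfolding free_words_def by (rule free_gen_carrier)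

lemma rels_carrier: "rels n d \<subseteq> carrier (free_words R A n d)"
proof -
  interpret F: module R "free_words R A n d" by (rule free_words_module)
  show ?thesis
    unfolding rels_def
    by (auto simp del: free_module_simps intro!: F.minus_closed F.a_closed F.smult_closed free_gen_words
        intro: hwords_add hwords_smult)
qed

lemma tensor_quotient: "quotient R (free_words R A n d) (tensor_relations R A n d)"
  unfolding quotient_def quotient_axioms_def tensor_relations_eq
  by (intro conjI free_words_module generated_submodule_submodule rels_carrier)

lemma tensor_module: "module R (tensor_power R A n d)"
  unfolding tensor_power_def by (rule quotient.quotient_module_module[OF tensor_quotient])

lemma pure_eq: "w \<in> hwords A n d \<Longrightarrow> pure_tensor R A w =
    tensor_relations R A n d +>\<^bsub>free_words R A n d\<^esub> free_gen R w"
  by (auto simp: pure_tensor_def hwords_def)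

lemma pure_closed: "w \<in> hwords A n d \<Longrightarrow> pure_tensor R A w \<in> carrier (tensor_power R A n d)"
  unfolding pure_eq tensor_power_def
  by (intro quotient.coset_carrier[OF tensor_quotient] free_gen_words)

text \<open>The value does not depend on the representative that the choice operator selects: two
  representatives differ by a relation, and the linear extension of a multilinear
  \<open>\<phi>\<close> vanishes on relations.\<close>

lemma tensor_lift_coset:
  assumes N: "module R N" and \<phi>: "multilinear R A n d N \<phi>" and f: "f \<in> carrier (free_words R A n d)"
  shows "tensor_lift R N \<phi> (tensor_relations R A n d +>\<^bsub>free_words R A n d\<^esub> f) = free_lift R N \<phi> f"
proof -
  interpret N: module R N by (rule N)
  interpret F: module R "free_words R A n d" by (rule free_words_module)
  interpret Q: quotient R "free_words R A n d" "tensor_relations R A n d" by (rule tensor_quotient)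
  let ?h = "free_lift R N \<phi>"
  have \<phi>1: "\<phi> \<in> hwords A n d \<rightarrow> carrier N" using \<phi> by (simp add: multilinear_def)
  have hadd: "?h (f \<oplus>\<^bsub>free_words R A n d\<^esub> g) = ?h f \<oplus>\<^bsub>N\<^esub> ?h g"
    if "f \<in> carrier (free_words R A n d)" "g \<in> carrier (free_words R A n d)" for f g
    using N.free_lift_add[OF that[unfolded free_words_def] \<phi>1] by (simp add: free_words_def)
  have hsm: "?h (r \<odot>\<^bsub>free_words R A n d\<^esub> f) = r \<odot>\<^bsub>N\<^esub> ?h f"
    if "r \<in> carrier R" "f \<in> carrier (free_words R A n d)" for f r
    using N.free_lift_smult[OF that(2)[unfolded free_words_def] that(1) \<phi>1] by (simp add: free_words_def)
  have hcl: "?h f \<in> carrier N" if "f \<in> carrier (free_words R A n d)" for f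
    using N.free_lift_closed[OF that[unfolded free_words_def] \<phi>1] .
  have hgen: "?h (free_gen R w) = \<phi> w" if "w \<in> hwords A n d" for w
    using N.free_lift_gen[OF that \<phi>1] .
  have hdiff: "?h (f \<ominus>\<^bsub>free_words R A n d\<^esub> g) = ?h f \<ominus>\<^bsub>N\<^esub> ?h g"
    if "f \<in> carrier (free_words R A n d)" "g \<in> carrier (free_words R A n d)" for f g
  proof -
    have "?h f = ?h ((f \<ominus>\<^bsub>free_words R A n d\<^esub> g) \<oplus>\<^bsub>free_words R A n d\<^esub> g)"
      using that by (simp only: F.M.minus_eq F.M.a_assoc F.M.l_neg F.M.r_zero F.M.a_inv_closed)
    also have "\<dots> = ?h (f \<ominus>\<^bsub>free_words R A n d\<^esub> g) \<oplus>\<^bsub>N\<^esub> ?h g"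
      using that by (intro hadd) auto
    finally show ?thesis
      using that hcl[of "f \<ominus>\<^bsub>free_words R A n d\<^esub> g"] hcl
      by (simp add: N.M.minus_eq N.M.a_assoc N.M.r_neg)
  qed
  have ker: "?h m = \<zero>\<^bsub>N\<^esub>" if "m \<in> tensor_relations R A n d" for m
  proof (rule generated_submodule_le_kernel[OF free_words_module N rels_carrier, where h = ?h])
    show "m \<in> generated_submodule R (free_words R A n d) (rels n d)"
      using that unfolding tensor_relations_eq .
  next
    fix x assume "x \<in> rels n d"
    then consider u e y z w where "u @ (e, y) # w \<in> hwords A n d" "u @ (e, z) # w \<in> hwords A n d"
        "x = free_gen R (u @ (e, y \<oplus>\<^bsub>A e\<^esub> z) # w) \<ominus>\<^bsub>free_words R A n d\<^esub>
         (free_gen R (u @ (e, y) # w) \<oplus>\<^bsub>free_words R A n d\<^esub> free_gen R (u @ (e, z) # w))"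
      | u e r y w where "r \<in> carrier R" "u @ (e, y) # w \<in> hwords A n d"
        "x = free_gen R (u @ (e, r \<odot>\<^bsub>A e\<^esub> y) # w) \<ominus>\<^bsub>free_words R A n d\<^esub>
         (r \<odot>\<^bsub>free_words R A n d\<^esub> free_gen R (u @ (e, y) # w))"
      unfolding rels_def by blast
    then show "?h x = \<zero>\<^bsub>N\<^esub>"
    proof cases
      case 1
      then show ?thesis using multilinear_closed[OF \<phi>]
        by (simp only: hdiff hadd hgen free_gen_words hwords_add F.M.a_closed multilinear_add[OF \<phi>])
           (simp add: N.M.minus_eq N.M.r_neg)
    next
      case 2
      then show ?thesis using multilinear_closed[OF \<phi>]
        by (simp only: hdiff hsm hgen free_gen_words hwords_smult F.smult_closed multilinear_smult[OF \<phi>])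
           (simp add: N.M.minus_eq N.M.r_neg)
    qed
  qed (simp_all only: hcl hadd hsm)
  let ?X = "tensor_relations R A n d +>\<^bsub>free_words R A n d\<^esub> f"
  have "f \<in> ?X" using f by (rule Q.Q.a_rcos_self)
  then have "(SOME g. g \<in> ?X) \<in> ?X" by (rule someI[of "\<lambda>g. g \<in> ?X"])
  then obtain m where m: "m \<in> tensor_relations R A n d" "(SOME g. g \<in> ?X) = m \<oplus>\<^bsub>free_words R A n d\<^esub> f"
    by (auto simp: a_r_coset_def')
  have "m \<in> carrier (free_words R A n d)" using m(1) Q.Q.a_subset by blast
  then have "?h (SOME g. g \<in> ?X) = ?h f"
    unfolding m(2) using f hcl by (simp add: hadd ker[OF m(1)])
  then show ?thesis unfolding tensor_lift_def Let_def free_lift_def .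
qed

lemma tensor_lift_pure:
  assumes "module R N" "multilinear R A n d N \<phi>" "w \<in> hwords A n d"
  shows "tensor_lift R N \<phi> (pure_tensor R A w) = \<phi> w"
  using assms module.free_lift_gen[OF assms(1,3)]
  by (simp add: pure_eq tensor_lift_coset multilinear_def)

lemma tensor_lift_linear:
  assumes N: "module R N" and \<phi>: "multilinear R A n d N \<phi>"
  shows "X \<in> carrier (tensor_power R A n d) \<Longrightarrow> tensor_lift R N \<phi> X \<in> carrier N"
    and "X \<in> carrier (tensor_power R A n d) \<Longrightarrow> Y \<in> carrier (tensor_power R A n d) \<Longrightarrow>
      tensor_lift R N \<phi> (X \<oplus>\<^bsub>tensor_power R A n d\<^esub> Y) = tensor_lift R N \<phi> X \<oplus>\<^bsub>N\<^esub> tensor_lift R N \<phi> Y"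
    and "r \<in> carrier R \<Longrightarrow> X \<in> carrier (tensor_power R A n d) \<Longrightarrow>
      tensor_lift R N \<phi> (r \<odot>\<^bsub>tensor_power R A n d\<^esub> X) = r \<odot>\<^bsub>N\<^esub> tensor_lift R N \<phi> X"
proof -
  interpret N: module R N by (rule N)
  interpret F: module R "free_words R A n d" by (rule free_words_module)
  interpret Q: quotient R "free_words R A n d" "tensor_relations R A n d" by (rule tensor_quotient)
  have \<phi>1: "\<phi> \<in> hwords A n d \<rightarrow> carrier N" using \<phi> by (simp add: multilinear_def)
  note lift = tensor_lift_coset[OF N \<phi>]
  show "tensor_lift R N \<phi> X \<in> carrier N" if "X \<in> carrier (tensor_power R A n d)"
  proof -
    obtain f where f: "f \<in> carrier (free_words R A n d)"
      "X = tensor_relations R A n d +>\<^bsub>free_words R A n d\<^esub> f"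
      using \<open>X \<in> _\<close> unfolding tensor_power_def by (rule Q.coset_cases)
    show ?thesis unfolding f(2) lift[OF f(1)]
      using N.free_lift_closed[OF f(1)[unfolded free_words_def] \<phi>1] .
  qed
  show "tensor_lift R N \<phi> (X \<oplus>\<^bsub>tensor_power R A n d\<^esub> Y) = tensor_lift R N \<phi> X \<oplus>\<^bsub>N\<^esub> tensor_lift R N \<phi> Y"
    if "X \<in> carrier (tensor_power R A n d)" "Y \<in> carrier (tensor_power R A n d)"
  proof -
    obtain f where f: "f \<in> carrier (free_words R A n d)"
      "X = tensor_relations R A n d +>\<^bsub>free_words R A n d\<^esub> f"
      using \<open>X \<in> _\<close> unfolding tensor_power_def by (rule Q.coset_cases)
    obtain g where g: "g \<in> carrier (free_words R A n d)"
      "Y = tensor_relations R A n d +>\<^bsub>free_words R A n d\<^esub> g"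
      using \<open>Y \<in> _\<close> unfolding tensor_power_def by (rule Q.coset_cases)
    show ?thesis
      unfolding f(2) g(2) tensor_power_def Q.coset_add[OF f(1) g(1)] lift[OF f(1)] lift[OF g(1)]
        lift[OF F.M.a_closed[OF f(1) g(1)]]
      using N.free_lift_add[OF f(1)[unfolded free_words_def] g(1)[unfolded free_words_def] \<phi>1]
      by (simp add: free_words_def)
  qed
  show "tensor_lift R N \<phi> (r \<odot>\<^bsub>tensor_power R A n d\<^esub> X) = r \<odot>\<^bsub>N\<^esub> tensor_lift R N \<phi> X"
    if "r \<in> carrier R" "X \<in> carrier (tensor_power R A n d)"
  proof -
    obtain f where f: "f \<in> carrier (free_words R A n d)"
      "X = tensor_relations R A n d +>\<^bsub>free_words R A n d\<^esub> f"
      using \<open>X \<in> _\<close> unfolding tensor_power_def by (rule Q.coset_cases)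
    show ?thesis
      unfolding f(2) tensor_power_def Q.coset_smult[OF that(1) f(1)] lift[OF f(1)]
        lift[OF F.smult_closed[OF that(1) f(1)]]
      using N.free_lift_smult[OF f(1)[unfolded free_words_def] that(1) \<phi>1]
      by (simp add: free_words_def)
  qed
qed

lemma pure_add:
  assumes "u @ (e, x) # w \<in> hwords A n d" "u @ (e, y) # w \<in> hwords A n d"
  shows "pure_tensor R A (u @ (e, x \<oplus>\<^bsub>A e\<^esub> y) # w) =
    pure_tensor R A (u @ (e, x) # w) \<oplus>\<^bsub>tensor_power R A n d\<^esub> pure_tensor R A (u @ (e, y) # w)"
proof -
  interpret F: module R "free_words R A n d" by (rule free_words_module)
  interpret Q: quotient R "free_words R A n d" "tensor_relations R A n d" by (rule tensor_quotient)
  have "free_gen R (u @ (e, x \<oplus>\<^bsub>A e\<^esub> y) # w) \<ominus>\<^bsub>free_words R A n d\<^esub>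
      (free_gen R (u @ (e, x) # w) \<oplus>\<^bsub>free_words R A n d\<^esub> free_gen R (u @ (e, y) # w)) \<in> rels n d"
    unfolding rels_def using assms by blast
  then show ?thesis
    unfolding tensor_power_def pure_eq[OF assms(1)] pure_eq[OF assms(2)] pure_eq[OF hwords_add[OF assms]]
      Q.coset_add[OF free_gen_words[OF assms(1)] free_gen_words[OF assms(2)]]
    using assms hwords_add[OF assms] generated_submodule_subset
    by (intro Q.coset_eqI) (auto simp: tensor_relations_eq intro!: F.M.a_closed free_gen_words
        dest: set_mp[OF generated_submodule_subset])
qed

lemma pure_smult:
  assumes "u @ (e, x) # w \<in> hwords A n d" "r \<in> carrier R"
  shows "pure_tensor R A (u @ (e, r \<odot>\<^bsub>A e\<^esub> x) # w) =
    r \<odot>\<^bsub>tensor_power R A n d\<^esub> pure_tensor R A (u @ (e, x) # w)"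
proof -
  interpret F: module R "free_words R A n d" by (rule free_words_module)
  interpret Q: quotient R "free_words R A n d" "tensor_relations R A n d" by (rule tensor_quotient)
  have "free_gen R (u @ (e, r \<odot>\<^bsub>A e\<^esub> x) # w) \<ominus>\<^bsub>free_words R A n d\<^esub>
      (r \<odot>\<^bsub>free_words R A n d\<^esub> free_gen R (u @ (e, x) # w)) \<in> rels n d"
    unfolding rels_def using assms by blast
  then show ?thesis
    unfolding tensor_power_def pure_eq[OF assms(1)] pure_eq[OF hwords_smult[OF assms(2,1)]]
      Q.coset_smult[OF assms(2) free_gen_words[OF assms(1)]]
    using assms hwords_smult[OF assms(2,1)]
    by (intro Q.coset_eqI) (auto simp: tensor_relations_eq intro!: F.smult_closed free_gen_words
        dest: set_mp[OF generated_submodule_subset])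
qed

text \<open>Induction over the support of a representative, splitting off one word with its
  coefficient at a time. The coefficients are arbitrary elements of R, hence the scalar in the case
  \<open>pure\<close>.\<close>

lemma tensor_induct [consumes 1, case_names zero add pure]:
  assumes X: "X \<in> carrier (tensor_power R A n d)" and P0: "P \<zero>\<^bsub>tensor_power R A n d\<^esub>"
    and Padd: "\<And>X Y. X \<in> carrier (tensor_power R A n d) \<Longrightarrow> Y \<in> carrier (tensor_power R A n d) \<Longrightarrow>
      P X \<Longrightarrow> P Y \<Longrightarrow> P (X \<oplus>\<^bsub>tensor_power R A n d\<^esub> Y)"
    and Pp: "\<And>r w. r \<in> carrier R \<Longrightarrow> w \<in> hwords A n d \<Longrightarrow> P (r \<odot>\<^bsub>tensor_power R A n d\<^esub> pure_tensor R A w)"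
  shows "P X"
proof -
  interpret T: module R "tensor_power R A n d" by (rule tensor_module)
  interpret F: module R "free_words R A n d" by (rule free_words_module)
  interpret Q: quotient R "free_words R A n d" "tensor_relations R A n d" by (rule tensor_quotient)
  have *: "P (tensor_relations R A n d +>\<^bsub>free_words R A n d\<^esub> f)"
    if "f \<in> carrier (free_words R A n d)" "finite S" "{w. f w \<noteq> \<zero>\<^bsub>R\<^esub>} = S" for f S
    using that(2,1,3)
  proof (induction S arbitrary: f rule: finite_induct)
    case empty
    then have "f = (\<lambda>w. \<zero>\<^bsub>R\<^esub>)" by auto
    then have "tensor_relations R A n d +>\<^bsub>free_words R A n d\<^esub> f = \<zero>\<^bsub>tensor_power R A n d\<^esub>"
      using F.M.a_coset_add_zero[OF Q.Q.a_subset]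
      by (simp add: tensor_power_def free_words_def)
    then show ?case using P0 by simp
  next
    case (insert w S)
    define g where "g = f(w := \<zero>\<^bsub>R\<^esub>)"
    have f: "\<And>v. f v \<in> carrier R" "\<And>v. f v \<noteq> \<zero>\<^bsub>R\<^esub> \<Longrightarrow> v \<in> hwords A n d"
      using insert.prems by (auto simp: free_words_def free_carrier)
    have w: "w \<in> hwords A n d" using insert f by auto
    have gS: "{v. g v \<noteq> \<zero>\<^bsub>R\<^esub>} = S" using insert unfolding g_def by auto
    then have g: "g \<in> carrier (free_words R A n d)"
      using f insert unfolding free_words_def free_carrier g_def by auto
    have fw: "f w \<odot>\<^bsub>free_words R A n d\<^esub> free_gen R w \<in> carrier (free_words R A n d)"
      using f w by (intro F.smult_closed free_gen_words)
    have "f = f w \<odot>\<^bsub>free_words R A n d\<^esub> free_gen R w \<oplus>\<^bsub>free_words R A n d\<^esub> g"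
      using f(1) by (auto simp: free_words_def g_def free_gen_def fun_eq_iff)
    then have "tensor_relations R A n d +>\<^bsub>free_words R A n d\<^esub> f =
      f w \<odot>\<^bsub>tensor_power R A n d\<^esub> pure_tensor R A w \<oplus>\<^bsub>tensor_power R A n d\<^esub>
        (tensor_relations R A n d +>\<^bsub>free_words R A n d\<^esub> g)"
      unfolding tensor_power_def pure_eq[OF w] Q.coset_smult[OF f(1) free_gen_words[OF w]]
        Q.coset_add[OF fw g] by simp
    moreover have "tensor_relations R A n d +>\<^bsub>free_words R A n d\<^esub> g \<in> carrier (tensor_power R A n d)"
      unfolding tensor_power_def using g by (rule Q.coset_carrier)
    ultimately show ?case
      using insert.IH[OF g gS] f(1) w by (simp only:) (intro Padd Pp T.smult_closed pure_closed)
  qed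
  obtain f where f: "f \<in> carrier (free_words R A n d)"
    "X = tensor_relations R A n d +>\<^bsub>free_words R A n d\<^esub> f"
    using X unfolding tensor_power_def by (rule Q.coset_cases)
  then have "finite {w. f w \<noteq> \<zero>\<^bsub>R\<^esub>}" by (simp add: free_words_def free_carrier)
  then show ?thesis using *[OF f(1) _ refl] f(2) by simp
qed

end

section \<open>Maps between bigraded modules\<close>

lemma signed_closed: "abelian_group M \<Longrightarrow> x \<in> carrier M \<Longrightarrow> signed M n x \<in> carrier M"
  by (simp add: signed_def abelian_group.a_inv_closed)

lemma signed_add: "abelian_group M \<Longrightarrow> x \<in> carrier M \<Longrightarrow> y \<in> carrier M \<Longrightarrow>
    signed M n (x \<oplus>\<^bsub>M\<^esub> y) = signed M n x \<oplus>\<^bsub>M\<^esub> signed M n y"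
  by (simp add: signed_def abelian_group.minus_add)

lemma signed_smult: "module R M \<Longrightarrow> r \<in> carrier R \<Longrightarrow> x \<in> carrier M \<Longrightarrow>
    signed M n (r \<odot>\<^bsub>M\<^esub> x) = r \<odot>\<^bsub>M\<^esub> signed M n x"
  by (simp add: signed_def module.smult_r_minus)

lemma signed_signed: "abelian_group M \<Longrightarrow> x \<in> carrier M \<Longrightarrow>
    signed M m (signed M n x) = signed M (m + n) x"
  by (auto simp: signed_def abelian_group.minus_minus)

lemma signed_cong: "even (m - n) \<Longrightarrow> signed M m x = signed M n x"
  by (auto simp: signed_def)

lemma signed_0 [simp]: "signed M 0 x = x"
  by (simp add: signed_def)

lemma signed_zero: "abelian_group M \<Longrightarrow> signed M n \<zero>\<^bsub>M\<^esub> = \<zero>\<^bsub>M\<^esub>"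
  by (simp add: signed_def abelian_group.minus_equality abelian_groupE)

lemma chain_eval_chain_sign: "abelian_group N \<Longrightarrow> chain_eval N (chain_sign n c) = signed N n (chain_eval N c)"
  by (simp add: chain_sign_def signed_def abelian_group.chain_eval_minus)

lemma module_abelian_group: "module R M \<Longrightarrow> abelian_group M"
  by (rule module.axioms(2))

lemma gmapsI:
  assumes "\<And>d x. x \<in> carrier (A d) \<Longrightarrow> f d x \<in> carrier (B (d + e))"
    and "\<And>d x. x \<notin> carrier (A d) \<Longrightarrow> f d x = undefined"
    and "\<And>d x y. x \<in> carrier (A d) \<Longrightarrow> y \<in> carrier (A d) \<Longrightarrow>
        f d (x \<oplus>\<^bsub>A d\<^esub> y) = f d x \<oplus>\<^bsub>B (d + e)\<^esub> f d y"
    and "\<And>d r x. r \<in> carrier R \<Longrightarrow> x \<in> carrier (A d) \<Longrightarrow> f d (r \<odot>\<^bsub>A d\<^esub> x) = r \<odot>\<^bsub>B (d + e)\<^esub> f d x"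
  shows "f \<in> gmaps R A B e"
  using assms unfolding gmaps_def by (auto simp: PiE_def extensional_def)

lemma gmaps_closed: "f \<in> gmaps R A B e \<Longrightarrow> x \<in> carrier (A d) \<Longrightarrow> f d x \<in> carrier (B (d + e))"
  unfolding gmaps_def by blast

lemma gmaps_undefined: "f \<in> gmaps R A B e \<Longrightarrow> x \<notin> carrier (A d) \<Longrightarrow> f d x = undefined"
  unfolding gmaps_def PiE_def extensional_def by blast

lemma gmaps_add: "f \<in> gmaps R A B e \<Longrightarrow> x \<in> carrier (A d) \<Longrightarrow> y \<in> carrier (A d) \<Longrightarrow>
    f d (x \<oplus>\<^bsub>A d\<^esub> y) = f d x \<oplus>\<^bsub>B (d + e)\<^esub> f d y"
  unfolding gmaps_def by blast

lemma gmaps_smult: "f \<in> gmaps R A B e \<Longrightarrow> r \<in> carrier R \<Longrightarrow> x \<in> carrier (A d) \<Longrightarrow>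
    f d (r \<odot>\<^bsub>A d\<^esub> x) = r \<odot>\<^bsub>B (d + e)\<^esub> f d x"
  unfolding gmaps_def by blast

lemma gmaps_abelian_group_hom:
  assumes "f \<in> gmaps R A B e" "abelian_group (A d)" "abelian_group (B (d + e))"
  shows "abelian_group_hom (A d) (B (d + e)) (f d)"
  using assms
  by (intro abelian_group_homI group_hom.intro abelian_group.a_group)
     (auto simp: group_hom_axioms_def hom_def gmaps_closed gmaps_add)

lemma gmaps_signed:
  assumes "f \<in> gmaps R A B e" "abelian_group (A d)" "abelian_group (B (d + e))" "x \<in> carrier (A d)"
  shows "f d (signed (A d) n x) = signed (B (d + e)) n (f d x)"
  using abelian_group_hom.hom_a_inv[OF gmaps_abelian_group_hom[OF assms(1-3)]] assms(4)
  by (simp add: signed_def)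

lemma gmaps_ext:
  assumes "f \<in> gmaps R A B e" "g \<in> gmaps R A B e" "\<And>d x. x \<in> carrier (A d) \<Longrightarrow> f d x = g d x"
  shows "f = g"
proof (intro ext)
  fix d x show "f d x = g d x"
    using assms by (cases "x \<in> carrier (A d)") (simp_all add: gmaps_undefined)
qed

lemma gzero_gmaps:
  assumes A: "\<And>d. module R (A d)" and B: "\<And>d. module R (B d)"
  shows "gzero A B e \<in> gmaps R A B e"
proof (rule gmapsI)
  fix d
  interpret A: module R "A d" by (rule A)
  interpret B: module R "B (d + e)" by (rule B)
  show "x \<in> carrier (A d) \<Longrightarrow> gzero A B e d x \<in> carrier (B (d + e))"
    "x \<notin> carrier (A d) \<Longrightarrow> gzero A B e d x = undefined"
    "x \<in> carrier (A d) \<Longrightarrow> y \<in> carrier (A d) \<Longrightarrow>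
      gzero A B e d (x \<oplus>\<^bsub>A d\<^esub> y) = gzero A B e d x \<oplus>\<^bsub>B (d + e)\<^esub> gzero A B e d y"
    "r \<in> carrier R \<Longrightarrow> x \<in> carrier (A d) \<Longrightarrow>
      gzero A B e d (r \<odot>\<^bsub>A d\<^esub> x) = r \<odot>\<^bsub>B (d + e)\<^esub> gzero A B e d x" for x y r
    by (simp_all add: gzero_def)
qed

lemma gsigned_gmaps:
  assumes A: "\<And>d. module R (A d)" and B: "\<And>d. module R (B d)" and f: "f \<in> gmaps R A B e"
  shows "gsigned A B e n f \<in> gmaps R A B e"
proof (rule gmapsI)
  fix d
  interpret A: module R "A d" by (rule A)
  interpret B: module R "B (d + e)" by (rule B)
  show "x \<in> carrier (A d) \<Longrightarrow> gsigned A B e n f d x \<in> carrier (B (d + e))"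
    "x \<notin> carrier (A d) \<Longrightarrow> gsigned A B e n f d x = undefined"
    "x \<in> carrier (A d) \<Longrightarrow> y \<in> carrier (A d) \<Longrightarrow>
      gsigned A B e n f d (x \<oplus>\<^bsub>A d\<^esub> y) = gsigned A B e n f d x \<oplus>\<^bsub>B (d + e)\<^esub> gsigned A B e n f d y"
    "r \<in> carrier R \<Longrightarrow> x \<in> carrier (A d) \<Longrightarrow>
      gsigned A B e n f d (r \<odot>\<^bsub>A d\<^esub> x) = r \<odot>\<^bsub>B (d + e)\<^esub> gsigned A B e n f d x" for x y r
    by (simp_all add: gsigned_def gmaps_closed[OF f] gmaps_add[OF f] gmaps_smult[OF f]
        signed_closed[OF B.M.abelian_group_axioms] signed_add[OF B.M.abelian_group_axioms] signed_smult[OF B])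
qed

lemma gsigned_apply: "x \<in> carrier (A d) \<Longrightarrow> gsigned A B e n f d x = signed (B (d + e)) n (f d x)"
  by (simp add: gsigned_def)

lemma gcomp_apply: "x \<in> carrier (A d) \<Longrightarrow> gcomp A eg f g d x = f (d + eg) (g d x)"
  by (simp add: gcomp_def)

lemma gcomp_gmaps:
  assumes "\<And>d. module R (A d)" "f \<in> gmaps R B C ef" "g \<in> gmaps R A B eg" "e = eg + ef"
  shows "gcomp A eg f g \<in> gmaps R A C e"
  unfolding assms(4)
proof (rule gmapsI)
  show "gcomp A eg f g d x \<in> carrier (C (d + (eg + ef)))" if "x \<in> carrier (A d)" for d x
    using gmaps_closed[OF assms(2) gmaps_closed[OF assms(3) that]] that by (simp add: gcomp_apply add.assoc)
  show "gcomp A eg f g d x = undefined" if "x \<notin> carrier (A d)" for d x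
    using that by (simp add: gcomp_def)
  show "gcomp A eg f g d (x \<oplus>\<^bsub>A d\<^esub> y) =
      gcomp A eg f g d x \<oplus>\<^bsub>C (d + (eg + ef))\<^esub> gcomp A eg f g d y"
    if "x \<in> carrier (A d)" "y \<in> carrier (A d)" for d x y
    using that gmaps_add[OF assms(2) gmaps_closed[OF assms(3)] gmaps_closed[OF assms(3)]]
      module_abelian_group[OF assms(1)[of d]]
    by (simp add: gcomp_apply abelian_groupE gmaps_add[OF assms(3)] add.assoc)
  show "gcomp A eg f g d (r \<odot>\<^bsub>A d\<^esub> x) = r \<odot>\<^bsub>C (d + (eg + ef))\<^esub> gcomp A eg f g d x"
    if "r \<in> carrier R" "x \<in> carrier (A d)" for d r x
    using that gmaps_smult[OF assms(2) _ gmaps_closed[OF assms(3)]] module.smult_closed[OF assms(1)]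
    by (simp add: gcomp_apply gmaps_smult[OF assms(3)] add.assoc)
qed

lemma gsum_apply: "x \<in> carrier (A d) \<Longrightarrow>
    gsum A B e I s h d x = (\<Oplus>\<^bsub>B (d + e)\<^esub>k\<in>I. signed (B (d + e)) (s k) (h k d x))"
  by (simp add: gsum_def)

lemma gsum_gmaps:
  assumes A: "\<And>d. module R (A d)" and B: "\<And>d. module R (B d)"
    and h: "\<And>k. k \<in> I \<Longrightarrow> h k \<in> gmaps R A B e"
  shows "gsum A B e I s h \<in> gmaps R A B e"
proof (rule gmapsI)
  fix d x assume x: "x \<in> carrier (A d)"
  interpret B: module R "B (d + e)" by (rule B)
  have *: "signed (B (d + e)) (s k) (h k d x) \<in> carrier (B (d + e))" if "k \<in> I" "x \<in> carrier (A d)" for k x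
    using that by (intro signed_closed B.M.abelian_group_axioms gmaps_closed[OF h])
  show "gsum A B e I s h d x \<in> carrier (B (d + e))"
    using * x by (auto simp: gsum_apply intro!: B.M.finsum_closed)
  show "gsum A B e I s h d (r \<odot>\<^bsub>A d\<^esub> x) = r \<odot>\<^bsub>B (d + e)\<^esub> gsum A B e I s h d x"
    if r: "r \<in> carrier R" for r
  proof -
    have rx: "r \<odot>\<^bsub>A d\<^esub> x \<in> carrier (A d)" by (rule module.smult_closed[OF A r x])
    have "(\<Oplus>\<^bsub>B (d + e)\<^esub>k\<in>I. signed (B (d + e)) (s k) (h k d (r \<odot>\<^bsub>A d\<^esub> x))) =
        (\<Oplus>\<^bsub>B (d + e)\<^esub>k\<in>I. r \<odot>\<^bsub>B (d + e)\<^esub> signed (B (d + e)) (s k) (h k d x))"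
      using r x * B by (intro B.M.finsum_cong')
        (auto simp: gmaps_smult[OF h] signed_smult[OF B] gmaps_closed[OF h] intro!: B.smult_closed)
    also have "\<dots> = r \<odot>\<^bsub>B (d + e)\<^esub> (\<Oplus>\<^bsub>B (d + e)\<^esub>k\<in>I. signed (B (d + e)) (s k) (h k d x))"
    proof (cases "finite I")
      case True
      show ?thesis by (rule B.finsum_smult_ldistr[symmetric, OF True r]) (use * x in auto)
    next
      case False then show ?thesis using r by (simp add: B.M.finsum_infinite)
    qed
    finally show ?thesis by (simp add: gsum_apply x rx)
  qed
  show "gsum A B e I s h d (x \<oplus>\<^bsub>A d\<^esub> y) = gsum A B e I s h d x \<oplus>\<^bsub>B (d + e)\<^esub> gsum A B e I s h d y"
    if y: "y \<in> carrier (A d)" for y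
  proof -
    have xy: "x \<oplus>\<^bsub>A d\<^esub> y \<in> carrier (A d)"
      by (rule abelian_groupE(1)[OF module_abelian_group[OF A] x y])
    have "(\<Oplus>\<^bsub>B (d + e)\<^esub>k\<in>I. signed (B (d + e)) (s k) (h k d (x \<oplus>\<^bsub>A d\<^esub> y))) =
        (\<Oplus>\<^bsub>B (d + e)\<^esub>k\<in>I. signed (B (d + e)) (s k) (h k d x) \<oplus>\<^bsub>B (d + e)\<^esub>
           signed (B (d + e)) (s k) (h k d y))"
      using x y * by (intro B.M.finsum_cong')
        (auto simp: gmaps_add[OF h] signed_add B.M.abelian_group_axioms gmaps_closed[OF h])
    also have "\<dots> = (\<Oplus>\<^bsub>B (d + e)\<^esub>k\<in>I. signed (B (d + e)) (s k) (h k d x)) \<oplus>\<^bsub>B (d + e)\<^esub>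
        (\<Oplus>\<^bsub>B (d + e)\<^esub>k\<in>I. signed (B (d + e)) (s k) (h k d y))"
      using * x y by (intro B.M.finsum_addf) auto
    finally show ?thesis by (simp add: gsum_apply x y xy)
  qed
qed (simp add: gsum_def)

text \<open>The passage from signed sums of maps to formal sums: carrier conditions afterwards
  concern single summands only.\<close>

lemma gsum_chain_eval:
  assumes "abelian_group (B (d + e))" "\<And>k. k \<in> I \<Longrightarrow> h k d x \<in> carrier (B (d + e))" "x \<in> carrier (A d)"
  shows "gsum A B e I s h d x = chain_eval (B (d + e)) (\<Sum>k\<in>I. chain_sign (s k) (frag_of (h k d x)))"
  unfolding gsum_apply[where A = A, OF assms(3)] abelian_group.chain_eval_sum[OF assms(1)]
  by (rule abelian_monoid.finsum_cong'[OF abelian_group.axioms(1)[OF assms(1)]])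
     (auto simp: chain_eval_chain_sign assms abelian_group.chain_eval_frag_of[OF assms(1)] intro!: signed_closed)

lemma hwords_iff: "w \<in> hwords A n d \<longleftrightarrow> length w = n \<and> wdeg w = d \<and> hword A w"
  by (auto simp: hwords_def hword_def)

section \<open>Linear maps on pure tensors\<close>

context bigraded
begin

lemma A_group: "abelian_group (A d)"
  by (rule module_abelian_group[OF A_module])

lemma tensor_group: "abelian_group (tensor_power R A n d)"
  by (rule module_abelian_group[OF tensor_module])

lemma pure_closed': "hword A w \<Longrightarrow> pure_tensor R A w \<in> carrier (tensor_power R A (length w) (wdeg w))"
  by (rule pure_closed) (simp add: hwords_iff)

lemma gmaps_pure_multilinear:
  assumes "f \<in> gmaps R (tensor_power R A n) B e"
  shows "multilinear R A n d (B (d + e)) (\<lambda>w. f d (pure_tensor R A w))"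
  unfolding multilinear_def
  by (auto simp: gmaps_closed[OF assms] pure_closed pure_add pure_smult gmaps_add[OF assms] gmaps_smult[OF assms])

text \<open>Agreement on pure tensors spreads by \<open>tensor_induct\<close>. Through this rule the
  comparisons of structure equations below become statements on words.\<close>

lemma gmaps_pure_ext:
  assumes B: "\<And>d. module R (B d)"
    and f: "f \<in> gmaps R (tensor_power R A n) B e" and g: "g \<in> gmaps R (tensor_power R A n) B e"
    and eq: "\<And>w. hword A w \<Longrightarrow> length w = n \<Longrightarrow> f (wdeg w) (pure_tensor R A w) = g (wdeg w) (pure_tensor R A w)"
  shows "f = g"
proof (rule gmaps_ext[OF f g])
  fix d X assume X: "X \<in> carrier (tensor_power R A n d)"
  interpret T: module R "tensor_power R A n d" by (rule tensor_module)
  show "f d X = g d X" using X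
  proof (induction rule: tensor_induct)
    case zero
    show ?case
      using abelian_group_hom.hom_zero[OF gmaps_abelian_group_hom[OF f tensor_group module_abelian_group[OF B]]]
        abelian_group_hom.hom_zero[OF gmaps_abelian_group_hom[OF g tensor_group module_abelian_group[OF B]]]
      by simp
  next
    case (add X Y) then show ?case by (simp add: gmaps_add[OF f] gmaps_add[OF g])
  next
    case (pure r w)
    then show ?case
      using eq[of w] by (auto simp: gmaps_smult[OF f] gmaps_smult[OF g] pure_closed hwords_iff pure_closed')
  qed
qed

lemma lift_gmaps:
  assumes B: "\<And>d. module R (B d)" and \<phi>: "\<And>d. multilinear R A n d (B (d + e)) (\<phi> d)"
  shows "(\<lambda>d. \<lambda>X\<in>carrier (tensor_power R A n d). tensor_lift R (B (d + e)) (\<phi> d) X)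
    \<in> gmaps R (tensor_power R A n) B e"
proof (rule gmapsI, goal_cases)
  case (3 d x y)
  then show ?case
    using abelian_groupE(1)[OF tensor_group, of x n d y] by (simp add: tensor_lift_linear[OF B \<phi>])
next
  case (4 d r x)
  then show ?case
    using module.smult_closed[OF tensor_module, of r x n d] by (simp add: tensor_lift_linear[OF B \<phi>])
qed (simp_all add: tensor_lift_linear[OF B \<phi>])

lemma tensor1_id_multilinear: "multilinear R A 1 d (A d) (\<lambda>w. snd (hd w))"
proof -
  have *: "u = [] \<and> w = [] \<and> e = d \<and> x \<in> carrier (A d)"
    if "u @ (e, x) # w \<in> hwords A 1 d" for u e x w
    using that by (auto simp: hwords_iff)
  have "snd (hd w) \<in> carrier (A d)" if "w \<in> hwords A 1 d" for w
    using that by (auto simp: hwords_iff length_Suc_conv)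
  then show ?thesis unfolding multilinear_def by (auto dest!: *[unfolded One_nat_def])
qed

lemma tensor1_id_gmaps: "tensor1_id R A \<in> gmaps R (tensor_power R A 1) A (0, 0)"
  using lift_gmaps[of A 1 "(0, 0)" "\<lambda>d w. snd (hd w)"] A_module tensor1_id_multilinear
  unfolding tensor1_id_def by (simp flip: zero_prod_def)

lemma tensor1_id_pure: "snd x \<in> carrier (A (fst x)) \<Longrightarrow> tensor1_id R A (fst x) (pure_tensor R A [x]) = snd x"
  unfolding tensor1_id_def
  using tensor_lift_pure[OF A_module tensor1_id_multilinear, of "[x]" "fst x"] pure_closed[of "[x]" 1 "fst x"]
  by (simp add: hwords_iff)

section \<open>Tensor product of two maps\<close>

lemma multilinear_Cons_pure:
  assumes b: "b \<in> carrier (A e)"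
  shows "multilinear R A m d (tensor_power R A (Suc m) (e + d)) (\<lambda>w. pure_tensor R A ((e, b) # w))"
proof -
  have h: "(e, b) # w \<in> hwords A (Suc m) (e + d)" if "w \<in> hwords A m d" for w
    using that b by (simp add: hwords_iff)
  show ?thesis unfolding multilinear_def
  proof (intro conjI allI impI)
    fix u e' x y w assume *: "u @ (e', x) # w \<in> hwords A m d \<and> u @ (e', y) # w \<in> hwords A m d"
    show "pure_tensor R A ((e, b) # u @ (e', x \<oplus>\<^bsub>A e'\<^esub> y) # w) =
       pure_tensor R A ((e, b) # u @ (e', x) # w) \<oplus>\<^bsub>tensor_power R A (Suc m) (e + d)\<^esub>
       pure_tensor R A ((e, b) # u @ (e', y) # w)"
      using pure_add[of "(e, b) # u" e' x w "Suc m" "e + d" y] h * by auto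
  next
    fix u e' r x w assume *: "r \<in> carrier R \<and> u @ (e', x) # w \<in> hwords A m d"
    show "pure_tensor R A ((e, b) # u @ (e', r \<odot>\<^bsub>A e'\<^esub> x) # w) =
       r \<odot>\<^bsub>tensor_power R A (Suc m) (e + d)\<^esub> pure_tensor R A ((e, b) # u @ (e', x) # w)"
      using pure_smult[of "(e, b) # u" e' x w "Suc m" "e + d" r] h * by auto
  qed (auto intro: pure_closed h)
qed

lemma tensor_cons_pure:
  assumes "b \<in> carrier (A e)" "w \<in> hwords A m d"
  shows "tensor_cons R A m e b d (pure_tensor R A w) = pure_tensor R A ((e, b) # w)"
  unfolding tensor_cons_def
  by (rule tensor_lift_pure[OF tensor_module multilinear_Cons_pure[OF assms(1)] assms(2)])

lemma tensor_cons_linear: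
  assumes b: "b \<in> carrier (A e)"
  shows "Y \<in> carrier (tensor_power R A m d) \<Longrightarrow>
      tensor_cons R A m e b d Y \<in> carrier (tensor_power R A (Suc m) (e + d))"
    and "X \<in> carrier (tensor_power R A m d) \<Longrightarrow> Y \<in> carrier (tensor_power R A m d) \<Longrightarrow>
      tensor_cons R A m e b d (X \<oplus>\<^bsub>tensor_power R A m d\<^esub> Y) =
      tensor_cons R A m e b d X \<oplus>\<^bsub>tensor_power R A (Suc m) (e + d)\<^esub> tensor_cons R A m e b d Y"
    and "r \<in> carrier R \<Longrightarrow> X \<in> carrier (tensor_power R A m d) \<Longrightarrow>
      tensor_cons R A m e b d (r \<odot>\<^bsub>tensor_power R A m d\<^esub> X) =
      r \<odot>\<^bsub>tensor_power R A (Suc m) (e + d)\<^esub> tensor_cons R A m e b d X"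
  unfolding tensor_cons_def
  by (simp_all add: tensor_lift_linear[OF tensor_module multilinear_Cons_pure[OF b]])

lemma tensor_cons_zero:
  assumes b: "b \<in> carrier (A e)"
  shows "tensor_cons R A m e b d \<zero>\<^bsub>tensor_power R A m d\<^esub> = \<zero>\<^bsub>tensor_power R A (Suc m) (e + d)\<^esub>"
proof -
  interpret M: module R "tensor_power R A m d" by (rule tensor_module)
  interpret N: module R "tensor_power R A (Suc m) (e + d)" by (rule tensor_module)
  show ?thesis
    using tensor_cons_linear(3)[OF b zero_closed M.M.zero_closed]
      tensor_cons_linear(1)[OF b M.M.zero_closed] by simp
qed

text \<open>By construction \<open>tensor_cons\<close> lifts a map in \<open>Y\<close> with
  \<open>b\<close> fixed, so linearity in \<open>b\<close> is not built in. It follows from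
  multilinearity of pure tensors by induction on \<open>Y\<close>.\<close>

lemma tensor_cons_left:
  assumes b: "b \<in> carrier (A e)" "b' \<in> carrier (A e)" and r: "r \<in> carrier R"
    and Y: "Y \<in> carrier (tensor_power R A m d)"
  shows "tensor_cons R A m e (b \<oplus>\<^bsub>A e\<^esub> b') d Y =
      tensor_cons R A m e b d Y \<oplus>\<^bsub>tensor_power R A (Suc m) (e + d)\<^esub> tensor_cons R A m e b' d Y"
    and "tensor_cons R A m e (r \<odot>\<^bsub>A e\<^esub> b) d Y =
      r \<odot>\<^bsub>tensor_power R A (Suc m) (e + d)\<^esub> tensor_cons R A m e b d Y"
proof -
  interpret Ae: module R "A e" by (rule A_module)
  interpret M: module R "tensor_power R A m d" by (rule tensor_module)
  interpret N: module R "tensor_power R A (Suc m) (e + d)" by (rule tensor_module)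
  have bb: "b \<oplus>\<^bsub>A e\<^esub> b' \<in> carrier (A e)" "r \<odot>\<^bsub>A e\<^esub> b \<in> carrier (A e)" using b r by auto
  show "tensor_cons R A m e (b \<oplus>\<^bsub>A e\<^esub> b') d Y =
      tensor_cons R A m e b d Y \<oplus>\<^bsub>tensor_power R A (Suc m) (e + d)\<^esub> tensor_cons R A m e b' d Y"
    using Y
  proof (induction rule: tensor_induct)
    case zero show ?case by (simp add: tensor_cons_zero b bb)
  next
    case (add X Y)
    then show ?case
      using tensor_cons_linear(1)[OF b(1)] tensor_cons_linear(1)[OF b(2)]
      by (simp add: tensor_cons_linear(2)[OF bb(1)] tensor_cons_linear(2)[OF b(1)]
          tensor_cons_linear(2)[OF b(2)] N.M.a_ac)
  next
    case (pure s w)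
    have h: "(e, b) # w \<in> hwords A (Suc m) (e + d)" if "b \<in> carrier (A e)" for b
      using that pure by (simp add: hwords_iff)
    show ?case
      using pure pure_add[of "[]" e b w "Suc m" "e + d" b'] h b pure_closed[OF h]
      by (simp add: tensor_cons_linear(3) bb tensor_cons_pure pure_closed N.smult_r_distr)
  qed
  show "tensor_cons R A m e (r \<odot>\<^bsub>A e\<^esub> b) d Y =
      r \<odot>\<^bsub>tensor_power R A (Suc m) (e + d)\<^esub> tensor_cons R A m e b d Y"
    using Y
  proof (induction rule: tensor_induct)
    case zero show ?case using r by (simp add: tensor_cons_zero b bb)
  next
    case (add X Y)
    then show ?case
      using tensor_cons_linear(1)[OF b(1)] r
      by (simp add: tensor_cons_linear(2)[OF bb(2)] tensor_cons_linear(2)[OF b(1)] N.smult_r_distr)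
  next
    case (pure s w)
    have h: "(e, b) # w \<in> hwords A (Suc m) (e + d)" if "b \<in> carrier (A e)" for b
      using that pure by (simp add: hwords_iff)
    \<comment> \<open>The scalar \<open>s\<close> of the pure tensor and \<open>r\<close> have to
      change places, so commutativity of R enters.\<close>
    show ?case
      using pure pure_smult[of "[]" e b w "Suc m" "e + d" r] h b r pure_closed[OF h]
      by (simp add: tensor_cons_linear(3) bb tensor_cons_pure pure_closed m_comm flip: N.smult_assoc1)
  qed
qed

end

definition tensor_word :: "('r, 's) ring_scheme \<Rightarrow> ('r, 'a) bgmod \<Rightarrow> ('r, 'b) bgmod \<Rightarrow>
    nat \<Rightarrow> nat \<Rightarrow> bideg \<Rightarrow> bideg \<Rightarrow>
    (('a, 'r) tens, 'b) gmap \<Rightarrow> (('a, 'r) tens, ('b, 'r) tens) gmap \<Rightarrow> bideg \<Rightarrow>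
    (bideg \<times> 'a) list \<Rightarrow> ('b, 'r) tens" where
  "tensor_word R A B p m ef eg f g d w =
     (let a = take p w; c = drop p w; N = tensor_power R B (Suc m) (d + (ef + eg)) in
             signed N (bdot eg (wdeg a))
               (tensor_cons R B m
                  (wdeg a + ef) (f (wdeg a) (pure_tensor R A a))
                  (wdeg c + eg) (g (wdeg c) (pure_tensor R A c))))"

lemma gtensor_eq: "gtensor R A B p n m ef eg f g =
   (\<lambda>d. \<lambda>X\<in>carrier (tensor_power R A (p + n) d).
      tensor_lift R (tensor_power R B (Suc m) (d + (ef + eg))) (tensor_word R A B p m ef eg f g d) X)"
  unfolding gtensor_def tensor_word_def[abs_def] Let_def ..

locale bigraded_pair = A: bigraded R A + B: bigraded R B
  for R :: "('r, 's) ring_scheme" and A :: "('r, 'a) bgmod" and B :: "('r, 'b) bgmod"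
begin

context
  fixes p n m ef eg f g
  assumes f: "f \<in> gmaps R (tensor_power R A p) B ef"
    and g: "g \<in> gmaps R (tensor_power R A n) (tensor_power R B m) eg"
begin

lemma tensor_word_append:
  assumes "length a = p" "wdeg a + wdeg c = d"
  shows "tensor_word R A B p m ef eg f g d (a @ c) =
    signed (tensor_power R B (Suc m) ((wdeg a + ef) + (wdeg c + eg))) (bdot eg (wdeg a))
      (tensor_cons R B m (wdeg a + ef) (f (wdeg a) (pure_tensor R A a))
         (wdeg c + eg) (g (wdeg c) (pure_tensor R A c)))"
proof -
  have "d + (ef + eg) = (wdeg a + ef) + (wdeg c + eg)" using assms by (simp add: algebra_simps)
  moreover have "take p (a @ c) = a" "drop p (a @ c) = c" using assms by simp_all
  ultimately show ?thesis unfolding tensor_word_def Let_def by (simp only:)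
qed

text \<open>The letter that varies belongs either to the arguments of \<open>g\<close> or to those
  of \<open>f\<close>. Its bidegree is fixed, so the Koszul sign is the same in all words that are
  compared.\<close>

lemma tensor_word_multilinear:
  "multilinear R A (p + n) d (tensor_power R B (Suc m) (d + (ef + eg))) (tensor_word R A B p m ef eg f g d)"
proof -
  let ?W = "tensor_word R A B p m ef eg f g d"
  have fc: "f (wdeg a) (pure_tensor R A a) \<in> carrier (B (wdeg a + ef))" if "hword A a" "length a = p" for a
    using gmaps_closed[OF f, of "pure_tensor R A a" "wdeg a"] A.pure_closed'[OF that(1)] that(2) by simp
  have gc: "g (wdeg c) (pure_tensor R A c) \<in> carrier (tensor_power R B m (wdeg c + eg))"
    if "hword A c" "length c = n" for c
    using gmaps_closed[OF g, of "pure_tensor R A c" "wdeg c"] A.pure_closed'[OF that(1)] that(2) by simp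
  have D: "d + (ef + eg) = (wdeg a + ef) + (wdeg c + eg)" if "wdeg a + wdeg c = d" for a c :: "(bideg \<times> 'a) list"
    using that by (simp add: algebra_simps)
  have tc: "tensor_cons R B m (wdeg a + ef) (f (wdeg a) (pure_tensor R A a))
         (wdeg c + eg) (g (wdeg c) (pure_tensor R A c)) \<in>
       carrier (tensor_power R B (Suc m) ((wdeg a + ef) + (wdeg c + eg)))"
    if "hword A a" "length a = p" "hword A c" "length c = n" for a c
    using that by (intro B.tensor_cons_linear fc gc)
  have closed: "?W w \<in> carrier (tensor_power R B (Suc m) (d + (ef + eg)))" if "w \<in> hwords A (p + n) d" for w
  proof -
    let ?a = "take p w" and ?c = "drop p w"
    have ac: "hword A ?a" "length ?a = p" "hword A ?c" "length ?c = n" "wdeg ?a + wdeg ?c = d"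
      using that by (auto simp: hwords_iff hword_take_drop simp flip: wdeg_simps(3))
    show ?thesis
      using tensor_word_append[OF ac(2,5)] tc[OF ac(1-4)]
      by (simp add: D[OF ac(5)] signed_closed B.tensor_group)
  qed
  have add: "?W (u @ (e, x \<oplus>\<^bsub>A e\<^esub> y) # w) =
      ?W (u @ (e, x) # w) \<oplus>\<^bsub>tensor_power R B (Suc m) (d + (ef + eg))\<^esub> ?W (u @ (e, y) # w)"
    if h: "u @ (e, x) # w \<in> hwords A (p + n) d" "u @ (e, y) # w \<in> hwords A (p + n) d" for u e x y w
  proof (cases "p \<le> length u")
    case True
    define a u' where "a = take p u" and "u' = drop p u"
    have u: "u = a @ u'" by (simp add: a_def u'_def)
    have la: "length a = p" using True by (simp add: a_def)
    have hc: "u' @ (e, x) # w \<in> hwords A n (wdeg (u' @ (e, x) # w))"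
      "u' @ (e, y) # w \<in> hwords A n (wdeg (u' @ (e, x) # w))"
      and ga: "hword A a" and dd: "wdeg a + wdeg (u' @ (e, x) # w) = d"
      using h la by (auto simp: u hwords_iff algebra_simps)
    let ?z = "wdeg (u' @ (e, x) # w)"
    have *: "?W (u @ (e, v) # w) = signed (tensor_power R B (Suc m) ((wdeg a + ef) + (?z + eg))) (bdot eg (wdeg a))
      (tensor_cons R B m (wdeg a + ef) (f (wdeg a) (pure_tensor R A a))
         (?z + eg) (g ?z (pure_tensor R A (u' @ (e, v) # w))))" for v
      using tensor_word_append[OF la, of "u' @ (e, v) # w" d] dd by (simp add: u)
    note ml = A.gmaps_pure_multilinear[OF g, of ?z]
    show ?thesis
      unfolding * D[OF dd] multilinear_add[OF ml hc]
      using B.tensor_cons_linear(1,2)[OF fc[OF ga la]] multilinear_closed[OF ml hc(1)] multilinear_closed[OF ml hc(2)]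
      by (simp add: signed_add[OF B.tensor_group])
  next
    case False
    \<comment> \<open>The number of letters after the varying one that still belong to
      \<open>f\<close>.\<close>
    define k where "k = p - Suc (length u)"
    define a where "a = (\<lambda>v. u @ (e, v) # take k w)"
    define c where "c = drop k w"
    have w: "w = take k w @ c" by (simp add: c_def)
    have len: "k \<le> length w" using h False by (auto simp: hwords_iff k_def)
    have la: "length (a v) = p" for v using False len by (simp add: a_def k_def)
    have u: "u @ (e, v) # w = a v @ c" for v using w by (simp add: a_def)
    let ?z = "wdeg (a x)"
    have za: "wdeg (a v) = ?z" for v by (simp add: a_def)
    have hc: "a x \<in> hwords A p ?z" "a y \<in> hwords A p ?z" and gc': "hword A c" "length c = n"
      and dd: "?z + wdeg c = d"
      using h la za[of y] unfolding u hwords_iff by auto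
    have *: "?W (u @ (e, v) # w) = signed (tensor_power R B (Suc m) ((?z + ef) + (wdeg c + eg))) (bdot eg ?z)
      (tensor_cons R B m (?z + ef) (f ?z (pure_tensor R A (a v)))
         (wdeg c + eg) (g (wdeg c) (pure_tensor R A c)))" for v
      using tensor_word_append[OF la[of v], of c d] dd unfolding u za[of v] by simp
    note ml = A.gmaps_pure_multilinear[OF f, of ?z]
    have fa: "f ?z (pure_tensor R A (a (x \<oplus>\<^bsub>A e\<^esub> y))) =
        f ?z (pure_tensor R A (a x)) \<oplus>\<^bsub>B (?z + ef)\<^esub> f ?z (pure_tensor R A (a y))"
      using multilinear_add[OF ml, of u e x "take k w" y] hc unfolding a_def by simp
    show ?thesis
      unfolding * D[OF dd] fa
      using B.tensor_cons_left(1)[OF multilinear_closed[OF ml hc(1)] multilinear_closed[OF ml hc(2)] A.one_closed gc[OF gc']]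
        B.tensor_cons_linear(1)[OF multilinear_closed[OF ml hc(1)] gc[OF gc']]
        B.tensor_cons_linear(1)[OF multilinear_closed[OF ml hc(2)] gc[OF gc']]
      by (simp add: signed_add[OF B.tensor_group])
  qed
  have smult: "?W (u @ (e, r \<odot>\<^bsub>A e\<^esub> x) # w) =
      r \<odot>\<^bsub>tensor_power R B (Suc m) (d + (ef + eg))\<^esub> ?W (u @ (e, x) # w)"
    if r: "r \<in> carrier R" and h: "u @ (e, x) # w \<in> hwords A (p + n) d" for u e x r w
  proof (cases "p \<le> length u")
    case True
    define a u' where "a = take p u" and "u' = drop p u"
    have u: "u = a @ u'" by (simp add: a_def u'_def)
    have la: "length a = p" using True by (simp add: a_def)
    have hc: "u' @ (e, x) # w \<in> hwords A n (wdeg (u' @ (e, x) # w))"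
      and ga: "hword A a" and dd: "wdeg a + wdeg (u' @ (e, x) # w) = d"
      using h la by (auto simp: u hwords_iff algebra_simps)
    let ?z = "wdeg (u' @ (e, x) # w)"
    have *: "?W (u @ (e, v) # w) = signed (tensor_power R B (Suc m) ((wdeg a + ef) + (?z + eg))) (bdot eg (wdeg a))
      (tensor_cons R B m (wdeg a + ef) (f (wdeg a) (pure_tensor R A a))
         (?z + eg) (g ?z (pure_tensor R A (u' @ (e, v) # w))))" for v
      using tensor_word_append[OF la, of "u' @ (e, v) # w" d] dd by (simp add: u)
    note ml = A.gmaps_pure_multilinear[OF g, of ?z]
    show ?thesis
      unfolding * D[OF dd] multilinear_smult[OF ml r hc]
      using B.tensor_cons_linear(1,3)[OF fc[OF ga la]] multilinear_closed[OF ml hc(1)] r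
      by (simp add: signed_smult[OF B.tensor_module])
  next
    case False
    define k where "k = p - Suc (length u)"
    define a where "a = (\<lambda>v. u @ (e, v) # take k w)"
    define c where "c = drop k w"
    have w: "w = take k w @ c" by (simp add: c_def)
    have len: "k \<le> length w" using h False by (auto simp: hwords_iff k_def)
    have la: "length (a v) = p" for v using False len by (simp add: a_def k_def)
    have u: "u @ (e, v) # w = a v @ c" for v using w by (simp add: a_def)
    let ?z = "wdeg (a x)"
    have za: "wdeg (a v) = ?z" for v by (simp add: a_def)
    have hc: "a x \<in> hwords A p ?z" and gc': "hword A c" "length c = n"
      and dd: "?z + wdeg c = d"
      using h la unfolding u hwords_iff by auto
    have *: "?W (u @ (e, v) # w) = signed (tensor_power R B (Suc m) ((?z + ef) + (wdeg c + eg))) (bdot eg ?z)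
      (tensor_cons R B m (?z + ef) (f ?z (pure_tensor R A (a v)))
         (wdeg c + eg) (g (wdeg c) (pure_tensor R A c)))" for v
      using tensor_word_append[OF la[of v], of c d] dd unfolding u za[of v] by simp
    note ml = A.gmaps_pure_multilinear[OF f, of ?z]
    have fa: "f ?z (pure_tensor R A (a (r \<odot>\<^bsub>A e\<^esub> x))) = r \<odot>\<^bsub>B (?z + ef)\<^esub> f ?z (pure_tensor R A (a x))"
      using multilinear_smult[OF ml r, of u e x "take k w"] hc unfolding a_def by simp
    show ?thesis
      unfolding * D[OF dd] fa
      using B.tensor_cons_left(2)[OF multilinear_closed[OF ml hc(1)] multilinear_closed[OF ml hc(1)] r gc[OF gc']]
        B.tensor_cons_linear(1)[OF multilinear_closed[OF ml hc(1)] gc[OF gc']] r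
      by (simp add: signed_smult[OF B.tensor_module])
  qed
  show ?thesis unfolding multilinear_def using closed add smult by blast
qed

lemma gtensor_gmaps:
  "gtensor R A B p n m ef eg f g \<in> gmaps R (tensor_power R A (p + n)) (tensor_power R B (Suc m)) (ef + eg)"
  unfolding gtensor_eq
  by (rule A.lift_gmaps[OF B.tensor_module tensor_word_multilinear])

lemma gtensor_pure:
  assumes "hword A a" "length a = p" "hword A c" "length c = n"
  shows "gtensor R A B p n m ef eg f g (wdeg (a @ c)) (pure_tensor R A (a @ c)) =
    signed (tensor_power R B (Suc m) ((wdeg a + ef) + (wdeg c + eg))) (bdot eg (wdeg a))
      (tensor_cons R B m (wdeg a + ef) (f (wdeg a) (pure_tensor R A a))
         (wdeg c + eg) (g (wdeg c) (pure_tensor R A c)))"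
proof -
  have h: "a @ c \<in> hwords A (p + n) (wdeg a + wdeg c)" using assms by (simp add: hwords_iff)
  show ?thesis
    using A.pure_closed[OF h] A.tensor_lift_pure[OF B.tensor_module tensor_word_multilinear h]
      tensor_word_append[OF assms(2), of c "wdeg a + wdeg c"]
    by (simp add: gtensor_eq)
qed

end

end

section \<open>Tensor products of maps on words\<close>

text \<open>On a pure tensor, a tensor product of maps yields a pure tensor up to a sign. This is
  the word of the result, and \<open>ksign\<close> is the exponent of the sign; see
  \<open>gtensors_pure\<close>.\<close>

fun outs :: "('r, 's) ring_scheme \<Rightarrow> ('r, 'a) bgmod \<Rightarrow> (('a, 'r) tens, 'b) gmap op list \<Rightarrow>
    (bideg \<times> 'a) list \<Rightarrow> (bideg \<times> 'b) list" where
  "outs R A [] w = []"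
| "outs R A ((q, e, f) # fs) w =
     (wdeg (take q w) + e, f (wdeg (take q w)) (pure_tensor R A (take q w))) # outs R A fs (drop q w)"

text \<open>In the nesting used by \<open>gtensors\<close>, all later operations pass the letters
  consumed by the first one together, so their degrees enter as a sum.\<close>

fun ksign :: "'f op list \<Rightarrow> (bideg \<times> 'a) list \<Rightarrow> int" where
  "ksign [] w = 0"
| "ksign ((q, e, f) # fs) w = bdot (ops_deg fs) (wdeg (take q w)) + ksign fs (drop q w)"

definition ops_ok :: "('r, 's) ring_scheme \<Rightarrow> ('r, 'a) bgmod \<Rightarrow> ('r, 'b) bgmod \<Rightarrow>
    (('a, 'r) tens, 'b) gmap op list \<Rightarrow> bool" where
  "ops_ok R A B fs \<longleftrightarrow> (\<forall>(q, e, f)\<in>set fs. f \<in> gmaps R (tensor_power R A q) B e)"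

lemma ops_simps [simp]:
  "ops_arity [] = 0" "ops_arity ((q, e, f) # fs) = q + ops_arity fs"
  "ops_deg [] = 0" "ops_deg ((q, e, f) # fs) = e + ops_deg fs"
  "ops_deg (fs @ gs) = ops_deg fs + ops_deg gs"
  "ops_arity (fs @ gs) = ops_arity fs + ops_arity gs"
  by (simp_all add: ops_arity_def ops_deg_def)

lemma ops_ok_simps [simp]:
  "ops_ok R A B []" "ops_ok R A B ((q, e, f) # fs) \<longleftrightarrow> f \<in> gmaps R (tensor_power R A q) B e \<and> ops_ok R A B fs"
  "ops_ok R A B (fs @ gs) \<longleftrightarrow> ops_ok R A B fs \<and> ops_ok R A B gs"
  by (simp_all add: ops_ok_def ball_Un)

lemma hwords_0: "hwords A 0 d = hwords B 0 d"
  by (auto simp: hwords_def)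

text \<open>Only the empty word has length 0, so the module leaves no trace. The base case of
  \<open>gtensors\<close>, written with A, may thus be read as a map into the power of B.\<close>

lemma tensor_power_0:
  fixes A :: "('r, 'a) bgmod" and B :: "('r, 'a) bgmod"
  shows "tensor_power R A 0 = tensor_power R B 0"
proof -
  have "free_words R A 0 = free_words R B 0"
    by (simp add: free_words_def fun_eq_iff hwords_0[of A _ B])
  moreover have "tensor_relations R A 0 = tensor_relations R B 0"
    unfolding tensor_relations_def fun_eq_iff calculation by (simp add: hwords_def)
  ultimately show ?thesis by (simp add: tensor_power_def)
qed

lemma pure_tensor_Nil:
  fixes A :: "('r, 'a) bgmod" and B :: "('r, 'a) bgmod"
  shows "pure_tensor R A [] = pure_tensor R B []"
proof -
  have "free_words R A 0 = free_words R B 0"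
    by (simp add: free_words_def fun_eq_iff hwords_0[of A _ B])
  moreover have "tensor_relations R A 0 = tensor_relations R B 0"
    unfolding tensor_relations_def fun_eq_iff calculation by (simp add: hwords_def)
  ultimately show ?thesis by (simp add: pure_tensor_def)
qed

lemma gid_gmaps:
  assumes A: "\<And>d. module R (A d)" shows "gid A \<in> gmaps R A A 0"
proof (rule gmapsI)
  fix d
  interpret A: module R "A d" by (rule A)
  show "x \<in> carrier (A d) \<Longrightarrow> gid A d x \<in> carrier (A (d + 0))"
    "x \<notin> carrier (A d) \<Longrightarrow> gid A d x = undefined"
    "x \<in> carrier (A d) \<Longrightarrow> y \<in> carrier (A d) \<Longrightarrow>
      gid A d (x \<oplus>\<^bsub>A d\<^esub> y) = gid A d x \<oplus>\<^bsub>A (d + 0)\<^esub> gid A d y"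
    "r \<in> carrier R \<Longrightarrow> x \<in> carrier (A d) \<Longrightarrow>
      gid A d (r \<odot>\<^bsub>A d\<^esub> x) = r \<odot>\<^bsub>A (d + 0)\<^esub> gid A d x" for x y r
    by (simp_all add: gid_def)
qed

context bigraded
begin

lemma tensor_cons_signed:
  assumes b: "b \<in> carrier (A e)" and Y: "Y \<in> carrier (tensor_power R A m d)"
  shows "tensor_cons R A m e b d (signed (tensor_power R A m d) n Y) =
    signed (tensor_power R A (Suc m) (e + d)) n (tensor_cons R A m e b d Y)"
proof -
  interpret M: module R "tensor_power R A m d" by (rule tensor_module)
  interpret N: module R "tensor_power R A (Suc m) (e + d)" by (rule tensor_module)
  \<comment> \<open>A sign is multiplication by -1, which reduces the claim to linearity.\<close>
  have "tensor_cons R A m e b d ((\<ominus>\<^bsub>R\<^esub> \<one>\<^bsub>R\<^esub>) \<odot>\<^bsub>tensor_power R A m d\<^esub> Y) =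
      (\<ominus>\<^bsub>R\<^esub> \<one>\<^bsub>R\<^esub>) \<odot>\<^bsub>tensor_power R A (Suc m) (e + d)\<^esub> tensor_cons R A m e b d Y"
    using Y by (intro tensor_cons_linear(3)[OF b]) auto
  then show ?thesis
    using Y tensor_cons_linear(1)[OF b Y] by (simp add: signed_def M.smult_l_minus N.smult_l_minus)
qed

end

locale bigraded_pair' = bigraded_pair R A B
  for R :: "('r, 's) ring_scheme" and A :: "('r, 'a) bgmod" and B :: "('r, 'a) bgmod"
begin

lemma gtensors_gmaps:
  "ops_ok R A B fs \<Longrightarrow> gtensors R A B fs \<in> gmaps R (tensor_power R A (ops_arity fs)) (tensor_power R B (length fs)) (ops_deg fs)"
proof (induction fs)
  case Nil
  show ?case
    using gid_gmaps[of R "tensor_power R A 0", OF A.tensor_module] tensor_power_0[of R A B] by simp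
next
  case (Cons op fs)
  then show ?case by (cases op) (auto intro: gtensor_gmaps)
qed

lemma outs_props:
  assumes "ops_ok R A B fs" "hword A w" "length w = ops_arity fs"
  shows "hword B (outs R A fs w)" "wdeg (outs R A fs w) = wdeg w + ops_deg fs"
    "length (outs R A fs w) = length fs"
proof -
  have "hword B (outs R A fs w) \<and> wdeg (outs R A fs w) = wdeg w + ops_deg fs \<and>
      length (outs R A fs w) = length fs"
    using assms
  proof (induction fs arbitrary: w)
    case (Cons op fs)
    obtain q e f where op: "op = (q, e, f)" by (cases op)
    have f: "f \<in> gmaps R (tensor_power R A q) B e" "ops_ok R A B fs" using Cons.prems op by auto
    have l: "length (take q w) = q" "length (drop q w) = ops_arity fs" using Cons.prems op by auto
    have "f (wdeg (take q w)) (pure_tensor R A (take q w)) \<in> carrier (B (wdeg (take q w) + e))"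
      using gmaps_closed[OF f(1)] A.pure_closed'[of "take q w"] hword_take_drop[OF Cons.prems(2)] l by simp
    moreover have "wdeg w = wdeg (take q w) + wdeg (drop q w)" by (simp flip: wdeg_simps(3))
    ultimately show ?case
      using Cons.IH[OF f(2) hword_take_drop(2)[OF Cons.prems(2)] l(2)] by (simp add: op algebra_simps)
  qed simp
  then show "hword B (outs R A fs w)" "wdeg (outs R A fs w) = wdeg w + ops_deg fs"
    "length (outs R A fs w) = length fs" by auto
qed

lemma gtensors_pure:
  assumes "ops_ok R A B fs" "hword A w" "length w = ops_arity fs"
  shows "gtensors R A B fs (wdeg w) (pure_tensor R A w) =
    signed (tensor_power R B (length fs) (wdeg w + ops_deg fs)) (ksign fs w) (pure_tensor R B (outs R A fs w))"
  using assms
proof (induction fs arbitrary: w)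
  case Nil
  then show ?case using A.pure_closed'[of "[]"] by (simp add: gid_def pure_tensor_Nil[of R A B])
next
  case (Cons op fs)
  obtain q e f where op: "op = (q, e, f)" by (cases op)
  define a c where "a = take q w" and "c = drop q w"
  have w: "w = a @ c" by (simp add: a_def c_def)
  have f: "f \<in> gmaps R (tensor_power R A q) B e" "ops_ok R A B fs" using Cons.prems op by auto
  have l: "length a = q" "length c = ops_arity fs" using Cons.prems op by (auto simp: a_def c_def)
  have g: "hword A a" "hword A c" using Cons.prems w by auto
  let ?b = "f (wdeg a) (pure_tensor R A a)" and ?o = "outs R A fs c"
  have b: "?b \<in> carrier (B (wdeg a + e))"
    using gmaps_closed[OF f(1)] A.pure_closed'[OF g(1)] l by simp
  note o = outs_props[OF f(2) g(2) l(2)]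
  have ho: "?o \<in> hwords B (length fs) (wdeg c + ops_deg fs)" using o by (simp add: hwords_iff)
  have "gtensors R A B (op # fs) (wdeg w) (pure_tensor R A w) =
    signed (tensor_power R B (Suc (length fs)) ((wdeg a + e) + (wdeg c + ops_deg fs))) (bdot (ops_deg fs) (wdeg a))
      (tensor_cons R B (length fs) (wdeg a + e) ?b (wdeg c + ops_deg fs)
         (gtensors R A B fs (wdeg c) (pure_tensor R A c)))"
    unfolding op w by (simp add: gtensor_pure[OF f(1) gtensors_gmaps[OF f(2)] g(1) l(1) g(2) l(2)] flip: wdeg_simps(3))
  also have "\<dots> = signed (tensor_power R B (Suc (length fs)) ((wdeg a + e) + (wdeg c + ops_deg fs)))
      (bdot (ops_deg fs) (wdeg a) + ksign fs c) (pure_tensor R B ((wdeg a + e, ?b) # ?o))"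
    unfolding Cons.IH[OF f(2) g(2) l(2)] B.tensor_cons_signed[OF b B.pure_closed[OF ho]]
      B.tensor_cons_pure[OF b ho]
    using b ho by (intro signed_signed B.tensor_group B.pure_closed) (simp add: hwords_iff)
  also have "wdeg a + e + (wdeg c + ops_deg fs) = wdeg w + ops_deg (op # fs)"
    by (simp add: w op algebra_simps)
  finally show ?case by (simp add: op a_def c_def)
qed

end

section \<open>Suspension of a family of maps\<close>

definition word_value :: "('r, 's) ring_scheme \<Rightarrow> ('r, 'a) bgmod \<Rightarrow> (nat \<times> nat \<Rightarrow> (('a, 'r) tens, 'b) gmap) \<Rightarrow>
    nat \<Rightarrow> (bideg \<times> 'a) list \<Rightarrow> 'b" where
  "word_value R A f p w = f (p, length w) (wdeg w) (pure_tensor R A w)"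

definition derived_family :: "('r, 's) ring_scheme \<Rightarrow> ('r, 'a) bgmod \<Rightarrow> ('r, 'b) bgmod \<Rightarrow> int \<Rightarrow>
    (nat \<times> nat \<Rightarrow> (('a, 'r) tens, 'b) gmap) \<Rightarrow> bool" where
  "derived_family R A B k f \<longleftrightarrow> (\<forall>i. \<forall>j\<ge>1. f (i, j) \<in> gmaps R (tensor_power R A j) B (- int i, k - int i - int j))"

text \<open>The exponent of the suspension sign. It is a quadratic form in the bidegrees and the length, and it
  absorbs at the same time the Koszul signs for \<open>bdot\<close> (which pair both gradings separately) and the
  signs of \<open>sgn_dA\<close>; see \<open>sign_post\<close> and \<open>sign_pre\<close>.\<close>

fun theta :: "(bideg \<times> 'a) list \<Rightarrow> int" where
  "theta [] = 0"
| "theta (x # w) = fst (fst x) * int (length w) + (fst (fst x) + snd (fst x) + 1) * snd (wdeg w) + theta w"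

text \<open>For k = 1 this is \<open>theta\<close> alone. For k = 2 the added term has the parity of
  the upper degree of the value, by \<open>outdeg_eq\<close>.\<close>

definition susp_sign :: "int \<Rightarrow> nat \<Rightarrow> (bideg \<times> 'a) list \<Rightarrow> int" where
  "susp_sign k p w = theta w + (k - 1) * (int p + int (length w) + snd (wdeg w))"

text \<open>The value is paired with its bidegree so that it can serve as a letter of another
  word.\<close>

definition suspension :: "('r, 's) ring_scheme \<Rightarrow> ('r, 'a) bgmod \<Rightarrow> ('r, 'b) bgmod \<Rightarrow> int \<Rightarrow>
    (nat \<times> nat \<Rightarrow> (('a, 'r) tens, 'b) gmap) \<Rightarrow> nat \<Rightarrow> (bideg \<times> 'a) list \<Rightarrow> bideg \<times> 'b" where
  "suspension R A B k f p w = (outdeg k p w, signed (B (outdeg k p w)) (susp_sign k p w) (word_value R A f p w))"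

lemma outdeg_eq: "outdeg k p w = wdeg w + (- int p, k - int p - int (length w))"
  by (simp add: outdeg_def sdeg_def diag_def prod_eq_iff)

lemma theta_append: "theta (a @ b) = theta a + theta b + fst (wdeg a) * int (length b) +
    (fst (wdeg a) + snd (wdeg a) + int (length a)) * snd (wdeg b)"
  by (induction a) (simp_all add: algebra_simps)

lemma theta_cong: "map fst v = map fst w \<Longrightarrow> theta v = theta w"
proof (induction v arbitrary: w)
  case (Cons x v)
  then obtain y w' where w: "w = y # w'" "fst x = fst y" "map fst v = map fst w'" by (cases w) auto
  have "wdeg v = wdeg w'" "length v = length w'"
    using w(3) by (simp_all only: wdeg_def map_eq_imp_length_eq[OF w(3)])
  then show ?case unfolding w(1) by (simp add: w(2) Cons.IH[OF w(3)])
qed simp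

lemma susp_sign_cong: "map fst v = map fst w \<Longrightarrow> susp_sign k p v = susp_sign k p w"
  unfolding susp_sign_def wdeg_def by (simp only: theta_cong[of v w] map_eq_imp_length_eq[of fst v fst w])

lemma sdeg_cong: "map fst v = map fst w \<Longrightarrow> sdeg v = sdeg w"
  unfolding sdeg_def wdeg_def by (simp only: map_eq_imp_length_eq[of fst v fst w])

lemma derived_family_gmaps: "derived_family R A B k f \<Longrightarrow> w \<noteq> [] \<Longrightarrow>
    f (p, length w) \<in> gmaps R (tensor_power R A (length w)) B (- int p, k - int p - int (length w))"
  by (simp add: derived_family_def Suc_le_eq)

text \<open>Additivity in a letter implies compatibility with negation; this is
  \<open>chain_eval_frag_extend\<close> applied to a signed generator.\<close>

lemma chain_additive_signed:
  assumes N: "abelian_group N" and B: "\<And>d. abelian_group (B d)" and \<Phi>: "chain_additive N B D \<Phi>"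
    and "y \<in> carrier (B d)" "hword B u" "hword B c" "sdeg (u @ (d, y) # c) - diag i = D"
  shows "chain_eval N (\<Phi> i (u @ (d, signed (B d) n y) # c)) = chain_eval N (chain_sign n (\<Phi> i (u @ (d, y) # c)))"
proof -
  let ?\<Theta> = "\<lambda>y. \<Phi> i (u @ (d, y) # c)"
  interpret N: abelian_group N by (rule N)
  interpret B: abelian_group "B d" by (rule B)
  have "chain_eval N (frag_extend ?\<Theta> (chain_sign n (frag_of y))) = chain_eval N (?\<Theta> (chain_eval (B d) (chain_sign n (frag_of y))))"
  proof (rule N.chain_eval_frag_extend[OF B])
    show "Poly_Mapping.keys (chain_sign n (frag_of y)) \<subseteq> carrier (B d)"
      using assms(4) by (simp add: chain_sign_def)
    fix x z assume "x \<in> carrier (B d)" "z \<in> carrier (B d)"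
    then show "chain_eval N (?\<Theta> (x \<oplus>\<^bsub>B d\<^esub> z)) = chain_eval N (?\<Theta> x + ?\<Theta> z)"
      using assms(5-7) by (intro chain_additiveD[OF \<Phi>]) auto
  qed
  then show ?thesis
    using assms(4) by (auto simp: chain_sign_def signed_def frag_extend_minus B.chain_eval_minus)
qed

context bigraded_pair
begin

lemma word_value_closed:
  assumes "derived_family R A B k f" "hword A w" "w \<noteq> []"
  shows "word_value R A f p w \<in> carrier (B (outdeg k p w))"
  unfolding word_value_def outdeg_eq
  by (rule gmaps_closed[OF derived_family_gmaps[OF assms(1,3)] A.pure_closed'[OF assms(2)]])

lemma suspension_word_family: "derived_family R A B k f \<Longrightarrow> word_family A B k (suspension R A B k f)"
  unfolding word_family_def suspension_def by (simp add: signed_closed[OF B.A_group] word_value_closed)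

lemma suspension_chain_additive:
  assumes f: "derived_family R A B k f"
  shows "chain_additive (B (D + (0, k))) A D (\<lambda>i c. frag_of (snd (suspension R A B k f i c)))"
  unfolding chain_additive_def
proof (intro allI impI)
  fix i u d x y w
  assume *: "x \<in> carrier (A d)" "y \<in> carrier (A d)" "hword A u" "hword A w"
    "sdeg (u @ (d, x) # w) - diag i = D"
  let ?W = "\<lambda>v. u @ (d, v) # w"
  interpret N: abelian_group "B (D + (0, k))" by (rule B.A_group)
  have od: "outdeg k i (?W v) = D + (0, k)" for v
  proof -
    have "sdeg (?W v) = sdeg (?W x)" by (rule sdeg_cong) simp
    then show ?thesis using *(5) unfolding outdeg_def by (auto simp: prod_eq_iff)
  qed
  \<comment> \<open>The sign depends on degrees and length only, so it is common to the three words
    that are compared.\<close>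
  have s: "susp_sign k i (?W v) = susp_sign k i (?W x)" for v by (rule susp_sign_cong) simp
  have g: "hword A (?W v)" if "v \<in> carrier (A d)" for v using that * by simp
  have h: "?W v \<in> hwords A (length (?W x)) (wdeg (?W x))" if "v \<in> carrier (A d)" for v
    using g[OF that] by (simp add: hwords_iff)
  have fm: "f (i, length (?W x)) \<in> gmaps R (tensor_power R A (length (?W x))) B (- int i, k - int i - int (length (?W x)))"
    by (rule derived_family_gmaps[OF f]) simp
  have "wdeg (?W x) + (- int i, k - int i - int (length (?W x))) = D + (0, k)"
    using od[of x] unfolding outdeg_eq .
  with multilinear_add[OF A.gmaps_pure_multilinear[OF fm] h[OF *(1)] h[OF *(2)]]
  have "word_value R A f i (?W (x \<oplus>\<^bsub>A d\<^esub> y)) = word_value R A f i (?W x) \<oplus>\<^bsub>B (D + (0, k))\<^esub> word_value R A f i (?W y)"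
    unfolding word_value_def by simp
  moreover have "word_value R A f i (?W v) \<in> carrier (B (D + (0, k)))" if "v \<in> carrier (A d)" for v
    using word_value_closed[OF f g[OF that], of i] od by simp
  ultimately show "chain_eval (B (D + (0, k))) (frag_of (snd (suspension R A B k f i (?W (x \<oplus>\<^bsub>A d\<^esub> y))))) =
      chain_eval (B (D + (0, k))) (frag_of (snd (suspension R A B k f i (?W x))) + frag_of (snd (suspension R A B k f i (?W y))))"
    using * unfolding suspension_def od s[of "x \<oplus>\<^bsub>A d\<^esub> y"] s[of y]
    by (simp add: N.chain_eval_add signed_closed[OF B.A_group] signed_add[OF B.A_group])
qed

end

section \<open>Closed forms of the sums over blocks and insertions\<close>

fun gouts :: "(nat \<Rightarrow> 'x list \<Rightarrow> 'y) \<Rightarrow> nat list \<Rightarrow> nat list \<Rightarrow> 'x list \<Rightarrow> 'y list" where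
  "gouts g (p # ps) (q # qs) w = g p (take q w) # gouts g ps qs (drop q w)"
| "gouts g _ _ w = []"

definition post_index :: "nat \<Rightarrow> nat \<Rightarrow> (nat \<times> nat list \<times> nat list) set" where
  "post_index u v = {(i, ps, qs). u = i + sum_list ps \<and> qs \<in> compositions v \<and> length ps = length qs}"

lemma post_index_0: "post_index u 0 = {(u, [], [])}"
proof -
  have "qs = []" if "qs \<in> compositions 0" for qs
  proof (cases qs)
    case (Cons q qs')
    then show ?thesis using that unfolding compositions_def by auto
  qed simp
  moreover have "[] \<in> compositions 0" unfolding compositions_def by simp
  ultimately have c: "compositions 0 = {[]}" by blast
  show ?thesis
  proof (rule Set.set_eqI)
    fix x :: "nat \<times> nat list \<times> nat list"
    obtain i ps qs where x: "x = (i, ps, qs)" by (cases x)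
    show "x \<in> post_index u 0 \<longleftrightarrow> x \<in> {(u, [], [])}"
      unfolding x post_index_def c by (cases ps; cases qs) auto
  qed
qed

text \<open>The first block has one letter besides the k letters taken from the rest of the word, as
  in the recursion of \<open>extend\<close>; hence \<open>Suc k\<close>.\<close>

definition post_cons :: "(nat \<times> nat) \<times> (nat \<times> nat list \<times> nat list) \<Rightarrow> nat \<times> nat list \<times> nat list" where
  "post_cons = (\<lambda>((k, p), (i, ps, qs)). (i, p # ps, Suc k # qs))"

lemma post_index_Suc: "post_index u (Suc n) =
    post_cons ` (SIGMA kp:{..n} \<times> {..u}. post_index (u - snd kp) (n - fst kp))"
proof (intro equalityI subsetI)
  fix x assume x: "x \<in> post_index u (Suc n)"
  obtain i ps qs where x': "x = (i, ps, qs)" by (cases x)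
  obtain q qs' where qs: "qs = q # qs'" using x x' by (cases qs) (auto simp: post_index_def compositions_def)
  obtain p ps' where ps: "ps = p # ps'" using x x' qs by (cases ps) (auto simp: post_index_def)
  have "q \<ge> 1" using x x' qs by (auto simp: post_index_def compositions_def)
  then have "x = post_cons ((q - 1, p), (i, ps', qs'))"
    "((q - 1, p), (i, ps', qs')) \<in> (SIGMA kp:{..n} \<times> {..u}. post_index (u - snd kp) (n - fst kp))"
    using x by (auto simp: x' qs ps post_cons_def post_index_def compositions_def)
  then show "x \<in> post_cons ` (SIGMA kp:{..n} \<times> {..u}. post_index (u - snd kp) (n - fst kp))" by blast
qed (auto simp: post_cons_def post_index_def compositions_def)

lemma inj_post_cons: "inj_on post_cons S"
  by (auto simp: inj_on_def post_cons_def)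

lemma finite_post_index: "finite (post_index u n)"
proof (induction n arbitrary: u rule: less_induct)
  case (less n)
  show ?case
  proof (cases n)
    case 0 then show ?thesis by (simp add: post_index_0)
  next
    case (Suc m)
    then show ?thesis using less by (auto simp: post_index_Suc intro!: finite_imageI finite_SigmaI)
  qed
qed

text \<open>Unrolls the recursion into one sum over the index set of
  \<open>dA_postcomp\<close>.\<close>

lemma extend_eq_sum:
  "extend g \<Phi> u w = (\<Sum>(i, ps, qs)\<in>post_index u (length w). \<Phi> i (gouts g ps qs w))"
proof (induction w arbitrary: \<Phi> u rule: length_induct_word)
  case (1 w)
  show ?case
  proof (cases w)
    case Nil then show ?thesis by (simp add: post_index_0)
  next
    case (Cons x v)
    let ?n = "length v"
    define F where "F = (\<lambda>kp (i, ps, qs). \<Phi> i (g (snd kp) (x # take (fst kp) v) # gouts g ps qs (drop (fst kp) v)))"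
    have "(\<Sum>(i, ps, qs)\<in>post_index u (length w). \<Phi> i (gouts g ps qs w)) =
      (\<Sum>y\<in>(SIGMA kp:{..?n} \<times> {..u}. post_index (u - snd kp) (?n - fst kp)).
         case post_cons y of (i, ps, qs) \<Rightarrow> \<Phi> i (gouts g ps qs w))"
      by (simp add: Cons post_index_Suc sum.reindex[OF inj_post_cons] comp_def)
    also have "\<dots> = (\<Sum>(kp, z)\<in>(SIGMA kp:{..?n} \<times> {..u}. post_index (u - snd kp) (?n - fst kp)). F kp z)"
      by (rule sum.cong) (auto simp: F_def post_cons_def Cons)
    also have "\<dots> = (\<Sum>kp\<in>{..?n} \<times> {..u}. sum (F kp) (post_index (u - snd kp) (?n - fst kp)))"
      by (rule sum.Sigma[symmetric]) (auto simp: finite_post_index)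
    also have "\<dots> = (\<Sum>k\<le>?n. \<Sum>p\<le>u. sum (F (k, p)) (post_index (u - p) (?n - k)))"
      by (subst sum.cartesian_product) (simp add: case_prod_beta)
    also have "\<dots> = (\<Sum>k\<le>?n. \<Sum>p\<le>u. \<Sum>(i, ps, qs)\<in>post_index (u - p) (?n - k).
        \<Phi> i (g p (x # take k v) # gouts g ps qs (drop k v)))"
      by (simp add: F_def)
    also have "\<dots> = (\<Sum>k\<le>?n. \<Sum>p\<le>u. extend g (\<lambda>i c. \<Phi> i (g p (x # take k v) # c)) (u - p) (drop k v))"
      by (intro sum.cong refl) (simp add: 1 Cons)
    finally show ?thesis by (simp add: Cons extend.simps(2))
  qed
qed

text \<open>Here r letters are passed, the next \<open>Suc k\<close> are consumed, and p is the
  index of the inserted map.\<close>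

lemma coderiv_eq_sum:
  "coderiv \<pi> m \<Phi> u w = (\<Sum>r<length w. \<Sum>k<length w - r. \<Sum>p\<le>u. chain_sign (psum \<pi> (take r w))
     (\<Phi> (u - p) (take r w @ m p (take (Suc k) (drop r w)) # drop (r + Suc k) w)))"
proof (induction w arbitrary: \<Phi>)
  case (Cons x v)
  have "chain_sign (\<pi> x) (coderiv \<pi> m (\<lambda>i c. \<Phi> i (x # c)) u v) =
    (\<Sum>r<length v. \<Sum>k<length v - r. \<Sum>p\<le>u. chain_sign (psum \<pi> (take (Suc r) (x # v)))
     (\<Phi> (u - p) (take (Suc r) (x # v) @ m p (take (Suc k) (drop (Suc r) (x # v))) # drop (Suc r + Suc k) (x # v))))"
    unfolding Cons by (simp add: chain_sign_sum chain_sign_chain_sign)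
  then show ?case
    unfolding coderiv.simps length_Cons sum.lessThan_Suc_shift
    by (simp add: cuts_def sum_splits_def lessThan_Suc_atMost del: sum.lessThan_Suc)
qed simp

definition pre_index :: "nat \<Rightarrow> nat \<Rightarrow> (nat \<times> nat \<times> nat \<times> nat \<times> nat \<times> nat) set" where
  "pre_index u v = {(i, p, j, q, r, t). u = i + p \<and> v = j + q - 1 \<and> j = 1 + r + t \<and> 1 \<le> q}"

text \<open>The data r, q = \<open>Suc k\<close> and p are free; the others are forced by i = u - p,
  j = v + 1 - q and t = v - r - q.\<close>

lemma sum_pre_index:
  "(\<Sum>x\<in>pre_index u v. F x) = (\<Sum>r<v. \<Sum>k<v - r. \<Sum>p\<le>u. F (u - p, p, v - k, Suc k, r, v - r - Suc k))"
proof -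
  have "(\<Sum>r<v. \<Sum>k<v - r. \<Sum>p\<le>u. F (u - p, p, v - k, Suc k, r, v - r - Suc k)) =
    (\<Sum>(r, k, p)\<in>(SIGMA r:{..<v}. SIGMA k:{..<v - r}. {..u}). F (u - p, p, v - k, Suc k, r, v - r - Suc k))"
    by (simp add: sum.Sigma)
  also have "\<dots> = (\<Sum>x\<in>pre_index u v. F x)"
    by (rule sum.reindex_bij_witness[of _ "\<lambda>(i, p, j, q, r, t). (r, q - 1, p)"
        "\<lambda>(r, k, p). (u - p, p, v - k, Suc k, r, v - r - Suc k)"]) (auto simp: pre_index_def)
  finally show ?thesis by simp
qed

section \<open>The structure equations on words\<close>

lemma sum_nth_1: "(\<Sum>k = 1..length xs. f (xs ! (k - 1))) = sum_list (map f xs)"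
proof -
  have "(\<Sum>k = 1..length xs. f (xs ! (k - 1))) = (\<Sum>k<length xs. f (xs ! k))"
    by (simp add: sum.atLeast1_atMost_eq)
  then show ?thesis by (simp add: sum_list_sum_nth atLeast0LessThan)
qed

text \<open>A new first block raises both j and every old position t by one, so the old coefficients
  j + t keep their parity. With L old blocks, the new block adds (p + q)(L + 2) and q times the sum
  over the old blocks.\<close>

lemma sgn_dA_Cons:
  assumes "length ps = length qs"
  shows "even (int (sgn_dA (p # ps) (q # qs)) -
    (int (sgn_dA ps qs) + (int p + int q) * int (length qs) +
      int q * (int (sum_list ps) + int (sum_list qs))))"
proof -
  let ?L = "length qs"
  let ?h = "\<lambda>k. ps ! (k - 1) + qs ! (k - 1)"
  have inner: "(\<Sum>w = Suc (Suc t)..Suc ?L. (p # ps) ! (w - 1) + (q # qs) ! (w - 1)) =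
      (\<Sum>w = Suc t..?L. ?h w)" for t
    unfolding sum.shift_bounds_cl_Suc_ivl by (intro sum.cong) (auto simp: nth_Cons')
  have tot: "(\<Sum>w = Suc 0..?L. ?h w) = sum_list ps + sum_list qs"
    using sum_nth_1[of "\<lambda>x. x" ps] sum_nth_1[of "\<lambda>x. x" qs] assms by (simp add: sum.distrib)
  have "sgn_dA (p # ps) (q # qs) =
    (\<Sum>t = 1..Suc ?L. ((p # ps) ! (t - 1) + (q # qs) ! (t - 1)) * (Suc ?L + t) +
       (q # qs) ! (t - 1) * (\<Sum>w = t + 1..Suc ?L. (p # ps) ! (w - 1) + (q # qs) ! (w - 1)))"
    by (simp add: sgn_dA_def Let_def)
  also have "\<dots> = (p + q) * (Suc ?L + 1) + q * (sum_list ps + sum_list qs) +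
     (\<Sum>t = 1..?L. (ps ! (t - 1) + qs ! (t - 1)) * (Suc ?L + Suc t) + qs ! (t - 1) * (\<Sum>w = t + 1..?L. ?h w))"
  proof -
    have "(\<Sum>t = 1..Suc ?L. ((p # ps) ! (t - 1) + (q # qs) ! (t - 1)) * (Suc ?L + t) +
       (q # qs) ! (t - 1) * (\<Sum>w = t + 1..Suc ?L. (p # ps) ! (w - 1) + (q # qs) ! (w - 1))) =
      (p + q) * (Suc ?L + 1) + q * (\<Sum>w = Suc 1..Suc ?L. (p # ps) ! (w - 1) + (q # qs) ! (w - 1)) +
      (\<Sum>t = Suc 1..Suc ?L. ((p # ps) ! (t - 1) + (q # qs) ! (t - 1)) * (Suc ?L + t) +
       (q # qs) ! (t - 1) * (\<Sum>w = t + 1..Suc ?L. (p # ps) ! (w - 1) + (q # qs) ! (w - 1)))"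
      by (subst sum.atLeast_Suc_atMost) simp_all
    moreover have "(\<Sum>t = Suc 1..Suc ?L. ((p # ps) ! (t - 1) + (q # qs) ! (t - 1)) * (Suc ?L + t) +
       (q # qs) ! (t - 1) * (\<Sum>w = t + 1..Suc ?L. (p # ps) ! (w - 1) + (q # qs) ! (w - 1))) =
      (\<Sum>t = 1..?L. (ps ! (t - 1) + qs ! (t - 1)) * (Suc ?L + Suc t) + qs ! (t - 1) * (\<Sum>w = t + 1..?L. ?h w))"
      unfolding sum.shift_bounds_cl_Suc_ivl
      by (intro sum.cong refl) (use inner in \<open>auto simp: nth_Cons'\<close>)
    ultimately show ?thesis using inner[of 0] tot by simp
  qed
  also have "(\<Sum>t = 1..?L. (ps ! (t - 1) + qs ! (t - 1)) * (Suc ?L + Suc t) + qs ! (t - 1) * (\<Sum>w = t + 1..?L. ?h w))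
    = sgn_dA ps qs + 2 * (\<Sum>t = 1..?L. ps ! (t - 1) + qs ! (t - 1))"
    unfolding sgn_dA_def Let_def sum_distrib_left sum.distrib[symmetric]
    by (intro sum.cong refl) (simp add: algebra_simps sum_distrib_left)
  finally have "int (sgn_dA (p # ps) (q # qs)) = int (sgn_dA ps qs) + (int p + int q) * int (length qs) +
      int q * (int (sum_list ps) + int (sum_list qs)) +
      2 * (int p + int q + int (\<Sum>t = 1..?L. ps ! (t - 1) + qs ! (t - 1)))"
    by (simp add: algebra_simps)
  then show ?thesis by simp
qed

definition map_ops :: "(nat \<times> nat \<Rightarrow> 'f) \<Rightarrow> nat list \<Rightarrow> nat list \<Rightarrow> 'f op list" where
  "map_ops g ps qs = map (\<lambda>(p, q). (q, (- int p, 1 - int p - int q), g (p, q))) (zip ps qs)"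

lemma map_ops_simps [simp]: "map_ops g [] [] = []"
  "map_ops g (p # ps) (q # qs) = (q, (- int p, 1 - int p - int q), g (p, q)) # map_ops g ps qs"
  by (simp_all add: map_ops_def)

lemma map_ops_props:
  assumes "length ps = length qs"
  shows "length (map_ops g ps qs) = length qs" "ops_arity (map_ops g ps qs) = sum_list qs"
    "ops_deg (map_ops g ps qs) =
      (- int (sum_list ps), int (length qs) - int (sum_list ps) - int (sum_list qs))"
  using assms by (induction ps qs rule: list_induct2) (simp_all add: zero_prod_def)

lemma length_outs [simp]: "length (outs R A fs w) = length fs"
  by (induction R A fs w rule: outs.induct) simp_all

lemma wdeg_outs: "length w = ops_arity fs \<Longrightarrow> wdeg (outs R A fs w) = wdeg w + ops_deg fs"
proof (induction R A fs w rule: outs.induct)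
  case (2 R A q e f fs w)
  have "wdeg w = wdeg (take q w) + wdeg (drop q w)" by (simp flip: wdeg_simps(3))
  then show ?case using 2 by (simp add: algebra_simps)
qed simp

fun theta_sum :: "nat list \<Rightarrow> (bideg \<times> 'a) list \<Rightarrow> int" where
  "theta_sum [] w = 0"
| "theta_sum (q # qs) w = theta (take q w) + theta_sum qs (drop q w)"

text \<open>The balance for a substitution: the derived sign and the Koszul sign account for the
  suspension signs of the word, of its blocks (\<open>theta_sum\<close>) and of the output word. The
  induction removes the first block, and \<open>theta_append\<close> turns the change into a
  polynomial in degrees and lengths.\<close>

lemma sign_post:
  assumes "length ps = length qs" "sum_list qs = length w"
  shows "even (int (sgn_dA ps qs) + ksign (map_ops g ps qs) w + theta w +
    theta (outs R A (map_ops g ps qs) w) + theta_sum qs w)"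
  using assms
proof (induction ps qs arbitrary: w rule: list_induct2)
  case Nil
  then show ?case by (simp add: sgn_dA_def)
next
  case (Cons p ps q qs)
  define a c where "a = take q w" and "c = drop q w"
  have w: "w = a @ c" by (simp add: a_def c_def)
  have l: "length a = q" "sum_list qs = length c" using Cons.prems by (auto simp: a_def c_def)
  let ?o = "outs R A (map_ops g ps qs) c"
  note gp = map_ops_props[OF Cons.hyps]
  have o: "length ?o = length qs"
    "wdeg ?o = wdeg c + (- int (sum_list ps), int (length qs) - int (sum_list ps) - int (length c))"
    using wdeg_outs[of c "map_ops g ps qs" R A] gp[of g] l by simp_all
  \<comment> \<open>Short names for degrees and lengths make the parity claim a polynomial identity
    over the integers.\<close>
  define X Y Yc L P Q where "X = fst (wdeg a)" and "Y = snd (wdeg a)" and "Yc = snd (wdeg c)"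
    and "L = int (length qs)" and "P = int (sum_list ps)" and "Q = int (length c)"
  note d = this
  let ?IH = "int (sgn_dA ps qs) + ksign (map_ops g ps qs) c + theta c + theta ?o + theta_sum qs c"
  let ?S = "int (sgn_dA ps qs) + (int p + int q) * L + int q * (P + Q)"
  let ?G = "(- P * X + (L - P - Q) * Y) + ksign (map_ops g ps qs) c + (theta a + theta c + X * Q + (X + Y + int q) * Yc) +
    ((X - int p) * L + (X - int p + (Y + 1 - int p - int q) + 1) * (Yc + L - P - Q) + theta ?o) + (theta a + theta_sum qs c)"
  \<comment> \<open>The change in the induction step is exhibited as an explicit double.\<close>
  have eq: "?S + ?G - ?IH = 2 * (P * int q + Q * int q - P * X + L * Y - P * Y - Q * Y + theta a + X * Yc
     + Y * Yc + L * X - Yc * int p - L * int p + P * int p + Q * int p + Yc + L - P - Q)"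
    by (simp add: algebra_simps)
  have "even (?S + ?G - ?IH)" unfolding eq by (rule dvd_triv_left)
  moreover have "even ?IH" using Cons.IH[OF l(2)] .
  moreover have "even (int (sgn_dA (p # ps) (q # qs)) - ?S)"
    using sgn_dA_Cons[OF Cons.hyps, of p q] l by (simp add: d)
  moreover have "int (sgn_dA (p # ps) (q # qs)) + ksign (map_ops g (p # ps) (q # qs)) w + theta w +
     theta (outs R A (map_ops g (p # ps) (q # qs)) w) + theta_sum (q # qs) w = int (sgn_dA (p # ps) (q # qs)) + ?G"
    unfolding w using l o by (simp add: gp[of g] theta_append d bdot_def algebra_simps)
  ultimately show ?case by (metis (no_types, lifting) diff_add_cancel even_add even_diff)
qed

text \<open>The balance for inserting one map at the middle block \<open>b\<close>: the sign of
  \<open>dA_precomp\<close>, the Koszul sign over \<open>a\<close>, the normalisation of the result,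
  the coderivation sign over \<open>a\<close> and the suspension signs of the inner and the outer
  map cancel. Only the degrees of the outer letters matter, hence the copies \<open>a'\<close> and
  \<open>c'\<close>.\<close>

lemma sign_pre:
  fixes a b c :: "(bideg \<times> 'a) list" and y :: 'b
  assumes "length a = r" "length b = q" "length c = t" "map fst a' = map fst a" "map fst c' = map fst c"
    and j: "j = 1 + r + t"
  shows "even (int (r * q + t + p * j) + bdot (- int p, 2 - int p - int q) (wdeg a) +
    (theta (a @ b @ c) + snd (wdeg (a @ b @ c)) + int (length (a @ b @ c)) +
      (k - 1) * (int (i + p) + int (length (a @ b @ c)) + snd (wdeg (a @ b @ c)) + 1)) +
    psum shifted_deg a + susp_sign 2 p b + susp_sign k i (a' @ (wdeg b + (- int p, 2 - int p - int q), y) # c'))"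
proof -
  have len: "length a' = r" "length c' = t" using assms by (metis length_map)+
  have deg: "wdeg a' = wdeg a" "wdeg c' = wdeg c" using assms by (simp_all add: wdeg_def)
  have th: "theta a' = theta a" "theta c' = theta c" using assms(4,5) by (simp_all only: theta_cong[of a' a] theta_cong[of c' c])
  have ps: "psum shifted_deg a = snd (wdeg a) - fst (wdeg a) - int r"
    unfolding assms(1)[symmetric] by (induction a) (auto simp: shifted_deg_def)
  define Xa Ya Xb Yb Xc Yc where "Xa = fst (wdeg a)" and "Ya = snd (wdeg a)" and "Xb = fst (wdeg b)"
    and "Yb = snd (wdeg b)" and "Xc = fst (wdeg c)" and "Yc = snd (wdeg c)"
  note d = this
  define R' Q' T' P' I' where "R' = int r" and "Q' = int q" and "T' = int t" and "P' = int p" and "I' = int i"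
  note e = this
  have "int (r * q + t + p * j) + bdot (- int p, 2 - int p - int q) (wdeg a) +
    (theta (a @ b @ c) + snd (wdeg (a @ b @ c)) + int (length (a @ b @ c)) +
      (k - 1) * (int (i + p) + int (length (a @ b @ c)) + snd (wdeg (a @ b @ c)) + 1)) +
    psum shifted_deg a + susp_sign 2 p b + susp_sign k i (a' @ (wdeg b + (- int p, 2 - int p - int q), y) # c') =
    R' * Q' + T' + P' * (1 + R' + T') + (- P' * Xa + (2 - P' - Q') * Ya) +
    (theta a + (theta b + theta c + Xb * T' + (Xb + Yb + Q') * Yc) + Xa * (Q' + T') + (Xa + Ya + R') * (Yb + Yc) +
     (Ya + Yb + Yc) + (R' + Q' + T') + (k - 1) * (I' + P' + (R' + Q' + T') + (Ya + Yb + Yc) + 1)) +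
    (Ya - Xa - R') + (theta b + (P' + Q' + Yb)) +
    (theta a + ((Xb - P') * T' + (Xb - P' + (Yb + 2 - P' - Q') + 1) * Yc + theta c) + Xa * (1 + T') +
      (Xa + Ya + R') * (Yb + 2 - P' - Q' + Yc) + (k - 1) * (I' + (R' + 1 + T') + (Ya + (Yb + 2 - P' - Q') + Yc)))"
    unfolding susp_sign_def ps by (simp add: theta_append assms(1-3) len deg th j bdot_def d e algebra_simps)
  also have "\<dots> = 2 * (- Xa * P' + 2 * Ya - Ya * P' - Ya * Q' + theta a + theta b + theta c + Xb * T' + Xb * Yc
     + Yb * Yc + Xa * T' + Xa * Yb + Xa * Yc + Ya * Yb + Ya * Yc + Yb * R' + Yc * R' + I' * k + k * R' + k * T'
     + Ya * k + Yb * k + Yc * k + 2 * k - I' - 2 + Xa + P' + Q' - Yc * P' + Yc)"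
    by (simp add: algebra_simps)
  finally show ?thesis by (simp only: dvd_triv_left)
qed

section \<open>The derived composite as substitution\<close>

lemma map_ops_ok:
  assumes "derived_family R A B 1 g" "\<forall>q\<in>set qs. 1 \<le> q"
  shows "ops_ok R A B (map_ops g ps qs)"
  unfolding map_ops_def ops_ok_def using assms by (auto simp: derived_family_def dest!: set_zip_rightD)

text \<open>The suspension sign of each block is pulled out of its letter by
  \<open>chain_additive_signed\<close>; together these signs form \<open>theta_sum\<close>.\<close>

lemma (in bigraded_pair') multilin_gouts:
  assumes N: "abelian_group N" and g: "derived_family R A B 1 g"
    and "length ps = length qs" "sum_list qs = length w" "\<forall>q\<in>set qs. 1 \<le> q" "hword A w"
    and "chain_additive N B D \<Phi>" "sdeg w - diag (sum_list ps) - diag i = D"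
  shows "chain_eval N (\<Phi> i (gouts (suspension R A B 1 g) ps qs w)) = chain_eval N (chain_sign (theta_sum qs w) (\<Phi> i (outs R A (map_ops g ps qs) w)))"
  using assms(3-)
proof (induction ps qs arbitrary: w \<Phi> D rule: list_induct2)
  case (Cons p ps q qs)
  interpret N: abelian_group N by (rule N)
  define a c where "a = take q w" and "c = drop q w"
  have w: "w = a @ c" by (simp add: a_def c_def)
  have l: "length a = q" "sum_list qs = length c" using Cons.prems by (auto simp: a_def c_def)
  have a: "a \<noteq> []" "hword A a" "hword A c" using Cons.prems l w by auto
  let ?d = "outdeg 1 p a" and ?v = "word_value R A g p a" and ?o = "outs R A (map_ops g ps qs) c"
  have v: "?v \<in> carrier (B ?d)" by (rule word_value_closed[OF g a(2,1)])
  have qs: "\<forall>q\<in>set qs. 1 \<le> q" using Cons.prems by simp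
  note gp = map_ops_props[OF Cons.hyps, of g]
  have lc: "length c = ops_arity (map_ops g ps qs)" using gp l by simp
  note op = outs_props[OF map_ops_ok[OF g qs] a(3) lc]
  have so: "sdeg ?o = sdeg c - diag (sum_list ps)"
    unfolding sdeg_def op gp by (simp add: diag_def l prod_eq_iff)
  have D: "sdeg a - diag p + sdeg c - diag (sum_list ps) - diag i = D"
    using Cons.prems(4) unfolding w by (auto simp: diag_add prod_eq_iff Cons.prems(5)[unfolded w, symmetric])
  have dd: "?d - (0, 1) = sdeg a - diag p" by (simp add: outdeg_def)
  let ?z = "suspension R A B 1 g p a"
  have z: "?z = (?d, signed (B ?d) (theta a) ?v)" by (simp add: suspension_def susp_sign_def)
  have M: "chain_additive N B (D - (?d - (0, 1))) (\<lambda>i c. \<Phi> i (?z # c))"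
    using chain_additive_Cons[OF Cons.prems(4), of ?z] v by (simp add: z signed_closed[OF B.A_group])
  have "chain_eval N (\<Phi> i (?z # gouts (suspension R A B 1 g) ps qs c)) = chain_eval N (chain_sign (theta_sum qs c) (\<Phi> i (?z # ?o)))"
    using D by (intro Cons.IH[OF l(2) qs a(3) M]) (simp add: dd flip: D)
  also have "\<dots> = chain_eval N (chain_sign (theta_sum qs c) (chain_sign (theta a) (\<Phi> i ((?d, ?v) # ?o))))"
  proof (rule N.chain_eval_chain_sign_cong)
    have "sdeg ([] @ (?d, ?v) # ?o) - diag i = D"
      using D by (simp add: so dd algebra_simps)
    from chain_additive_signed[OF N B.A_group Cons.prems(4) v _ op(1) this, of "theta a"]
    show "chain_eval N (\<Phi> i (?z # ?o)) = chain_eval N (chain_sign (theta a) (\<Phi> i ((?d, ?v) # ?o)))"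
      by (simp add: z)
  qed
  finally show ?case
    using l by (simp add: a_def[symmetric] c_def[symmetric] chain_sign_chain_sign outdeg_eq word_value_def add.commute)
qed simp

lemma (in abelian_group) chain_eval_chain_sign_frag_signed:
  "x \<in> carrier G \<Longrightarrow> chain_eval G (chain_sign n (frag_of (if even m then x else \<ominus> x))) = chain_eval G (chain_sign (n + m) (frag_of x))"
  by (auto simp: chain_sign_def chain_eval_minus)

lemma chain_eval_chain_sign_signed:
  fixes N :: "('r, 'a) module"
  assumes "abelian_group N" "x \<in> carrier N"
  shows "chain_eval N (chain_sign n (frag_of (signed N m x))) = chain_eval N (chain_sign (n + m) (frag_of x))"
  using abelian_group.chain_eval_chain_sign_frag_signed[OF assms] unfolding signed_def .

lemma dA_postcomp_eq: "dA_postcomp R A B C k \<epsilon> h g u v =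
  gsum (tensor_power R A v) C (- int u, k - int u - int v) (post_index u v)
    (\<lambda>(i, ps, qs). int (\<epsilon> + sgn_dA ps qs))
    (\<lambda>(i, ps, qs). gcomp (tensor_power R A v) (ops_deg (map_ops g ps qs)) (h (i, length qs))
       (gtensors R A B (map_ops g ps qs)))"
  unfolding dA_postcomp_def post_index_def map_ops_def Let_def ..

locale bigraded_triple = AB: bigraded_pair' R A B + C: bigraded R C
  for R :: "('r, 's) ring_scheme" and A :: "('r, 'a) bgmod" and B :: "('r, 'a) bgmod" and C :: "('r, 'a) bgmod"
begin

sublocale BC: bigraded_pair R B C ..

context
  fixes h g k
  assumes h: "derived_family R B C k h" and g: "derived_family R A B 1 g"
begin

lemma post_term:
  assumes v: "1 \<le> v" and idx: "(i, ps, qs) \<in> post_index u v"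
  shows "gcomp (tensor_power R A v) (ops_deg (map_ops g ps qs)) (h (i, length qs)) (gtensors R A B (map_ops g ps qs))
      \<in> gmaps R (tensor_power R A v) C (- int u, k - int u - int v)" (is ?G)
    and "hword A w \<Longrightarrow> length w = v \<Longrightarrow>
      gcomp (tensor_power R A v) (ops_deg (map_ops g ps qs)) (h (i, length qs)) (gtensors R A B (map_ops g ps qs))
        (wdeg w) (pure_tensor R A w) =
      signed (C (outdeg k u w)) (ksign (map_ops g ps qs) w) (word_value R B h i (outs R A (map_ops g ps qs) w))"
    and "hword A w \<Longrightarrow> length w = v \<Longrightarrow> word_value R B h i (outs R A (map_ops g ps qs) w) \<in> carrier (C (outdeg k u w))"
    and "hword A w \<Longrightarrow> length w = v \<Longrightarrow> outdeg k i (outs R A (map_ops g ps qs) w) = outdeg k u w"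
proof -
  let ?gs = "map_ops g ps qs"
  have l: "length ps = length qs" and s: "sum_list qs = v" and q: "\<forall>q\<in>set qs. 1 \<le> q" and u: "u = i + sum_list ps"
    using idx by (auto simp: post_index_def compositions_def)
  have L: "1 \<le> length qs" using s v by (cases qs) auto
  note gp = map_ops_props[OF l, of g]
  have ok: "ops_ok R A B ?gs" by (rule map_ops_ok[OF g q])
  have gt: "gtensors R A B ?gs \<in> gmaps R (tensor_power R A v) (tensor_power R B (length qs)) (ops_deg ?gs)"
    using AB.gtensors_gmaps[OF ok] gp s by simp
  have hg: "h (i, length qs) \<in> gmaps R (tensor_power R B (length qs)) C (- int i, k - int i - int (length qs))"
    using h L by (simp add: derived_family_def)
  show ?G
    by (rule gcomp_gmaps[OF AB.A.tensor_module hg gt]) (simp add: gp(3) s u)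
  assume w: "hword A w" "length w = v"
  note op = AB.outs_props[OF ok w(1), unfolded gp, OF w(2)[folded s]]
  let ?o = "outs R A ?gs w"
  show od: "outdeg k i ?o = outdeg k u w"
    unfolding outdeg_eq op by (simp add: w s u prod_eq_iff)
  have "length ?o \<noteq> 0" unfolding length_outs gp using L by auto
  then have "?o \<noteq> []" by (metis list.size(3))
  then show "word_value R B h i ?o \<in> carrier (C (outdeg k u w))"
    using BC.word_value_closed[OF h op(1), of i] od by simp
  have cl: "pure_tensor R B ?o \<in> carrier (tensor_power R B (length qs) (wdeg w + ops_deg ?gs))"
    using AB.B.pure_closed'[OF op(1)] by (simp add: op gp)
  have pw: "pure_tensor R A w \<in> carrier (tensor_power R A v (wdeg w))"
    using AB.A.pure_closed'[OF w(1)] w(2) by simp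
  have dd: "wdeg w + ops_deg ?gs + (- int i, k - int i - int (length qs)) = outdeg k u w"
    unfolding outdeg_eq gp by (simp add: w s u prod_eq_iff)
  have "gcomp (tensor_power R A v) (ops_deg ?gs) (h (i, length qs)) (gtensors R A B ?gs) (wdeg w) (pure_tensor R A w)
    = h (i, length qs) (wdeg w + ops_deg ?gs)
       (signed (tensor_power R B (length qs) (wdeg w + ops_deg ?gs)) (ksign ?gs w) (pure_tensor R B ?o))"
    unfolding gcomp_apply[where A = "tensor_power R A v", OF pw] using AB.gtensors_pure[OF ok w(1)] gp(1,2) w(2) s by simp
  also have "\<dots> = signed (C (outdeg k u w)) (ksign ?gs w) (h (i, length qs) (wdeg w + ops_deg ?gs) (pure_tensor R B ?o))"
    using gmaps_signed[OF hg AB.B.tensor_group C.A_group cl] unfolding dd by simp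
  also have "h (i, length qs) (wdeg w + ops_deg ?gs) (pure_tensor R B ?o) = word_value R B h i ?o"
    unfolding word_value_def op gp ..
  finally show "gcomp (tensor_power R A v) (ops_deg ?gs) (h (i, length qs)) (gtensors R A B ?gs)
        (wdeg w) (pure_tensor R A w) = signed (C (outdeg k u w)) (ksign ?gs w) (word_value R B h i ?o)" .
qed

lemma dA_postcomp_gmaps:
  assumes "1 \<le> v"
  shows "dA_postcomp R A B C k \<epsilon> h g u v \<in> gmaps R (tensor_power R A v) C (- int u, k - int u - int v)"
  unfolding dA_postcomp_eq
  by (rule gsum_gmaps[OF AB.A.tensor_module C.A_module]) (auto intro: post_term(1)[OF assms])

text \<open>The signs of the definition are absorbed summand by summand through
  \<open>sign_post\<close>, and plain substitution of suspended families remains. The factor in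
  front is the suspension sign of the composite, apart from \<open>\<epsilon>\<close>.\<close>

lemma dA_postcomp_pure:
  assumes w: "hword A w" "w \<noteq> []"
  shows "dA_postcomp R A B C k \<epsilon> h g u (length w) (wdeg w) (pure_tensor R A w) =
    signed (C (outdeg k u w)) (int \<epsilon> + susp_sign k u w) (chain_eval (C (outdeg k u w))
      (extend (suspension R A B 1 g) (\<lambda>i c. frag_of (snd (suspension R B C k h i c))) u w))"
proof -
  let ?v = "length w" and ?N = "C (outdeg k u w)"
  let ?\<Phi> = "\<lambda>i c. frag_of (snd (suspension R B C k h i c))"
  interpret N: abelian_group ?N by (rule C.A_group)
  have v: "1 \<le> ?v" using w(2) by (cases w) auto
  have od: "wdeg w + (- int u, k - int u - int ?v) = outdeg k u w" by (simp add: outdeg_eq)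
  have D: "sdeg w - diag u + (0, k) = outdeg k u w" by (simp add: outdeg_def)
  have ml: "chain_additive ?N B (sdeg w - diag u) ?\<Phi>"
    using BC.suspension_chain_additive[OF h, of "sdeg w - diag u"] unfolding D .
  let ?T = "\<lambda>(i, ps, qs). gcomp (tensor_power R A ?v) (ops_deg (map_ops g ps qs)) (h (i, length qs)) (gtensors R A B (map_ops g ps qs))"
  have "dA_postcomp R A B C k \<epsilon> h g u ?v (wdeg w) (pure_tensor R A w) =
    chain_eval ?N (\<Sum>x\<in>post_index u ?v. chain_sign ((\<lambda>(i, ps, qs). int (\<epsilon> + sgn_dA ps qs)) x) (frag_of (?T x (wdeg w) (pure_tensor R A w))))"
    unfolding dA_postcomp_eq od[symmetric]
  proof (rule gsum_chain_eval[OF C.A_group])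
    fix x assume "x \<in> post_index u ?v"
    then show "?T x (wdeg w) (pure_tensor R A w) \<in> carrier (C (wdeg w + (- int u, k - int u - int ?v)))"
      using gmaps_closed[OF post_term(1)[OF v] AB.A.pure_closed'[OF w(1)]] by (cases x) auto
  qed (rule AB.A.pure_closed'[OF w(1)])
  also have "\<dots> = chain_eval ?N (chain_sign (int \<epsilon> + susp_sign k u w) (extend (suspension R A B 1 g) ?\<Phi> u w))"
    unfolding extend_eq_sum chain_sign_sum
  proof (rule N.chain_eval_sum_cong)
    fix x assume x: "x \<in> post_index u ?v"
    obtain i ps qs where x': "x = (i, ps, qs)" by (cases x)
    note idx = x[unfolded x']
    have l: "length ps = length qs" and s: "sum_list qs = ?v" and q: "\<forall>q\<in>set qs. 1 \<le> q" and u: "u = i + sum_list ps"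
      using idx by (auto simp: post_index_def compositions_def)
    let ?gs = "map_ops g ps qs" and ?o = "outs R A (map_ops g ps qs) w"
    let ?y = "word_value R B h i ?o"
    note gp = map_ops_props[OF l, of g]
    have y: "?y \<in> carrier ?N" by (rule post_term(3)[OF v idx w(1) refl])
    have "wdeg ?o = wdeg w + ops_deg ?gs" by (rule wdeg_outs) (simp add: gp s)
    then have e: "snd (wdeg ?o) = snd (wdeg w) + (int (length qs) - int (sum_list ps) - int ?v)"
      by (simp add: gp s)
    have ev0: "even (int (sgn_dA ps qs) + ksign ?gs w + theta w + theta ?o + theta_sum qs w)"
      by (rule sign_post[OF l s])
    \<comment> \<open>Apart from the exponent treated by \<open>sign_post\<close>, the difference is
      an explicit double.\<close>
    have eq: "int (\<epsilon> + sgn_dA ps qs) + ksign ?gs w - (int \<epsilon> + susp_sign k u w + theta_sum qs w + susp_sign k i ?o) =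
      (int (sgn_dA ps qs) + ksign ?gs w + theta w + theta ?o + theta_sum qs w) - 2 * (theta w + theta ?o + theta_sum qs w +
        (k - 1) * (int i + snd (wdeg w) + int (length qs)))"
      unfolding susp_sign_def e length_outs gp u by (simp add: algebra_simps)
    have sign: "even (int (\<epsilon> + sgn_dA ps qs) + ksign ?gs w - (int \<epsilon> + susp_sign k u w + theta_sum qs w + susp_sign k i ?o))"
      unfolding eq by (rule dvd_diff[OF ev0 dvd_triv_left])
    have "chain_eval ?N (chain_sign (int (\<epsilon> + sgn_dA ps qs)) (frag_of (?T x (wdeg w) (pure_tensor R A w)))) =
       chain_eval ?N (chain_sign (int (\<epsilon> + sgn_dA ps qs) + ksign ?gs w) (frag_of ?y))"
      unfolding x' using post_term(2)[OF v idx w(1) refl] by (simp add: chain_eval_chain_sign_signed[OF C.A_group y])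
    also have "\<dots> = chain_eval ?N (chain_sign (int \<epsilon> + susp_sign k u w + theta_sum qs w + susp_sign k i ?o) (frag_of ?y))"
      by (simp only: chain_sign_cong[OF sign])
    also have "\<dots> = chain_eval ?N (chain_sign (int \<epsilon> + susp_sign k u w + theta_sum qs w) (?\<Phi> i ?o))"
      unfolding suspension_def post_term(4)[OF v idx w(1) refl] snd_conv by (simp add: chain_eval_chain_sign_signed[OF C.A_group y])
    also have "\<dots> = chain_eval ?N (chain_sign (int \<epsilon> + susp_sign k u w) (chain_sign (theta_sum qs w) (?\<Phi> i ?o)))"
      by (simp add: chain_sign_chain_sign)
    also have "\<dots> = chain_eval ?N (chain_sign (int \<epsilon> + susp_sign k u w) (?\<Phi> i (gouts (suspension R A B 1 g) ps qs w)))"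
      by (intro N.chain_eval_chain_sign_cong AB.multilin_gouts[OF C.A_group g l s q w(1) ml, symmetric])
         (simp add: u diag_add algebra_simps)
    finally show "chain_eval ?N (chain_sign ((\<lambda>(i, ps, qs). int (\<epsilon> + sgn_dA ps qs)) x) (frag_of (?T x (wdeg w) (pure_tensor R A w)))) =
        chain_eval ?N (chain_sign (int \<epsilon> + susp_sign k u w) ((\<lambda>(i, ps, qs). ?\<Phi> i (gouts (suspension R A B 1 g) ps qs w)) x))"
      by (simp add: x')
  qed
  finally show ?thesis by (simp add: chain_eval_chain_sign[OF C.A_group])
qed

end

end

section \<open>The derived precomposite as a coderivation\<close>

abbreviation (input) id_op :: "('r, 's) ring_scheme \<Rightarrow> ('r, 'a) bgmod \<Rightarrow> (('a, 'r) tens, 'a) gmap op" where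
  "id_op R A \<equiv> (Suc 0, (0, 0), tensor1_id R A)"

definition insert_ops :: "('r, 's) ring_scheme \<Rightarrow> ('r, 'a) bgmod \<Rightarrow> (nat \<times> nat \<Rightarrow> (('a, 'r) tens, 'a) gmap) \<Rightarrow>
    nat \<Rightarrow> nat \<Rightarrow> nat \<Rightarrow> nat \<Rightarrow> (('a, 'r) tens, 'a) gmap op list" where
  "insert_ops R A m r p q t = replicate r (id_op R A) @ [(q, (- int p, 2 - int p - int q), m (p, q))] @ replicate t (id_op R A)"

lemma dA_precomp_eq: "dA_precomp R A B k f m u v =
     gsum (tensor_power R A v) B (- int u, k + 1 - int u - int v) (pre_index u v)
       (\<lambda>(i, p, j, q, r, t). int (r * q + t + p * j))
       (\<lambda>(i, p, j, q, r, t). gcomp (tensor_power R A v) (- int p, 2 - int p - int q) (f (i, j))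
          (gtensors R A A (insert_ops R A m r p q t)))"
  unfolding dA_precomp_def pre_index_def insert_ops_def One_nat_def ..

lemma replicate_props [simp]:
  "ops_arity (replicate r (Suc 0, (0, 0), f)) = r" "ops_deg (replicate r (Suc 0, (0, 0), f)) = 0"
  by (induction r) (simp_all add: zero_prod_def)

lemma bdot_add: "bdot e (a + b) = bdot e a + bdot e b"
  by (simp add: bdot_def algebra_simps)

lemma bdot_0 [simp]: "bdot 0 a = 0" "bdot e 0 = 0"
  by (simp_all add: bdot_def)

text \<open>Identity operations have degree 0, so the letters in front are passed only by the
  operations \<open>fs\<close>.\<close>

lemma ksign_replicate:
  "r \<le> length w \<Longrightarrow> ksign (replicate r (Suc 0, (0, 0), f) @ fs) w =
    bdot (ops_deg fs) (wdeg (take r w)) + ksign fs (drop r w)"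
proof (induction r arbitrary: w)
  case (Suc r)
  then obtain x v where w: "w = x # v" "r \<le> length v" by (cases w) auto
  show ?case using Suc.IH[OF w(2)] by (simp add: w bdot_add)
qed simp

lemma (in bigraded) outs_replicate:
  "r \<le> length w \<Longrightarrow> hword A w \<Longrightarrow>
    outs R A (replicate r (id_op R A) @ fs) w = take r w @ outs R A fs (drop r w)"
proof (induction r arbitrary: w)
  case (Suc r)
  then obtain x v where w: "w = x # v" "r \<le> length v" by (cases w) auto
  have "hword A v" "snd x \<in> carrier (A (fst x))" using Suc.prems w by auto
  then show ?case
    using Suc.IH[OF w(2)] tensor1_id_pure[of x] by (simp add: w flip: zero_prod_def)
qed simp

context bigraded_pair'
begin

sublocale AA: bigraded_pair' R A A ..

context
  fixes m f k
  assumes m: "derived_family R A A 2 m" and f: "derived_family R A B k f"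
begin

lemma insert_ops_props:
  assumes q: "1 \<le> q"
  shows "ops_ok R A A (insert_ops R A m r p q t)" "ops_arity (insert_ops R A m r p q t) = r + q + t"
    "ops_deg (insert_ops R A m r p q t) = (- int p, 2 - int p - int q)" "length (insert_ops R A m r p q t) = 1 + r + t"
proof -
  have r: "ops_ok R A A (replicate r (id_op R A))" for r
    unfolding ops_ok_def using A.tensor1_id_gmaps by auto
  show "ops_ok R A A (insert_ops R A m r p q t)"
    using m q r by (simp add: insert_ops_def derived_family_def)
qed (simp_all add: insert_ops_def)

lemma insert_ops_outs:
  assumes "hword A a" "hword A b" "hword A c" "length a = r" "length b = q" "length c = t" "1 \<le> q"
  shows "outs R A (insert_ops R A m r p q t) (a @ b @ c) = a @ (outdeg 2 p b, word_value R A m p b) # c"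
    and "ksign (insert_ops R A m r p q t) (a @ b @ c) = bdot (- int p, 2 - int p - int q) (wdeg a)"
proof -
  have c: "outs R A (replicate t (id_op R A)) c = c" "ksign (replicate t (id_op R A)) c = 0"
    using A.outs_replicate[of t c "[]"] ksign_replicate[of t c "tensor1_id R A" "[]"] assms by simp_all
  show "outs R A (insert_ops R A m r p q t) (a @ b @ c) = a @ (outdeg 2 p b, word_value R A m p b) # c"
    unfolding insert_ops_def using assms c by (simp add: A.outs_replicate outdeg_eq word_value_def)
  show "ksign (insert_ops R A m r p q t) (a @ b @ c) = bdot (- int p, 2 - int p - int q) (wdeg a)"
    unfolding insert_ops_def using assms c by (simp add: ksign_replicate)
qed

lemma pre_term:
  assumes idx: "(i, p, j, q, r, t) \<in> pre_index u v"
  shows "gcomp (tensor_power R A v) (- int p, 2 - int p - int q) (f (i, j)) (gtensors R A A (insert_ops R A m r p q t))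
      \<in> gmaps R (tensor_power R A v) B (- int u, k + 1 - int u - int v)" (is ?G)
    and "hword A a \<Longrightarrow> hword A b \<Longrightarrow> hword A c \<Longrightarrow> length a = r \<Longrightarrow> length b = q \<Longrightarrow> length c = t \<Longrightarrow>
      gcomp (tensor_power R A v) (- int p, 2 - int p - int q) (f (i, j)) (gtensors R A A (insert_ops R A m r p q t))
        (wdeg (a @ b @ c)) (pure_tensor R A (a @ b @ c)) =
      signed (B (outdeg (k + 1) u (a @ b @ c))) (bdot (- int p, 2 - int p - int q) (wdeg a))
        (word_value R A f i (a @ (outdeg 2 p b, word_value R A m p b) # c))"
    and "hword A a \<Longrightarrow> hword A b \<Longrightarrow> hword A c \<Longrightarrow> length a = r \<Longrightarrow> length b = q \<Longrightarrow> length c = t \<Longrightarrow>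
      word_value R A f i (a @ (outdeg 2 p b, word_value R A m p b) # c) \<in> carrier (B (outdeg (k + 1) u (a @ b @ c)))"
    and "length a = r \<Longrightarrow> length b = q \<Longrightarrow> length c = t \<Longrightarrow>
      outdeg k i (a @ (outdeg 2 p b, y) # c) = outdeg (k + 1) u (a @ b @ c)"
proof -
  have u: "u = i + p" and v: "v = r + q + t" and j: "j = 1 + r + t" and q: "1 \<le> q"
    using idx by (auto simp: pre_index_def)
  note pp = insert_ops_props[OF q, of r p t]
  let ?gs = "insert_ops R A m r p q t"
  have gt: "gtensors R A A ?gs \<in> gmaps R (tensor_power R A v) (tensor_power R A j) (- int p, 2 - int p - int q)"
    using AA.gtensors_gmaps[OF pp(1)] unfolding pp v j .
  have fg: "f (i, j) \<in> gmaps R (tensor_power R A j) B (- int i, k - int i - int j)"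
  proof -
    have "1 \<le> j" using j by simp
    then show ?thesis using f unfolding derived_family_def by blast
  qed
  show ?G
    by (rule gcomp_gmaps[OF A.tensor_module fg gt]) (use v j q in \<open>simp add: u\<close>)
  show od: "outdeg k i (a @ (outdeg 2 p b, y) # c) = outdeg (k + 1) u (a @ b @ c)"
    if "length a = r" "length b = q" "length c = t" for y
    using that by (simp add: outdeg_eq u prod_eq_iff)
  assume g: "hword A a" "hword A b" "hword A c" and l: "length a = r" "length b = q" "length c = t"
  let ?w = "a @ b @ c" and ?o = "a @ (outdeg 2 p b, word_value R A m p b) # c"
  have w: "hword A ?w" "length ?w = ops_arity ?gs" using g l pp by simp_all
  note po = insert_ops_outs[OF g l q, of p]
  note op = AA.outs_props[OF pp(1) w, unfolded po pp]
  show "word_value R A f i ?o \<in> carrier (B (outdeg (k + 1) u ?w))"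
    using word_value_closed[OF f op(1), of i] od[OF l] by simp
  have cl: "pure_tensor R A ?o \<in> carrier (tensor_power R A j (wdeg ?w + (- int p, 2 - int p - int q)))"
    using A.pure_closed'[OF op(1)] unfolding op j .
  have pw: "pure_tensor R A ?w \<in> carrier (tensor_power R A v (wdeg ?w))"
    using A.pure_closed'[OF w(1)] l v by (simp add: add.assoc)
  have dd: "wdeg ?w + (- int p, 2 - int p - int q) + (- int i, k - int i - int j) = outdeg (k + 1) u ?w"
    unfolding outdeg_eq using l by (simp add: u j prod_eq_iff)
  have "gcomp (tensor_power R A v) (- int p, 2 - int p - int q) (f (i, j)) (gtensors R A A ?gs) (wdeg ?w) (pure_tensor R A ?w)
    = f (i, j) (wdeg ?w + (- int p, 2 - int p - int q))
       (signed (tensor_power R A j (wdeg ?w + (- int p, 2 - int p - int q))) (bdot (- int p, 2 - int p - int q) (wdeg a)) (pure_tensor R A ?o))"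
    unfolding gcomp_apply[where A = "tensor_power R A v", OF pw] AA.gtensors_pure[OF pp(1) w] po pp j ..
  also have "\<dots> = signed (B (outdeg (k + 1) u ?w)) (bdot (- int p, 2 - int p - int q) (wdeg a))
      (f (i, j) (wdeg ?w + (- int p, 2 - int p - int q)) (pure_tensor R A ?o))"
    using gmaps_signed[OF fg A.tensor_group B.A_group cl] unfolding dd by simp
  also have "f (i, j) (wdeg ?w + (- int p, 2 - int p - int q)) (pure_tensor R A ?o) = word_value R A f i ?o"
    unfolding word_value_def[of R A f i] op j ..
  finally show "gcomp (tensor_power R A v) (- int p, 2 - int p - int q) (f (i, j)) (gtensors R A A ?gs)
        (wdeg ?w) (pure_tensor R A ?w) =
      signed (B (outdeg (k + 1) u ?w)) (bdot (- int p, 2 - int p - int q) (wdeg a)) (word_value R A f i ?o)" .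
qed

lemma dA_precomp_gmaps:
  "dA_precomp R A B k f m u v \<in> gmaps R (tensor_power R A v) B (- int u, k + 1 - int u - int v)"
  unfolding dA_precomp_eq
  by (rule gsum_gmaps[OF A.tensor_module B.A_module]) (auto intro: pre_term(1))

text \<open>The counterpart for insertions, with signs absorbed by \<open>sign_pre\<close>. For k =
  1 the exponent in front differs from \<open>susp_sign 2 u w\<close> by u; this is the origin of
  the factor (-1)^u on the right of the morphism equation.\<close>

lemma dA_precomp_pure:
  assumes w: "hword A w"
  shows "dA_precomp R A B k f m u (length w) (wdeg w) (pure_tensor R A w) =
    signed (B (outdeg (k + 1) u w)) (theta w + snd (wdeg w) + int (length w) +
        (k - 1) * (int u + int (length w) + snd (wdeg w) + 1))
      (chain_eval (B (outdeg (k + 1) u w)) (coderiv shifted_deg (suspension R A A 2 m) (\<lambda>i c. frag_of (snd (suspension R A B k f i c))) u w))"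
proof -
  let ?v = "length w" and ?N = "B (outdeg (k + 1) u w)"
  let ?\<Phi> = "\<lambda>i c. frag_of (snd (suspension R A B k f i c))"
  let ?E = "theta w + snd (wdeg w) + int (length w) + (k - 1) * (int u + int (length w) + snd (wdeg w) + 1)"
  interpret N: abelian_group ?N by (rule B.A_group)
  have od: "wdeg w + (- int u, k + 1 - int u - int ?v) = outdeg (k + 1) u w" by (simp add: outdeg_eq)
  have D: "sdeg w - diag u + (0, 1) + (0, k) = outdeg (k + 1) u w" by (simp add: outdeg_def prod_eq_iff)
  have ml: "chain_additive ?N A (sdeg w - diag u + (0, 1)) ?\<Phi>"
    using suspension_chain_additive[OF f, of "sdeg w - diag u + (0, 1)"] unfolding D .
  let ?T = "\<lambda>(i, p, j, q, r, t). gcomp (tensor_power R A ?v) (- int p, 2 - int p - int q) (f (i, j))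
          (gtensors R A A (insert_ops R A m r p q t))"
  let ?s = "\<lambda>(i, p, j, q, r, t). int (r * q + t + p * j)"
  have "dA_precomp R A B k f m u ?v (wdeg w) (pure_tensor R A w) =
    chain_eval ?N (\<Sum>x\<in>pre_index u ?v. chain_sign (?s x) (frag_of (?T x (wdeg w) (pure_tensor R A w))))"
    unfolding dA_precomp_eq od[symmetric]
  proof (rule gsum_chain_eval[OF B.A_group])
    fix x assume "x \<in> pre_index u ?v"
    then show "?T x (wdeg w) (pure_tensor R A w) \<in> carrier (B (wdeg w + (- int u, k + 1 - int u - int ?v)))"
      using gmaps_closed[OF pre_term(1) A.pure_closed'[OF w(1)]] by (cases x) auto
  qed (rule A.pure_closed'[OF w(1)])
  also have "\<dots> = chain_eval ?N (chain_sign ?E (coderiv shifted_deg (suspension R A A 2 m) ?\<Phi> u w))"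
    unfolding coderiv_eq_sum sum_pre_index chain_sign_sum
  proof (intro N.chain_eval_sum_cong)
    fix r l p assume r: "r \<in> {..<?v}" and l: "l \<in> {..<?v - r}" and p: "p \<in> {..u}"
    \<comment> \<open>The inserted map passes \<open>a\<close>, consumes \<open>b\<close> and leaves
      \<open>c\<close> behind it.\<close>
    define a b c where "a = take r w" and "b = take (Suc l) (drop r w)" and "c = drop (r + Suc l) w"
    let ?q = "Suc l" and ?t = "?v - r - Suc l" and ?i = "u - p" and ?j = "?v - r - l + r"
    have w': "w = a @ b @ c"
      unfolding a_def b_def c_def by (metis append_take_drop_id drop_drop add.commute)
    have g: "hword A a" "hword A b" "hword A c" using w unfolding w' by simp_all
    have len: "length a = r" "length b = ?q" "length c = ?t"
      using r l by (auto simp: a_def b_def c_def)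
    let ?x = "(?i, p, ?v - l, ?q, r, ?t)"
    have idx: "?x \<in> pre_index u ?v" using r l p by (auto simp: pre_index_def)
    have j: "?v - l = 1 + r + ?t" using r l by auto
    let ?e = "bdot (- int p, 2 - int p - int ?q) (wdeg a)"
    let ?o = "a @ (outdeg 2 p b, word_value R A m p b) # c"
    let ?y = "word_value R A f ?i ?o"
    have y: "?y \<in> carrier ?N" using pre_term(3)[OF idx g len] unfolding w'[symmetric] .
    have b: "b \<noteq> []" using len by auto
    have ob: "outdeg 2 p b = wdeg b + (- int p, 2 - int p - int ?q)" by (simp add: outdeg_eq len)
    have up: "int (?i + p) = int u" using p by simp
    have "even (?s ?x + ?e + (?E + psum shifted_deg a + susp_sign 2 p b + susp_sign k ?i ?o))"
      using sign_pre[OF len refl refl j, of p k ?i "word_value R A m p b"]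
      unfolding ob w'[symmetric] up by (simp only: prod.case add.assoc)
    then have sign: "even (?s ?x + ?e - (?E + psum shifted_deg a + susp_sign 2 p b + susp_sign k ?i ?o))"
      by (simp only: even_diff)
    have "chain_eval ?N (chain_sign (?s ?x) (frag_of (?T ?x (wdeg w) (pure_tensor R A w)))) = chain_eval ?N (chain_sign (?s ?x + ?e) (frag_of ?y))"
      using pre_term(2)[OF idx g len] unfolding w'[symmetric] by (simp add: chain_eval_chain_sign_signed[OF B.A_group y])
    also have "\<dots> = chain_eval ?N (chain_sign (?E + psum shifted_deg a + susp_sign 2 p b + susp_sign k ?i ?o) (frag_of ?y))"
      by (simp only: chain_sign_cong[OF sign])
    also have "\<dots> = chain_eval ?N (chain_sign (?E + psum shifted_deg a + susp_sign 2 p b) (?\<Phi> ?i ?o))"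
      using pre_term(4)[OF idx len, of "word_value R A m p b"] unfolding w'[symmetric] suspension_def
      by (simp add: chain_eval_chain_sign_signed[OF B.A_group y])
    also have "\<dots> = chain_eval ?N (chain_sign (?E + psum shifted_deg a) (chain_sign (susp_sign 2 p b) (?\<Phi> ?i ?o)))"
      by (simp add: chain_sign_chain_sign)
    also have "\<dots> = chain_eval ?N (chain_sign (?E + psum shifted_deg a) (?\<Phi> ?i (a @ suspension R A A 2 m p b # c)))"
    proof (rule N.chain_eval_chain_sign_cong)
      have "sdeg ?o - diag ?i = sdeg w - diag u + (0, 1)"
        using p by (simp add: w' outdeg_def diag_def prod_eq_iff)
      from chain_additive_signed[OF B.A_group A.A_group ml AA.word_value_closed[OF m g(2) b] g(1,3) this, of "susp_sign 2 p b"]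
      show "chain_eval ?N (chain_sign (susp_sign 2 p b) (?\<Phi> ?i ?o)) = chain_eval ?N (?\<Phi> ?i (a @ suspension R A A 2 m p b # c))"
        by (simp add: suspension_def[of R A A 2 m])
    qed
    finally show "chain_eval ?N (chain_sign (?s ?x) (frag_of (?T ?x (wdeg w) (pure_tensor R A w)))) =
      chain_eval ?N (chain_sign ?E (chain_sign (psum shifted_deg (take r w)) (?\<Phi> ?i (take r w @ suspension R A A 2 m p (take ?q (drop r w)) # drop (r + ?q) w))))"
      by (simp add: chain_sign_chain_sign a_def b_def c_def)
  qed
  finally show ?thesis by (simp add: chain_eval_chain_sign[OF B.A_group])
qed

end

end

section \<open>The category of derived A-infinity algebras\<close>

text \<open>The suspended identity morphism; see \<open>suspension_dident\<close>.\<close>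

definition word_id :: "('r, 'a) bgmod \<Rightarrow> nat \<Rightarrow> (bideg \<times> 'a) list \<Rightarrow> bideg \<times> 'a" where
  "word_id A p w = (outdeg 1 p w, if p = 0 \<and> length w = 1 then snd (hd w) else \<zero>\<^bsub>A (outdeg 1 p w)\<^esub>)"

lemma word_id_single [simp]: "word_id A 0 [x] = x"
  by (simp add: word_id_def outdeg_def prod_eq_iff)

lemma word_id_other: "p \<noteq> 0 \<or> length w \<noteq> 1 \<Longrightarrow> word_id A p w = (outdeg 1 p w, \<zero>\<^bsub>A (outdeg 1 p w)\<^esub>)"
  by (auto simp: word_id_def)

lemma word_family_word_id:
  assumes "\<And>d. abelian_group (A d)"
  shows "word_family A A 1 (word_id A)"
  unfolding word_family_def
proof (intro allI impI conjI)
  fix p w assume w: "hword A w" "w \<noteq> []"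
  show "fst (word_id A p w) = outdeg 1 p w" by (simp add: word_id_def)
  show "snd (word_id A p w) \<in> carrier (A (outdeg 1 p w))"
  proof (cases "p = 0 \<and> length w = 1")
    case True
    then obtain x where "w = [x]" by (cases w) auto
    with True w show ?thesis by (simp add: outdeg_def prod_eq_iff word_id_def)
  next
    case False
    then show ?thesis using abelian_groupE(2)[OF assms] by (auto simp: word_id_other)
  qed
qed

lemma chain_additive_zero:
  assumes N: "abelian_group N" and A: "\<And>d. abelian_group (A d)" and \<Phi>: "chain_additive N A D \<Phi>"
    and "hword A c" "d - (0, 1) + sdeg c - diag i = D"
  shows "chain_eval N (\<Phi> i ((d, \<zero>\<^bsub>A d\<^esub>) # c)) = chain_eval N 0"
proof -
  interpret N: abelian_group N by (rule N)
  interpret A: abelian_group "A d" by (rule A)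
  have "chain_eval N (\<Phi> i ([] @ (d, \<zero>\<^bsub>A d\<^esub> \<oplus>\<^bsub>A d\<^esub> \<zero>\<^bsub>A d\<^esub>) # c)) =
      chain_eval N (\<Phi> i ([] @ (d, \<zero>\<^bsub>A d\<^esub>) # c) + \<Phi> i ([] @ (d, \<zero>\<^bsub>A d\<^esub>) # c))"
    by (rule chain_additiveD[OF \<Phi>]) (use assms in auto)
  then show ?thesis by (simp add: N.chain_eval_add N.add.l_cancel_one')
qed

lemma (in abelian_group) chain_eval_sum_single:
  assumes "finite I" "j \<in> I" "\<And>i. i \<in> I \<Longrightarrow> i \<noteq> j \<Longrightarrow> chain_eval G (f i) = \<zero>"
  shows "chain_eval G (\<Sum>i\<in>I. f i) = chain_eval G (f j)"
proof -
  have "chain_eval G (\<Sum>i\<in>I. f i) = chain_eval G (\<Sum>i\<in>I. if i = j then f i else 0)"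
    by (rule chain_eval_sum_cong) (use assms in auto)
  then show ?thesis using assms by simp
qed

lemma (in abelian_group) chain_eval_sum2_single:
  assumes "finite I" "finite J" "k \<in> I" "l \<in> J"
    "\<And>i j. i \<in> I \<Longrightarrow> j \<in> J \<Longrightarrow> i \<noteq> k \<or> j \<noteq> l \<Longrightarrow> chain_eval G (f i j) = \<zero>"
  shows "chain_eval G (\<Sum>i\<in>I. \<Sum>j\<in>J. f i j) = chain_eval G (f k l)"
proof -
  have "chain_eval G (\<Sum>j\<in>J. f i j) = \<zero>" if "i \<in> I" "i \<noteq> k" for i
  proof -
    have "chain_eval G (\<Sum>j\<in>J. f i j) = chain_eval G (\<Sum>j\<in>J. 0)" by (rule chain_eval_sum_cong) (use assms that in auto)
    then show ?thesis by simp
  qed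
  then have "chain_eval G (\<Sum>i\<in>I. \<Sum>j\<in>J. f i j) = chain_eval G (\<Sum>j\<in>J. f k j)"
    using assms by (intro chain_eval_sum_single) auto
  also have "\<dots> = chain_eval G (f k l)" by (rule chain_eval_sum_single) (use assms in auto)
  finally show ?thesis .
qed

lemma outdeg_Cons:
  assumes "fst y = outdeg k p a"
  shows "sdeg (y # b) = sdeg a - diag p + (0, k) - (0, 1) + sdeg b"
  using assms by (simp add: outdeg_def prod_eq_iff)

text \<open>A block with more than one letter or with positive index yields a zero letter, and
  additivity kills its term. Only the cut into single letters of index 0 survives.\<close>

lemma extend_word_id_left:
  assumes N: "abelian_group N" and A: "\<And>d. abelian_group (A d)" and w: "hword A w"
    and \<Phi>: "chain_additive N A (sdeg w - diag u) \<Phi>"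
  shows "chain_eval N (extend (word_id A) \<Phi> u w) = chain_eval N (\<Phi> u w)"
  using w \<Phi>
proof (induction w arbitrary: \<Phi>)
  case Nil show ?case by simp
next
  case (Cons x v)
  interpret N: abelian_group N by (rule N)
  have x: "snd x \<in> carrier (A (fst x))" and v: "hword A v" using Cons.prems by auto
  let ?T = "\<lambda>k p. extend (word_id A) (\<lambda>i c. \<Phi> i (word_id A p (x # take k v) # c)) (u - p) (drop k v)"
  have "chain_eval N (extend (word_id A) \<Phi> u (x # v)) = chain_eval N (?T 0 0)"
    unfolding extend.simps
  proof (rule N.chain_eval_sum2_single)
    fix k p assume kp: "k \<in> {..length v}" "p \<in> {..u}" "k \<noteq> 0 \<or> p \<noteq> 0"
    let ?a = "x # take k v" and ?b = "drop k v"
    have id: "word_id A p ?a = (outdeg 1 p ?a, \<zero>\<^bsub>A (outdeg 1 p ?a)\<^esub>)"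
      using kp by (intro word_id_other) auto
    have "chain_eval N (?T k p) = chain_eval N (extend (word_id A) (\<lambda>i c. 0) (u - p) ?b)"
      unfolding id
    proof (rule extend_cong_chain_eval[OF N word_family_word_id[OF A] hword_take_drop(2)[OF v]])
      fix i c assume c: "hword A c" "sdeg c - diag i = sdeg ?b - diag (u - p)"
      have s: "sdeg v = sdeg (take k v) + sdeg ?b"
        by (metis append_take_drop_id sdeg_simps(3))
      have "sdeg ?a - diag p + sdeg c - diag i = sdeg ?a - diag p + (sdeg ?b - diag (u - p))"
        unfolding c(2)[symmetric] by (simp add: algebra_simps)
      also have "\<dots> = sdeg (x # v) - diag u"
        using kp by (simp add: s diag_def prod_eq_iff)
      finally have "outdeg 1 p ?a - (0, 1) + sdeg c - diag i = sdeg (x # v) - diag u"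
        by (simp add: outdeg_def prod_eq_iff)
      then show "chain_eval N (\<Phi> i ((outdeg 1 p ?a, \<zero>\<^bsub>A (outdeg 1 p ?a)\<^esub>) # c)) = chain_eval N 0"
        by (rule chain_additive_zero[OF N A Cons.prems(2) c(1)])
    qed
    then show "chain_eval N (?T k p) = \<zero>\<^bsub>N\<^esub>" by simp
  qed auto
  also have "\<dots> = chain_eval N (\<Phi> u (x # v))"
    using Cons.IH[OF v] chain_additive_Cons[OF Cons.prems(2) x] by (simp add: algebra_simps)
  finally show ?case .
qed

text \<open>The identity vanishes on words of length at least 2, so only the cut into a single
  block, carrying the whole index, survives.\<close>

lemma extend_word_id_right:
  assumes B: "\<And>d. abelian_group (B d)" and g: "word_family A B 1 g" and w: "hword A w" "w \<noteq> []"
  shows "chain_eval (B (outdeg 1 u w)) (extend g (\<lambda>i c. frag_of (snd (word_id B i c))) u w) = snd (g u w)"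
proof -
  obtain x v where xv: "w = x # v" using w(2) by (cases w) auto
  let ?N = "B (outdeg 1 u w)"
  interpret N: abelian_group ?N by (rule B)
  have v: "hword A v" using w xv by simp
  let ?T = "\<lambda>k p. extend g (\<lambda>i c. frag_of (snd (word_id B i (g p (x # take k v) # c)))) (u - p) (drop k v)"
  have "chain_eval ?N (extend g (\<lambda>i c. frag_of (snd (word_id B i c))) u w) = chain_eval ?N (?T (length v) u)"
    unfolding xv extend.simps
  proof (rule abelian_group.chain_eval_sum2_single[OF B])
    fix k p assume kp: "k \<in> {..length v}" "p \<in> {..u}" "k \<noteq> length v \<or> p \<noteq> u"
    let ?a = "x # take k v" and ?b = "drop k v"
    have a: "hword A ?a" using w v by (simp add: xv hword_take_drop)
    have fa: "fst (g p ?a) = outdeg 1 p ?a" using g a by (simp add: word_family_def)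
    have s: "sdeg v = sdeg (take k v) + sdeg ?b"
      by (metis append_take_drop_id sdeg_simps(3))
    have "chain_eval ?N (?T k p) = chain_eval ?N (extend g (\<lambda>i c. 0) (u - p) ?b)"
    proof (rule extend_cong_chain_eval[OF B g hword_take_drop(2)[OF v]])
      fix i c assume c: "hword B c" "sdeg c - diag i = sdeg ?b - diag (u - p)" "c = [] \<longleftrightarrow> ?b = []"
      show "chain_eval ?N (frag_of (snd (word_id B i (g p ?a # c)))) = chain_eval ?N 0"
      proof (cases "i \<noteq> 0 \<or> c \<noteq> []")
        case True
        have "sdeg (g p ?a # c) - diag i = sdeg w - diag u"
          unfolding outdeg_Cons[OF fa] using c(2) kp by (auto simp: xv s diag_def prod_eq_iff)
        then have "outdeg 1 i (g p ?a # c) = outdeg 1 u w"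
          unfolding outdeg_def by (auto simp: prod_eq_iff)
        then show ?thesis using True by (subst word_id_other) auto
      next
        case False
        \<comment> \<open>With c empty and i = 0, conservation of degree forces the first block to
          use the whole index, which contradicts p \<noteq> u.\<close>
        then have "k = length v" "p \<noteq> u" using c kp by auto
        then have "diag (u - p) = 0" using c False by (auto simp: prod_eq_iff)
        then show ?thesis using \<open>p \<noteq> u\<close> kp by (auto simp: diag_def prod_eq_iff)
      qed
    qed
    then show "chain_eval (B (outdeg 1 u (x # v))) (?T k p) = \<zero>\<^bsub>B (outdeg 1 u (x # v))\<^esub>"
      using N.chain_eval_0 unfolding xv by simp
  qed auto
  also have "\<dots> = snd (g u w)"
    using g w unfolding word_family_def by (simp add: xv abelian_group.chain_eval_frag_of[OF B])
  finally show ?thesis .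
qed

text \<open>After an insertion the word has a single letter only if the map has consumed all of
  \<open>w\<close>, and its index must then be u; the identity annihilates all other terms.\<close>

lemma coderiv_word_id:
  assumes A: "\<And>d. abelian_group (A d)" and m: "word_family A A 2 m" and w: "hword A w" "w \<noteq> []"
  shows "chain_eval (A (outdeg 2 u w)) (coderiv \<pi> m (\<lambda>i c. frag_of (snd (word_id A i c))) u w) = snd (m u w)"
proof -
  obtain x v where xv: "w = x # v" using w(2) by (cases w) auto
  let ?N = "A (outdeg 2 u w)"
  interpret N: abelian_group ?N by (rule A)
  have v: "hword A v" using w xv by simp
  let ?T = "\<lambda>k p. frag_of (snd (word_id A (u - p) (m p (x # take k v) # drop k v)))"
  have "chain_eval ?N (\<Sum>k\<le>length v. \<Sum>p\<le>u. ?T k p) = chain_eval ?N (?T (length v) u)"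
  proof (rule N.chain_eval_sum2_single)
    fix k p assume kp: "k \<in> {..length v}" "p \<in> {..u}" "k \<noteq> length v \<or> p \<noteq> u"
    let ?a = "x # take k v" and ?b = "drop k v"
    have a: "hword A ?a" using w v by (simp add: xv hword_take_drop)
    have fa: "fst (m p ?a) = outdeg 2 p ?a" using m a by (simp add: word_family_def)
    have s: "sdeg v = sdeg (take k v) + sdeg ?b"
      by (metis append_take_drop_id sdeg_simps(3))
    have "outdeg 1 (u - p) (m p ?a # ?b) = outdeg 2 u w"
      unfolding outdeg_def outdeg_Cons[OF fa] using kp by (auto simp: xv s diag_def prod_eq_iff)
    then show "chain_eval ?N (?T k p) = \<zero>\<^bsub>?N\<^esub>"
      using kp by (subst word_id_other) auto
  qed auto
  \<comment> \<open>In these terms \<open>x\<close> stays in place and c is nonempty, so the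
    identity meets a word with at least two letters.\<close>
  moreover have "chain_eval ?N (coderiv \<pi> m (\<lambda>i c. frag_of (snd (word_id A i (x # c)))) u v) = chain_eval ?N (coderiv \<pi> m (\<lambda>i c. 0) u v)"
  proof (cases "v = []")
    case False
    show ?thesis
    proof (rule coderiv_cong_chain_eval[OF A m v])
      fix i c assume c: "hword A c" "sdeg c - diag i = sdeg v - diag u + (0, 1)" "c = [] \<longleftrightarrow> v = []"
      have "outdeg 1 i (x # c) = outdeg 2 u w"
        unfolding outdeg_def using c(2) by (auto simp: xv diag_def prod_eq_iff)
      then show "chain_eval ?N (frag_of (snd (word_id A i (x # c)))) = chain_eval ?N 0"
        using c False by (subst word_id_other) auto
    qed
  qed simp
  moreover have "chain_eval ?N (?T (length v) u) = snd (m u w)"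
    using m w unfolding word_family_def by (simp add: xv abelian_group.chain_eval_frag_of[OF A])
  moreover have "snd (m u w) \<in> carrier ?N" using m w by (simp add: word_family_def)
  ultimately show ?thesis
    by (simp add: xv N.chain_eval_add[unfolded xv] N.chain_eval_0[unfolded xv] cuts_def sum_splits_def chain_eval_chain_sign[OF A] signed_zero[OF A] abelian_groupE(5)[OF A]
        abelian_monoid.r_zero[OF abelian_group.axioms(1)[OF A]])
qed

lemma extend_family_cong:
  assumes "\<And>p a. hword A a \<Longrightarrow> a \<noteq> [] \<Longrightarrow> g p a = g' p a" "hword A w"
  shows "extend g \<Phi> u w = extend g' \<Phi> u w"
  using assms(2)
proof (induction w arbitrary: \<Phi> u rule: length_induct_word)
  case (1 w)
  show ?case
  proof (cases w)
    case Nil then show ?thesis by simp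
  next
    case (Cons x v)
    then have v: "hword A v" "hword A [x]" using 1(2) by auto
    have "extend g (\<lambda>i c. \<Phi> i (g p (x # take k v) # c)) (u - p) (drop k v) =
        extend g' (\<lambda>i c. \<Phi> i (g' p (x # take k v) # c)) (u - p) (drop k v)" for k p
      using 1(1)[of "drop k v"] assms(1)[of "x # take k v" p] v Cons hword_take_drop[OF v(1), of k] by simp
    then show ?thesis by (simp add: Cons extend.simps(2))
  qed
qed

abbreviation (input) frag_family :: "(nat \<Rightarrow> 'x list \<Rightarrow> bideg \<times> 'a) \<Rightarrow> nat \<Rightarrow> 'x list \<Rightarrow> ('a \<Rightarrow>\<^sub>0 int)" where
  "frag_family g \<equiv> (\<lambda>i c. frag_of (snd (g i c)))"

lemma signed_inj: "abelian_group M \<Longrightarrow> x \<in> carrier M \<Longrightarrow> y \<in> carrier M \<Longrightarrow>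
    signed M n x = signed M n y \<longleftrightarrow> x = y"
  by (metis signed_def abelian_group.minus_minus)

lemma fst_suspension [simp]: "fst (suspension R A B k f p w) = outdeg k p w"
  by (simp add: suspension_def)

lemma derived_familyI: "f \<in> (\<Pi>\<^sub>E (i, j)\<in>UNIV \<times> {1..}. gmaps R (tensor_power R A j) B (- int i, k - int i - int j)) \<Longrightarrow> derived_family R A B k f"
  by (auto simp: derived_family_def dest: PiE_mem)

section \<open>The morphism equation on words\<close>

definition word_morphism :: "('r, 'a) bgmod \<Rightarrow> ('r, 'a) bgmod \<Rightarrow>
    (nat \<Rightarrow> (bideg \<times> 'a) list \<Rightarrow> bideg \<times> 'a) \<Rightarrow> (nat \<Rightarrow> (bideg \<times> 'a) list \<Rightarrow> bideg \<times> 'a) \<Rightarrow>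
    (nat \<Rightarrow> (bideg \<times> 'a) list \<Rightarrow> bideg \<times> 'a) \<Rightarrow> bool" where
  "word_morphism A B m n g \<longleftrightarrow> (\<forall>u w. hword A w \<longrightarrow> w \<noteq> [] \<longrightarrow>
     chain_eval (B (outdeg 2 u w)) (coderiv shifted_deg m (frag_family g) u w) = chain_eval (B (outdeg 2 u w)) (extend g (frag_family n) u w))"

context bigraded_pair'
begin

text \<open>Suspension loses no information on nonempty words, since its sign is invertible, and
  arity 0 lies outside the index set.\<close>

lemma suspension_ext:
  assumes f: "f \<in> (\<Pi>\<^sub>E (i, j)\<in>UNIV \<times> {1..}. gmaps R (tensor_power R A j) B (- int i, 1 - int i - int j))"
    and g: "g \<in> (\<Pi>\<^sub>E (i, j)\<in>UNIV \<times> {1..}. gmaps R (tensor_power R A j) B (- int i, 1 - int i - int j))"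
    and eq: "\<And>p w. hword A w \<Longrightarrow> w \<noteq> [] \<Longrightarrow> suspension R A B 1 f p w = suspension R A B 1 g p w"
  shows "f = g"
proof (rule PiE_ext[OF f g])
  fix x :: "nat \<times> nat" assume "x \<in> UNIV \<times> {1..}"
  then obtain i j where x: "x = (i, j)" "1 \<le> j" by auto
  show "f x = g x" unfolding x
  proof (rule A.gmaps_pure_ext[OF B.A_module])
    show "f (i, j) \<in> gmaps R (tensor_power R A j) B (- int i, 1 - int i - int j)"
      "g (i, j) \<in> gmaps R (tensor_power R A j) B (- int i, 1 - int i - int j)"
      using derived_familyI[OF f] derived_familyI[OF g] x by (auto simp: derived_family_def)
    fix w assume w: "hword A w" "length w = j"
    then have ne: "w \<noteq> []" using x by auto
    show "f (i, j) (wdeg w) (pure_tensor R A w) = g (i, j) (wdeg w) (pure_tensor R A w)"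
      using eq[OF w(1) ne, of i] word_value_closed[OF derived_familyI[OF f] w(1) ne, of i] word_value_closed[OF derived_familyI[OF g] w(1) ne, of i]
      by (simp add: suspension_def signed_inj[OF B.A_group]) (simp add: word_value_def w(2))
  qed
qed

text \<open>Both sides carry the same sign once the factor (-1)^u of the derived equation is
  included. This sign cancels and the sign-free equation of suspended families remains.\<close>

lemma morphism_iff:
  assumes m: "derived_family R A A 2 m" and n: "derived_family R B B 2 n" and f: "derived_family R A B 1 f"
  shows "(\<forall>u. \<forall>v\<ge>1. dA_precomp R A B 1 f m u v = dA_postcomp R A B B 2 u n f u v) \<longleftrightarrow>
    word_morphism A B (suspension R A A 2 m) (suspension R B B 2 n) (suspension R A B 1 f)"
proof -
  interpret ABB: bigraded_triple R A B B ..
  have *: "dA_precomp R A B 1 f m u (length w) (wdeg w) (pure_tensor R A w) =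
      dA_postcomp R A B B 2 u n f u (length w) (wdeg w) (pure_tensor R A w) \<longleftrightarrow>
    chain_eval (B (outdeg 2 u w)) (coderiv shifted_deg (suspension R A A 2 m) (frag_family (suspension R A B 1 f)) u w) =
    chain_eval (B (outdeg 2 u w)) (extend (suspension R A B 1 f) (frag_family (suspension R B B 2 n)) u w)"
    if w: "hword A w" "w \<noteq> []" for u w
  proof -
    let ?e = "theta w + snd (wdeg w) + int (length w)"
    \<comment> \<open>The two exponents differ by 2u.\<close>
    have "even (int u + susp_sign 2 u w - ?e)" by (simp add: susp_sign_def)
    then have "signed (B (outdeg 2 u w)) (int u + susp_sign 2 u w) z = signed (B (outdeg 2 u w)) ?e z" for z
      by (rule signed_cong)
    then show ?thesis
      unfolding ABB.dA_postcomp_pure[OF n f w] dA_precomp_pure[OF m f w(1)]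
      by (simp add: signed_inj[OF B.A_group] abelian_group.chain_eval_closed[OF B.A_group])
  qed
  show ?thesis
  proof
    assume "\<forall>u. \<forall>v\<ge>1. dA_precomp R A B 1 f m u v = dA_postcomp R A B B 2 u n f u v"
    then show "word_morphism A B (suspension R A A 2 m) (suspension R B B 2 n) (suspension R A B 1 f)"
      unfolding word_morphism_def using * by (simp add: Suc_le_eq)
  next
    assume h: "word_morphism A B (suspension R A A 2 m) (suspension R B B 2 n) (suspension R A B 1 f)"
    show "\<forall>u. \<forall>v\<ge>1. dA_precomp R A B 1 f m u v = dA_postcomp R A B B 2 u n f u v"
    proof (intro allI impI)
      fix u v :: nat assume v: "1 \<le> v"
      show "dA_precomp R A B 1 f m u v = dA_postcomp R A B B 2 u n f u v"
      proof (rule A.gmaps_pure_ext[OF B.A_module])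
        show "dA_precomp R A B 1 f m u v \<in> gmaps R (tensor_power R A v) B (- int u, 2 - int u - int v)"
          using dA_precomp_gmaps[OF m f, of u v] by simp
        show "dA_postcomp R A B B 2 u n f u v \<in> gmaps R (tensor_power R A v) B (- int u, 2 - int u - int v)"
          by (rule ABB.dA_postcomp_gmaps[OF n f v])
        fix w assume w: "hword A w" "length w = v"
        then have ne: "w \<noteq> []" using v by auto
        show "dA_precomp R A B 1 f m u v (wdeg w) (pure_tensor R A w) =
          dA_postcomp R A B B 2 u n f u v (wdeg w) (pure_tensor R A w)"
          using *[OF w(1) ne, of u] h w ne unfolding word_morphism_def by blast
      qed
    qed
  qed
qed

end

section \<open>Composition of derived morphisms\<close>

definition dcomp :: "('r, 's) ring_scheme \<Rightarrow> ('r, 'a) bgmod \<Rightarrow> ('r, 'a) bgmod \<Rightarrow> ('r, 'a) bgmod \<Rightarrow>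
    (nat \<times> nat \<Rightarrow> (('a, 'r) tens, 'a) gmap) \<Rightarrow> (nat \<times> nat \<Rightarrow> (('a, 'r) tens, 'a) gmap) \<Rightarrow>
    nat \<times> nat \<Rightarrow> (('a, 'r) tens, 'a) gmap" where
  "dcomp R A B C f g = (\<lambda>(u, k)\<in>UNIV \<times> {1..}. dA_postcomp R A B C 1 0 f g u k)"

context bigraded_triple
begin

sublocale AC: bigraded_pair' R A C ..

context
  fixes f g
  assumes f: "derived_family R B C 1 f" and g: "derived_family R A B 1 g"
begin

lemma dcomp_PiE:
  "dcomp R A B C f g \<in> (\<Pi>\<^sub>E (i, j)\<in>UNIV \<times> {1..}. gmaps R (tensor_power R A j) C (- int i, 1 - int i - int j))"
  unfolding dcomp_def using dA_postcomp_gmaps[OF f g] by (auto simp: PiE_def Pi_def extensional_def)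

lemma dcomp_derived_family: "derived_family R A C 1 (dcomp R A B C f g)"
  by (rule derived_familyI[OF dcomp_PiE])

text \<open>The sign in front in \<open>dA_postcomp_pure\<close> and the suspension sign of the
  composite are equal, so they cancel.\<close>

lemma suspension_dcomp:
  assumes w: "hword A w" "w \<noteq> []"
  shows "suspension R A C 1 (dcomp R A B C f g) p w = (outdeg 1 p w,
    chain_eval (C (outdeg 1 p w)) (extend (suspension R A B 1 g) (frag_family (suspension R B C 1 f)) p w))"
proof -
  have "word_value R A (dcomp R A B C f g) p w = dA_postcomp R A B C 1 0 f g p (length w) (wdeg w) (pure_tensor R A w)"
    using w by (simp add: word_value_def dcomp_def Suc_le_eq)
  then show ?thesis
    unfolding suspension_def dA_postcomp_pure[OF f g w]
    by (simp add: signed_signed[OF C.A_group] abelian_group.chain_eval_closed[OF C.A_group])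
       (simp add: signed_def)
qed

text \<open>The structure of A is moved past \<open>g\<close> by \<open>coderiv_extend\<close> and
  past \<open>f\<close> by its own morphism equation; \<open>extend_comp\<close> then merges the two
  extensions.\<close>

lemma word_morphism_dcomp:
  assumes mA: "derived_family R A A 2 mA" and mB: "derived_family R B B 2 mB" and mC: "derived_family R C C 2 mC"
    and mg: "word_morphism A B (suspension R A A 2 mA) (suspension R B B 2 mB) (suspension R A B 1 g)"
    and mf: "word_morphism B C (suspension R B B 2 mB) (suspension R C C 2 mC) (suspension R B C 1 f)"
  shows "word_morphism A C (suspension R A A 2 mA) (suspension R C C 2 mC) (suspension R A C 1 (dcomp R A B C f g))"
  unfolding word_morphism_def
proof (intro allI impI)
  fix u w assume w: "hword A w" "w \<noteq> []"
  let ?N = "C (outdeg 2 u w)"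
  interpret N: abelian_group ?N by (rule C.A_group)
  interpret BB: bigraded_pair R B B ..
  interpret CC: bigraded_pair R C C ..
  note fA = AB.AA.suspension_word_family[OF mA] and fB = BB.suspension_word_family[OF mB] and fC = CC.suspension_word_family[OF mC]
    and fg = AB.suspension_word_family[OF g] and ff = BC.suspension_word_family[OF f]
  have D: "sdeg w - diag u + (0, 1) + (0, 1) = outdeg 2 u w" "sdeg w - diag u + (0, 2) = outdeg 2 u w"
    by (simp_all add: outdeg_def prod_eq_iff)
  have mlf: "chain_additive ?N B (sdeg w - diag u + (0, 1)) (frag_family (suspension R B C 1 f))"
    using BC.suspension_chain_additive[OF f, of "sdeg w - diag u + (0, 1)"] unfolding D .
  have mlm: "chain_additive ?N C (sdeg w - diag u) (frag_family (suspension R C C 2 mC))"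
    using CC.suspension_chain_additive[OF mC, of "sdeg w - diag u"] unfolding D .
  have "chain_eval ?N (coderiv shifted_deg (suspension R A A 2 mA) (frag_family (suspension R A C 1 (dcomp R A B C f g))) u w) =
    chain_eval ?N (coderiv shifted_deg (suspension R A A 2 mA) (extend (suspension R A B 1 g) (frag_family (suspension R B C 1 f))) u w)"
  proof (rule coderiv_cong_chain_eval[OF C.A_group fA w(1)])
    fix i c assume c: "hword A c" "sdeg c - diag i = sdeg w - diag u + (0, 1)" "c = [] \<longleftrightarrow> w = []"
    have "outdeg 1 i c = outdeg 2 u w" using c(2) by (auto simp: outdeg_def prod_eq_iff)
    then show "chain_eval ?N (frag_of (snd (suspension R A C 1 (dcomp R A B C f g) i c))) =
        chain_eval ?N (extend (suspension R A B 1 g) (frag_family (suspension R B C 1 f)) i c)"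
      using c w suspension_dcomp[of c i] by simp
  qed
  also have "\<dots> = chain_eval ?N (extend (suspension R A B 1 g) (coderiv shifted_deg (suspension R B B 2 mB) (frag_family (suspension R B C 1 f))) u w)"
    using mg by (intro coderiv_extend[OF C.A_group AB.B.A_group fA fB fg w(1) _ mlf]) (auto simp: word_morphism_def)
  also have "\<dots> = chain_eval ?N (extend (suspension R A B 1 g) (extend (suspension R B C 1 f) (frag_family (suspension R C C 2 mC))) u w)"
  proof (rule extend_cong_chain_eval[OF C.A_group fg w(1)])
    fix i c assume c: "hword B c" "sdeg c - diag i = sdeg w - diag u" "c = [] \<longleftrightarrow> w = []"
    have "outdeg 2 i c = outdeg 2 u w" using c(2) by (auto simp: outdeg_def prod_eq_iff)
    then show "chain_eval ?N (coderiv shifted_deg (suspension R B B 2 mB) (frag_family (suspension R B C 1 f)) i c) =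
        chain_eval ?N (extend (suspension R B C 1 f) (frag_family (suspension R C C 2 mC)) i c)"
      using mf c w unfolding word_morphism_def by metis
  qed
  also have "\<dots> = chain_eval ?N (extend (suspension R A C 1 (dcomp R A B C f g)) (frag_family (suspension R C C 2 mC)) u w)"
    by (rule extend_comp[OF C.A_group C.A_group fg ff w(1) suspension_dcomp mlm, symmetric])
  finally show "chain_eval ?N (coderiv shifted_deg (suspension R A A 2 mA) (frag_family (suspension R A C 1 (dcomp R A B C f g))) u w) =
      chain_eval ?N (extend (suspension R A C 1 (dcomp R A B C f g)) (frag_family (suspension R C C 2 mC)) u w)" .
qed

end

end

text \<open>Both sides become the iterated substitution of \<open>h\<close> into \<open>g\<close>
  into \<open>f\<close>. On the left this is the suspended form of the inner composite, on the right
  it is \<open>extend_comp\<close>.\<close>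

lemma dcomp_assoc:
  fixes A B C D :: "('r, 'a) bgmod"
  assumes "bigraded R A" "bigraded R B" "bigraded R C" "bigraded R D"
    and f: "derived_family R C D 1 f" and g: "derived_family R B C 1 g" and h: "derived_family R A B 1 h"
  shows "dcomp R A B D (dcomp R B C D f g) h = dcomp R A C D f (dcomp R A B C g h)"
proof -
  interpret A: bigraded R A by fact
  interpret B: bigraded R B by fact
  interpret C: bigraded R C by fact
  interpret D: bigraded R D by fact
  interpret ABC: bigraded_triple R A B C ..
  interpret ABD: bigraded_triple R A B D ..
  interpret ACD: bigraded_triple R A C D ..
  interpret BCD: bigraded_triple R B C D ..
  note fg = BCD.dcomp_derived_family[OF f g] and gh = ABC.dcomp_derived_family[OF g h]
  show ?thesis
  proof (rule ABD.AC.suspension_ext[OF ABD.dcomp_PiE[OF fg h] ACD.dcomp_PiE[OF f gh]])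
    fix p w assume w: "hword A w" "w \<noteq> []"
    let ?N = "D (outdeg 1 p w)"
    interpret N: abelian_group ?N by (rule D.A_group)
    have ml: "chain_additive ?N C (sdeg w - diag p) (frag_family (suspension R C D 1 f))"
      using ACD.BC.suspension_chain_additive[OF f, of "sdeg w - diag p"] by (simp add: outdeg_def algebra_simps)
    have "chain_eval ?N (extend (suspension R A B 1 h) (frag_family (suspension R B D 1 (dcomp R B C D f g))) p w) =
      chain_eval ?N (extend (suspension R A B 1 h) (extend (suspension R B C 1 g) (frag_family (suspension R C D 1 f))) p w)"
    proof (rule extend_cong_chain_eval[OF D.A_group ABC.AB.suspension_word_family[OF h] w(1)])
      fix i c assume c: "hword B c" "sdeg c - diag i = sdeg w - diag p" "c = [] \<longleftrightarrow> w = []"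
      have "outdeg 1 i c = outdeg 1 p w" using c(2) by (auto simp: outdeg_def prod_eq_iff)
      then show "chain_eval ?N (frag_of (snd (suspension R B D 1 (dcomp R B C D f g) i c))) =
        chain_eval ?N (extend (suspension R B C 1 g) (frag_family (suspension R C D 1 f)) i c)"
        using c w BCD.suspension_dcomp[OF f g c(1), of i] by simp
    qed
    also have "\<dots> = chain_eval ?N (extend (suspension R A C 1 (dcomp R A B C g h)) (frag_family (suspension R C D 1 f)) p w)"
      by (rule extend_comp[OF D.A_group C.A_group ABC.AB.suspension_word_family[OF h] ABC.BC.suspension_word_family[OF g] w(1)
            ABC.suspension_dcomp[OF g h] ml, symmetric])
    finally show "suspension R A D 1 (dcomp R A B D (dcomp R B C D f g) h) p w =
        suspension R A D 1 (dcomp R A C D f (dcomp R A B C g h)) p w"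
      by (simp add: ABD.suspension_dcomp[OF fg h w] ACD.suspension_dcomp[OF f gh w])
  qed
qed

section \<open>Identity morphisms\<close>

definition dident :: "('r, 's) ring_scheme \<Rightarrow> ('r, 'a) bgmod \<Rightarrow> nat \<times> nat \<Rightarrow> (('a, 'r) tens, 'a) gmap" where
  "dident R A = (\<lambda>(i, j)\<in>UNIV \<times> {1..}. if (i, j) = (0, 1) then tensor1_id R A
     else gzero (tensor_power R A j) A (- int i, 1 - int i - int j))"

context bigraded
begin

lemma dident_PiE:
  "dident R A \<in> (\<Pi>\<^sub>E (i, j)\<in>UNIV \<times> {1..}. gmaps R (tensor_power R A j) A (- int i, 1 - int i - int j))"
proof -
  have "gzero (tensor_power R A j) A (- int i, 1 - int i - int j) \<in> gmaps R (tensor_power R A j) A (- int i, 1 - int i - int j)"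
    for i j by (rule gzero_gmaps[OF tensor_module A_module])
  then show ?thesis
    unfolding dident_def using tensor1_id_gmaps by (auto simp: PiE_def Pi_def extensional_def)
qed

lemma suspension_dident:
  assumes w: "hword A w" "w \<noteq> []"
  shows "suspension R A A 1 (dident R A) p w = word_id A p w"
proof (cases "p = 0 \<and> length w = 1")
  case True
  then obtain x where x: "w = [x]" by (cases w) auto
  have "outdeg 1 0 [x] = fst x" by (simp add: outdeg_def prod_eq_iff)
  then show ?thesis
    using True w tensor1_id_pure[of x] by (simp add: suspension_def x susp_sign_def word_value_def dident_def prod_eq_iff)
next
  case False
  have "word_value R A (dident R A) p w = \<zero>\<^bsub>A (outdeg 1 p w)\<^esub>"
    using False w pure_closed'[OF w(1)] by (auto simp: word_value_def dident_def gzero_def outdeg_eq Suc_le_eq)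
  with False show ?thesis by (subst word_id_other) (auto simp: suspension_def signed_zero[OF A_group])
qed

end

lemma dcomp_ident:
  fixes A B :: "('r, 'a) bgmod"
  assumes "bigraded R A" "bigraded R B"
    and f: "f \<in> (\<Pi>\<^sub>E (i, j)\<in>UNIV \<times> {1..}. gmaps R (tensor_power R A j) B (- int i, 1 - int i - int j))"
  shows "dcomp R A B B (dident R B) f = f" "dcomp R A A B f (dident R A) = f"
proof -
  interpret A: bigraded R A by fact
  interpret B: bigraded R B by fact
  interpret AB: bigraded_pair' R A B ..
  interpret ABB: bigraded_triple R A B B ..
  interpret AAB: bigraded_triple R A A B ..
  note ff = derived_familyI[OF f] and iA = derived_familyI[OF A.dident_PiE] and iB = derived_familyI[OF B.dident_PiE]
  show "dcomp R A B B (dident R B) f = f"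
  proof (rule AB.suspension_ext[OF ABB.dcomp_PiE[OF iB ff] f])
    fix p w assume w: "hword A w" "w \<noteq> []"
    let ?N = "B (outdeg 1 p w)"
    have "chain_eval ?N (extend (suspension R A B 1 f) (frag_family (suspension R B B 1 (dident R B))) p w) =
      chain_eval ?N (extend (suspension R A B 1 f) (frag_family (word_id B)) p w)"
      by (rule extend_cong_chain_eval[OF B.A_group AB.suspension_word_family[OF ff] w(1)]) (use w in \<open>simp add: B.suspension_dident\<close>)
    also have "\<dots> = snd (suspension R A B 1 f p w)"
      by (rule extend_word_id_right[OF B.A_group AB.suspension_word_family[OF ff] w])
    finally show "suspension R A B 1 (dcomp R A B B (dident R B) f) p w = suspension R A B 1 f p w"
      by (simp add: ABB.suspension_dcomp[OF iB ff w] prod_eq_iff)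
  qed
  show "dcomp R A A B f (dident R A) = f"
  proof (rule AB.suspension_ext[OF AAB.dcomp_PiE[OF ff iA] f])
    fix p w assume w: "hword A w" "w \<noteq> []"
    let ?N = "B (outdeg 1 p w)"
    interpret N: abelian_group ?N by (rule B.A_group)
    have ml: "chain_additive ?N A (sdeg w - diag p) (frag_family (suspension R A B 1 f))"
      using AB.suspension_chain_additive[OF ff, of "sdeg w - diag p"] by (simp add: outdeg_def algebra_simps)
    have "extend (suspension R A A 1 (dident R A)) (frag_family (suspension R A B 1 f)) p w = extend (word_id A) (frag_family (suspension R A B 1 f)) p w"
      by (rule extend_family_cong[OF A.suspension_dident w(1)])
    then have "chain_eval ?N (extend (suspension R A A 1 (dident R A)) (frag_family (suspension R A B 1 f)) p w) =
        chain_eval ?N (frag_of (snd (suspension R A B 1 f p w)))"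
      by (simp add: extend_word_id_left[OF B.A_group A.A_group w(1) ml])
    also have "\<dots> = snd (suspension R A B 1 f p w)"
      using AB.suspension_word_family[OF ff] w by (simp add: word_family_def)
    finally show "suspension R A B 1 (dcomp R A A B f (dident R A)) p w = suspension R A B 1 f p w"
      by (simp add: AAB.suspension_dcomp[OF ff iA w] prod_eq_iff)
  qed
qed

text \<open>Both sides reduce to the suspended structure map itself, by
  \<open>coderiv_word_id\<close> and \<open>extend_word_id_left\<close>.\<close>

lemma (in bigraded) word_morphism_dident:
  assumes m: "derived_family R A A 2 m"
  shows "word_morphism A A (suspension R A A 2 m) (suspension R A A 2 m) (suspension R A A 1 (dident R A))"
  unfolding word_morphism_def
proof (intro allI impI)
  fix u w assume w: "hword A w" "w \<noteq> []"
  interpret AA: bigraded_pair' R A A ..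
  let ?N = "A (outdeg 2 u w)"
  interpret N: abelian_group ?N by (rule A_group)
  note fm = AA.suspension_word_family[OF m]
  have ml: "chain_additive ?N A (sdeg w - diag u) (frag_family (suspension R A A 2 m))"
    using AA.suspension_chain_additive[OF m, of "sdeg w - diag u"] by (simp add: outdeg_def algebra_simps)
  have "chain_eval ?N (coderiv shifted_deg (suspension R A A 2 m) (frag_family (suspension R A A 1 (dident R A))) u w) =
      chain_eval ?N (coderiv shifted_deg (suspension R A A 2 m) (frag_family (word_id A)) u w)"
    by (rule coderiv_cong_chain_eval[OF A_group fm w(1)]) (use w in \<open>simp add: suspension_dident\<close>)
  also have "\<dots> = chain_eval ?N (frag_of (snd (suspension R A A 2 m u w)))"
    using fm w coderiv_word_id[OF A_group fm w] by (simp add: word_family_def)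
  also have "\<dots> = chain_eval ?N (extend (word_id A) (frag_family (suspension R A A 2 m)) u w)"
    by (rule extend_word_id_left[OF A_group A_group w(1) ml, symmetric])
  also have "extend (word_id A) (frag_family (suspension R A A 2 m)) u w = extend (suspension R A A 1 (dident R A)) (frag_family (suspension R A A 2 m)) u w"
    by (rule extend_family_cong[OF suspension_dident w(1), symmetric])
  finally show "chain_eval ?N (coderiv shifted_deg (suspension R A A 2 m) (frag_family (suspension R A A 1 (dident R A))) u w) =
    chain_eval ?N (extend (suspension R A A 1 (dident R A)) (frag_family (suspension R A A 2 m)) u w)" .
qed

section \<open>The category axioms\<close>

lemma dA_algebrasD:
  assumes "X \<in> dA_algebras R" "cring R"
  shows "bigraded R (dA_module X)" "derived_family R (dA_module X) (dA_module X) 2 (dA_op X)"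
proof -
  show "bigraded R (dA_module X)" using assms by (simp add: bigraded_def bigraded_axioms_def dA_algebras_def)
  have "dA_op X \<in> (\<Pi>\<^sub>E (i, j)\<in>UNIV \<times> {1..}.
       gmaps R (tensor_power R (dA_module X) j) (dA_module X) (- int i, 2 - int i - int j))"
    using assms unfolding dA_algebras_def by blast
  then show "derived_family R (dA_module X) (dA_module X) 2 (dA_op X)" by (rule derived_familyI)
qed

lemma dA_morphisms_iff:
  assumes X: "X \<in> dA_algebras R" and Y: "Y \<in> dA_algebras R" and R: "cring R"
  shows "f \<in> dA_morphisms R X Y \<longleftrightarrow>
    f \<in> (\<Pi>\<^sub>E (i, j)\<in>UNIV \<times> {1..}.
       gmaps R (tensor_power R (dA_module X) j) (dA_module Y) (- int i, 1 - int i - int j)) \<and>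
    word_morphism (dA_module X) (dA_module Y) (suspension R (dA_module X) (dA_module X) 2 (dA_op X))
      (suspension R (dA_module Y) (dA_module Y) 2 (dA_op Y)) (suspension R (dA_module X) (dA_module Y) 1 f)"
proof -
  interpret X: bigraded R "dA_module X" by (rule dA_algebrasD[OF X R])
  interpret Y: bigraded R "dA_module Y" by (rule dA_algebrasD[OF Y R])
  interpret XY: bigraded_pair' R "dA_module X" "dA_module Y" ..
  show ?thesis
    unfolding dA_morphisms_def mem_Collect_eq
    using XY.morphism_iff[OF dA_algebrasD(2)[OF X R] dA_algebrasD(2)[OF Y R] derived_familyI] by blast
qed

lemma derived_A_infinity_simps:
  "Obj (derived_A_infinity R) = dA_algebras R"
  "Hom (derived_A_infinity R) = dA_morphisms R"
  "Ident (derived_A_infinity R) X = dident R (dA_module X)"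
  "Comp (derived_A_infinity R) X Y Z = dcomp R (dA_module X) (dA_module Y) (dA_module Z)"
  by (simp_all add: derived_A_infinity_def dident_def dcomp_def[abs_def])

theorem derived_A_infinity_category:
  fixes R :: "('r, 's) ring_scheme"
  assumes R: "cring R"
  shows "category (derived_A_infinity R ::
    (('r, 'a) dA_algebra, nat \<times> nat \<Rightarrow> (('a, 'r) tens, 'a) gmap) category_data)"
proof
  fix X :: "('r, 'a) dA_algebra"
  assume "X \<in> Obj (derived_A_infinity R)"
  then have X: "X \<in> dA_algebras R" by (simp add: derived_A_infinity_simps)
  interpret X: bigraded R "dA_module X" by (rule dA_algebrasD[OF X R])
  show "Ident (derived_A_infinity R) X \<in> Hom (derived_A_infinity R) X X"
    using X.dident_PiE X.word_morphism_dident[OF dA_algebrasD(2)[OF X R]]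
    by (simp add: derived_A_infinity_simps dA_morphisms_iff[OF X X R])
next
  fix X Y Z :: "('r, 'a) dA_algebra" and f g
  assume "X \<in> Obj (derived_A_infinity R)" "Y \<in> Obj (derived_A_infinity R)" "Z \<in> Obj (derived_A_infinity R)"
    "f \<in> Hom (derived_A_infinity R) Y Z" "g \<in> Hom (derived_A_infinity R) X Y"
  then have X: "X \<in> dA_algebras R" and Y: "Y \<in> dA_algebras R" and Z: "Z \<in> dA_algebras R"
    and f: "f \<in> dA_morphisms R Y Z" and g: "g \<in> dA_morphisms R X Y"
    by (simp_all add: derived_A_infinity_simps)
  interpret X: bigraded R "dA_module X" by (rule dA_algebrasD[OF X R])
  interpret Y: bigraded R "dA_module Y" by (rule dA_algebrasD[OF Y R])
  interpret Z: bigraded R "dA_module Z" by (rule dA_algebrasD[OF Z R])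
  interpret XYZ: bigraded_triple R "dA_module X" "dA_module Y" "dA_module Z" ..
  note f' = f[unfolded dA_morphisms_iff[OF Y Z R]] and g' = g[unfolded dA_morphisms_iff[OF X Y R]]
  note ff = derived_familyI[OF conjunct1[OF f']] and gg = derived_familyI[OF conjunct1[OF g']]
  have "dcomp R (dA_module X) (dA_module Y) (dA_module Z) f g \<in> dA_morphisms R X Z"
    unfolding dA_morphisms_iff[OF X Z R]
    using XYZ.dcomp_PiE[OF ff gg] XYZ.word_morphism_dcomp[OF ff gg dA_algebrasD(2)[OF X R] dA_algebrasD(2)[OF Y R]
        dA_algebrasD(2)[OF Z R] conjunct2[OF g'] conjunct2[OF f']] by blast
  then show "Comp (derived_A_infinity R) X Y Z f g \<in> Hom (derived_A_infinity R) X Z"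
    by (simp add: derived_A_infinity_simps)
next
  fix X Y :: "('r, 'a) dA_algebra" and f
  assume "X \<in> Obj (derived_A_infinity R)" "Y \<in> Obj (derived_A_infinity R)"
    "f \<in> Hom (derived_A_infinity R) X Y"
  then have X: "X \<in> dA_algebras R" and Y: "Y \<in> dA_algebras R" and f: "f \<in> dA_morphisms R X Y"
    by (simp_all add: derived_A_infinity_simps)
  note f' = conjunct1[OF f[unfolded dA_morphisms_iff[OF X Y R]]]
  note c = dcomp_ident[OF dA_algebrasD(1)[OF X R] dA_algebrasD(1)[OF Y R] f']
  show "Comp (derived_A_infinity R) X Y Y (Ident (derived_A_infinity R) Y) f = f"
    using c(1) by (simp add: derived_A_infinity_simps)
  show "Comp (derived_A_infinity R) X X Y f (Ident (derived_A_infinity R) X) = f"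
    using c(2) by (simp add: derived_A_infinity_simps)
next
  fix W X Y Z :: "('r, 'a) dA_algebra" and f g h
  assume "W \<in> Obj (derived_A_infinity R)" "X \<in> Obj (derived_A_infinity R)" "Y \<in> Obj (derived_A_infinity R)"
    "Z \<in> Obj (derived_A_infinity R)" "f \<in> Hom (derived_A_infinity R) Y Z"
    "g \<in> Hom (derived_A_infinity R) X Y" "h \<in> Hom (derived_A_infinity R) W X"
  then have W: "W \<in> dA_algebras R" and X: "X \<in> dA_algebras R" and Y: "Y \<in> dA_algebras R" and Z: "Z \<in> dA_algebras R"
    and f: "f \<in> dA_morphisms R Y Z" and g: "g \<in> dA_morphisms R X Y" and h: "h \<in> dA_morphisms R W X"
    by (simp_all add: derived_A_infinity_simps)
  have "derived_family R (dA_module Y) (dA_module Z) 1 f" "derived_family R (dA_module X) (dA_module Y) 1 g"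
    "derived_family R (dA_module W) (dA_module X) 1 h"
    by (rule derived_familyI, use f g h in \<open>simp add: dA_morphisms_iff[OF Y Z R] dA_morphisms_iff[OF X Y R]
        dA_morphisms_iff[OF W X R]\<close>)+
  from dcomp_assoc[OF dA_algebrasD(1)[OF W R] dA_algebrasD(1)[OF X R] dA_algebrasD(1)[OF Y R]
      dA_algebrasD(1)[OF Z R] this]
  show "Comp (derived_A_infinity R) W X Z (Comp (derived_A_infinity R) X Y Z f g) h =
      Comp (derived_A_infinity R) W Y Z f (Comp (derived_A_infinity R) W X Y g h)"
    by (simp add: derived_A_infinity_simps)
qed

section \<open>Tensor products of sequences of maps\<close>

text \<open>Distributions of an index n over l tensor factors; unlike in
  \<open>compositions\<close>, a share may be 0.\<close>

definition weak_compositions :: "nat \<Rightarrow> nat \<Rightarrow> nat list set" where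
  "weak_compositions l n = {ps. length ps = l \<and> sum_list ps = n}"

lemma weak_compositions_0: "weak_compositions 0 n = (if n = 0 then {[]} else {})"
  by (auto simp: weak_compositions_def)

lemma weak_compositions_Suc: "weak_compositions (Suc l) n = (\<lambda>(p, ps). p # ps) ` (SIGMA p:{..n}. weak_compositions l (n - p))"
proof (intro equalityI subsetI)
  fix ps assume "ps \<in> weak_compositions (Suc l) n"
  then obtain p ps' where "ps = p # ps'" "length ps' = l" "p + sum_list ps' = n"
    by (cases ps) (auto simp: weak_compositions_def)
  then show "ps \<in> (\<lambda>(p, ps). p # ps) ` (SIGMA p:{..n}. weak_compositions l (n - p))"
    by (intro image_eqI[of _ _ "(p, ps')"]) (auto simp: weak_compositions_def)
qed (auto simp: weak_compositions_def)

lemma finite_weak_compositions: "finite (weak_compositions l n)"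
  by (induction l arbitrary: n) (simp_all add: weak_compositions_0 weak_compositions_Suc)

lemma sum_weak_compositions_Suc: "(\<Sum>ps\<in>weak_compositions (Suc l) n. F ps) = (\<Sum>p\<le>n. \<Sum>ps\<in>weak_compositions l (n - p). F (p # ps))"
proof -
  have inj: "inj_on (\<lambda>(p, ps). p # ps) (SIGMA p:{..n}. weak_compositions l (n - p))" by (auto simp: inj_on_def)
  have "(\<Sum>ps\<in>weak_compositions (Suc l) n. F ps) = (\<Sum>(p, ps)\<in>(SIGMA p:{..n}. weak_compositions l (n - p)). F (p # ps))"
    unfolding weak_compositions_Suc by (subst sum.reindex[OF inj]) (simp add: case_prod_beta comp_def)
  also have "\<dots> = (\<Sum>p\<le>n. \<Sum>ps\<in>weak_compositions l (n - p). F (p # ps))"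
    by (rule sum.Sigma[symmetric]) (auto simp: finite_weak_compositions)
  finally show ?thesis .
qed

lemma sum_antidiagonal: "(\<Sum>x\<in>{(i, j). i + j = n}. F x) = (\<Sum>p\<le>n. F (p, n - p))" for n :: nat
  by (rule sum.reindex_bij_witness[of _ "\<lambda>p. (p, n - p)" fst]) auto

text \<open>For a product nested to the right, the sign (-1)^(i|g|) of each step involves the total
  degree of all later factors.\<close>

fun tC_tensor_sign :: "nat list \<Rightarrow> 'f op list \<Rightarrow> int" where
  "tC_tensor_sign (p # ps) ((q, e, f) # fs) = int p * tdeg (ops_deg fs) + tC_tensor_sign ps fs"
| "tC_tensor_sign _ _ = 0"

definition entries :: "nat list \<Rightarrow> (nat \<Rightarrow> 'f) op list \<Rightarrow> 'f op list" where
  "entries ps gs = map (\<lambda>(p, (q, e, f)). (q, entry_deg e p, f p)) (zip ps gs)"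

lemma entries_simps [simp]:
  "entries [] gs = []" "entries (p # ps) ((q, e, f) # gs) = (q, entry_deg e p, f p) # entries ps gs"
  by (simp_all add: entries_def)

definition tC_ok :: "('r, 's) ring_scheme \<Rightarrow> ('r, 'a) bgmod \<Rightarrow> ('r, 'b) bgmod \<Rightarrow>
    (nat \<Rightarrow> (('a, 'r) tens, 'b) gmap) op list \<Rightarrow> bool" where
  "tC_ok R A B fs \<longleftrightarrow> (\<forall>(q, e, f)\<in>set fs. f \<in> tC_hom R (tensor_power R A q) B e)"

lemma tC_ok_simps [simp]:
  "tC_ok R A B []" "tC_ok R A B ((q, e, f) # fs) \<longleftrightarrow> f \<in> tC_hom R (tensor_power R A q) B e \<and> tC_ok R A B fs"
  "tC_ok R A B (fs @ gs) \<longleftrightarrow> tC_ok R A B fs \<and> tC_ok R A B gs"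
  by (simp_all add: tC_ok_def ball_Un)

lemma tC_hom_entry: "f \<in> tC_hom R A B e \<Longrightarrow> f i \<in> gmaps R A B (entry_deg e i)"
  by (simp add: tC_hom_def)

lemma entry_deg_add: "entry_deg e i + entry_deg e' j = entry_deg (e + e') (i + j)"
  by (simp add: entry_deg_def prod_eq_iff)

lemma entries_props:
  assumes "length ps = length gs"
  shows "ops_deg (entries ps gs) = entry_deg (ops_deg gs) (sum_list ps)"
    "ops_arity (entries ps gs) = ops_arity gs" "length (entries ps gs) = length gs"
proof -
  have "ops_deg (entries ps gs) = entry_deg (ops_deg gs) (sum_list ps) \<and>
      ops_arity (entries ps gs) = ops_arity gs \<and> length (entries ps gs) = length gs"
    using assms
  proof (induction ps gs rule: list_induct2)
    case Nil show ?case by (simp add: entry_deg_def prod_eq_iff)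
  next
    case (Cons p ps op gs)
    then show ?case by (cases op) (simp add: entry_deg_add)
  qed
  then show "ops_deg (entries ps gs) = entry_deg (ops_deg gs) (sum_list ps)"
    "ops_arity (entries ps gs) = ops_arity gs" "length (entries ps gs) = length gs" by auto
qed

lemma entries_ok: "length ps = length gs \<Longrightarrow> tC_ok R A B gs \<Longrightarrow> ops_ok R A B (entries ps gs)"
proof (induction ps gs rule: list_induct2)
  case (Cons p ps op gs)
  then show ?case by (cases op) (simp add: tC_hom_entry)
qed simp

lemma hom_chain_eval:
  assumes "abelian_group_hom G H h" and "\<And>k. k \<in> I \<Longrightarrow> y k \<in> carrier G"
  shows "h (chain_eval G (\<Sum>k\<in>I. chain_sign (s k) (frag_of (y k)))) = chain_eval H (\<Sum>k\<in>I. chain_sign (s k) (frag_of (h (y k))))"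
proof -
  interpret h: abelian_group_hom G H h by fact
  have *: "h (chain_eval G (chain_sign n (frag_of y))) = chain_eval H (chain_sign n (frag_of (h y)))" if "y \<in> carrier G" for n y
    using that by (simp add: chain_sign_def h.G.chain_eval_minus h.H.chain_eval_minus)
  show ?thesis using assms(2)
    by (induction I rule: infinite_finite_induct) (simp_all add: h.G.chain_eval_add h.H.chain_eval_add *)
qed

lemma (in abelian_group) chain_eval_chain_sign_frag_chain_eval: "chain_eval G (chain_sign n (frag_of (chain_eval G c))) = chain_eval G (chain_sign n c)"
  by (simp add: chain_sign_def chain_eval_minus)

section \<open>Expansion on pure tensors\<close>

context bigraded
begin

lemma tensor_cons_hom:
  assumes b: "b \<in> carrier (A e)"
  shows "abelian_group_hom (tensor_power R A m d) (tensor_power R A (Suc m) (e + d)) (tensor_cons R A m e b d)"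
  by (intro abelian_group_homI group_hom.intro abelian_group.a_group tensor_group)
     (auto simp: group_hom_axioms_def hom_def tensor_cons_linear[OF b] tensor_group abelian_group.a_group)

lemma tensor_cons_signed_left:
  assumes b: "b \<in> carrier (A e)" and Y: "Y \<in> carrier (tensor_power R A m d)"
  shows "tensor_cons R A m e (signed (A e) n b) d Y =
    signed (tensor_power R A (Suc m) (e + d)) n (tensor_cons R A m e b d Y)"
proof -
  interpret M: module R "A e" by (rule A_module)
  interpret N: module R "tensor_power R A (Suc m) (e + d)" by (rule tensor_module)
  have "tensor_cons R A m e ((\<ominus>\<^bsub>R\<^esub> \<one>\<^bsub>R\<^esub>) \<odot>\<^bsub>A e\<^esub> b) d Y =
      (\<ominus>\<^bsub>R\<^esub> \<one>\<^bsub>R\<^esub>) \<odot>\<^bsub>tensor_power R A (Suc m) (e + d)\<^esub> tensor_cons R A m e b d Y"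
    by (rule tensor_cons_left(2)[OF b b _ Y]) simp
  then show ?thesis
    using b tensor_cons_linear(1)[OF b Y] by (simp add: signed_def M.smult_l_minus N.smult_l_minus)
qed

lemma tensor_cons_zero_left:
  assumes Y: "Y \<in> carrier (tensor_power R A m d)"
  shows "tensor_cons R A m e \<zero>\<^bsub>A e\<^esub> d Y = \<zero>\<^bsub>tensor_power R A (Suc m) (e + d)\<^esub>"
proof -
  interpret M: module R "A e" by (rule A_module)
  interpret N: module R "tensor_power R A (Suc m) (e + d)" by (rule tensor_module)
  show ?thesis
    using tensor_cons_left(2)[OF M.M.zero_closed M.M.zero_closed zero_closed Y]
      tensor_cons_linear(1)[OF M.M.zero_closed Y] by simp
qed

end

context bigraded_pair'
begin

lemma tC_tensors_gmaps:
  "tC_ok R A B gs \<Longrightarrow> tC_tensors R A B gs n \<in>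
    gmaps R (tensor_power R A (ops_arity gs)) (tensor_power R B (length gs)) (entry_deg (ops_deg gs) n)"
proof (induction gs arbitrary: n)
  case Nil
  have "gid (tensor_power R A 0) \<in> gmaps R (tensor_power R A 0) (tensor_power R A 0) 0"
    by (rule gid_gmaps) (rule A.tensor_module)
  moreover have "gzero (tensor_power R A 0) (tensor_power R A 0) e \<in> gmaps R (tensor_power R A 0) (tensor_power R A 0) e" for e
    by (rule gzero_gmaps) (rule A.tensor_module)+
  ultimately show ?case
    unfolding list.size ops_simps tC_tensors.simps tensor_power_0[of R B A]
    by (auto simp: tC_single_def entry_deg_def zero_prod_def)
next
  case (Cons op gs)
  obtain q e f where op: "op = (q, e, f)" by (cases op)
  have f: "f \<in> tC_hom R (tensor_power R A q) B e" "tC_ok R A B gs" using Cons.prems op by auto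
  have "gtensor R A B q (ops_arity gs) (length gs) (entry_deg e i) (entry_deg (ops_deg gs) j) (f i) (tC_tensors R A B gs j)
     \<in> gmaps R (tensor_power R A (q + ops_arity gs)) (tensor_power R B (Suc (length gs))) (entry_deg (e + ops_deg gs) n)"
    if "i + j = n" for i j
    using gtensor_gmaps[OF tC_hom_entry[OF f(1)] Cons.IH[OF f(2)], of i j] that by (simp add: entry_deg_add)
  then show ?case
    unfolding op tC_tensors.simps tC_tensor_def
    by (simp, intro gsum_gmaps A.tensor_module B.tensor_module) auto
qed

lemma gtensors_Cons_pure:
  assumes f: "f \<in> gmaps R (tensor_power R A q) B e" and fs: "ops_ok R A B fs"
    and w: "hword A a" "length a = q" "hword A c" "length c = ops_arity fs"
  shows "gtensors R A B ((q, e, f) # fs) (wdeg (a @ c)) (pure_tensor R A (a @ c)) =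
    signed (tensor_power R B (Suc (length fs)) ((wdeg a + e) + (wdeg c + ops_deg fs))) (bdot (ops_deg fs) (wdeg a))
      (tensor_cons R B (length fs) (wdeg a + e) (f (wdeg a) (pure_tensor R A a))
         (wdeg c + ops_deg fs) (gtensors R A B fs (wdeg c) (pure_tensor R A c)))"
  unfolding gtensors.simps by (rule gtensor_pure[OF f gtensors_gmaps[OF fs] w])

lemma gtensors_pure_closed:
  assumes fs: "ops_ok R A B fs" and c: "hword A c" "length c = ops_arity fs"
  shows "gtensors R A B fs (wdeg c) (pure_tensor R A c) \<in> carrier (tensor_power R B (length fs) (wdeg c + ops_deg fs))"
  using gmaps_closed[OF gtensors_gmaps[OF fs] A.pure_closed'[OF c(1), unfolded c(2)]] .

text \<open>Flattens the nested sums of \<open>tC_tensor\<close> into one sum over distributions of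
  n. In the step, additivity of \<open>tensor_cons\<close> in its right argument moves the inner sum
  outwards; the Koszul sign depends on the distribution only through the total share of the later
  factors, so it can be taken inside.\<close>

lemma tC_tensors_pure:
  assumes "tC_ok R A B gs" "hword A w" "length w = ops_arity gs"
  shows "tC_tensors R A B gs n (wdeg w) (pure_tensor R A w) =
    chain_eval (tensor_power R B (length gs) (wdeg w + entry_deg (ops_deg gs) n))
      (\<Sum>ps\<in>weak_compositions (length gs) n. chain_sign (tC_tensor_sign ps gs) (frag_of (gtensors R A B (entries ps gs) (wdeg w) (pure_tensor R A w))))"
  using assms
proof (induction gs arbitrary: n w)
  case Nil
  then have w: "w = []" by simp
  have p: "pure_tensor R A [] \<in> carrier (tensor_power R A 0 0)" using A.pure_closed'[of "[]"] by simp
  show ?case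
  \<comment> \<open>The empty product is concentrated in index 0; for n > 0 there is no distribution
    over zero factors, and both sides vanish.\<close>
  proof (cases "n = 0")
    case True
    then show ?thesis
      using p by (simp add: w weak_compositions_0 tC_single_def gid_def entry_deg_def tensor_power_0[of R B A]
          abelian_group.chain_eval_frag_of[OF A.tensor_group] flip: zero_prod_def)
  next
    case False
    then show ?thesis
      using p by (simp add: w weak_compositions_0 tC_single_def gzero_def entry_deg_def tensor_power_0[of R B A]
          abelian_group.chain_eval_0[OF A.tensor_group] flip: zero_prod_def)
  qed
next
  case (Cons op gs)
  obtain q e f where op: "op = (q, e, f)" by (cases op)
  define a c where "a = take q w" and "c = drop q w"
  have w: "w = a @ c" by (simp add: a_def c_def)
  have f: "f \<in> tC_hom R (tensor_power R A q) B e" "tC_ok R A B gs" using Cons.prems op by auto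
  have l: "length a = q" "length c = ops_arity gs" using Cons.prems op by (auto simp: a_def c_def)
  have g: "hword A a" "hword A c" using Cons.prems w by auto
  let ?N = "tensor_power R B (Suc (length gs)) (wdeg w + entry_deg (ops_deg (op # gs)) n)"
  interpret N: abelian_group ?N by (rule B.tensor_group)
  have pw: "pure_tensor R A w \<in> carrier (tensor_power R A (q + ops_arity gs) (wdeg w))"
    using A.pure_closed'[OF Cons.prems(2)] Cons.prems(3) op by simp
  have N: "tensor_power R B (Suc (length gs)) ((wdeg a + entry_deg e i) + (wdeg c + entry_deg (ops_deg gs) j)) = ?N"
    if "i + j = n" for i j
  proof -
    have "(wdeg a + entry_deg e i) + (wdeg c + entry_deg (ops_deg gs) j) =
        wdeg w + (entry_deg e i + entry_deg (ops_deg gs) j)"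
      by (simp add: w algebra_simps)
    then show ?thesis unfolding entry_deg_add that op by simp
  qed
  let ?G = "\<lambda>i j. gtensor R A B q (ops_arity gs) (length gs) (entry_deg e i) (entry_deg (ops_deg gs) j) (f i) (tC_tensors R A B gs j)"
  have gt: "?G i j \<in> gmaps R (tensor_power R A (q + ops_arity gs)) (tensor_power R B (Suc (length gs))) (entry_deg (e + ops_deg gs) n)"
    if "i + j = n" for i j
    using gtensor_gmaps[OF tC_hom_entry[OF f(1)] tC_tensors_gmaps[OF f(2)], of i j] that by (simp add: entry_deg_add)
  have "tC_tensors R A B (op # gs) n (wdeg w) (pure_tensor R A w) =
    chain_eval ?N (\<Sum>x\<in>{(i, j). i + j = n}. chain_sign ((\<lambda>(i, j). int i * tdeg (ops_deg gs)) x)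
      (frag_of ((\<lambda>(i, j). ?G i j) x (wdeg w) (pure_tensor R A w))))"
    unfolding op tC_tensors.simps tC_tensor_def length_Cons ops_simps
  proof (subst gsum_chain_eval[where A = "tensor_power R A (q + ops_arity gs)" and B = "tensor_power R B (Suc (length gs))"
        and d = "wdeg w" and x = "pure_tensor R A w", OF B.tensor_group _ pw])
    fix x assume "x \<in> {(i, j). i + j = n}"
    then show "(\<lambda>(i, j). ?G i j) x (wdeg w) (pure_tensor R A w) \<in>
        carrier (tensor_power R B (Suc (length gs)) (wdeg w + entry_deg (e + ops_deg gs) n))"
      using gmaps_closed[OF gt pw] by auto
  qed simp
  also have "\<dots> = chain_eval ?N (\<Sum>i\<le>n. chain_sign (int i * tdeg (ops_deg gs)) (frag_of (?G i (n - i) (wdeg w) (pure_tensor R A w))))"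
    by (simp add: sum_antidiagonal)
  also have "\<dots> = chain_eval ?N (\<Sum>ps\<in>weak_compositions (Suc (length gs)) n. chain_sign (tC_tensor_sign ps (op # gs))
      (frag_of (gtensors R A B (entries ps (op # gs)) (wdeg w) (pure_tensor R A w))))"
    unfolding sum_weak_compositions_Suc
  proof (rule N.chain_eval_sum_cong)
    fix i assume i: "i \<in> {..n}"
    let ?j = "n - i"
    have ij: "i + ?j = n" using i by simp
    let ?b = "f i (wdeg a) (pure_tensor R A a)"
    let ?M = "tensor_power R B (length gs) (wdeg c + entry_deg (ops_deg gs) ?j)"
    let ?Y = "\<lambda>ps. gtensors R A B (entries ps gs) (wdeg c) (pure_tensor R A c)"
    let ?tc = "tensor_cons R B (length gs) (wdeg a + entry_deg e i) ?b (wdeg c + entry_deg (ops_deg gs) ?j)"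
    let ?k = "bdot (entry_deg (ops_deg gs) ?j) (wdeg a)"
    have b: "?b \<in> carrier (B (wdeg a + entry_deg e i))"
      using gmaps_closed[OF tC_hom_entry[OF f(1)] A.pure_closed'[OF g(1), unfolded l]] .
    have Y: "?Y ps \<in> carrier ?M" if "ps \<in> weak_compositions (length gs) ?j" for ps
    proof -
      have ps: "length ps = length gs" "sum_list ps = ?j" using that by (auto simp: weak_compositions_def)
      show ?thesis
        using gtensors_pure_closed[OF entries_ok[OF ps(1) f(2)] g(2)] entries_props[OF ps(1)] l ps by simp
    qed
    note h = B.tensor_cons_hom[OF b, of "length gs" "wdeg c + entry_deg (ops_deg gs) ?j", unfolded N[OF ij]]
    have tcY: "?tc (?Y ps) \<in> carrier ?N" if "ps \<in> weak_compositions (length gs) ?j" for ps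
      using B.tensor_cons_linear(1)[OF b Y[OF that]] unfolding N[OF ij] .
    have "?G i ?j (wdeg w) (pure_tensor R A w) = signed ?N ?k (?tc (tC_tensors R A B gs ?j (wdeg c) (pure_tensor R A c)))"
      unfolding w using gtensor_pure[OF tC_hom_entry[OF f(1)] tC_tensors_gmaps[OF f(2)] g(1) l(1) g(2) l(2), of i ?j]
      unfolding N[OF ij] w .
    also have "\<dots> = signed ?N ?k (chain_eval ?N (\<Sum>ps\<in>weak_compositions (length gs) ?j. chain_sign (tC_tensor_sign ps gs) (frag_of (?tc (?Y ps)))))"
      unfolding Cons.IH[OF f(2) g(2) l(2)] by (simp only: hom_chain_eval[where I = "weak_compositions (length gs) ?j" and y = ?Y and s = "\<lambda>ps. tC_tensor_sign ps gs", OF h Y])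
    also have "\<dots> = chain_eval ?N (\<Sum>ps\<in>weak_compositions (length gs) ?j. chain_sign (?k + tC_tensor_sign ps gs) (frag_of (?tc (?Y ps))))"
      by (simp add: chain_eval_chain_sign[OF B.tensor_group, symmetric] chain_sign_sum chain_sign_chain_sign)
    finally have G: "?G i ?j (wdeg w) (pure_tensor R A w) =
      chain_eval ?N (\<Sum>ps\<in>weak_compositions (length gs) ?j. chain_sign (?k + tC_tensor_sign ps gs) (frag_of (?tc (?Y ps))))" .
    have "chain_eval ?N (chain_sign (int i * tdeg (ops_deg gs)) (frag_of (?G i ?j (wdeg w) (pure_tensor R A w)))) =
      chain_eval ?N (\<Sum>ps\<in>weak_compositions (length gs) ?j. chain_sign (int i * tdeg (ops_deg gs) + (?k + tC_tensor_sign ps gs)) (frag_of (?tc (?Y ps))))"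
      unfolding G N.chain_eval_chain_sign_frag_chain_eval by (simp add: chain_sign_sum chain_sign_chain_sign)
    also have "\<dots> = chain_eval ?N (\<Sum>ps\<in>weak_compositions (length gs) ?j. chain_sign (tC_tensor_sign (i # ps) (op # gs))
      (frag_of (gtensors R A B (entries (i # ps) (op # gs)) (wdeg w) (pure_tensor R A w))))"
    proof (rule N.chain_eval_sum_cong)
      fix ps assume P: "ps \<in> weak_compositions (length gs) ?j"
      then have ps: "length ps = length gs" "sum_list ps = ?j" by (auto simp: weak_compositions_def)
      note ep = entries_props[OF ps(1)]
      have "gtensors R A B (entries (i # ps) (op # gs)) (wdeg w) (pure_tensor R A w) = signed ?N ?k (?tc (?Y ps))"
        using gtensors_Cons_pure[OF tC_hom_entry[OF f(1)] entries_ok[OF ps(1) f(2)] g(1) l(1) g(2), of i] l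
        unfolding op entries_simps w by (simp only: ep ps(2) N[OF ij, unfolded w op])
      then show "chain_eval ?N (chain_sign (int i * tdeg (ops_deg gs) + (?k + tC_tensor_sign ps gs)) (frag_of (?tc (?Y ps)))) =
        chain_eval ?N (chain_sign (tC_tensor_sign (i # ps) (op # gs)) (frag_of (gtensors R A B (entries (i # ps) (op # gs)) (wdeg w) (pure_tensor R A w))))"
        using chain_eval_chain_sign_signed[OF B.tensor_group tcY[OF P], of "tC_tensor_sign (i # ps) (op # gs)" ?k] by (simp add: op algebra_simps)
    qed
    finally show "chain_eval ?N (chain_sign (int i * tdeg (ops_deg gs)) (frag_of (?G i ?j (wdeg w) (pure_tensor R A w)))) =
      chain_eval ?N (\<Sum>ps\<in>weak_compositions (length gs) ?j. chain_sign (tC_tensor_sign (i # ps) (op # gs))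
      (frag_of (gtensors R A B (entries (i # ps) (op # gs)) (wdeg w) (pure_tensor R A w))))" .
  qed
  finally show ?case by (simp only: length_Cons)
qed

lemma gtensors_zero:
  assumes "ops_ok R A B fs" "hword A w" "length w = ops_arity fs"
    and "(q, e, gzero (tensor_power R A q) B e) \<in> set fs"
  shows "gtensors R A B fs (wdeg w) (pure_tensor R A w) = \<zero>\<^bsub>tensor_power R B (length fs) (wdeg w + ops_deg fs)\<^esub>"
  using assms
proof (induction fs arbitrary: w)
  case (Cons op fs)
  obtain q' e' f where op: "op = (q', e', f)" by (cases op)
  define a c where "a = take q' w" and "c = drop q' w"
  have w: "w = a @ c" by (simp add: a_def c_def)
  have f: "f \<in> gmaps R (tensor_power R A q') B e'" "ops_ok R A B fs" using Cons.prems op by auto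
  have l: "length a = q'" "length c = ops_arity fs" using Cons.prems op by (auto simp: a_def c_def)
  have g: "hword A a" "hword A c" using Cons.prems w by auto
  have N: "wdeg a + e' + (wdeg c + ops_deg fs) = wdeg w + ops_deg (op # fs)" by (simp add: op w algebra_simps)
  note gp = gtensors_Cons_pure[OF f g(1) l(1) g(2) l(2), unfolded N, folded w op]
  have pa: "pure_tensor R A a \<in> carrier (tensor_power R A q' (wdeg a))" using A.pure_closed'[OF g(1), unfolded l] .
  show ?case
  proof (cases "op = (q, e, gzero (tensor_power R A q) B e)")
    case True
    then have "f (wdeg a) (pure_tensor R A a) = \<zero>\<^bsub>B (wdeg a + e')\<^esub>" using pa op by (simp add: gzero_def)
    then show ?thesis
      unfolding gp using B.tensor_cons_zero_left[OF gtensors_pure_closed[OF f(2) g(2) l(2)], of "wdeg a + e'"]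
      by (simp add: N signed_zero[OF B.tensor_group])
  next
    case False
    then have "gtensors R A B fs (wdeg c) (pure_tensor R A c) = \<zero>\<^bsub>tensor_power R B (length fs) (wdeg c + ops_deg fs)\<^esub>"
      using Cons.prems(4) by (intro Cons.IH[OF f(2) g(2) l(2)]) auto
    then show ?thesis
      unfolding gp using B.tensor_cons_zero[OF gmaps_closed[OF f(1) pa], of "length fs" "wdeg c + ops_deg fs"]
      by (simp add: N signed_zero[OF B.tensor_group])
  qed
qed simp

text \<open>Signs of single factors collect into one sign in front. The relation pairs each modified
  factor with its exponent and the original factor. Degrees, arities, lengths and well-typedness are
  carried in the conclusion because the induction step needs them.\<close>

lemma gtensors_signed:
  assumes "list_all2 (\<lambda>(q', e', f') (n, q, e, f). q' = q \<and> e' = e \<and>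
      f' \<in> gmaps R (tensor_power R A q) B e \<and> f \<in> gmaps R (tensor_power R A q) B e \<and>
      (\<forall>d. \<forall>X\<in>carrier (tensor_power R A q d). f' d X = signed (B (d + e)) n (f d X))) fs' nfs"
    and "hword A w" "length w = ops_arity (map snd nfs)"
  shows "gtensors R A B fs' (wdeg w) (pure_tensor R A w) =
    signed (tensor_power R B (length nfs) (wdeg w + ops_deg (map snd nfs))) (sum_list (map fst nfs))
      (gtensors R A B (map snd nfs) (wdeg w) (pure_tensor R A w)) \<and>
    ops_deg fs' = ops_deg (map snd nfs) \<and> ops_arity fs' = ops_arity (map snd nfs) \<and> length fs' = length nfs \<and>
    ops_ok R A B fs' \<and> ops_ok R A B (map snd nfs)"
  using assms
proof (induction fs' nfs arbitrary: w rule: list_all2_induct)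
  case (Cons op' fs' nop nfs)
  obtain n q e f where nop: "nop = (n, q, e, f)" by (cases nop)
  obtain f' where op': "op' = (q, e, f')" using Cons.hyps(1) nop by (cases op') auto
  have f: "f' \<in> gmaps R (tensor_power R A q) B e" "f \<in> gmaps R (tensor_power R A q) B e"
    and ff: "\<And>d X. X \<in> carrier (tensor_power R A q d) \<Longrightarrow> f' d X = signed (B (d + e)) n (f d X)"
    using Cons.hyps(1) nop op' by auto
  let ?fs = "map snd nfs"
  define a c where "a = take q w" and "c = drop q w"
  have w: "w = a @ c" by (simp add: a_def c_def)
  have l: "length a = q" "length c = ops_arity ?fs" using Cons.prems nop by (auto simp: a_def c_def)
  have g: "hword A a" "hword A c" using Cons.prems w by auto
  note IH = Cons.IH[OF g(2) l(2)]
  then have ok: "ops_ok R A B fs'" "ops_ok R A B ?fs" and d: "ops_deg fs' = ops_deg ?fs"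
    "ops_arity fs' = ops_arity ?fs" "length fs' = length nfs" by auto
  have pa: "pure_tensor R A a \<in> carrier (tensor_power R A q (wdeg a))" using A.pure_closed'[OF g(1), unfolded l] .
  have N: "wdeg a + e + (wdeg c + ops_deg ?fs) = wdeg w + ops_deg (map snd (nop # nfs))" by (simp add: nop w algebra_simps)
  let ?N = "tensor_power R B (length (nop # nfs)) (wdeg w + ops_deg (map snd (nop # nfs)))"
  let ?b = "f (wdeg a) (pure_tensor R A a)" and ?Y = "gtensors R A B ?fs (wdeg c) (pure_tensor R A c)"
  let ?tc = "tensor_cons R B (length nfs) (wdeg a + e)"
  have b: "?b \<in> carrier (B (wdeg a + e))" by (rule gmaps_closed[OF f(2) pa])
  have Y: "?Y \<in> carrier (tensor_power R B (length nfs) (wdeg c + ops_deg ?fs))"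
    using gtensors_pure_closed[OF ok(2) g(2) l(2)] by simp
  have tY: "?tc ?b (wdeg c + ops_deg ?fs) ?Y \<in> carrier ?N"
    using B.tensor_cons_linear(1)[OF b Y] by (simp add: N)
  let ?m = "sum_list (map fst nfs)"
  have "gtensors R A B (op' # fs') (wdeg w) (pure_tensor R A w) =
    signed ?N (bdot (ops_deg ?fs) (wdeg a)) (?tc (signed (B (wdeg a + e)) n ?b) (wdeg c + ops_deg ?fs)
      (signed (tensor_power R B (length nfs) (wdeg c + ops_deg ?fs)) ?m ?Y))"
    using gtensors_Cons_pure[OF f(1) ok(1) g(1) l(1) g(2)] l IH ff[OF pa] unfolding op' w d
    by (simp add: N[unfolded w])
  also have "\<dots> = signed ?N (bdot (ops_deg ?fs) (wdeg a)) (signed ?N n (signed ?N ?m (?tc ?b (wdeg c + ops_deg ?fs) ?Y)))"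
    using B.tensor_cons_signed_left[OF b signed_closed[OF B.tensor_group Y], of n ?m] B.tensor_cons_signed[OF b Y, of ?m]
    by (simp add: N)
  also have "\<dots> = signed ?N (n + ?m) (signed ?N (bdot (ops_deg ?fs) (wdeg a)) (?tc ?b (wdeg c + ops_deg ?fs) ?Y))"
    using tY by (simp only: signed_signed[OF B.tensor_group] signed_closed[OF B.tensor_group] ac_simps)
  also have "signed ?N (bdot (ops_deg ?fs) (wdeg a)) (?tc ?b (wdeg c + ops_deg ?fs) ?Y) =
      gtensors R A B (map snd (nop # nfs)) (wdeg w) (pure_tensor R A w)"
    using gtensors_Cons_pure[OF f(2) ok(2) g(1) l(1) g(2) l(2)] unfolding nop w by (simp add: N[unfolded w nop])
  finally show ?case using ok d f by (simp add: nop op')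
qed (use A.pure_closed'[of "[]"] in \<open>simp add: gid_def\<close>)

end

section \<open>Comparison of the two kinds of structure equations\<close>

text \<open>With all p equal to 0 the two exponents differ only at the last position j, where
  \<open>sgn_dA\<close> has the even term 2 j q_j.\<close>

lemma even_sgn_tC: "even (int (sgn_tC qs) - int (sgn_dA (replicate (length qs) 0) qs))"
proof (cases "length qs")
  case 0 then show ?thesis by (simp add: sgn_tC_def sgn_dA_def)
next
  case (Suc n)
  let ?f = "\<lambda>k. qs ! (k - 1) * (length qs + k) + qs ! (k - 1) * (\<Sum>s = k + 1..length qs. qs ! (s - 1))"
  have "sgn_dA (replicate (length qs) 0) qs = (\<Sum>k = 1..length qs. ?f k)"
    unfolding sgn_dA_def Let_def by (intro sum.cong) (auto intro!: sum.cong)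
  also have "{1..length qs} = insert (length qs) {1..<length qs}" using Suc by auto
  also have "(\<Sum>k\<in>insert (length qs) {1..<length qs}. ?f k) = sgn_tC qs + 2 * (qs ! (length qs - 1) * length qs)"
    by (simp add: sgn_tC_def Let_def)
  finally show ?thesis by simp
qed

text \<open>The exponent that the inner components contribute through their factors
  (-1)^(pq).\<close>

fun pq_sum :: "nat list \<Rightarrow> nat list \<Rightarrow> int" where
  "pq_sum (p # ps) (q # qs) = int (p * q) + pq_sum ps qs"
| "pq_sum _ _ = 0"

definition tC_map_ops :: "(nat \<Rightarrow> 'f) \<Rightarrow> nat list \<Rightarrow> 'f op list" where
  "tC_map_ops G qs = map (\<lambda>q. (q, (0, 1 - int q), G q)) qs"

lemma tC_map_ops_simps [simp]: "tC_map_ops G [] = []" "tC_map_ops G (q # qs) = (q, (0, 1 - int q), G q) # tC_map_ops G qs"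
  by (simp_all add: tC_map_ops_def)

lemma tC_map_ops_props: "length (tC_map_ops G qs) = length qs" "ops_arity (tC_map_ops G qs) = sum_list qs"
  "ops_deg (tC_map_ops G qs) = (0, int (length qs) - int (sum_list qs))"
  by (induction qs) (simp_all add: zero_prod_def)

text \<open>Compares the derived exponent with the one for p = 0, which has the parity of
  \<open>sgn_tC\<close>. The difference consists of the tensor sign, the factors (-1)^(pq) of the
  components, and the product of the sum of the p with the sum of the q, which is part of the global
  exponent uv.\<close>

lemma sign_tC_post:
  assumes "length ps = length qs"
  shows "even (int (sgn_dA (replicate (length qs) 0) qs) + int (sgn_dA ps qs) + tC_tensor_sign ps (tC_map_ops G qs) +
    int (sum_list ps) * int (sum_list qs) + pq_sum ps qs)"
  using assms
proof (induction ps qs rule: list_induct2)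
  case Nil show ?case by (simp add: sgn_dA_def)
next
  case (Cons p ps q qs)
  define L P Q P' Q' where "L = int (length qs)" and "P = int (sum_list ps)" and "Q = int (sum_list qs)"
    and "P' = int p" and "Q' = int q"
  note d = this
  let ?z = "replicate (length qs) (0::nat)"
  let ?IH = "int (sgn_dA ?z qs) + int (sgn_dA ps qs) + tC_tensor_sign ps (tC_map_ops G qs) + P * Q + pq_sum ps qs"
  let ?S = "int (sgn_dA ps qs) + (P' + Q') * L + Q' * (P + Q)"
  let ?T = "int (sgn_dA ?z qs) + Q' * L + Q' * Q"
  have s1: "even (int (sgn_dA (p # ps) (q # qs)) - ?S)"
    using sgn_dA_Cons[OF Cons.hyps, of p q] by (simp only: d)
  have s0: "even (int (sgn_dA (0 # ?z) (q # qs)) - ?T)"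
    using sgn_dA_Cons[of ?z qs 0 q] by (simp add: d sum_list_replicate)
  have IH: "even ?IH" using Cons.IH by (simp only: d)
  have "int (sgn_dA (replicate (length (q # qs)) 0) (q # qs)) + int (sgn_dA (p # ps) (q # qs)) +
      tC_tensor_sign (p # ps) (tC_map_ops G (q # qs)) + int (sum_list (p # ps)) * int (sum_list (q # qs)) + pq_sum (p # ps) (q # qs) =
    ?IH + (int (sgn_dA (p # ps) (q # qs)) - ?S) + (int (sgn_dA (0 # ?z) (q # qs)) - ?T) +
    2 * (Q' * L + Q' * Q + P' * L + Q' * P + P' * Q')"
    by (simp add: tC_map_ops_props tdeg_def d algebra_simps)
  also have "even \<dots>" by (intro dvd_add IH s1 s0 dvd_triv_left)
  finally show ?case .
qed

text \<open>Compositions occur in \<open>post_index\<close> with all indices 0, and the finiteness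
  of that set is known.\<close>

lemma finite_compositions: "finite (compositions v)"
proof (rule finite_subset)
  show "compositions v \<subseteq> (\<lambda>(i, ps, qs). qs) ` post_index 0 v"
  proof
    fix qs assume "qs \<in> compositions v"
    then have "(0, replicate (length qs) 0, qs) \<in> post_index 0 v"
      by (simp add: post_index_def sum_list_replicate)
    then show "qs \<in> (\<lambda>(i, ps, qs). qs) ` post_index 0 v" by force
  qed
qed (simp add: finite_post_index)

lemma sum_post_index:
  "(\<Sum>(i, ps, qs)\<in>post_index u v. F i ps qs) =
   (\<Sum>qs\<in>compositions v. \<Sum>i\<le>u. \<Sum>ps\<in>weak_compositions (length qs) (u - i). F i ps qs)"
proof -
  have "(\<Sum>qs\<in>compositions v. \<Sum>i\<le>u. \<Sum>ps\<in>weak_compositions (length qs) (u - i). F i ps qs) =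
    (\<Sum>(qs, i, ps)\<in>(SIGMA qs:compositions v. SIGMA i:{..u}. weak_compositions (length qs) (u - i)). F i ps qs)"
    by (simp add: sum.Sigma finite_compositions finite_weak_compositions)
  also have "\<dots> = (\<Sum>(i, ps, qs)\<in>post_index u v. F i ps qs)"
    by (rule sum.reindex_bij_witness[of _ "\<lambda>(i, ps, qs). (qs, i, ps)" "\<lambda>(qs, i, ps). (i, ps, qs)"])
       (auto simp: post_index_def weak_compositions_def)
  finally show ?thesis by simp
qed

section \<open>The sign change on families and its inverse\<close>

lemma entry_deg_0: "entry_deg (0, k - int j) i = (- int i, k - int i - int j)"
  by (simp add: entry_deg_def)

definition tC_family :: "('r, 's) ring_scheme \<Rightarrow> ('r, 'a) bgmod \<Rightarrow> ('r, 'b) bgmod \<Rightarrow> int \<Rightarrow>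
    (nat \<Rightarrow> nat \<Rightarrow> (('a, 'r) tens, 'b) gmap) \<Rightarrow> bool" where
  "tC_family R A B k F \<longleftrightarrow> (\<forall>j\<ge>1. F j \<in> tC_hom R (tensor_power R A j) B (0, k - int j))"

lemma tC_family_entry: "tC_family R A B k F \<Longrightarrow> 1 \<le> j \<Longrightarrow>
    F j i \<in> gmaps R (tensor_power R A j) B (- int i, k - int i - int j)"
  using tC_hom_entry[of "F j" R "tensor_power R A j" B "(0, k - int j)" i] by (simp add: tC_family_def entry_deg_0)

text \<open>With k = 2 this is the sign change on structures, with k = 1 the one on
  morphisms.\<close>

definition psi :: "('r, 's) ring_scheme \<Rightarrow> ('r, 'a) bgmod \<Rightarrow> ('r, 'b) bgmod \<Rightarrow> int \<Rightarrow>
    (nat \<Rightarrow> nat \<Rightarrow> (('a, 'r) tens, 'b) gmap) \<Rightarrow> nat \<times> nat \<Rightarrow> (('a, 'r) tens, 'b) gmap" where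
  "psi R A B k F = (\<lambda>(i, j)\<in>UNIV \<times> {1..}.
     gsigned (tensor_power R A j) B (- int i, k - int i - int j) (int (i * j)) (F j i))"

text \<open>The factor is the one of \<open>psi\<close>, being its own inverse; what changes is the
  order of the indices and the index set on which the family is extensional.\<close>

definition unpsi :: "('r, 's) ring_scheme \<Rightarrow> ('r, 'a) bgmod \<Rightarrow> ('r, 'b) bgmod \<Rightarrow> int \<Rightarrow>
    (nat \<times> nat \<Rightarrow> (('a, 'r) tens, 'b) gmap) \<Rightarrow> nat \<Rightarrow> nat \<Rightarrow> (('a, 'r) tens, 'b) gmap" where
  "unpsi R A B k f = (\<lambda>j\<in>{1..}. \<lambda>i.
     gsigned (tensor_power R A j) B (- int i, k - int i - int j) (int (i * j)) (f (i, j)))"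

lemma psi_apply: "1 \<le> j \<Longrightarrow> psi R A B k F (i, j) =
    gsigned (tensor_power R A j) B (- int i, k - int i - int j) (int (i * j)) (F j i)"
  by (simp add: psi_def)

lemma unpsi_apply: "1 \<le> j \<Longrightarrow> unpsi R A B k f j i =
    gsigned (tensor_power R A j) B (- int i, k - int i - int j) (int (i * j)) (f (i, j))"
  by (simp add: unpsi_def)

lemma gsigned_gsigned:
  assumes "\<And>d. abelian_group (B d)" "f \<in> gmaps R A B e"
  shows "gsigned A B e m (gsigned A B e n f) = gsigned A B e (m + n) f"
  unfolding gsigned_def
  by (intro ext) (auto simp: signed_signed[OF assms(1)] gmaps_closed[OF assms(2)])

lemma gsigned_even:
  assumes "f \<in> gmaps R A B e" "even n"
  shows "gsigned A B e n f = f"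
  unfolding gsigned_def signed_def using assms(2) gmaps_undefined[OF assms(1)] by (intro ext) (auto simp: restrict_def)

text \<open>The sign is an involution on maps of the given bidegree.\<close>

lemma gsigned_inj:
  assumes B: "\<And>d. abelian_group (B d)" and f: "f \<in> gmaps R A B e" and g: "g \<in> gmaps R A B e"
  shows "gsigned A B e n f = gsigned A B e n g \<longleftrightarrow> f = g"
proof
  assume "gsigned A B e n f = gsigned A B e n g"
  then have "gsigned A B e n (gsigned A B e n f) = gsigned A B e n (gsigned A B e n g)" by simp
  then show "f = g"
    unfolding gsigned_gsigned[OF B f] gsigned_gsigned[OF B g] by (simp add: gsigned_even[OF f] gsigned_even[OF g])
qed simp

lemma gsigned_gzero: "(\<And>d. abelian_group (B d)) \<Longrightarrow> gsigned A B e n (gzero A B e) = gzero A B e"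
  unfolding gsigned_def gzero_def by (intro ext) (auto simp: signed_zero restrict_def)

lemma gmaps_chain_eval:
  assumes "f \<in> gmaps R A B e" "abelian_group (A d)" "abelian_group (B (d + e))"
    and "\<And>k. k \<in> I \<Longrightarrow> y k \<in> carrier (A d)"
  shows "f d (chain_eval (A d) (\<Sum>k\<in>I. chain_sign (s k) (frag_of (y k)))) = chain_eval (B (d + e)) (\<Sum>k\<in>I. chain_sign (s k) (frag_of (f d (y k))))"
  by (rule hom_chain_eval[OF gmaps_abelian_group_hom[OF assms(1-3)] assms(4)])

lemma tC_comp_gmaps:
  assumes A: "\<And>d. module R (A d)" and C: "\<And>d. module R (C d)"
    and f: "f \<in> tC_hom R B C ef" and g: "\<And>n. g n \<in> gmaps R A B (entry_deg eg n)"
  shows "tC_comp A C ef eg f g u \<in> gmaps R A C (entry_deg (ef + eg) u)"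
  unfolding tC_comp_def
  by (rule gsum_gmaps[OF A C])
     (auto intro!: gcomp_gmaps[OF A tC_hom_entry[OF f] g] simp: entry_deg_add add.commute)

lemma tC_comp_chain_eval:
  assumes A: "\<And>d. module R (A d)" and C: "\<And>d. module R (C d)"
    and f: "f \<in> tC_hom R B C ef" and g: "\<And>n. g n \<in> gmaps R A B (entry_deg eg n)"
    and x: "x \<in> carrier (A d)"
  shows "tC_comp A C ef eg f g u d x = chain_eval (C (d + entry_deg (ef + eg) u))
    (\<Sum>i\<le>u. chain_sign (int i * tdeg eg) (frag_of (f i (d + entry_deg eg (u - i)) (g (u - i) d x))))"
proof -
  have gc: "gcomp A (entry_deg eg j) (f i) (g j) \<in> gmaps R A C (entry_deg (ef + eg) u)" if "i + j = u" for i j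
    by (rule gcomp_gmaps[OF A tC_hom_entry[OF f] g]) (use that in \<open>simp add: entry_deg_add add.commute\<close>)
  have "tC_comp A C ef eg f g u d x = chain_eval (C (d + entry_deg (ef + eg) u))
    (\<Sum>y\<in>{(i, j). i + j = u}. chain_sign ((\<lambda>(i, j). int i * tdeg eg) y)
       (frag_of ((\<lambda>(i, j). gcomp A (entry_deg eg j) (f i) (g j)) y d x)))"
    unfolding tC_comp_def
    by (rule gsum_chain_eval[where A = A, OF module_abelian_group[OF C] _ x]) (use gmaps_closed[OF gc x] in auto)
  then show ?thesis by (simp add: sum_antidiagonal gcomp_apply[where A = A, OF x])
qed

context bigraded_pair
begin

lemma psi_PiE:
  assumes "tC_family R A B k F"
  shows "psi R A B k F \<in> (\<Pi>\<^sub>E (i, j)\<in>UNIV \<times> {1..}. gmaps R (tensor_power R A j) B (- int i, k - int i - int j))"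
  unfolding psi_def using gsigned_gmaps[OF A.tensor_module B.A_module tC_family_entry[OF assms]]
  by (auto simp: PiE_def Pi_def extensional_def)

lemma psi_derived_family: "tC_family R A B k F \<Longrightarrow> derived_family R A B k (psi R A B k F)"
  by (rule derived_familyI[OF psi_PiE])

lemma unpsi_PiE:
  assumes "derived_family R A B k f"
  shows "unpsi R A B k f \<in> (\<Pi>\<^sub>E j\<in>{1..}. tC_hom R (tensor_power R A j) B (0, k - int j))"
  unfolding unpsi_def tC_hom_def
  using assms gsigned_gmaps[OF A.tensor_module B.A_module]
  by (auto simp: PiE_def Pi_def extensional_def entry_deg_0 derived_family_def)

lemma tC_familyI: "F \<in> (\<Pi>\<^sub>E j\<in>{1..}. tC_hom R (tensor_power R A j) B (0, k - int j)) \<Longrightarrow> tC_family R A B k F"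
  by (auto simp: tC_family_def dest: PiE_mem)

lemma psi_unpsi:
  assumes f: "f \<in> (\<Pi>\<^sub>E (i, j)\<in>UNIV \<times> {1..}. gmaps R (tensor_power R A j) B (- int i, k - int i - int j))"
  shows "psi R A B k (unpsi R A B k f) = f"
proof (rule PiE_ext[OF psi_PiE[OF tC_familyI[OF unpsi_PiE[OF derived_familyI[OF f]]]] f])
  fix x :: "nat \<times> nat" assume "x \<in> UNIV \<times> {1..}"
  then obtain i j where x: "x = (i, j)" "1 \<le> j" by auto
  have fm: "f (i, j) \<in> gmaps R (tensor_power R A j) B (- int i, k - int i - int j)"
    using derived_familyI[OF f] x by (simp add: derived_family_def)
  show "psi R A B k (unpsi R A B k f) x = f x"
    unfolding x(1) psi_apply[OF x(2)] unpsi_apply[OF x(2)] gsigned_gsigned[OF B.A_group fm]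
    by (simp add: gsigned_even[OF fm])
qed

lemma unpsi_psi:
  assumes F: "F \<in> (\<Pi>\<^sub>E j\<in>{1..}. tC_hom R (tensor_power R A j) B (0, k - int j))"
  shows "unpsi R A B k (psi R A B k F) = F"
proof (rule PiE_ext[OF unpsi_PiE[OF psi_derived_family[OF tC_familyI[OF F]]] F])
  fix j :: nat assume "j \<in> {1..}"
  then have j: "1 \<le> j" by simp
  show "unpsi R A B k (psi R A B k F) j = F j"
  proof
    fix i
    note fm = tC_family_entry[OF tC_familyI[OF F] j, of i]
    show "unpsi R A B k (psi R A B k F) j i = F j i"
      unfolding psi_apply[OF j] unpsi_apply[OF j] gsigned_gsigned[OF B.A_group fm]
      by (simp add: gsigned_even[OF fm])
  qed
qed

end

section \<open>Composites on the two sides\<close>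

lemma tC_map_ops_ok:
  assumes "tC_family R A B 1 G" "\<forall>q\<in>set qs. 1 \<le> q"
  shows "tC_ok R A B (tC_map_ops G qs)"
  using assms(2) by (induction qs) (use assms(1) in \<open>simp_all add: tC_family_def\<close>)

lemma entries_tC_map_ops:
  "length ps = length qs \<Longrightarrow> entries ps (tC_map_ops G qs) = map_ops (\<lambda>(p, q). G q p) ps qs"
  by (induction ps qs rule: list_induct2) (simp_all add: entry_deg_0)

context bigraded_triple
begin

context
  fixes H G k
  assumes H: "tC_family R B C k H" and G: "tC_family R A B 1 G"
begin

lemma gtensors_psi:
  assumes l: "length ps = length qs" and q: "\<forall>q\<in>set qs. 1 \<le> q" and w: "hword A w" "length w = sum_list qs"
  shows "gtensors R A B (map_ops (psi R A B 1 G) ps qs) (wdeg w) (pure_tensor R A w) =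
    signed (tensor_power R B (length qs) (wdeg w + ops_deg (map_ops (psi R A B 1 G) ps qs))) (pq_sum ps qs)
      (gtensors R A B (entries ps (tC_map_ops G qs)) (wdeg w) (pure_tensor R A w))"
proof -
  \<comment> \<open>Each factor is paired with its exponent pq, in the form that
    \<open>gtensors_signed\<close> expects.\<close>
  define nfs where "nfs = map (\<lambda>(p, q). (int (p * q), q, (- int p, 1 - int p - int q), G q p)) (zip ps qs)"
  have snd_nfs: "map snd nfs = entries ps (tC_map_ops G qs)"
    unfolding entries_tC_map_ops[OF l] nfs_def map_ops_def by (simp add: case_prod_beta comp_def)
  have fst_nfs: "sum_list (map fst nfs) = pq_sum ps qs"
    using l unfolding nfs_def by (induction ps qs rule: list_induct2) simp_all
  have len: "length nfs = length qs" using l by (simp add: nfs_def)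
  have rel: "list_all2 (\<lambda>(q', e', f') (n, q, e, f). q' = q \<and> e' = e \<and>
      f' \<in> gmaps R (tensor_power R A q) B e \<and> f \<in> gmaps R (tensor_power R A q) B e \<and>
      (\<forall>d. \<forall>X\<in>carrier (tensor_power R A q d). f' d X = signed (B (d + e)) n (f d X)))
      (map_ops (psi R A B 1 G) ps qs) nfs"
    using l q unfolding nfs_def
  proof (induction ps qs rule: list_induct2)
    case (Cons p ps q qs)
    then have q: "1 \<le> q" by simp
    note fm = tC_family_entry[OF G q, of p]
    show ?case using Cons fm psi_apply[OF q, of R A B 1 G p]
      by (simp add: gsigned_gmaps[OF AB.A.tensor_module AB.B.A_module fm] gsigned_apply)
  qed simp
  have ar: "length w = ops_arity (map snd nfs)"
    unfolding snd_nfs using w l by (simp add: entries_props tC_map_ops_props)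
  have "ops_deg (map_ops (psi R A B 1 G) ps qs) = ops_deg (map snd nfs)"
    using AB.gtensors_signed[OF rel w(1) ar] by blast
  then show ?thesis
    using conjunct1[OF AB.gtensors_signed[OF rel w(1) ar]] unfolding snd_nfs fst_nfs len by simp
qed

lemma tC_postcomp_gmaps:
  assumes v: "1 \<le> v"
  shows "tC_postcomp R A B C k H G v u \<in> gmaps R (tensor_power R A v) C (- int u, k - int u - int v)"
  unfolding tC_postcomp_def tC_sum_def entry_deg_0 Let_def tC_map_ops_def[symmetric]
proof (rule gsum_gmaps[OF AB.A.tensor_module C.A_module])
  fix qs assume "qs \<in> compositions v"
  then have s: "sum_list qs = v" and q: "\<forall>q\<in>set qs. 1 \<le> q" by (auto simp: compositions_def)
  have L: "1 \<le> length qs" using s v by (cases qs) auto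
  have "tC_comp (tensor_power R A v) C (0, k - int (length qs)) (ops_deg (tC_map_ops G qs)) (H (length qs)) (tC_tensors R A B (tC_map_ops G qs)) u
     \<in> gmaps R (tensor_power R A v) C (entry_deg ((0, k - int (length qs)) + ops_deg (tC_map_ops G qs)) u)"
    using H L AB.tC_tensors_gmaps[OF tC_map_ops_ok[OF G q]] s
    by (intro tC_comp_gmaps[OF AB.A.tensor_module C.A_module, of _ "tensor_power R B (length qs)"])
       (simp_all add: tC_family_def tC_map_ops_props)
  then show "tC_comp (tensor_power R A v) C (0, k - int (length qs)) (ops_deg (tC_map_ops G qs)) (H (length qs)) (tC_tensors R A B (tC_map_ops G qs)) u
     \<in> gmaps R (tensor_power R A v) C (- int u, k - int u - int v)"
    using entry_deg_0[of k v u] by (simp add: tC_map_ops_props s)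
qed

text \<open>The number \<open>\<epsilon>\<close> occurs in front and inside
  \<open>dA_postcomp\<close>, so it can be chosen freely: 0 fits composition, u the morphism
  equation. With u = i + (sum of the p) and v = (sum of the q), the exponent uv is iv plus the
  product of the two sums. The first term comes from the exponent i(L - v) of the composition and
  the factor (-1)^(iL) of the outer map of arity L; the second is the one in
  \<open>sign_tC_post\<close>.\<close>

theorem tC_postcomp_eq:
  assumes v: "1 \<le> v"
  shows "tC_postcomp R A B C k H G v u = gsigned (tensor_power R A v) C (- int u, k - int u - int v)
    (int (u * v) + int \<epsilon>) (dA_postcomp R A B C k \<epsilon> (psi R B C k H) (psi R A B 1 G) u v)"
proof (rule AB.A.gmaps_pure_ext[OF C.A_module tC_postcomp_gmaps[OF v]])
  note h = BC.psi_derived_family[OF H] and g = AB.psi_derived_family[OF G]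
  note post = dA_postcomp_gmaps[OF h g v, of \<epsilon> u]
  show "gsigned (tensor_power R A v) C (- int u, k - int u - int v)
    (int (u * v) + int \<epsilon>) (dA_postcomp R A B C k \<epsilon> (psi R B C k H) (psi R A B 1 G) u v)
    \<in> gmaps R (tensor_power R A v) C (- int u, k - int u - int v)"
    by (rule gsigned_gmaps[OF AB.A.tensor_module C.A_module post])
  fix w assume w: "hword A w" "length w = v"
  have ed: "wdeg w + (- int u, k - int u - int v) = outdeg k u w" by (simp add: outdeg_eq w)
  let ?N = "C (outdeg k u w)"
  interpret N: abelian_group ?N by (rule C.A_group)
  have pw: "pure_tensor R A w \<in> carrier (tensor_power R A v (wdeg w))"
    using AB.A.pure_closed'[OF w(1)] w(2) by simp
  let ?X = "pure_tensor R A w"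
  \<comment> \<open>The value of one summand without the signs under comparison; both sides are
    expanded in these values.\<close>
  let ?t = "\<lambda>i ps qs. H (length qs) i (wdeg w + ops_deg (entries ps (tC_map_ops G qs))) (gtensors R A B (entries ps (tC_map_ops G qs)) (wdeg w) ?X)"
  have trm: "?t i ps qs \<in> carrier ?N"
    and deg: "ops_deg (entries ps (tC_map_ops G qs)) = entry_deg (ops_deg (tC_map_ops G qs)) (u - i)"
    and Y: "gtensors R A B (entries ps (tC_map_ops G qs)) (wdeg w) ?X \<in>
      carrier (tensor_power R B (length qs) (wdeg w + ops_deg (entries ps (tC_map_ops G qs))))"
    and dA: "gcomp (tensor_power R A v) (ops_deg (map_ops (psi R A B 1 G) ps qs)) (psi R B C k H (i, length qs))
        (gtensors R A B (map_ops (psi R A B 1 G) ps qs)) (wdeg w) ?X =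
      signed ?N (int (i * length qs) + pq_sum ps qs) (?t i ps qs)"
    and dd: "wdeg w + ops_deg (entries ps (tC_map_ops G qs)) + (- int i, k - int i - int (length qs)) = outdeg k u w"
    if "(i, ps, qs) \<in> post_index u v" for i ps qs
  proof -
    have l: "length ps = length qs" and s: "sum_list qs = v" and q: "\<forall>q\<in>set qs. 1 \<le> q" and u: "u = i + sum_list ps"
      using that by (auto simp: post_index_def compositions_def)
    have L: "1 \<le> length qs" using s v by (cases qs) auto
    have l': "length ps = length (tC_map_ops G qs)" using l by (simp add: tC_map_ops_props)
    note ep = entries_props[OF l'] and ok = tC_map_ops_ok[OF G q]
    show deg: "ops_deg (entries ps (tC_map_ops G qs)) = entry_deg (ops_deg (tC_map_ops G qs)) (u - i)"
      using ep u by simp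
    have hword: "ops_deg (map_ops (psi R A B 1 G) ps qs) = ops_deg (entries ps (tC_map_ops G qs))"
      unfolding entries_tC_map_ops[OF l] by (simp add: map_ops_props[OF l])
    show Y: "gtensors R A B (entries ps (tC_map_ops G qs)) (wdeg w) ?X \<in>
      carrier (tensor_power R B (length qs) (wdeg w + ops_deg (entries ps (tC_map_ops G qs))))"
      using AB.gtensors_pure_closed[OF entries_ok[OF l' ok] w(1)] w(2) s ep by (simp add: tC_map_ops_props)
    show dd: "wdeg w + ops_deg (entries ps (tC_map_ops G qs)) + (- int i, k - int i - int (length qs)) = outdeg k u w"
      unfolding entries_tC_map_ops[OF l] map_ops_props[OF l] outdeg_eq using u s w by (simp add: prod_eq_iff)
    show trm: "?t i ps qs \<in> carrier ?N"
      using gmaps_closed[OF tC_family_entry[OF H L, of i] Y] unfolding dd .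
    have "gcomp (tensor_power R A v) (ops_deg (map_ops (psi R A B 1 G) ps qs)) (psi R B C k H (i, length qs))
        (gtensors R A B (map_ops (psi R A B 1 G) ps qs)) (wdeg w) ?X =
      psi R B C k H (i, length qs) (wdeg w + ops_deg (entries ps (tC_map_ops G qs)))
       (signed (tensor_power R B (length qs) (wdeg w + ops_deg (entries ps (tC_map_ops G qs)))) (pq_sum ps qs)
          (gtensors R A B (entries ps (tC_map_ops G qs)) (wdeg w) ?X))"
      unfolding gcomp_apply[where A = "tensor_power R A v", OF pw]
      using gtensors_psi[OF l q w(1)] w(2) s by (simp add: hword)
    also have "\<dots> = signed ?N (int (i * length qs)) (signed ?N (pq_sum ps qs) (?t i ps qs))"
      unfolding psi_apply[OF L] gsigned_apply[of _ "tensor_power R B (length qs)", OF signed_closed[OF AB.B.tensor_group Y]] dd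
      using gmaps_signed[OF tC_family_entry[OF H L, of i] AB.B.tensor_group C.A_group Y, of "pq_sum ps qs"] unfolding dd by simp
    finally show "gcomp (tensor_power R A v) (ops_deg (map_ops (psi R A B 1 G) ps qs)) (psi R B C k H (i, length qs))
        (gtensors R A B (map_ops (psi R A B 1 G) ps qs)) (wdeg w) ?X =
      signed ?N (int (i * length qs) + pq_sum ps qs) (?t i ps qs)"
      by (simp add: signed_signed[OF C.A_group trm])
  qed
  have pc: "gcomp (tensor_power R A v) (ops_deg (map_ops (psi R A B 1 G) ps qs)) (psi R B C k H (i, length qs))
        (gtensors R A B (map_ops (psi R A B 1 G) ps qs)) (wdeg w) ?X \<in> carrier ?N"
    if "(i, ps, qs) \<in> post_index u v" for i ps qs
    unfolding dA[OF that] by (rule signed_closed[OF C.A_group trm[OF that]])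
  let ?comp = "\<lambda>qs. tC_comp (tensor_power R A v) C (0, k - int (length qs)) (ops_deg (tC_map_ops G qs)) (H (length qs)) (tC_tensors R A B (tC_map_ops G qs)) u"
  have comp: "?comp qs (wdeg w) ?X = chain_eval ?N (\<Sum>i\<le>u. \<Sum>ps\<in>weak_compositions (length qs) (u - i).
      chain_sign (int i * tdeg (ops_deg (tC_map_ops G qs)) + tC_tensor_sign ps (tC_map_ops G qs)) (frag_of (?t i ps qs)))"
    and compc: "?comp qs (wdeg w) ?X \<in> carrier ?N"
    if "qs \<in> compositions v" for qs
  proof -
    have s: "sum_list qs = v" and q: "\<forall>q\<in>set qs. 1 \<le> q" using that by (auto simp: compositions_def)
    have L: "1 \<le> length qs" using s v by (cases qs) auto
    note ok = tC_map_ops_ok[OF G q]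
    have "(0, k - int (length qs)) + ops_deg (tC_map_ops G qs) = (0, k - int v)" by (simp add: tC_map_ops_props s)
    then have e: "wdeg w + entry_deg ((0, k - int (length qs)) + ops_deg (tC_map_ops G qs)) u = outdeg k u w"
      using ed by (simp only: entry_deg_0)
    have tg: "tC_tensors R A B (tC_map_ops G qs) n \<in> gmaps R (tensor_power R A v) (tensor_power R B (length qs)) (entry_deg (ops_deg (tC_map_ops G qs)) n)" for n
      using AB.tC_tensors_gmaps[OF ok, of n] by (simp add: tC_map_ops_props s)
    have "H (length qs) \<in> tC_hom R (tensor_power R B (length qs)) C (0, k - int (length qs))"
      using H L by (simp add: tC_family_def)
    from tC_comp_chain_eval[OF AB.A.tensor_module C.A_module this tg pw, of u, unfolded e]
    have c: "?comp qs (wdeg w) ?X = chain_eval ?N (\<Sum>i\<le>u. chain_sign (int i * tdeg (ops_deg (tC_map_ops G qs))) (frag_of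
       (H (length qs) i (wdeg w + entry_deg (ops_deg (tC_map_ops G qs)) (u - i)) (tC_tensors R A B (tC_map_ops G qs) (u - i) (wdeg w) ?X))))" .
    then show "?comp qs (wdeg w) ?X \<in> carrier ?N" by simp
    show "?comp qs (wdeg w) ?X = chain_eval ?N (\<Sum>i\<le>u. \<Sum>ps\<in>weak_compositions (length qs) (u - i).
      chain_sign (int i * tdeg (ops_deg (tC_map_ops G qs)) + tC_tensor_sign ps (tC_map_ops G qs)) (frag_of (?t i ps qs)))"
      unfolding c
    proof (rule N.chain_eval_sum_cong)
      fix i assume i: "i \<in> {..u}"
      let ?d = "wdeg w + entry_deg (ops_deg (tC_map_ops G qs)) (u - i)"
      have idx: "(i, ps, qs) \<in> post_index u v" if "ps \<in> weak_compositions (length qs) (u - i)" for ps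
        using that i \<open>qs \<in> compositions v\<close> by (auto simp: post_index_def weak_compositions_def)
      have dd': "?d + (- int i, k - int i - int (length qs)) = outdeg k u w"
        unfolding outdeg_eq entry_deg_def tC_map_ops_props using i s w by (simp add: prod_eq_iff)
      have "H (length qs) i ?d (tC_tensors R A B (tC_map_ops G qs) (u - i) (wdeg w) ?X) =
        H (length qs) i ?d (chain_eval (tensor_power R B (length qs) ?d) (\<Sum>ps\<in>weak_compositions (length qs) (u - i).
           chain_sign (tC_tensor_sign ps (tC_map_ops G qs)) (frag_of (gtensors R A B (entries ps (tC_map_ops G qs)) (wdeg w) ?X))))"
        using AB.tC_tensors_pure[OF ok w(1), of "u - i"] w(2) s by (simp add: tC_map_ops_props(1,2))
      also have "\<dots> = chain_eval ?N (\<Sum>ps\<in>weak_compositions (length qs) (u - i). chain_sign (tC_tensor_sign ps (tC_map_ops G qs))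
           (frag_of (H (length qs) i ?d (gtensors R A B (entries ps (tC_map_ops G qs)) (wdeg w) ?X))))"
        unfolding dd'[symmetric]
        by (rule gmaps_chain_eval[OF tC_family_entry[OF H L] AB.B.tensor_group C.A_group])
           (use Y[OF idx] deg[OF idx] in simp)
      also have "\<dots> = chain_eval ?N (\<Sum>ps\<in>weak_compositions (length qs) (u - i). chain_sign (tC_tensor_sign ps (tC_map_ops G qs)) (frag_of (?t i ps qs)))"
        by (rule N.chain_eval_sum_cong) (simp add: deg[OF idx])
      finally have "H (length qs) i ?d (tC_tensors R A B (tC_map_ops G qs) (u - i) (wdeg w) ?X) =
        chain_eval ?N (\<Sum>ps\<in>weak_compositions (length qs) (u - i). chain_sign (tC_tensor_sign ps (tC_map_ops G qs)) (frag_of (?t i ps qs)))" .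
      then show "chain_eval ?N (chain_sign (int i * tdeg (ops_deg (tC_map_ops G qs))) (frag_of (H (length qs) i ?d (tC_tensors R A B (tC_map_ops G qs) (u - i) (wdeg w) ?X)))) =
        chain_eval ?N (\<Sum>ps\<in>weak_compositions (length qs) (u - i). chain_sign (int i * tdeg (ops_deg (tC_map_ops G qs)) + tC_tensor_sign ps (tC_map_ops G qs)) (frag_of (?t i ps qs)))"
        by (simp add: N.chain_eval_chain_sign_frag_chain_eval chain_sign_sum chain_sign_chain_sign)
    qed
  qed
  have "tC_postcomp R A B C k H G v u (wdeg w) ?X =
    chain_eval ?N (\<Sum>qs\<in>compositions v. chain_sign (int (sgn_tC qs)) (frag_of (?comp qs (wdeg w) ?X)))"
    unfolding tC_postcomp_def tC_sum_def entry_deg_0 Let_def tC_map_ops_def[symmetric]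
    by (subst gsum_chain_eval[where A = "tensor_power R A v", OF C.A_group _ pw]) (use compc in \<open>simp_all add: ed\<close>)
  also have "\<dots> = chain_eval ?N (\<Sum>qs\<in>compositions v. \<Sum>i\<le>u. \<Sum>ps\<in>weak_compositions (length qs) (u - i).
      chain_sign (int (sgn_tC qs) + (int i * tdeg (ops_deg (tC_map_ops G qs)) + tC_tensor_sign ps (tC_map_ops G qs))) (frag_of (?t i ps qs)))"
    by (rule N.chain_eval_sum_cong) (simp add: comp N.chain_eval_chain_sign_frag_chain_eval chain_sign_sum chain_sign_chain_sign)
  also have "\<dots> = chain_eval ?N (\<Sum>(i, ps, qs)\<in>post_index u v.
      chain_sign (int (sgn_tC qs) + (int i * tdeg (ops_deg (tC_map_ops G qs)) + tC_tensor_sign ps (tC_map_ops G qs))) (frag_of (?t i ps qs)))"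
    unfolding sum_post_index ..
  also have "\<dots> = chain_eval ?N (\<Sum>(i, ps, qs)\<in>post_index u v. chain_sign (int (u * v) + int \<epsilon>)
      (chain_sign (int (\<epsilon> + sgn_dA ps qs)) (frag_of (gcomp (tensor_power R A v) (ops_deg (map_ops (psi R A B 1 G) ps qs)) (psi R B C k H (i, length qs))
        (gtensors R A B (map_ops (psi R A B 1 G) ps qs)) (wdeg w) ?X))))"
  proof (rule N.chain_eval_sum_cong)
    fix x assume x: "x \<in> post_index u v"
    obtain i ps qs where x': "x = (i, ps, qs)" by (cases x)
    note idx = x[unfolded x']
    have l: "length ps = length qs" and s: "sum_list qs = v" and u: "u = i + sum_list ps"
      using idx by (auto simp: post_index_def compositions_def)
    define L P I V where "L = int (length qs)" and "P = int (sum_list ps)" and "I = int i" and "V = int v"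
    note d = this
    \<comment> \<open>The difference of exponents splits into two known even numbers and an explicit
      double.\<close>
    have "int (sgn_tC qs) + (int i * tdeg (ops_deg (tC_map_ops G qs)) + tC_tensor_sign ps (tC_map_ops G qs)) -
      (int (u * v) + int \<epsilon> + int (\<epsilon> + sgn_dA ps qs) + (int (i * length qs) + pq_sum ps qs)) =
      (int (sgn_tC qs) - int (sgn_dA (replicate (length qs) 0) qs)) +
      (int (sgn_dA (replicate (length qs) 0) qs) + int (sgn_dA ps qs) + tC_tensor_sign ps (tC_map_ops G qs) +
        int (sum_list ps) * int (sum_list qs) + pq_sum ps qs) -
      2 * (I * V + P * V + int \<epsilon> + int (sgn_dA ps qs) + pq_sum ps qs)"
      by (simp add: tC_map_ops_props s u tdeg_def d algebra_simps)
    also have "even \<dots>"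
      by (intro dvd_diff dvd_add even_sgn_tC sign_tC_post[OF l] dvd_triv_left)
    finally have sign: "even (int (sgn_tC qs) + (int i * tdeg (ops_deg (tC_map_ops G qs)) + tC_tensor_sign ps (tC_map_ops G qs)) -
      (int (u * v) + int \<epsilon> + int (\<epsilon> + sgn_dA ps qs) + (int (i * length qs) + pq_sum ps qs)))" .
    have "chain_eval ?N (chain_sign (int (sgn_tC qs) + (int i * tdeg (ops_deg (tC_map_ops G qs)) + tC_tensor_sign ps (tC_map_ops G qs))) (frag_of (?t i ps qs))) =
      chain_eval ?N (chain_sign (int (u * v) + int \<epsilon> + int (\<epsilon> + sgn_dA ps qs)) (frag_of (signed ?N (int (i * length qs) + pq_sum ps qs) (?t i ps qs))))"
      by (simp only: chain_sign_cong[OF sign] chain_eval_chain_sign_signed[OF C.A_group trm[OF idx]])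
    then show "chain_eval ?N (case x of (i, ps, qs) \<Rightarrow>
        chain_sign (int (sgn_tC qs) + (int i * tdeg (ops_deg (tC_map_ops G qs)) + tC_tensor_sign ps (tC_map_ops G qs))) (frag_of (?t i ps qs))) =
      chain_eval ?N (case x of (i, ps, qs) \<Rightarrow> chain_sign (int (u * v) + int \<epsilon>)
      (chain_sign (int (\<epsilon> + sgn_dA ps qs)) (frag_of (gcomp (tensor_power R A v) (ops_deg (map_ops (psi R A B 1 G) ps qs)) (psi R B C k H (i, length qs))
        (gtensors R A B (map_ops (psi R A B 1 G) ps qs)) (wdeg w) ?X))))"
      unfolding x' prod.case dA[OF idx] chain_sign_chain_sign .
  qed
  also have "\<dots> = signed ?N (int (u * v) + int \<epsilon>) (dA_postcomp R A B C k \<epsilon> (psi R B C k H) (psi R A B 1 G) u v (wdeg w) ?X)"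
    unfolding dA_postcomp_eq
    by (subst gsum_chain_eval[where A = "tensor_power R A v", OF C.A_group _ pw])
       (auto simp: ed chain_eval_chain_sign[OF C.A_group, symmetric] chain_sign_sum case_prod_beta intro: pc)
  also have "\<dots> = gsigned (tensor_power R A v) C (- int u, k - int u - int v) (int (u * v) + int \<epsilon>)
      (dA_postcomp R A B C k \<epsilon> (psi R B C k H) (psi R A B 1 G) u v) (wdeg w) ?X"
    by (simp only: gsigned_apply[of ?X "tensor_power R A v", OF pw] ed)
  finally show "tC_postcomp R A B C k H G v u (wdeg w) ?X =
    gsigned (tensor_power R A v) C (- int u, k - int u - int v) (int (u * v) + int \<epsilon>)
      (dA_postcomp R A B C k \<epsilon> (psi R B C k H) (psi R A B 1 G) u v) (wdeg w) ?X" .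
qed

end

end

section \<open>Insertions on the two sides\<close>

definition id_ops :: "nat \<Rightarrow> 'f \<Rightarrow> 'f op list" where
  "id_ops r f = replicate r (1, (0, 0), f)"

definition tC_insert_ops :: "('r, 's) ring_scheme \<Rightarrow> ('r, 'a) bgmod \<Rightarrow> (nat \<Rightarrow> nat \<Rightarrow> (('a, 'r) tens, 'a) gmap) \<Rightarrow>
    nat \<Rightarrow> nat \<Rightarrow> nat \<Rightarrow> (nat \<Rightarrow> (('a, 'r) tens, 'a) gmap) op list" where
  "tC_insert_ops R A M r q t = id_ops r (tC_one R A) @ [(q, (0, 2 - int q), M q)] @ id_ops t (tC_one R A)"

lemma id_ops_props [simp]: "ops_arity (id_ops r f) = r" "ops_deg (id_ops r f) = 0" "length (id_ops r f) = r"
  by (simp_all add: id_ops_def)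

lemma tC_insert_ops_props: "ops_arity (tC_insert_ops R A M r q t) = r + q + t" "ops_deg (tC_insert_ops R A M r q t) = (0, 2 - int q)"
  "length (tC_insert_ops R A M r q t) = 1 + r + t"
  by (simp_all add: tC_insert_ops_def)

lemma entries_append: "length ps = length gs \<Longrightarrow> entries (ps @ ps') (gs @ gs') = entries ps gs @ entries ps' gs'"
  by (simp add: entries_def)

lemma entries_ids0: "entries (replicate r 0) (id_ops r (tC_one R A)) = replicate r (id_op R A)"
  by (induction r) (simp_all add: id_ops_def tC_one_def tC_single_def entry_deg_def zero_prod_def)

text \<open>\<open>tC_one\<close> is zero in positive index, so an identity factor that receives a
  positive share becomes a zero map.\<close>

lemma entries_id_ops_pos:
  assumes "length ps = r" "ps \<noteq> replicate r 0"
  shows "\<exists>e. (1, e, gzero (tensor_power R A 1) A e) \<in> set (entries ps (id_ops r (tC_one R A)))"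
proof -
  obtain x where x: "x \<in> set ps" "x \<noteq> 0" using assms by (metis replicate_eqI)
  have "zip ps (id_ops r (tC_one R A)) = map (\<lambda>x. (x, (1, (0, 0), tC_one R A))) ps"
    unfolding id_ops_def using assms(1) by (simp add: zip_replicate2)
  then have "(1, entry_deg (0, 0) x, tC_one R A x) \<in> set (entries ps (id_ops r (tC_one R A)))"
    unfolding entries_def using x by force
  moreover have "tC_one R A x = gzero (tensor_power R A 1) A (entry_deg (0, 0) x)"
    using x by (simp add: tC_one_def tC_single_def)
  ultimately show ?thesis by (intro exI[of _ "entry_deg (0, 0) x"]) simp
qed

lemma tC_tensor_sign_zero:
  "length ps = length gs \<Longrightarrow> (\<forall>p\<in>set ps. p = 0) \<Longrightarrow> tC_tensor_sign (ps @ ps') (gs @ gs') = tC_tensor_sign ps' gs'"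
proof (induction ps gs rule: list_induct2)
  case (Cons p ps g gs) then show ?case by (cases g) simp
qed simp

lemma tC_precomp_eq_tC_insert_ops: "tC_precomp R A B k F M v =
     tC_sum (tensor_power R A v) B (0, k + 1 - int v)
       {(r, q, t, j). v = r + q + t \<and> j = 1 + r + t \<and> 1 \<le> q}
       (\<lambda>(r, q, t, j). int (r * q + t))
       (\<lambda>(r, q, t, j). tC_comp (tensor_power R A v) B (0, k - int j) (0, 2 - int q) (F j)
          (tC_tensors R A A (tC_insert_ops R A M r q t)))"
  unfolding tC_precomp_def tC_insert_ops_def id_ops_def ..

definition tpre_index :: "nat \<Rightarrow> (nat \<times> nat \<times> nat \<times> nat) set" where
  "tpre_index v = {(r, q, t, j). v = r + q + t \<and> j = 1 + r + t \<and> 1 \<le> q}"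

text \<open>The choice of i in the composition completes the arities to a derived index, with p = u
  - i.\<close>

lemma sum_tpre_index: "(\<Sum>(r, q, t, j)\<in>tpre_index v. \<Sum>i\<le>u. F r q t j i) =
    (\<Sum>(i, p, j, q, r, t)\<in>pre_index u v. F r q t j i)"
proof -
  have "(\<Sum>(r, q, t, j)\<in>tpre_index v. \<Sum>i\<le>u. F r q t j i) =
    (\<Sum>(x, i)\<in>tpre_index v \<times> {..u}. case x of (r, q, t, j) \<Rightarrow> F r q t j i)"
    unfolding sum.cartesian_product[symmetric] by (rule sum.cong) auto
  also have "\<dots> = (\<Sum>(i, p, j, q, r, t)\<in>pre_index u v. F r q t j i)"
    by (rule sum.reindex_bij_witness[of _ "\<lambda>(i, p, j, q, r, t). ((r, q, t, j), i)"
          "\<lambda>((r, q, t, j), i). (i, u - i, j, q, r, t)"]) (auto simp: tpre_index_def pre_index_def)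
  finally show ?thesis .
qed

context bigraded_pair'
begin

context
  fixes M F k
  assumes M: "tC_family R A A 2 M" and F: "tC_family R A B k F"
begin

lemma tC_insert_ops_ok:
  assumes "1 \<le> q" shows "tC_ok R A A (tC_insert_ops R A M r q t)"
proof -
  have "tC_one R A \<in> tC_hom R (tensor_power R A 1) A (0, 0)"
  proof -
    have "tC_one R A i \<in> gmaps R (tensor_power R A 1) A (entry_deg (0, 0) i)" for i
    proof (cases "i = 0")
      case True
      then show ?thesis using A.tensor1_id_gmaps by (simp add: tC_one_def tC_single_def entry_deg_def zero_prod_def)
    next
      case False
      then show ?thesis using gzero_gmaps[of R "tensor_power R A 1" A, OF A.tensor_module A.A_module]
        by (simp add: tC_one_def tC_single_def)
    qed
    then show ?thesis by (simp add: tC_hom_def)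
  qed
  then have "tC_ok R A A (id_ops r (tC_one R A))" for r by (simp add: tC_ok_def id_ops_def)
  then show ?thesis using M assms by (simp add: tC_insert_ops_def tC_family_def)
qed

text \<open>Only the distribution that gives the whole index n to the middle factor avoids a zero
  factor. Its tensor sign is trivial, because the identities in front have share 0 and those behind
  have degree 0.\<close>

lemma tC_tensors_tC_insert_ops:
  assumes q: "1 \<le> q" and w: "hword A w" "length w = r + q + t"
  shows "tC_tensors R A A (tC_insert_ops R A M r q t) n (wdeg w) (pure_tensor R A w) =
    gtensors R A A (insert_ops R A (\<lambda>(p, q). M q p) r n q t) (wdeg w) (pure_tensor R A w)"
proof -
  let ?gs = "tC_insert_ops R A M r q t" and ?X = "pure_tensor R A w"
  let ?p0 = "replicate r 0 @ [n] @ replicate t 0"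
  let ?N = "tensor_power R A (length ?gs) (wdeg w + entry_deg (ops_deg ?gs) n)"
  note ok = tC_insert_ops_ok[OF q, of r t]
  interpret N: abelian_group ?N by (rule A.tensor_group)
  have ar: "length w = ops_arity ?gs" using w by (simp add: tC_insert_ops_props)
  have p0: "?p0 \<in> weak_compositions (length ?gs) n" by (simp add: weak_compositions_def tC_insert_ops_props sum_list_replicate)
  have e0: "entries ?p0 ?gs = insert_ops R A (\<lambda>(p, q). M q p) r n q t"
    unfolding tC_insert_ops_def insert_ops_def by (simp add: entries_append entries_ids0 entry_deg_0)
  have s0: "tC_tensor_sign ?p0 ?gs = 0"
    unfolding tC_insert_ops_def using tC_tensor_sign_zero[of "replicate t 0" "id_ops t (tC_one R A)" "[]" "[]"]
    by (subst tC_tensor_sign_zero) (auto simp: tdeg_def)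
  have Y: "gtensors R A A (entries ps ?gs) (wdeg w) ?X \<in> carrier ?N" if "ps \<in> weak_compositions (length ?gs) n" for ps
  proof -
    have ps: "length ps = length ?gs" "sum_list ps = n" using that by (auto simp: weak_compositions_def)
    show ?thesis
      using AA.gtensors_pure_closed[OF entries_ok[OF ps(1) ok] w(1)] ar entries_props[OF ps(1)] ps by simp
  qed
  have zero: "gtensors R A A (entries ps ?gs) (wdeg w) ?X = \<zero>\<^bsub>?N\<^esub>"
    if P: "ps \<in> weak_compositions (length ?gs) n" and ne: "ps \<noteq> ?p0" for ps
  proof -
    have ps: "length ps = length ?gs" "sum_list ps = n" using P by (auto simp: weak_compositions_def)
    define a c where "a = take r ps" and "c = drop (Suc r) ps"
    have r: "r < length ps" using ps by (simp add: tC_insert_ops_props)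
    have ps': "ps = a @ [ps ! r] @ c" using id_take_nth_drop[OF r] by (simp add: a_def c_def)
    have la: "length a = r" "length c = t" using ps by (auto simp: a_def c_def tC_insert_ops_props)
    have e: "entries ps ?gs = entries a (id_ops r (tC_one R A)) @
        entries [ps ! r] [(q, (0, 2 - int q), M q)] @ entries c (id_ops t (tC_one R A))"
      unfolding tC_insert_ops_def by (subst ps') (simp add: entries_append la)
    \<comment> \<open>If both outer parts were zero, the middle share would be all of n, and the
      distribution would be the excluded one.\<close>
    have "a \<noteq> replicate r 0 \<or> c \<noteq> replicate t 0"
    proof (rule ccontr)
      assume "\<not> ?thesis"
      then have "ps = replicate r 0 @ [ps ! r] @ replicate t 0" using ps' by simp
      moreover from this have "ps ! r = n" using ps(2) by (metis add_0 add_0_right sum_list.Cons sum_list.Nil sum_list.append sum_list_replicate mult_0_right)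
      ultimately show False using ne by simp
    qed
    then obtain z where "(1, z, gzero (tensor_power R A 1) A z) \<in> set (entries ps ?gs)"
      unfolding e using entries_id_ops_pos[OF la(1), of R A] entries_id_ops_pos[OF la(2), of R A] by auto
    then show ?thesis
      using AA.gtensors_zero[OF entries_ok[OF ps(1) ok] w(1)] ar entries_props[OF ps(1)] ps by simp
  qed
  have "tC_tensors R A A ?gs n (wdeg w) ?X =
    chain_eval ?N (\<Sum>ps\<in>weak_compositions (length ?gs) n. chain_sign (tC_tensor_sign ps ?gs) (frag_of (gtensors R A A (entries ps ?gs) (wdeg w) ?X)))"
    by (rule AA.tC_tensors_pure[OF ok w(1) ar])
  also have "\<dots> = chain_eval ?N (chain_sign (tC_tensor_sign ?p0 ?gs) (frag_of (gtensors R A A (entries ?p0 ?gs) (wdeg w) ?X)))"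
    by (rule N.chain_eval_sum_single[OF finite_weak_compositions p0]) (simp add: zero chain_eval_chain_sign[OF A.tensor_group] signed_zero[OF A.tensor_group])
  also have "\<dots> = gtensors R A A (entries ?p0 ?gs) (wdeg w) ?X"
    using Y[OF p0] by (simp only: s0 chain_sign_zero N.chain_eval_frag_of)
  finally show ?thesis unfolding e0 .
qed

lemma gtensors_insert_ops_psi:
  assumes q: "1 \<le> q" and w: "hword A w" "length w = r + q + t"
  shows "gtensors R A A (insert_ops R A (psi R A A 2 M) r p q t) (wdeg w) (pure_tensor R A w) =
    signed (tensor_power R A (1 + r + t) (wdeg w + (- int p, 2 - int p - int q))) (int (p * q))
      (gtensors R A A (insert_ops R A (\<lambda>(p, q). M q p) r p q t) (wdeg w) (pure_tensor R A w))"
    and "gtensors R A A (insert_ops R A (\<lambda>(p, q). M q p) r p q t) (wdeg w) (pure_tensor R A w) \<in>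
      carrier (tensor_power R A (1 + r + t) (wdeg w + (- int p, 2 - int p - int q)))"
proof -
  define nfs where "nfs = replicate r (0::int, id_op R A) @ [(int (p * q), q, (- int p, 2 - int p - int q), M q p)] @
     replicate t (0, id_op R A)"
  have snd_nfs: "map snd nfs = insert_ops R A (\<lambda>(p, q). M q p) r p q t" by (simp add: nfs_def insert_ops_def)
  have fst_nfs: "sum_list (map fst nfs) = int (p * q)" by (simp add: nfs_def sum_list_replicate)
  have len: "length nfs = 1 + r + t" by (simp add: nfs_def)
  note fm = tC_family_entry[OF M q, of p]
  let ?P = "\<lambda>(q', e', f') (n, q, e, f). q' = q \<and> e' = e \<and>
      f' \<in> gmaps R (tensor_power R A q) A e \<and> f \<in> gmaps R (tensor_power R A q) A e \<and>
      (\<forall>d. \<forall>X\<in>carrier (tensor_power R A q d). f' d X = signed (A (d + e)) n (f d X))"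
  have ones: "list_all2 ?P (replicate r (id_op R A)) (replicate r (0, id_op R A))" for r
    using A.tensor1_id_gmaps by (simp add: list_all2_conv_all_nth)
  have rel: "list_all2 ?P (insert_ops R A (psi R A A 2 M) r p q t) nfs"
    unfolding insert_ops_def nfs_def psi_apply[OF q]
    by (intro list_all2_appendI ones)
      (simp add: fm gsigned_gmaps[OF A.tensor_module A.A_module fm] gsigned_apply psi_apply[OF q])
  have dg: "ops_deg (map snd nfs) = (- int p, 2 - int p - int q)" "ops_arity (map snd nfs) = r + q + t"
    unfolding nfs_def by simp_all
  have ar: "length w = ops_arity (map snd nfs)" using dg w by simp
  note gs = AA.gtensors_signed[OF rel w(1) ar]
  show "gtensors R A A (insert_ops R A (psi R A A 2 M) r p q t) (wdeg w) (pure_tensor R A w) =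
    signed (tensor_power R A (1 + r + t) (wdeg w + (- int p, 2 - int p - int q))) (int (p * q))
      (gtensors R A A (insert_ops R A (\<lambda>(p, q). M q p) r p q t) (wdeg w) (pure_tensor R A w))"
    using conjunct1[OF gs] unfolding fst_nfs len dg unfolding snd_nfs .
  have "ops_ok R A A (map snd nfs)" using gs by blast
  from AA.gtensors_pure_closed[OF this w(1) ar]
  show "gtensors R A A (insert_ops R A (\<lambda>(p, q). M q p) r p q t) (wdeg w) (pure_tensor R A w) \<in>
      carrier (tensor_power R A (1 + r + t) (wdeg w + (- int p, 2 - int p - int q)))"
    unfolding dg length_map len unfolding snd_nfs .
qed

lemma tC_insert_ops_gmaps:
  assumes "1 \<le> q" "v = r + q + t"
  shows "tC_tensors R A A (tC_insert_ops R A M r q t) n \<in>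
    gmaps R (tensor_power R A v) (tensor_power R A (1 + r + t)) (entry_deg (0, 2 - int q) n)"
  using AA.tC_tensors_gmaps[OF tC_insert_ops_ok[OF assms(1)], of r t n] by (simp only: tC_insert_ops_props assms(2))

lemma pre_entry_deg:
  assumes "v = r + q + t" "j = 1 + r + t"
  shows "entry_deg ((0, k - int j) + (0, 2 - int q)) u = (- int u, k + 1 - int u - int v)"
  using assms by (simp add: entry_deg_def)

lemma tC_precomp_gmaps:
  "tC_precomp R A B k F M v u \<in> gmaps R (tensor_power R A v) B (- int u, k + 1 - int u - int v)"
  unfolding tC_precomp_eq_tC_insert_ops tC_sum_def entry_deg_0
proof (rule gsum_gmaps[OF A.tensor_module B.A_module])
  fix x assume "x \<in> {(r, q, t, j). v = r + q + t \<and> j = 1 + r + t \<and> 1 \<le> q}"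
  then obtain r q t j where x: "x = (r, q, t, j)" "v = r + q + t" "j = 1 + r + t" "1 \<le> q" by auto
  have "1 \<le> j" using x by simp
  then have "F j \<in> tC_hom R (tensor_power R A j) B (0, k - int j)" using F unfolding tC_family_def by blast
  from tC_comp_gmaps[OF A.tensor_module B.A_module this tC_insert_ops_gmaps[OF x(4,2), folded x(3)], of u]
  show "(case x of (r, q, t, j) \<Rightarrow> tC_comp (tensor_power R A v) B (0, k - int j) (0, 2 - int q) (F j)
          (tC_tensors R A A (tC_insert_ops R A M r q t))) u
     \<in> gmaps R (tensor_power R A v) B (- int u, k + 1 - int u - int v)"
    unfolding x(1) prod.case pre_entry_deg[OF x(2,3)] .
qed

text \<open>Since u = i + p and v + 1 = j + q, the global exponent uv + u equals (i + p)(j + q). Its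
  four products are the sign pj of the derived equation, the factors ij and pq of the sign change,
  and iq, the parity of the exponent i(2 - q) of the composition.\<close>

theorem tC_precomp_eq:
  "tC_precomp R A B k F M v u = gsigned (tensor_power R A v) B (- int u, k + 1 - int u - int v)
    (int (u * v) + int u) (dA_precomp R A B k (psi R A B k F) (psi R A A 2 M) u v)"
proof (rule A.gmaps_pure_ext[OF B.A_module tC_precomp_gmaps])
  note f = psi_derived_family[OF F] and m = AA.psi_derived_family[OF M]
  note pre = dA_precomp_gmaps[OF m f, of u v]
  show "gsigned (tensor_power R A v) B (- int u, k + 1 - int u - int v)
    (int (u * v) + int u) (dA_precomp R A B k (psi R A B k F) (psi R A A 2 M) u v)
    \<in> gmaps R (tensor_power R A v) B (- int u, k + 1 - int u - int v)"
    by (rule gsigned_gmaps[OF A.tensor_module B.A_module pre])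
  fix w assume w: "hword A w" "length w = v"
  let ?X = "pure_tensor R A w"
  have ed: "wdeg w + (- int u, k + 1 - int u - int v) = outdeg (k + 1) u w" by (simp add: outdeg_eq w)
  let ?N = "B (outdeg (k + 1) u w)"
  interpret N: abelian_group ?N by (rule B.A_group)
  have pw: "?X \<in> carrier (tensor_power R A v (wdeg w))"
    using A.pure_closed'[OF w(1)] w(2) by simp
  let ?M = "\<lambda>(p, q). M q p"
  \<comment> \<open>Again the value of one summand without the signs under comparison, with the
    inner index p written as u - i.\<close>
  let ?t = "\<lambda>r q t j i. F j i (wdeg w + entry_deg (0, 2 - int q) (u - i)) (gtensors R A A (insert_ops R A ?M r (u - i) q t) (wdeg w) ?X)"
  have trm: "?t r q t j i \<in> carrier ?N"
    and dA: "gcomp (tensor_power R A v) (- int p, 2 - int p - int q) (psi R A B k F (i, j))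
        (gtensors R A A (insert_ops R A (psi R A A 2 M) r p q t)) (wdeg w) ?X =
      signed ?N (int (i * j) + int (p * q)) (?t r q t j i)"
    if "(i, p, j, q, r, t) \<in> pre_index u v" for i p j q r t
  proof -
    have u: "u = i + p" and v: "v = r + q + t" and j: "j = 1 + r + t" and q: "1 \<le> q"
      using that by (auto simp: pre_index_def)
    have j1: "1 \<le> j" using j by simp
    have p: "u - i = p" using u by simp
    have lw: "length w = r + q + t" using w v by simp
    have e: "entry_deg (0, 2 - int q) p = (- int p, 2 - int p - int q)" by (rule entry_deg_0)
    have dd: "wdeg w + (- int p, 2 - int p - int q) + (- int i, k - int i - int j) = outdeg (k + 1) u w"
      unfolding outdeg_eq using u v j w by (simp add: prod_eq_iff)
    note gp = gtensors_insert_ops_psi[OF q w(1) lw, of p, folded j]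
    show trm: "?t r q t j i \<in> carrier ?N"
      unfolding p e dd[symmetric] by (rule gmaps_closed[OF tC_family_entry[OF F j1] gp(2)])
    have "gcomp (tensor_power R A v) (- int p, 2 - int p - int q) (psi R A B k F (i, j))
        (gtensors R A A (insert_ops R A (psi R A A 2 M) r p q t)) (wdeg w) ?X =
      signed ?N (int (i * j)) (signed ?N (int (p * q)) (?t r q t j i))"
      unfolding gcomp_apply[where A = "tensor_power R A v", OF pw] gp(1) psi_apply[OF j1]
        gsigned_apply[of _ "tensor_power R A j", OF signed_closed[OF A.tensor_group gp(2)]] dd
      using gmaps_signed[OF tC_family_entry[OF F j1, of i] A.tensor_group B.A_group gp(2), of "int (p * q)"]
      unfolding dd p e by simp
    then show "gcomp (tensor_power R A v) (- int p, 2 - int p - int q) (psi R A B k F (i, j))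
        (gtensors R A A (insert_ops R A (psi R A A 2 M) r p q t)) (wdeg w) ?X =
      signed ?N (int (i * j) + int (p * q)) (?t r q t j i)"
      by (simp add: signed_signed[OF B.A_group trm])
  qed
  have pc: "gcomp (tensor_power R A v) (- int p, 2 - int p - int q) (psi R A B k F (i, j))
        (gtensors R A A (insert_ops R A (psi R A A 2 M) r p q t)) (wdeg w) ?X \<in> carrier ?N"
    if "(i, p, j, q, r, t) \<in> pre_index u v" for i p j q r t
    unfolding dA[OF that] by (rule signed_closed[OF B.A_group trm[OF that]])
  let ?comp = "\<lambda>r q t j. tC_comp (tensor_power R A v) B (0, k - int j) (0, 2 - int q) (F j) (tC_tensors R A A (tC_insert_ops R A M r q t)) u"
  have comp: "?comp r q t j (wdeg w) ?X = chain_eval ?N (\<Sum>i\<le>u. chain_sign (int i * (2 - int q)) (frag_of (?t r q t j i)))"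
    and compc: "?comp r q t j (wdeg w) ?X \<in> carrier ?N"
    if "(r, q, t, j) \<in> tpre_index v" for r q t j
  proof -
    have v: "v = r + q + t" and j: "j = 1 + r + t" and q: "1 \<le> q"
      using that by (auto simp: tpre_index_def)
    have lw: "length w = r + q + t" using w v by simp
    have "1 \<le> j" using j by simp
    then have "F j \<in> tC_hom R (tensor_power R A j) B (0, k - int j)" using F unfolding tC_family_def by blast
    from tC_comp_chain_eval[OF A.tensor_module B.A_module this tC_insert_ops_gmaps[OF q v, folded j] pw, of u,
        unfolded pre_entry_deg[OF v j] ed tC_tensors_tC_insert_ops[OF q w(1) lw]]
    show c: "?comp r q t j (wdeg w) ?X = chain_eval ?N (\<Sum>i\<le>u. chain_sign (int i * (2 - int q)) (frag_of (?t r q t j i)))"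
      by (simp add: tdeg_def)
    then show "?comp r q t j (wdeg w) ?X \<in> carrier ?N" by simp
  qed
  have "tC_precomp R A B k F M v u (wdeg w) ?X =
    chain_eval ?N (\<Sum>(r, q, t, j)\<in>tpre_index v. chain_sign (int (r * q + t)) (frag_of (?comp r q t j (wdeg w) ?X)))"
    unfolding tC_precomp_eq_tC_insert_ops tC_sum_def entry_deg_0 tpre_index_def[symmetric]
    by (subst gsum_chain_eval[where A = "tensor_power R A v", OF B.A_group _ pw])
       (auto simp: ed case_prod_beta intro!: compc)
  also have "\<dots> = chain_eval ?N (\<Sum>(r, q, t, j)\<in>tpre_index v. \<Sum>i\<le>u.
      chain_sign (int (r * q + t) + int i * (2 - int q)) (frag_of (?t r q t j i)))"
  proof (rule N.chain_eval_sum_cong)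
    fix x assume x: "x \<in> tpre_index v"
    obtain r q t j where x': "x = (r, q, t, j)" by (cases x)
    show "chain_eval ?N (case x of (r, q, t, j) \<Rightarrow> chain_sign (int (r * q + t)) (frag_of (?comp r q t j (wdeg w) ?X))) =
      chain_eval ?N (case x of (r, q, t, j) \<Rightarrow> \<Sum>i\<le>u. chain_sign (int (r * q + t) + int i * (2 - int q)) (frag_of (?t r q t j i)))"
      unfolding x' prod.case comp[OF x[unfolded x']] N.chain_eval_chain_sign_frag_chain_eval by (simp add: chain_sign_sum chain_sign_chain_sign)
  qed
  also have "\<dots> = chain_eval ?N (\<Sum>(i, p, j, q, r, t)\<in>pre_index u v.
      chain_sign (int (r * q + t) + int i * (2 - int q)) (frag_of (?t r q t j i)))"
    unfolding sum_tpre_index ..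
  also have "\<dots> = chain_eval ?N (\<Sum>(i, p, j, q, r, t)\<in>pre_index u v. chain_sign (int (u * v) + int u)
      (chain_sign (int (r * q + t + p * j)) (frag_of (gcomp (tensor_power R A v) (- int p, 2 - int p - int q) (psi R A B k F (i, j))
        (gtensors R A A (insert_ops R A (psi R A A 2 M) r p q t)) (wdeg w) ?X))))"
  proof (rule N.chain_eval_sum_cong)
    fix x assume x: "x \<in> pre_index u v"
    obtain i p j q r t where x': "x = (i, p, j, q, r, t)" by (cases x)
    note idx = x[unfolded x']
    have u: "u = i + p" and v: "v = r + q + t" and j: "j = 1 + r + t"
      using idx by (auto simp: pre_index_def)
    define I P Q S T where "I = int i" and "P = int p" and "Q = int q" and "S = int r" and "T = int t"
    note d = this
    have "int (r * q + t) + int i * (2 - int q) - (int (u * v) + int u + int (r * q + t + p * j) + (int (i * j) + int (p * q))) =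
      2 * (- I * Q - I * S - I * T - P * Q - P * S - P * T - P)"
      by (simp add: u v j d algebra_simps)
    then have sign: "even (int (r * q + t) + int i * (2 - int q) - (int (u * v) + int u + int (r * q + t + p * j) + (int (i * j) + int (p * q))))"
      by (simp only: dvd_triv_left)
    have "chain_eval ?N (chain_sign (int (r * q + t) + int i * (2 - int q)) (frag_of (?t r q t j i))) =
      chain_eval ?N (chain_sign (int (u * v) + int u + int (r * q + t + p * j)) (frag_of (signed ?N (int (i * j) + int (p * q)) (?t r q t j i))))"
      by (simp only: chain_sign_cong[OF sign] chain_eval_chain_sign_signed[OF B.A_group trm[OF idx]])
    then show "chain_eval ?N (case x of (i, p, j, q, r, t) \<Rightarrow> chain_sign (int (r * q + t) + int i * (2 - int q)) (frag_of (?t r q t j i))) =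
      chain_eval ?N (case x of (i, p, j, q, r, t) \<Rightarrow> chain_sign (int (u * v) + int u)
      (chain_sign (int (r * q + t + p * j)) (frag_of (gcomp (tensor_power R A v) (- int p, 2 - int p - int q) (psi R A B k F (i, j))
        (gtensors R A A (insert_ops R A (psi R A A 2 M) r p q t)) (wdeg w) ?X))))"
      unfolding x' prod.case dA[OF idx] chain_sign_chain_sign .
  qed
  also have "\<dots> = signed ?N (int (u * v) + int u) (dA_precomp R A B k (psi R A B k F) (psi R A A 2 M) u v (wdeg w) ?X)"
    unfolding dA_precomp_eq
    by (subst gsum_chain_eval[where A = "tensor_power R A v", OF B.A_group _ pw])
       (auto simp: ed chain_eval_chain_sign[OF B.A_group, symmetric] chain_sign_sum case_prod_beta intro: pc)
  also have "\<dots> = gsigned (tensor_power R A v) B (- int u, k + 1 - int u - int v) (int (u * v) + int u)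
      (dA_precomp R A B k (psi R A B k F) (psi R A A 2 M) u v) (wdeg w) ?X"
    by (simp only: gsigned_apply[of ?X "tensor_power R A v", OF pw] ed)
  finally show "tC_precomp R A B k F M v u (wdeg w) ?X =
    gsigned (tensor_power R A v) B (- int u, k + 1 - int u - int v) (int (u * v) + int u)
      (dA_precomp R A B k (psi R A B k F) (psi R A A 2 M) u v) (wdeg w) ?X" .
qed

end

end

section \<open>The isomorphism of categories\<close>

text \<open>The category axioms for \<open>C\<close> are not assumed: they are inherited from \<open>D\<close> along the bijections.\<close>

lemma isomorphism_transfer:
  assumes D: "category D"
    and FO: "\<And>X. X \<in> Obj C \<Longrightarrow> FO X \<in> Obj D" and GO: "\<And>Z. Z \<in> Obj D \<Longrightarrow> GO Z \<in> Obj C"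
    and GFO: "\<And>X. X \<in> Obj C \<Longrightarrow> GO (FO X) = X" and FGO: "\<And>Z. Z \<in> Obj D \<Longrightarrow> FO (GO Z) = Z"
    and FH: "\<And>X Y f. X \<in> Obj C \<Longrightarrow> Y \<in> Obj C \<Longrightarrow> f \<in> Hom C X Y \<Longrightarrow> FH X Y f \<in> Hom D (FO X) (FO Y)"
    and GH: "\<And>X Y h. X \<in> Obj C \<Longrightarrow> Y \<in> Obj C \<Longrightarrow> h \<in> Hom D (FO X) (FO Y) \<Longrightarrow> GH X Y h \<in> Hom C X Y"
    and GFH: "\<And>X Y f. X \<in> Obj C \<Longrightarrow> Y \<in> Obj C \<Longrightarrow> f \<in> Hom C X Y \<Longrightarrow> GH X Y (FH X Y f) = f"
    and FGH: "\<And>X Y h. X \<in> Obj C \<Longrightarrow> Y \<in> Obj C \<Longrightarrow> h \<in> Hom D (FO X) (FO Y) \<Longrightarrow> FH X Y (GH X Y h) = h"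
    and Id: "\<And>X. X \<in> Obj C \<Longrightarrow> Ident C X = GH X X (Ident D (FO X))"
    and Cp: "\<And>X Y Z f g. X \<in> Obj C \<Longrightarrow> Y \<in> Obj C \<Longrightarrow> Z \<in> Obj C \<Longrightarrow> f \<in> Hom C Y Z \<Longrightarrow> g \<in> Hom C X Y \<Longrightarrow>
      Comp C X Y Z f g = GH X Z (Comp D (FO X) (FO Y) (FO Z) (FH Y Z f) (FH X Y g))"
  shows "isomorphism_of_categories C D \<lparr>on_obj = FO, on_hom = FH\<rparr>"
proof -
  interpret D: category D by (rule D)
  have C: "category C"
    by unfold_locales
      (simp_all add: Id Cp GH FH FGH GFH FO D.Ident_in_Hom D.Comp_in_Hom D.Comp_Ident_left D.Comp_Ident_right
        D.Comp_assoc[of "FO _" "FO _" "FO _" "FO _"])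
  interpret C: category C by (rule C)
  \<comment> \<open>\<open>GH\<close> is indexed by objects of C, so for objects of D it is taken at
    their images under \<open>GO\<close>.\<close>
  let ?F = "\<lparr>on_obj = FO, on_hom = FH\<rparr>" and ?G = "\<lparr>on_obj = GO, on_hom = (\<lambda>Z W. GH (GO Z) (GO W))\<rparr>"
  have F: "cat_functor C D ?F"
    by unfold_locales (simp_all add: FO FH Id Cp FGH D.Ident_in_Hom D.Comp_in_Hom)
  have G: "cat_functor D C ?G"
  proof unfold_locales
    fix X Y f assume "X \<in> Obj D" "Y \<in> Obj D" "f \<in> Hom D X Y"
    then show "on_hom ?G X Y f \<in> Hom C (on_obj ?G X) (on_obj ?G Y)" by (simp add: GH GO FGO)
  next
    fix X assume "X \<in> Obj D"
    then show "on_hom ?G X X (Ident D X) = Ident C (on_obj ?G X)" by (simp add: Id GO FGO)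
  next
    fix X Y Z f g assume "X \<in> Obj D" "Y \<in> Obj D" "Z \<in> Obj D" "f \<in> Hom D Y Z" "g \<in> Hom D X Y"
    then show "on_hom ?G X Z (Comp D X Y Z f g) =
        Comp C (on_obj ?G X) (on_obj ?G Y) (on_obj ?G Z) (on_hom ?G Y Z f) (on_hom ?G X Y g)"
      by (simp add: Cp GO FGO GH FGH)
  qed (simp add: GO)
  have "functor_left_inverse C ?G ?F" "functor_left_inverse D ?F ?G"
    by (simp_all add: functor_left_inverse_def GFO FGO GFH FGH GO)
  with F G show ?thesis unfolding isomorphism_of_categories_def by blast
qed

section \<open>The first tensor power and the bijection on objects\<close>

text \<open>\<open>tC_diff\<close> acts on A, whereas operations of arity 1 act on the first tensor
  power. This inverse of \<open>tensor1_id\<close> recovers a differential from an operation of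
  arity 1.\<close>

definition tensor1_inv :: "('r, 's) ring_scheme \<Rightarrow> ('r, 'a) bgmod \<Rightarrow> ('a, ('a, 'r) tens) gmap" where
  "tensor1_inv R A = (\<lambda>d. \<lambda>x\<in>carrier (A d). pure_tensor R A [(d, x)])"

context bigraded
begin

lemma single_hwords: "x \<in> carrier (A d) \<Longrightarrow> [(d, x)] \<in> hwords A 1 d"
  by (simp add: hwords_iff)

lemma pure_single: "x \<in> carrier (A d) \<Longrightarrow> pure_tensor R A [(d, x)] \<in> carrier (tensor_power R A 1 d)"
  by (rule pure_closed[OF single_hwords])

lemma tensor1_inv_gmaps: "tensor1_inv R A \<in> gmaps R A (tensor_power R A 1) (0, 0)"
proof (rule gmapsI)
  fix d
  interpret M: module R "A d" by (rule A_module)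
  have d: "d + (0, 0) = d" by (simp add: prod_eq_iff)
  show "tensor1_inv R A d x \<in> carrier (tensor_power R A 1 (d + (0, 0)))" if "x \<in> carrier (A d)" for x
    using that pure_single[OF that] by (simp add: tensor1_inv_def d)
  show "tensor1_inv R A d x = undefined" if "x \<notin> carrier (A d)" for x
    using that by (simp add: tensor1_inv_def)
  show "tensor1_inv R A d (x \<oplus>\<^bsub>A d\<^esub> y) = tensor1_inv R A d x \<oplus>\<^bsub>tensor_power R A 1 (d + (0, 0))\<^esub> tensor1_inv R A d y"
    if "x \<in> carrier (A d)" "y \<in> carrier (A d)" for x y
    using that pure_add[of "[]" d x "[]" 1 d y] single_hwords[OF that(1)] single_hwords[OF that(2)]
    by (simp add: tensor1_inv_def d)
  show "tensor1_inv R A d (r \<odot>\<^bsub>A d\<^esub> x) = r \<odot>\<^bsub>tensor_power R A 1 (d + (0, 0))\<^esub> tensor1_inv R A d x"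
    if "r \<in> carrier R" "x \<in> carrier (A d)" for r x
    using that pure_smult[of "[]" d x "[]" 1 d r] single_hwords[OF that(2)] by (simp add: tensor1_inv_def d)
qed

lemma tensor1_inv_tensor1_id:
  assumes X: "X \<in> carrier (tensor_power R A 1 d)"
  shows "tensor1_inv R A d (tensor1_id R A d X) = X"
proof -
  let ?T = "tensor_power R A 1"
  have "gcomp ?T (0, 0) (tensor1_inv R A) (tensor1_id R A) = gid ?T"
  proof (rule gmaps_pure_ext[OF tensor_module])
    show "gcomp ?T (0, 0) (tensor1_inv R A) (tensor1_id R A) \<in> gmaps R ?T ?T 0"
      by (rule gcomp_gmaps[OF tensor_module tensor1_inv_gmaps tensor1_id_gmaps]) (simp add: zero_prod_def)
    show "gid ?T \<in> gmaps R ?T ?T 0" by (rule gid_gmaps[OF tensor_module])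
    fix w assume w: "hword A w" "length w = 1"
    then obtain x where x: "w = [x]" by (cases w) auto
    have p: "pure_tensor R A w \<in> carrier (?T (wdeg w))" using pure_closed'[OF w(1)] w(2) by simp
    have "tensor1_id R A (fst x) (pure_tensor R A [x]) = snd x" using w x by (intro tensor1_id_pure) simp
    then show "gcomp ?T (0, 0) (tensor1_inv R A) (tensor1_id R A) (wdeg w) (pure_tensor R A w) = gid ?T (wdeg w) (pure_tensor R A w)"
      using p w unfolding gcomp_apply[where A = ?T, OF p] by (simp add: x gid_def tensor1_inv_def flip: zero_prod_def)
  qed
  then have "gcomp ?T (0, 0) (tensor1_inv R A) (tensor1_id R A) d X = gid ?T d X" by simp
  then show ?thesis using X by (simp add: gcomp_def gid_def flip: zero_prod_def)
qed

end

text \<open>Arity 1 is stored as the differential. The restriction of the multiplications to arities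
  from 2 on makes them extensional, as membership in \<open>tC_algebras\<close> demands.\<close>

definition tC_of_derived :: "('r, 's) ring_scheme \<Rightarrow> ('r, 'a) dA_algebra \<Rightarrow> ('r, 'a) tC_algebra" where
  "tC_of_derived R Z =
     \<lparr>tC_module = dA_module Z,
      tC_diff = (\<lambda>i. gcomp (dA_module Z) (0, 0)
        (unpsi R (dA_module Z) (dA_module Z) 2 (dA_op Z) 1 i) (tensor1_inv R (dA_module Z))),
      tC_mul = restrict (unpsi R (dA_module Z) (dA_module Z) 2 (dA_op Z)) {2..}\<rparr>"

lemma derived_of_tC_eq: "derived_of_tC R X =
    \<lparr>dA_module = tC_module X, dA_op = psi R (tC_module X) (tC_module X) 2 (tC_op R X)\<rparr>"
  by (simp add: derived_of_tC_def psi_def)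

text \<open>A pointwise form of \<open>unpsi_psi\<close> for families such as \<open>tC_op\<close>,
  which are not given as elements of an extensional product.\<close>

lemma (in bigraded_pair) unpsi_psi_apply:
  assumes "tC_family R A B k F" "1 \<le> j"
  shows "unpsi R A B k (psi R A B k F) j i = F j i"
  unfolding psi_apply[OF assms(2)] unpsi_apply[OF assms(2)] gsigned_gsigned[OF B.A_group tC_family_entry[OF assms]]
  by (simp add: gsigned_even[OF tC_family_entry[OF assms]])

lemma tC_algebrasD:
  assumes X: "X \<in> tC_algebras R" and R: "cring R"
  shows "bigraded R (tC_module X)" "tC_family R (tC_module X) (tC_module X) 2 (tC_op R X)"
proof -
  show "bigraded R (tC_module X)"
    using X R by (simp add: bigraded_def bigraded_axioms_def tC_algebras_def twisted_complex_def)
  then interpret bigraded R "tC_module X" .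
  let ?A = "tC_module X"
  have d: "tC_diff X i \<in> gmaps R ?A ?A (- int i, 1 - int i)" for i
    using X by (simp add: tC_algebras_def twisted_complex_def)
  have m: "tC_mul X \<in> (\<Pi>\<^sub>E j\<in>{2..}. tC_hom R (tensor_power R ?A j) ?A (0, 2 - int j))"
    using X by (simp add: tC_algebras_def)
  show "tC_family R ?A ?A 2 (tC_op R X)"
    unfolding tC_family_def
  proof (intro allI impI)
    fix j :: nat assume j: "1 \<le> j"
    show "tC_op R X j \<in> tC_hom R (tensor_power R ?A j) ?A (0, 2 - int j)"
    proof (cases "j = 1")
      case True
      have "gcomp (tensor_power R ?A 1) (0, 0) (tC_diff X i) (tensor1_id R ?A) \<in>
          gmaps R (tensor_power R ?A 1) ?A (entry_deg (0, 2 - int 1) i)" for i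
        by (rule gcomp_gmaps[OF tensor_module d tensor1_id_gmaps]) (simp add: entry_deg_def)
      then show ?thesis by (simp add: True tC_op_def tC_hom_def)
    next
      case False
      then have "j \<in> {2..}" using j by simp
      then show ?thesis using PiE_mem[OF m] False by (simp add: tC_op_def)
    qed
  qed
qed

lemma derived_of_tC_in:
  assumes X: "X \<in> tC_algebras R" and R: "cring R"
  shows "derived_of_tC R X \<in> dA_algebras R"
proof -
  let ?A = "tC_module X" and ?op = "tC_op R X"
  interpret bigraded R ?A by (rule tC_algebrasD[OF X R])
  interpret AA: bigraded_pair' R ?A ?A ..
  note t = tC_algebrasD(2)[OF X R]
  note p = AA.psi_PiE[OF t] and dp = AA.psi_derived_family[OF t]
  have "dA_precomp R ?A ?A 2 (psi R ?A ?A 2 ?op) (psi R ?A ?A 2 ?op) u v =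
      gzero (tensor_power R ?A v) ?A (- int u, 3 - int u - int v)" if v: "1 \<le> v" for u v
  proof -
    let ?P = "dA_precomp R ?A ?A 2 (psi R ?A ?A 2 ?op) (psi R ?A ?A 2 ?op) u v"
    let ?Z = "gzero (tensor_power R ?A v) ?A (- int u, 3 - int u - int v)"
    have "tC_precomp R ?A ?A 2 ?op ?op v u = tC_zero (tensor_power R ?A v) ?A (0, 3 - int v) u"
      using X v by (simp add: tC_algebras_def)
    also have "\<dots> = ?Z" by (simp add: tC_zero_def entry_deg_0)
    finally have "gsigned (tensor_power R ?A v) ?A (- int u, 3 - int u - int v) (int (u * v) + int u) ?P = ?Z"
      unfolding AA.tC_precomp_eq[OF t t] by simp
    \<comment> \<open>Zero absorbs the global sign, which can then be cancelled on both
      sides.\<close>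
    also have "\<dots> = gsigned (tensor_power R ?A v) ?A (- int u, 3 - int u - int v) (int (u * v) + int u) ?Z"
      by (rule gsigned_gzero[OF A_group, symmetric])
    finally show ?thesis
      using gsigned_inj[OF A_group AA.dA_precomp_gmaps[OF dp dp, of u v, simplified] gzero_gmaps[OF tensor_module A_module]]
      by simp
  qed
  then show ?thesis
    unfolding dA_algebras_def derived_of_tC_eq using p bg by simp
qed

lemma tC_op_tC_of_derived:
  assumes Z: "Z \<in> dA_algebras R" and R: "cring R"
  shows "tC_op R (tC_of_derived R Z) = unpsi R (dA_module Z) (dA_module Z) 2 (dA_op Z)"
proof
  fix j :: nat
  let ?A = "dA_module Z"
  interpret bigraded R ?A by (rule dA_algebrasD[OF Z R])
  interpret AA: bigraded_pair' R ?A ?A ..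
  note d = dA_algebrasD(2)[OF Z R]
  note t = AA.tC_familyI[OF AA.unpsi_PiE[OF d]]
  \<comment> \<open>Arity 0 lies outside both index sets and gives the default value on both sides;
    arity 1 makes the detour through the differential.\<close>
  consider "j = 0" | "j = 1" | "2 \<le> j" by linarith
  then show "tC_op R (tC_of_derived R Z) j = unpsi R ?A ?A 2 (dA_op Z) j"
  proof cases
    case 2
    have "gcomp (tensor_power R ?A 1) (0, 0) (gcomp ?A (0, 0) (unpsi R ?A ?A 2 (dA_op Z) 1 i) (tensor1_inv R ?A)) (tensor1_id R ?A) =
        unpsi R ?A ?A 2 (dA_op Z) 1 i" for i
    proof (rule gmaps_ext)
      note u = tC_family_entry[OF t, of 1 i, simplified]
      show "unpsi R ?A ?A 2 (dA_op Z) 1 i \<in> gmaps R (tensor_power R ?A 1) ?A (- int i, 1 - int i)" using u by simp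
      have "gcomp ?A (0, 0) (unpsi R ?A ?A 2 (dA_op Z) 1 i) (tensor1_inv R ?A) \<in> gmaps R ?A ?A (- int i, 1 - int i)"
        by (rule gcomp_gmaps[OF A_module _ tensor1_inv_gmaps]) (use u in \<open>simp_all flip: zero_prod_def\<close>)
      then show "gcomp (tensor_power R ?A 1) (0, 0) (gcomp ?A (0, 0) (unpsi R ?A ?A 2 (dA_op Z) 1 i) (tensor1_inv R ?A)) (tensor1_id R ?A)
        \<in> gmaps R (tensor_power R ?A 1) ?A (- int i, 1 - int i)"
        by (rule gcomp_gmaps[OF tensor_module _ tensor1_id_gmaps]) simp
      fix d X assume X: "X \<in> carrier (tensor_power R ?A 1 d)"
      have "tensor1_id R ?A d X \<in> carrier (?A d)"
        using gmaps_closed[OF tensor1_id_gmaps X] by (simp flip: zero_prod_def)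
      then show "gcomp (tensor_power R ?A 1) (0, 0) (gcomp ?A (0, 0) (unpsi R ?A ?A 2 (dA_op Z) 1 i) (tensor1_inv R ?A)) (tensor1_id R ?A) d X =
        unpsi R ?A ?A 2 (dA_op Z) 1 i d X"
        using X tensor1_inv_tensor1_id[OF X] by (simp add: gcomp_def flip: zero_prod_def)
    qed
    with 2 show ?thesis by (simp add: tC_op_def tC_of_derived_def)
  qed (simp_all add: tC_op_def tC_of_derived_def unpsi_def)
qed

text \<open>The relation for \<open>v = 1\<close> is the twisted complex relation.\<close>

lemma tC_of_derived_twisted:
  assumes Z: "Z \<in> dA_algebras R" and R: "cring R"
  shows "twisted_complex R (dA_module Z) (tC_diff (tC_of_derived R Z))"
proof -
  let ?A = "dA_module Z" and ?m = "dA_op Z" and ?D = "tC_diff (tC_of_derived R Z)"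
  interpret bigraded R ?A by (rule dA_algebrasD[OF Z R])
  interpret AA: bigraded_pair' R ?A ?A ..
  note d = dA_algebrasD(2)[OF Z R]
  note t = AA.tC_familyI[OF AA.unpsi_PiE[OF d]]
  have D: "?D i \<in> gmaps R ?A ?A (- int i, 1 - int i)" for i
    unfolding tC_of_derived_def tC_algebra.simps
    by (rule gcomp_gmaps[OF A_module tC_family_entry[OF t] tensor1_inv_gmaps]) simp_all
  \<comment> \<open>In arity 1 the exponent ij of the sign change is just i.\<close>
  have Dx: "?D i e x = signed (?A (outdeg 2 i [(e, x)])) (int i) (word_value R ?A ?m i [(e, x)])"
    if x: "x \<in> carrier (?A e)" for i e x
    using x gsigned_apply[of "pure_tensor R ?A [(e, x)]" "tensor_power R ?A 1" e, OF pure_single[OF x]]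
    by (simp add: tC_of_derived_def gcomp_def tensor1_inv_def unpsi_apply word_value_def outdeg_eq flip: zero_prod_def)
  have "gsum ?A ?A (- int u, 2 - int u) {(i, j). i + j = u} (\<lambda>(i, j). int i)
        (\<lambda>(i, j). gcomp ?A (- int j, 1 - int j) (?D i) (?D j)) = gzero ?A ?A (- int u, 2 - int u)" for u
  proof (rule gmaps_ext)
    have gc: "gcomp ?A (- int j, 1 - int j) (?D i) (?D j) \<in> gmaps R ?A ?A (- int u, 2 - int u)" if "i + j = u" for i j
      by (rule gcomp_gmaps[OF A_module D D]) (use that in auto)
    show "gsum ?A ?A (- int u, 2 - int u) {(i, j). i + j = u} (\<lambda>(i, j). int i)
        (\<lambda>(i, j). gcomp ?A (- int j, 1 - int j) (?D i) (?D j)) \<in> gmaps R ?A ?A (- int u, 2 - int u)"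
      by (rule gsum_gmaps[OF A_module A_module]) (use gc in auto)
    show "gzero ?A ?A (- int u, 2 - int u) \<in> gmaps R ?A ?A (- int u, 2 - int u)"
      by (rule gzero_gmaps[OF A_module A_module])
    fix e x assume x: "x \<in> carrier (?A e)"
    let ?w = "[(e, x)]"
    let ?N = "?A (outdeg 3 u ?w)"
    interpret N: abelian_group ?N by (rule A_group)
    have ed: "e + (- int u, 2 - int u) = outdeg 3 u ?w" by (simp add: outdeg_eq prod_eq_iff)
    have w: "hword ?A ?w" using x by simp
    have pw: "pure_tensor R ?A ?w \<in> carrier (tensor_power R ?A 1 e)" by (rule pure_single[OF x])
    let ?y = "\<lambda>p. word_value R ?A ?m p ?w"
    let ?z = "\<lambda>p. word_value R ?A ?m (u - p) [(outdeg 2 p ?w, ?y p)]"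
    have y: "?y p \<in> carrier (?A (outdeg 2 p ?w))" for p by (rule AA.word_value_closed[OF d w]) simp
    \<comment> \<open>For v = 1 the only insertions have j = q = 1 and r = t = 0, so one summand for
      each p remains.\<close>
    have idx: "(u - p, p, 1, 1, 0, 0) \<in> pre_index u 1" if "p \<le> u" for p using that by (simp add: pre_index_def)
    have z: "?z p \<in> carrier ?N" if "p \<le> u" for p
      using AA.pre_term(3)[OF d d idx[OF that], of "[]" ?w "[]"] x by simp
    have DD: "?D (u - p) (e + (- int p, 1 - int p)) (?D p e x) = signed ?N (int p + int (u - p)) (?z p)" if p: "p \<le> u" for p
    proof -
      have e1: "e + (- int p, 1 - int p) = outdeg 2 p ?w" by (simp add: outdeg_eq)
      have e2: "outdeg 2 p ?w + (- int (u - p), 1 - int (u - p)) = outdeg 3 u ?w"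
        using p by (simp add: outdeg_eq prod_eq_iff)
      have e3: "outdeg 2 (u - p) [(outdeg 2 p ?w, ?y p)] = outdeg 3 u ?w"
        using p by (simp add: outdeg_eq prod_eq_iff)
      show ?thesis
        unfolding e1 Dx[OF x] gmaps_signed[OF D A_group A_group y] e2 Dx[OF y] e3
        by (rule signed_signed[OF A_group z[OF p]])
    qed
    have pre: "gcomp (tensor_power R ?A 1) (- int p, 2 - int p - int 1) (?m (u - p, 1))
        (gtensors R ?A ?A (insert_ops R ?A ?m 0 p 1 0)) e (pure_tensor R ?A ?w) = ?z p" if p: "p \<le> u" for p
      using AA.pre_term(2)[OF d d idx[OF p], of "[]" ?w "[]"] x by simp
    have "\<zero>\<^bsub>?N\<^esub> = dA_precomp R ?A ?A 2 ?m ?m u 1 e (pure_tensor R ?A ?w)"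
      using Z pw ed unfolding dA_algebras_def by (simp add: gzero_def)
    also have "\<dots> = chain_eval ?N (\<Sum>p\<le>u. chain_sign (int p) (frag_of (?z p)))"
    proof -
      have ed': "e + (- int u, 2 + 1 - int u - int 1) = outdeg 3 u ?w" by (simp add: outdeg_eq prod_eq_iff)
      have "dA_precomp R ?A ?A 2 ?m ?m u 1 e (pure_tensor R ?A ?w) =
        chain_eval ?N (\<Sum>x\<in>pre_index u 1. chain_sign ((\<lambda>(i, p, j, q, r, t). int (r * q + t + p * j)) x)
          (frag_of ((\<lambda>(i, p, j, q, r, t). gcomp (tensor_power R ?A 1) (- int p, 2 - int p - int q) (?m (i, j))
          (gtensors R ?A ?A (insert_ops R ?A ?m r p q t))) x e (pure_tensor R ?A ?w))))"
        unfolding dA_precomp_eq ed'[symmetric]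
      proof (rule gsum_chain_eval[where A = "tensor_power R ?A 1", OF A_group _ pw])
        fix y assume "y \<in> pre_index u 1"
        then show "(\<lambda>(i, p, j, q, r, t). gcomp (tensor_power R ?A 1) (- int p, 2 - int p - int q) (?m (i, j))
          (gtensors R ?A ?A (insert_ops R ?A ?m r p q t))) y e (pure_tensor R ?A ?w) \<in> carrier (?A (e + (- int u, 2 + 1 - int u - int 1)))"
          using gmaps_closed[OF AA.pre_term(1)[OF d d] pw] by (cases y) auto
      qed
      also have "\<dots> = chain_eval ?N (\<Sum>p\<le>u. chain_sign (int p) (frag_of (?z p)))"
        unfolding sum_pre_index using pre by (simp add: lessThan_Suc)
      finally show ?thesis .
    qed
    \<comment> \<open>The derived sign refers to the inner index p, the twisted sign to the outer
      index i, hence the reversal of the sum.\<close>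
    also have "\<dots> = chain_eval ?N (\<Sum>i\<le>u. chain_sign (int (u - i)) (frag_of (?z (u - i))))"
      by (rule arg_cong[where f = "chain_eval ?N"], rule sum.reindex_bij_witness[of _ "\<lambda>p. u - p" "\<lambda>p. u - p"]) auto
    also have "\<dots> = chain_eval ?N (\<Sum>i\<le>u. chain_sign (int i) (frag_of (?D i (e + (- int (u - i), 1 - int (u - i))) (?D (u - i) e x))))"
    proof (rule N.chain_eval_sum_cong)
      fix i assume "i \<in> {..u}"
      then have i: "i \<le> u" and ui: "u - (u - i) = i" by auto
      \<comment> \<open>The two differentials together contribute the exponent (u - i) + i, which
        turns the derived sign (-1)^(u - i) into the twisted sign (-1)^i.\<close>
      have even: "even (int (u - i) - (int i + (int (u - i) + int i)))" by simp
      show "chain_eval ?N (chain_sign (int (u - i)) (frag_of (?z (u - i)))) =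
        chain_eval ?N (chain_sign (int i) (frag_of (?D i (e + (- int (u - i), 1 - int (u - i))) (?D (u - i) e x))))"
        unfolding ui DD[of "u - i", unfolded ui, OF diff_le_self] chain_eval_chain_sign_signed[OF A_group z[of "u - i", unfolded ui, OF diff_le_self]]
        by (simp only: chain_sign_cong[OF even])
    qed
    also have "\<dots> = gsum ?A ?A (- int u, 2 - int u) {(i, j). i + j = u} (\<lambda>(i, j). int i)
        (\<lambda>(i, j). gcomp ?A (- int j, 1 - int j) (?D i) (?D j)) e x"
      using gmaps_closed[OF gc x] unfolding ed[symmetric]
      by (subst gsum_chain_eval[where A = ?A, OF A_group _ x]) (auto simp: sum_antidiagonal gcomp_apply[where A = ?A, OF x])
    finally show "gsum ?A ?A (- int u, 2 - int u) {(i, j). i + j = u} (\<lambda>(i, j). int i)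
        (\<lambda>(i, j). gcomp ?A (- int j, 1 - int j) (?D i) (?D j)) e x = gzero ?A ?A (- int u, 2 - int u) e x"
      using x by (simp add: gzero_def ed)
  qed
  then show ?thesis unfolding twisted_complex_def using bg D by blast
qed

lemma tC_of_derived_in:
  assumes Z: "Z \<in> dA_algebras R" and R: "cring R"
  shows "tC_of_derived R Z \<in> tC_algebras R"
proof -
  let ?A = "dA_module Z" and ?op = "unpsi R (dA_module Z) (dA_module Z) 2 (dA_op Z)"
  interpret bigraded R ?A by (rule dA_algebrasD[OF Z R])
  interpret AA: bigraded_pair' R ?A ?A ..
  note d = dA_algebrasD(2)[OF Z R]
  note u = AA.unpsi_PiE[OF d]
  note t = AA.tC_familyI[OF u]
  have "dA_op Z \<in> (\<Pi>\<^sub>E (i, j)\<in>UNIV \<times> {1..}. gmaps R (tensor_power R ?A j) ?A (- int i, 2 - int i - int j))"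
    using Z unfolding dA_algebras_def by blast
  note pu = AA.psi_unpsi[OF this]
  have "tC_precomp R ?A ?A 2 ?op ?op v = tC_zero (tensor_power R ?A v) ?A (0, 3 - int v)" if v: "1 \<le> v" for v
  proof
    fix u
    have "dA_precomp R ?A ?A 2 (dA_op Z) (dA_op Z) u v = gzero (tensor_power R ?A v) ?A (- int u, 3 - int u - int v)"
      using Z v unfolding dA_algebras_def by simp
    then show "tC_precomp R ?A ?A 2 ?op ?op v u = tC_zero (tensor_power R ?A v) ?A (0, 3 - int v) u"
      unfolding AA.tC_precomp_eq[OF t t] pu tC_zero_def entry_deg_0 by (simp add: gsigned_gzero[OF A_group])
  qed
  moreover have "restrict ?op {2..} \<in> (\<Pi>\<^sub>E j\<in>{2..}. tC_hom R (tensor_power R ?A j) ?A (0, 2 - int j))"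
    using t by (auto simp: tC_family_def)
  ultimately show ?thesis
    using tC_of_derived_twisted[OF Z R] tC_op_tC_of_derived[OF Z R]
    by (simp add: tC_algebras_def) (simp add: tC_of_derived_def)
qed

lemma derived_tC_of_derived:
  assumes Z: "Z \<in> dA_algebras R" and R: "cring R"
  shows "derived_of_tC R (tC_of_derived R Z) = Z"
proof -
  let ?A = "dA_module Z"
  interpret bigraded R ?A by (rule dA_algebrasD[OF Z R])
  interpret AA: bigraded_pair' R ?A ?A ..
  have "dA_op Z \<in> (\<Pi>\<^sub>E (i, j)\<in>UNIV \<times> {1..}. gmaps R (tensor_power R ?A j) ?A (- int i, 2 - int i - int j))"
    using Z unfolding dA_algebras_def by blast
  then show ?thesis
    unfolding derived_of_tC_eq tC_op_tC_of_derived[OF Z R]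
    by (simp add: tC_of_derived_def AA.psi_unpsi)
qed

lemma tC_of_derived_of_tC:
  assumes X: "X \<in> tC_algebras R" and R: "cring R"
  shows "tC_of_derived R (derived_of_tC R X) = X"
proof -
  let ?A = "tC_module X" and ?op = "tC_op R X"
  interpret bigraded R ?A by (rule tC_algebrasD[OF X R])
  interpret AA: bigraded_pair' R ?A ?A ..
  note up = AA.unpsi_psi_apply[OF tC_algebrasD(2)[OF X R]]
  have d: "tC_diff X i \<in> gmaps R ?A ?A (- int i, 1 - int i)" for i
    using X by (simp add: tC_algebras_def twisted_complex_def)
  have m: "tC_mul X \<in> (\<Pi>\<^sub>E j\<in>{2..}. tC_hom R (tensor_power R ?A j) ?A (0, 2 - int j))"
    using X by (simp add: tC_algebras_def)
  have "gcomp ?A (0, 0) (?op 1 i) (tensor1_inv R ?A) = tC_diff X i" for i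
  proof (intro ext)
    fix e x
    show "gcomp ?A (0, 0) (?op 1 i) (tensor1_inv R ?A) e x = tC_diff X i e x"
      using gmaps_undefined[OF d, of x e] pure_single[of x e] tensor1_id_pure[of "(e, x)"]
      by (simp add: gcomp_def tC_op_def tensor1_inv_def flip: zero_prod_def)
  qed
  moreover have "restrict (unpsi R ?A ?A 2 (psi R ?A ?A 2 ?op)) {2..} = tC_mul X"
  proof (rule ext, rule ext)
    fix j i
    show "restrict (unpsi R ?A ?A 2 (psi R ?A ?A 2 ?op)) {2..} j i = tC_mul X j i"
      using up[of j i] PiE_arb[OF m, of j] by (simp add: tC_op_def restrict_def)
  qed
  ultimately show ?thesis
    unfolding derived_of_tC_eq tC_of_derived_def dA_algebra.simps by (simp add: up)
qed

section \<open>The bijection on morphisms and the isomorphism\<close>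

text \<open>By \<open>tC_precomp_eq\<close>, and by \<open>tC_postcomp_eq\<close> with
  \<open>\<epsilon>\<close> = u, both sides of the morphism equation acquire the same exponent uv +
  u, which cancels.\<close>

lemma tC_morphisms_iff:
  assumes X: "X \<in> tC_algebras R" and Y: "Y \<in> tC_algebras R" and R: "cring R"
    and F: "F \<in> (\<Pi>\<^sub>E j\<in>{1..}. tC_hom R (tensor_power R (tC_module X) j) (tC_module Y) (0, 1 - int j))"
  shows "F \<in> tC_morphisms R X Y \<longleftrightarrow>
    psi R (tC_module X) (tC_module Y) 1 F \<in> dA_morphisms R (derived_of_tC R X) (derived_of_tC R Y)"
proof -
  let ?A = "tC_module X" and ?B = "tC_module Y"
  let ?m = "tC_op R X" and ?n = "tC_op R Y"
  interpret A: bigraded R ?A by (rule tC_algebrasD[OF X R])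
  interpret B: bigraded R ?B by (rule tC_algebrasD[OF Y R])
  interpret AB: bigraded_pair' R ?A ?B ..
  interpret ABB: bigraded_triple R ?A ?B ?B ..
  note m = tC_algebrasD(2)[OF X R] and n = tC_algebrasD(2)[OF Y R] and f = AB.tC_familyI[OF F]
  note dm = AB.AA.psi_derived_family[OF m] and dn = ABB.BC.psi_derived_family[OF n] and df = AB.psi_derived_family[OF f]
  let ?f = "psi R ?A ?B 1 F"
  have "tC_precomp R ?A ?B 1 F ?m v u = tC_postcomp R ?A ?B ?B 2 ?n F v u \<longleftrightarrow>
      dA_precomp R ?A ?B 1 ?f (psi R ?A ?A 2 ?m) u v = dA_postcomp R ?A ?B ?B 2 u (psi R ?B ?B 2 ?n) ?f u v"
    if v: "1 \<le> v" for u v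
    unfolding AB.tC_precomp_eq[OF m f] ABB.tC_postcomp_eq[OF n f v, of u u]
    using gsigned_inj[OF B.A_group AB.dA_precomp_gmaps[OF dm df, of u v, simplified] ABB.dA_postcomp_gmaps[OF dn df v, of u u]]
    by simp
  then have "(\<forall>v\<ge>1. tC_precomp R ?A ?B 1 F ?m v = tC_postcomp R ?A ?B ?B 2 ?n F v) \<longleftrightarrow>
    (\<forall>u. \<forall>v\<ge>1. dA_precomp R ?A ?B 1 ?f (psi R ?A ?A 2 ?m) u v = dA_postcomp R ?A ?B ?B 2 u (psi R ?B ?B 2 ?n) ?f u v)"
    unfolding fun_eq_iff[of "tC_precomp R ?A ?B 1 F ?m _"] by blast
  then show ?thesis
    unfolding tC_morphisms_def dA_morphisms_def derived_of_tC_eq mem_Collect_eq dA_algebra.simps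
    using F AB.psi_PiE[OF f] by blast
qed

lemma A_infinity_tC_simps:
  "Obj (A_infinity_tC R) = tC_algebras R"
  "Hom (A_infinity_tC R) = tC_morphisms R"
  "Ident (A_infinity_tC R) X = (\<lambda>j\<in>{1..}. if j = 1 then tC_one R (tC_module X)
         else tC_zero (tensor_power R (tC_module X) j) (tC_module X) (0, 1 - int j))"
  "Comp (A_infinity_tC R) X Y Z F G = (\<lambda>v\<in>{1..}.
         tC_postcomp R (tC_module X) (tC_module Y) (tC_module Z) 1 F G v)"
  by (simp_all add: A_infinity_tC_def)

theorem theorem4p50:
  fixes R :: "('r, 's) ring_scheme"
  assumes "cring R"
  shows "\<exists>\<Psi>. isomorphism_of_categories
           (A_infinity_tC R
             :: (('r, 'a) tC_algebra, nat \<Rightarrow> nat \<Rightarrow> (('a, 'r) tens, 'a) gmap) category_data)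
           (derived_A_infinity R
             :: (('r, 'a) dA_algebra, nat \<times> nat \<Rightarrow> (('a, 'r) tens, 'a) gmap) category_data) \<Psi> \<and>
         (\<forall>X\<in>Obj (A_infinity_tC R). on_obj \<Psi> X = derived_of_tC R X)"
proof -
  note R = assms
  let ?FH = "\<lambda>X Y. psi R (tC_module X) (tC_module Y) 1"
  let ?GH = "\<lambda>X Y. unpsi R (tC_module X) (tC_module Y) 1"
  let ?C = "A_infinity_tC R :: (('r, 'a) tC_algebra, nat \<Rightarrow> nat \<Rightarrow> (('a, 'r) tens, 'a) gmap) category_data"
  let ?D = "derived_A_infinity R :: (('r, 'a) dA_algebra, nat \<times> nat \<Rightarrow> (('a, 'r) tens, 'a) gmap) category_data"
  have tPiE: "F \<in> (\<Pi>\<^sub>E j\<in>{1..}. tC_hom R (tensor_power R (tC_module X) j) (tC_module Y) (0, 1 - int j))"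
    if "F \<in> tC_morphisms R X Y" for F and X Y :: "('r, 'a) tC_algebra"
    using that unfolding tC_morphisms_def by blast
  have dPiE: "f \<in> (\<Pi>\<^sub>E (i, j)\<in>UNIV \<times> {1..}. gmaps R (tensor_power R (tC_module X) j) (tC_module Y) (- int i, 1 - int i - int j))"
    if "f \<in> dA_morphisms R (derived_of_tC R X) (derived_of_tC R Y)" for f and X Y :: "('r, 'a) tC_algebra"
    using that unfolding dA_morphisms_def derived_of_tC_eq dA_algebra.simps by blast
  have "isomorphism_of_categories ?C ?D \<lparr>on_obj = derived_of_tC R, on_hom = ?FH\<rparr>"
  proof (rule isomorphism_transfer[where GO = "tC_of_derived R" and GH = ?GH,
        OF derived_A_infinity_category[OF R]], unfold A_infinity_tC_simps(1,2) derived_A_infinity_simps(1,2))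
    fix X Y :: "('r, 'a) tC_algebra"
    assume X: "X \<in> tC_algebras R" and Y: "Y \<in> tC_algebras R"
    interpret A: bigraded R "tC_module X" by (rule tC_algebrasD[OF X R])
    interpret B: bigraded R "tC_module Y" by (rule tC_algebrasD[OF Y R])
    interpret AB: bigraded_pair' R "tC_module X" "tC_module Y" ..
    show "?FH X Y F \<in> dA_morphisms R (derived_of_tC R X) (derived_of_tC R Y)"
      if F: "F \<in> tC_morphisms R X Y" for F
      using tC_morphisms_iff[OF X Y R tPiE[OF F]] F by blast
    show "?GH X Y (?FH X Y F) = F" if F: "F \<in> tC_morphisms R X Y" for F
      by (rule AB.unpsi_psi[OF tPiE[OF F]])
    show FG: "?FH X Y (?GH X Y h) = h" if h: "h \<in> dA_morphisms R (derived_of_tC R X) (derived_of_tC R Y)" for h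
      by (rule AB.psi_unpsi[OF dPiE[OF h]])
    show "?GH X Y h \<in> tC_morphisms R X Y" if h: "h \<in> dA_morphisms R (derived_of_tC R X) (derived_of_tC R Y)" for h
      using tC_morphisms_iff[OF X Y R AB.unpsi_PiE[OF derived_familyI[OF dPiE[OF h]]]] h FG[OF h] by simp
  next
    fix X :: "('r, 'a) tC_algebra" assume X: "X \<in> tC_algebras R"
    let ?A = "tC_module X"
    interpret A: bigraded R ?A by (rule tC_algebrasD[OF X R])
    show "Ident ?C X = ?GH X X (Ident ?D (derived_of_tC R X))"
    proof (rule ext, rule ext)
      fix j i
      \<comment> \<open>The sign is trivial at i = 0, j = 1, and the identity is zero at all other
        indices, so the sign change respects identities.\<close>
      have t: "gsigned (tensor_power R ?A 1) ?A (0, 0) 0 (tensor1_id R ?A) = tensor1_id R ?A"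
        by (rule gsigned_even[OF A.tensor1_id_gmaps]) simp
      have z: "tC_zero (tensor_power R ?A j) ?A (0, 1 - int j) i =
          gzero (tensor_power R ?A j) ?A (- int i, 1 - int i - int j)" for i j
        unfolding tC_zero_def entry_deg_0 ..
      have o: "tC_one R ?A i = (if i = 0 then tensor1_id R ?A else gzero (tensor_power R ?A 1) ?A (- int i, 1 - int i - int 1))"
        by (simp add: tC_one_def tC_single_def entry_deg_def)
      show "Ident ?C X j i = ?GH X X (Ident ?D (derived_of_tC R X)) j i"
        unfolding A_infinity_tC_simps derived_A_infinity_simps derived_of_tC_eq dA_algebra.simps unpsi_def dident_def
        using t by (auto simp: o z gsigned_gzero[OF A.A_group] restrict_def)
    qed
  next
    fix X Y Z :: "('r, 'a) tC_algebra" and F G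
    assume X: "X \<in> tC_algebras R" and Y: "Y \<in> tC_algebras R" and Z: "Z \<in> tC_algebras R"
      and F: "F \<in> tC_morphisms R Y Z" and G: "G \<in> tC_morphisms R X Y"
    interpret A: bigraded R "tC_module X" by (rule tC_algebrasD[OF X R])
    interpret B: bigraded R "tC_module Y" by (rule tC_algebrasD[OF Y R])
    interpret C: bigraded R "tC_module Z" by (rule tC_algebrasD[OF Z R])
    interpret ABC: bigraded_triple R "tC_module X" "tC_module Y" "tC_module Z" ..
    note f = ABC.BC.tC_familyI[OF tPiE[OF F]] and g = ABC.AB.tC_familyI[OF tPiE[OF G]]
    show "Comp ?C X Y Z F G = ?GH X Z (Comp ?D (derived_of_tC R X) (derived_of_tC R Y) (derived_of_tC R Z) (?FH Y Z F) (?FH X Y G))"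
    proof (rule ext, rule ext)
      fix j i
      \<comment> \<open>With \<open>\<epsilon>\<close> = 0 the global sign (-1)^(uv) of a composite
        is exactly the factor of the sign change, so no sign is left over.\<close>
      show "Comp ?C X Y Z F G j i =
        ?GH X Z (Comp ?D (derived_of_tC R X) (derived_of_tC R Y) (derived_of_tC R Z) (?FH Y Z F) (?FH X Y G)) j i"
        unfolding A_infinity_tC_simps derived_A_infinity_simps derived_of_tC_eq dA_algebra.simps unpsi_def dcomp_def
        using ABC.tC_postcomp_eq[OF f g, of j i 0] by (simp add: restrict_def)
    qed
  qed (simp_all add: derived_of_tC_in R tC_of_derived_in tC_of_derived_of_tC derived_tC_of_derived)
  then show ?thesis by (intro exI[of _ "\<lparr>on_obj = derived_of_tC R, on_hom = ?FH\<rparr>"]) simp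
qed

end
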